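(* Let $\Omega\subset\mathbb{R}^N$ be a bounded open set and let $s\in[0,1)$. Suppose $N>p\ge2$ and $q\in[1,p^* )$, where $p^*:=\frac{pN}{N-p}$. Let $g:\Omega\times\mathbb{R}\to\mathbb{R}$ be a Carathéodory function for which there exist $a_1,a_2>0$ with $|g(x,t)|\le a_1+a_2|t|^{q-1}$ for a.e. $x\in\Omega$ and all $t\in\mathbb{R}$. Then for every $\gamma>0$ there exists $\Lambda_\gamma>0$ such that, for every $0<\lambda<\Lambda_\gamma$, the problem $$-\Delta_pu+(-\Delta_p)^su=\lambda g(x,u)+\gamma|u|^{p^*-2}u\ \text{ in }\Omega,\qquad u=0\ \text{ in }\mathbb{R}^N\setminus\Omega,$$ admits at least one weak solution in $\mathbb{X}(\Omega)$ which is a local minimum of the energy functional $$\mathcal{J}_{\gamma,\lambda}(u):=\frac1p\int_\Omega|\nabla u|^pdx+\frac1p[u]_{s,p}^p-\lambda\int_\Omega\int_0^{u(x)}g(x,\tau)\,d\tau\,dx-\frac\gamma{p^*}\int_\Omega|u|^{p^*}dx,\quad u\in\mathbb{X}(\Omega).$$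
   Context: For $s\in(0,1)$ put $C_{N,p,s}:=\frac{\frac{sp}{2}(1-s)2^{2s-1}}{\pi^{(N-1)/2}}\frac{\Gamma(\frac{N+ps}{2})}{\Gamma(\frac{p+1}{2})\Gamma(2-s)}$ and $[u]_{s,p}:=\left(C_{N,p,s}\iint_{\mathbb{R}^{2N}}\frac{|u(x)-u(y)|^p}{|x-y|^{N+sp}}dx\,dy\right)^{1/p}$; also $[u]_{0,p}:=\|u\|_{L^p(\mathbb{R}^N)}$. $\mathbb{X}(\Omega)$ is the space of measurable $u:\mathbb{R}^N\to\mathbb{R}$ with $u=0$ in $\mathbb{R}^N\setminus\Omega$ and finite norm $\left(\|\nabla u\|_{L^p(\mathbb{R}^N)}^p+[u]_{s,p}^p\right)^{1/p}$. Here $\Delta_pu=\operatorname{div}(|\nabla u|^{p-2}\nabla u)$ and $(-\Delta_p)^su(x)=2C_{N,p,s}\lim_{\varepsilon\searrow0}\int_{\mathbb{R}^N\setminus B_\varepsilon(x)}\frac{|u(x)-u(y)|^{p-2}(u(x)-u(y))}{|x-y|^{N+sp}}dy$ for $s\in(0,1)$. Put $E_s(u,v):=C_{N,p,s}\iint_{\mathbb{R}^{2N}}\frac{|u(x)-u(y)|^{p-2}(u(x)-u(y))(v(x)-v(y))}{|x-y|^{N+sp}}dx\,dy$ for $s\in(0,1)$ and $E_0(u,v):=\int_\Omega|u|^{p-2}uv\,dx$. A weak solution is $u\in\mathbb{X}(\Omega)$ with $\int_\Omega|\nabla u|^{p-2}\nabla u\cdot\nabla v\,dx+E_s(u,v)=\int_\Omega(\lambda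 g(x,u)+\gamma|u|^{p^*-2}u)v\,dx$ for all $v\in\mathbb{X}(\Omega)$. Carathéodory means measurable in the first variable and continuous in the second. *)

theory Defs
  imports "HOL-Analysis.Analysis"
begin

text \<open>
  \<open>\<real>\<^sup>N\<close> is an arbitrary Euclidean space \<open>'a\<close> with \<open>N = DIM('a)\<close>, and "measurable" means Lebesgue
  measurable. Real exponents are written with \<^const>\<open>powr\<close>, for which \<open>0 powr a = 0\<close>; in expressions
  like \<open>|t|\<^sup>p\<^sup>-\<^sup>2 t\<close> this is harmless also for \<open>p = 2\<close>.
\<close>

subsection \<open>Weak gradients\<close>

primrec C_k :: "nat \<Rightarrow> ('a::euclidean_space \<Rightarrow> real) \<Rightarrow> bool" where
  "C_k 0 f \<longleftrightarrow> continuous_on UNIV f"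
| "C_k (Suc k) f \<longleftrightarrow>
     (\<forall>x. f differentiable (at x)) \<and> (\<forall>b\<in>Basis. C_k k (\<lambda>x. frechet_derivative f (at x) b))"

definition test_function :: "('a::euclidean_space \<Rightarrow> real) \<Rightarrow> bool" where
  "test_function \<phi> \<longleftrightarrow> (\<forall>k. C_k k \<phi>) \<and> compact (closure {x. \<phi> x \<noteq> 0})"

definition locally_integrable ::
    "('a::euclidean_space \<Rightarrow> 'b::{banach, second_countable_topology}) \<Rightarrow> bool" where
  "locally_integrable f \<longleftrightarrow> (\<forall>K. compact K \<longrightarrow> set_integrable lebesgue K f)"

definition is_weak_gradient :: "('a::euclidean_space \<Rightarrow> real) \<Rightarrow> ('a \<Rightarrow> 'a) \<Rightarrow> bool" where
  "is_weak_gradient u G \<longleftrightarrow> locally_integrable u \<and> locally_integrable G \<and>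
     (\<forall>\<phi>. test_function \<phi> \<longrightarrow> (\<forall>b\<in>Basis.
        (LINT x|lebesgue. u x * frechet_derivative \<phi> (at x) b) =
        - (LINT x|lebesgue. (G x \<bullet> b) * \<phi> x)))"

text \<open>A weak gradient is unique up to a null set, which no integral below sees.\<close>

definition weak_grad :: "('a::euclidean_space \<Rightarrow> real) \<Rightarrow> 'a \<Rightarrow> 'a" where
  "weak_grad u = (SOME G. is_weak_gradient u G)"

subsection \<open>The fractional seminorm and the space \<open>X(\<Omega>)\<close>\<close>

definition C_const :: "nat \<Rightarrow> real \<Rightarrow> real \<Rightarrow> real" where
  "C_const N p s =
     (s * p / 2 * (1 - s) * 2 powr (2 * s - 1)) / pi powr ((real N - 1) / 2) *
     (Gamma ((real N + p * s) / 2) / (Gamma ((p + 1) / 2) * Gamma (2 - s)))"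

definition gagliardo_integrand :: "real \<Rightarrow> real \<Rightarrow> ('a::euclidean_space \<Rightarrow> real) \<Rightarrow> 'a \<times> 'a \<Rightarrow> real" where
  "gagliardo_integrand s p u =
     (\<lambda>(x, y). \<bar>u x - u y\<bar> powr p / norm (x - y) powr (real DIM('a) + s * p))"

definition frac_seminorm_finite :: "real \<Rightarrow> real \<Rightarrow> ('a::euclidean_space \<Rightarrow> real) \<Rightarrow> bool" where
  "frac_seminorm_finite s p u \<longleftrightarrow>
     (if s = 0 then integrable lebesgue (\<lambda>x. \<bar>u x\<bar> powr p)
      else integrable lebesgue (gagliardo_integrand s p u))"

text \<open>Meaningful only under \<^const>\<open>frac_seminorm_finite\<close>, as non-convergent integrals have value \<open>0\<close>.\<close>

definition frac_seminorm :: "real \<Rightarrow> real \<Rightarrow> ('a::euclidean_space \<Rightarrow> real) \<Rightarrow> real" where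
  "frac_seminorm s p u =
     (if s = 0 then (LINT x|lebesgue. \<bar>u x\<bar> powr p) powr (1 / p)
      else (C_const DIM('a) p s * (LINT z|lebesgue. gagliardo_integrand s p u z)) powr (1 / p))"

text \<open>
  The finite norm includes that the weak gradient exists. Functions are not identified up to null
  sets; every a.e. class that vanishes a.e. outside \<open>\<Omega>\<close> has a member vanishing there everywhere.
\<close>

definition X_space :: "'a::euclidean_space set \<Rightarrow> real \<Rightarrow> real \<Rightarrow> ('a \<Rightarrow> real) set" where
  "X_space \<Omega> s p = {u. u \<in> borel_measurable lebesgue \<and> (\<forall>x. x \<notin> \<Omega> \<longrightarrow> u x = 0) \<and>
     (\<exists>G. is_weak_gradient u G) \<and> integrable lebesgue (\<lambda>x. norm (weak_grad u x) powr p) \<and>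
     frac_seminorm_finite s p u}"

definition X_norm :: "real \<Rightarrow> real \<Rightarrow> ('a::euclidean_space \<Rightarrow> real) \<Rightarrow> real" where
  "X_norm s p u =
     ((LINT x|lebesgue. norm (weak_grad u x) powr p) + frac_seminorm s p u powr p) powr (1 / p)"

subsection \<open>The problem\<close>

definition crit_exp :: "nat \<Rightarrow> real \<Rightarrow> real" where
  "crit_exp N p = p * real N / (real N - p)"

definition caratheodory_on :: "'a::euclidean_space set \<Rightarrow> ('a \<Rightarrow> real \<Rightarrow> real) \<Rightarrow> bool" where
  "caratheodory_on \<Omega> g \<longleftrightarrow>
     (\<forall>t. (\<lambda>x. g x t) \<in> borel_measurable (lebesgue_on \<Omega>)) \<and>
     (\<forall>x\<in>\<Omega>. continuous_on UNIV (g x))"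

text \<open>For \<open>q = 1\<close> the factor \<open>|t|\<^sup>q\<^sup>-\<^sup>1\<close> is \<open>1\<close> also at \<open>t = 0\<close>, where \<^const>\<open>powr\<close> would give \<open>0\<close>.\<close>

definition growth_on ::
    "'a::euclidean_space set \<Rightarrow> real \<Rightarrow> real \<Rightarrow> real \<Rightarrow> ('a \<Rightarrow> real \<Rightarrow> real) \<Rightarrow> bool" where
  "growth_on \<Omega> q a\<^sub>1 a\<^sub>2 g \<longleftrightarrow>
     (AE x in lebesgue. x \<in> \<Omega> \<longrightarrow>
        (\<forall>t. \<bar>g x t\<bar> \<le> a\<^sub>1 + a\<^sub>2 * (if q = 1 then 1 else \<bar>t\<bar> powr (q - 1))))"

definition frac_form :: "'a::euclidean_space set \<Rightarrow> real \<Rightarrow> real \<Rightarrow> ('a \<Rightarrow> real) \<Rightarrow> ('a \<Rightarrow> real) \<Rightarrow> real" where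
  "frac_form \<Omega> s p u v =
     (if s = 0 then (LINT x:\<Omega>|lebesgue. \<bar>u x\<bar> powr (p - 2) * u x * v x)
      else C_const DIM('a) p s *
        (LINT z|lebesgue. (case z of (x, y) \<Rightarrow>
           \<bar>u x - u y\<bar> powr (p - 2) * (u x - u y) * (v x - v y) /
           norm (x - y) powr (real DIM('a) + s * p))))"

definition weak_solution ::
    "'a::euclidean_space set \<Rightarrow> real \<Rightarrow> real \<Rightarrow> ('a \<Rightarrow> real \<Rightarrow> real) \<Rightarrow> real \<Rightarrow> real \<Rightarrow> ('a \<Rightarrow> real) \<Rightarrow> bool" where
  "weak_solution \<Omega> s p g \<gamma> lam u \<longleftrightarrow> u \<in> X_space \<Omega> s p \<and>
     (\<forall>v\<in>X_space \<Omega> s p.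
        (LINT x:\<Omega>|lebesgue. norm (weak_grad u x) powr (p - 2) * (weak_grad u x \<bullet> weak_grad v x))
          + frac_form \<Omega> s p u v =
        (LINT x:\<Omega>|lebesgue.
           (lam * g x (u x) + \<gamma> * \<bar>u x\<bar> powr (crit_exp DIM('a) p - 2) * u x) * v x))"

definition energy ::
    "'a::euclidean_space set \<Rightarrow> real \<Rightarrow> real \<Rightarrow> ('a \<Rightarrow> real \<Rightarrow> real) \<Rightarrow> real \<Rightarrow> real \<Rightarrow> ('a \<Rightarrow> real) \<Rightarrow> real" where
  "energy \<Omega> s p g \<gamma> lam u =
     1 / p * (LINT x:\<Omega>|lebesgue. norm (weak_grad u x) powr p)
     + 1 / p * frac_seminorm s p u powr p
     - lam * (LINT x:\<Omega>|lebesgue. (LBINT \<tau>=0..ereal (u x). g x \<tau>))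
     - \<gamma> / crit_exp DIM('a) p * (LINT x:\<Omega>|lebesgue. \<bar>u x\<bar> powr crit_exp DIM('a) p)"

definition X_local_min ::
    "'a::euclidean_space set \<Rightarrow> real \<Rightarrow> real \<Rightarrow> (('a \<Rightarrow> real) \<Rightarrow> real) \<Rightarrow> ('a \<Rightarrow> real) \<Rightarrow> bool" where
  "X_local_min \<Omega> s p J u \<longleftrightarrow> u \<in> X_space \<Omega> s p \<and>
     (\<exists>\<rho>>0. \<forall>v\<in>X_space \<Omega> s p. X_norm s p (\<lambda>x. v x - u x) < \<rho> \<longrightarrow> J u \<le> J v)"

end

theory Submission
  imports Defs "HOL-Complex_Analysis.Great_Picard"
begin

text \<open>
  Write \<open>r = p\<^sup>*\<close> and let \<open>P u\<close> be the \<open>p\<close>-th power of the norm of \<open>X(\<Omega>)\<close>. The energy is \<open>P u / p - \<integral>\<^sub>\<Omega> H(x, u)\<close>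
  with \<open>|H(x, t)| \<le> C (1 + |t|\<^sup>r)\<close>, and the solution is a minimiser on a small ball \<open>P u \<le> R\<close>. No
  weak compactness is used: by Clarkson's inequality the midpoint of two terms of a minimising sequence
  \<open>u\<^sub>n\<close> bounds \<open>P (u\<^sub>n - u\<^sub>m)\<close> by the midpoint defect of \<open>\<integral> H\<close>. By Rellich's theorem \<open>u\<^sub>n\<close> converges almost
  everywhere to some \<open>w\<close>, and then the defect is at most \<open>C (\<integral>|u\<^sub>n - w|\<^sup>r + \<integral>|u\<^sub>m - w|\<^sup>r) + o(1)\<close> by
  dominated convergence. Sobolev's inequality and Fatou's lemma bound these integrals by a multiple of
  \<open>R\<^bsup>r/p - 1\<^esup> limsup P (u\<^sub>n - u\<^sub>m)\<close>, so for small \<open>R\<close> the sequence is Cauchy and its limit is a minimiser.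
  For small \<open>\<lambda>\<close> the energy is positive on the sphere \<open>P u = R\<close> but \<open>0\<close> at the origin, hence the minimiser
  is interior, which makes it a local minimum and a critical point.
\<close>

section \<open>A smooth mollifier\<close>

text \<open>The embedding into L^r is not compact, so a minimising sequence may concentrate while it
  converges almost everywhere. A small radius excludes this: concentration costs \<open>P\<close> to
  the first power, but gains in the critical integral only to the power r/p > 1. The assumption p >=
  2 is what Clarkson's inequality rests on. The radius R depends on gamma and the growth constants
  but not on lambda, which is capped by 1 for this purpose; only then is lambda taken small relative
  to R. Three features of the definitions shape the preparations. \<open>weak_grad\<close> is a
  choice, so identities between gradients hold almost everywhere only. The boundary of \<Omega> may
  have positive measure, so integrals of gradients over \<Omega> and over the whole space agree
  because a weak gradient vanishes almost everywhere on the zero set of its function. Fubini's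
  theorem is applied over \<open>lborel\<close>, whereas the definitions use
  \<open>lebesgue\<close>; hence functions are replaced by Borel representatives before they are
  mollified.\<close>

definition flat_exp :: "nat \<Rightarrow> real \<Rightarrow> real" where
  "flat_exp m t = (if t > 0 then exp (- 1 / t) / t ^ m else 0)"

lemma flat_exp_nonneg: "0 \<le> flat_exp m t"
  by (simp add: flat_exp_def)

lemma flat_exp_eq_0: "t \<le> 0 \<Longrightarrow> flat_exp m t = 0"
  by (simp add: flat_exp_def)

text \<open>With n = m + k, the inequality (1 + x/n)^n <= exp x at x = 1/t, without the summand 1,
  gives exp (-1/t) <= (n t)^n. The case k = 0 yields boundedness, the case k = 2 differentiability
  at 0.\<close>

lemma flat_exp_le_power: "flat_exp m t \<le> real (m + k) ^ (m + k) * \<bar>t\<bar> ^ k"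
proof (cases "t > 0")
  case True
  define n where "n = m + k"
  have "exp (- 1 / t) \<le> (real n * t) ^ n"
  proof (cases "n = 0")
    case False
    have "(1 / (real n * t)) ^ n \<le> (1 + (1 / t) / real n) ^ n"
      using True False by (intro power_mono) (auto simp: field_simps)
    also have "\<dots> \<le> exp (1 / t)"
      using True False by (intro exp_ge_one_plus_x_over_n_power_n) (auto simp: field_simps intro:
          order_trans[of _ 0])
    finally show ?thesis
      using True False by (simp add: exp_minus field_simps power_divide)
  qed (use True in auto)
  then have "exp (- 1 / t) / t ^ m \<le> (real n * t) ^ n / t ^ m"
    using True by (intro divide_right_mono) auto
  also have "\<dots> = real n ^ n * t ^ k"
    using True by (simp add: n_def power_mult_distrib power_add)
  finally show ?thesis using True by (simp add: flat_exp_def n_def)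
qed (simp add: flat_exp_def)

lemma flat_exp_bounded: "flat_exp m t \<le> real m ^ m"
  using flat_exp_le_power[of m t 0] by simp

text \<open>The family is closed under differentiation, which is why the power \<open>t ^ m\<close>
  belongs to its definition: smoothness of every order follows by one induction with
  \<open>m\<close> arbitrary.\<close>

lemma flat_exp_has_derivative:
  "(flat_exp m has_real_derivative flat_exp (m + 2) t - real m * flat_exp (m + 1) t) (at t)"
proof -
  consider "t > 0" | "t < 0" | "t = 0" by linarith
  then show ?thesis
  proof cases
    case 1
    have "((\<lambda>t. exp (- 1 / t) / t ^ m) has_real_derivative flat_exp (m + 2) t - real m * flat_exp (m
        + 1) t) (at t)"
      using 1
      apply (auto intro!: derivative_eq_intros simp: flat_exp_def)
      apply (cases m)
       apply (auto simp: field_simps power2_eq_square)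
      done
    then show ?thesis
      by (rule has_field_derivative_transform_within_open[of _ _ _ "{0<..}"])
         (use 1 in \<open>auto simp: flat_exp_def\<close>)
  next
    case 2
    have "((\<lambda>t. 0) has_real_derivative flat_exp (m + 2) t - real m * flat_exp (m + 1) t) (at t)"
      using 2 by (auto simp: flat_exp_def)
    then show ?thesis
      by (rule has_field_derivative_transform_within_open[of _ _ _ "{..<0}"])
         (use 2 in \<open>auto simp: flat_exp_def\<close>)
  next
    case 3
    \<comment> \<open>The bound of order 2 leaves one factor |h| after division by h.\<close>
    have "(\<lambda>h. (flat_exp m (0 + h) - flat_exp m 0) / h) \<midarrow>0\<rightarrow> 0"
    proof (rule Lim_null_comparison)
      let ?c = "real (m + 2) ^ (m + 2)"
      show "(\<lambda>h. ?c * \<bar>h\<bar>) \<midarrow>0\<rightarrow> 0"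
        by (intro tendsto_eq_intros refl) auto
      have "norm ((flat_exp m (0 + h) - flat_exp m 0) / h) \<le> ?c * \<bar>h\<bar>" for h
        using flat_exp_le_power[of m h 2] flat_exp_nonneg[of m h]
        by (cases "h = 0") (auto simp: flat_exp_eq_0 field_simps power2_eq_square abs_mult)
      then show "\<forall>\<^sub>F h in at 0. norm ((flat_exp m (0 + h) - flat_exp m 0) / h) \<le> ?c * \<bar>h\<bar>"
        by simp
    qed
    then show ?thesis using 3 by (simp add: DERIV_def flat_exp_def)
  qed
qed

lemma C_k_Suc_imp: "C_k (Suc k) f \<Longrightarrow> C_k k f"
proof (induction k arbitrary: f)
  case 0
  then show ?case
    by (auto intro!: continuous_at_imp_continuous_on differentiable_imp_continuous_within)
qed auto

text \<open>\<open>C_k\<close> is phrased with \<open>frechet_derivative\<close>; by uniqueness of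
  derivatives, any derivative found by the calculus rules may be used instead.\<close>

lemma C_k_cong_derivative:
  assumes "\<And>x. (f has_derivative D x) (at x)" "\<And>b. b \<in> Basis \<Longrightarrow> C_k k (\<lambda>x. D x b)"
  shows "C_k (Suc k) f"
proof -
  have "frechet_derivative f (at x) = D x" for x
    using frechet_derivative_at[OF assms(1)] by simp
  then show ?thesis
    using assms by (auto simp: differentiable_def)
qed

lemma C_k_frechet:
  assumes "C_k (Suc k) f"
  shows "(f has_derivative frechet_derivative f (at x)) (at x)"
  using assms frechet_derivative_works by auto

lemma C_k_const: "C_k k (\<lambda>x. c)"
proof (induction k arbitrary: c)
  case (Suc k)
  show ?case by (rule C_k_cong_derivative[where D = "\<lambda>_ _. 0"]) (auto simp: Suc)
qed simp

lemma C_k_add: "C_k k f \<Longrightarrow> C_k k g \<Longrightarrow> C_k k (\<lambda>x. f x + g x)"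
proof (induction k arbitrary: f g)
  case 0
  then show ?case by (auto intro: continuous_intros)
next
  case (Suc k)
  show ?case
    by (rule C_k_cong_derivative[where D = "\<lambda>x h. frechet_derivative f (at x) h
        + frechet_derivative g (at x) h"])
       (use Suc in \<open>auto intro!: derivative_eq_intros C_k_frechet\<close>)
qed

lemma C_k_mult: "C_k k f \<Longrightarrow> C_k k g \<Longrightarrow> C_k k (\<lambda>x. f x * g x)"
proof (induction k arbitrary: f g)
  case 0
  then show ?case by (auto intro: continuous_intros)
next
  case (Suc k)
  show ?case
  proof (rule C_k_cong_derivative)
    show "((\<lambda>x. f x * g x) has_derivative
       (\<lambda>h. f x * frechet_derivative g (at x) h + frechet_derivative f (at x) h * g x)) (at x)" for x
      using Suc.prems by (auto intro!: derivative_eq_intros C_k_frechet)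
    show "C_k k (\<lambda>x. f x * frechet_derivative g (at x) b + frechet_derivative f (at x) b * g x)"
      if "b \<in> Basis" for b
      using Suc.prems that by (intro C_k_add Suc.IH) (auto intro: C_k_Suc_imp)
  qed
qed

lemma C_k_inner: "C_k k (\<lambda>x. (x - a) \<bullet> b)"
proof (cases k)
  case (Suc j)
  show ?thesis unfolding Suc
    by (rule C_k_cong_derivative[where D = "\<lambda>x h. h \<bullet> b"])
       (auto intro!: derivative_eq_intros C_k_const)
qed (auto intro!: continuous_intros)

text \<open>The type argument carries the space, which the result type does not show.\<close>

definition mollifier_mass :: "'a::euclidean_space itself \<Rightarrow> real \<Rightarrow> real" where
  "mollifier_mass _ e = (LINT z|(lborel :: 'a measure). flat_exp 0 (e\<^sup>2 - z \<bullet> z))"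

definition mollifier :: "real \<Rightarrow> 'a::euclidean_space \<Rightarrow> real" where
  "mollifier e z = flat_exp 0 (e\<^sup>2 - z \<bullet> z) / mollifier_mass TYPE('a) e"

text \<open>This is the gradient of \<open>mollifier e\<close>: \<open>flat_exp 2\<close> is the
  derivative of \<open>flat_exp 0\<close>, and -2 z is the gradient of
  \<open>e\<^sup>2 - z \<bullet> z\<close>.\<close>

definition mollifier_grad :: "real \<Rightarrow> 'a::euclidean_space \<Rightarrow> 'a" where
  "mollifier_grad e z = (- 2 * flat_exp 2 (e\<^sup>2 - z \<bullet> z) / mollifier_mass TYPE('a) e) *\<^sub>R z"

lemma flat_exp_compose_has_derivative:
  "((\<lambda>x. flat_exp m (c - (x - a) \<bullet> (x - a))) has_derivative
    (\<lambda>h. (flat_exp (m + 2) (c - (x - a) \<bullet> (x - a)) - real m * flat_exp (m + 1) (c - (x - a) \<bullet> (x - a)))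
       * (- 2 * ((x - a) \<bullet> h)))) (at x)"
proof -
  have "((\<lambda>x. c - (x - a) \<bullet> (x - a)) has_derivative (\<lambda>h. - 2 * ((x - a) \<bullet> h))) (at x)"
    by (auto intro!: derivative_eq_intros simp: inner_commute)
  from has_derivative_compose[OF this has_field_derivative_imp_has_derivative[OF flat_exp_has_derivative]]
  show ?thesis by simp
qed

lemma flat_exp_continuous: "continuous_on UNIV (flat_exp m)"
  using flat_exp_has_derivative by (meson DERIV_isCont continuous_at_imp_continuous_on)

lemma C_k_flat_exp_compose: "C_k k (\<lambda>x. flat_exp m (c - (x - a) \<bullet> (x - a)))"
proof (induction k arbitrary: m)
  case 0
  then show ?case
    by (auto intro!: continuous_intros continuous_on_compose2[OF flat_exp_continuous])
next
  case (Suc k)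
  have 2: "C_k k (\<lambda>x. (flat_exp (m + 2) (c - (x - a) \<bullet> (x - a)) + - real m * flat_exp (m
      + 1) (c - (x - a) \<bullet> (x - a)))
       * (- 2 * ((x - a) \<bullet> b)))" for b
    by (intro C_k_mult C_k_add C_k_const C_k_inner Suc.IH)
  show ?case
    by (rule C_k_cong_derivative[OF flat_exp_compose_has_derivative]) (use 2 in simp)
qed

lemma flat_exp_compose_borel[measurable]:
  "(\<lambda>z::'a::euclidean_space. flat_exp m (c - z \<bullet> z)) \<in> borel_measurable borel"
  by (intro borel_measurable_continuous_onI continuous_intros continuous_on_compose2[OF
      flat_exp_continuous]) auto

lemma flat_exp_compose_0:
  assumes "0 < e" "e \<le> norm z" shows "flat_exp m (e\<^sup>2 - z \<bullet> z) = 0"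
proof -
  have "e\<^sup>2 \<le> (norm z)\<^sup>2" using assms by (intro power_mono) auto
  then show ?thesis by (simp add: flat_exp_eq_0 power2_norm_eq_inner)
qed

lemma bounded_support_integrable:
  fixes f :: "'a::euclidean_space \<Rightarrow> 'b::{banach, second_countable_topology}"
  assumes [measurable]: "f \<in> borel_measurable borel"
    and "\<And>x. norm (f x) \<le> B" "\<And>x. R < norm x \<Longrightarrow> f x = 0"
  shows "integrable lborel f"
proof (rule Bochner_Integration.integrable_bound[where f = "\<lambda>x. indicator (cball 0 R) x * B"])
  show "integrable lborel (\<lambda>x::'a. indicator (cball 0 R) x * B)"
    by (intro integrable_mult_left integrable_real_indicator) (auto simp:
        emeasure_lborel_cball_finite[unfolded infinity_ennreal_def])
  show "AE x in lborel. norm (f x) \<le> norm (indicator (cball 0 R) x * B)"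
  proof (rule AE_I2)
    fix x
    show "norm (f x) \<le> norm (indicator (cball 0 R) x * B)"
      using assms(2)[of x] assms(3)[of x] by (cases "norm x \<le> R") auto
  qed
qed auto

lemma continuous_compact_support_bounded:
  fixes f :: "'a::euclidean_space \<Rightarrow> real"
  assumes "continuous_on UNIV f" "\<And>x. R < norm x \<Longrightarrow> f x = 0"
  obtains B where "\<And>x. \<bar>f x\<bar> \<le> B"
proof -
  have "compact (f ` cball 0 R)"
    by (intro compact_continuous_image continuous_on_subset[OF assms(1)]) auto
  then obtain B where "\<forall>y\<in>f ` cball 0 R. norm y \<le> B" using compact_imp_bounded bounded_iff by metis
  then have "\<bar>f x\<bar> \<le> max B 0" for x
    using assms(2)[of x] by (cases "norm x \<le> R") (auto simp: le_max_iff_disj)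
  then show ?thesis using that by blast
qed

lemma mollifier_mass_integrable:
  assumes "0 < e" shows "integrable lborel (\<lambda>z::'a::euclidean_space. flat_exp 0 (e\<^sup>2 - z \<bullet> z))"
  by (rule bounded_support_integrable[where B = 1 and R = e])
     (use assms flat_exp_bounded[of 0] flat_exp_nonneg[of 0] in \<open>auto simp: flat_exp_compose_0\<close>)

lemma mollifier_mass_pos: assumes "0 < e" shows "0 < mollifier_mass TYPE('a::euclidean_space) e"
proof -
  let ?f = "\<lambda>z::'a. flat_exp 0 (e\<^sup>2 - z \<bullet> z)"
  have "?f z > 0" if "z \<in> ball 0 e" for z
  proof -
    have "(norm z)\<^sup>2 < e\<^sup>2" using that by (intro power_strict_mono) auto
    then show ?thesis by (simp add: flat_exp_def power2_norm_eq_inner)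
  qed
  then have *: "ball 0 e \<subseteq> {z \<in> space lborel. ?f z \<noteq> 0}" by force
  have "0 < emeasure lborel (ball (0::'a) e)"
    using content_ball_pos[OF assms, of 0]
    by (metis emeasure_eq_ennreal_measure ennreal_0 enn2real_eq_0_iff less_irrefl measure_def not_gr_zero)
  also have "\<dots> \<le> emeasure lborel {z \<in> space lborel. ?f z \<noteq> 0}"
    by (intro emeasure_mono *) auto
  finally have "(LINT z|lborel. ?f z) \<noteq> 0"
    using integral_nonneg_eq_0_iff_AE[OF mollifier_mass_integrable[OF assms, where 'a='a]]
    by (subst integral_nonneg_eq_0_iff_AE[OF mollifier_mass_integrable[OF assms]])
       (auto simp: flat_exp_nonneg AE_iff_measurable[OF _ refl])
  moreover have "0 \<le> (LINT z|lborel. ?f z)"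
    by (intro integral_nonneg_AE) (simp add: flat_exp_nonneg)
  ultimately show ?thesis by (simp add: mollifier_mass_def)
qed

lemma mollifier_nonneg: "0 < e \<Longrightarrow> 0 \<le> mollifier e z"
  by (simp add: mollifier_def flat_exp_nonneg mollifier_mass_pos less_imp_le)

lemma mollifier_eq_0: "0 < e \<Longrightarrow> e \<le> norm z \<Longrightarrow> mollifier e z = 0"
  by (simp add: mollifier_def flat_exp_compose_0)

lemma mollifier_grad_eq_0: "0 < e \<Longrightarrow> e \<le> norm z \<Longrightarrow> mollifier_grad e z = 0"
  by (simp add: mollifier_grad_def flat_exp_compose_0)

lemma mollifier_integral:
  assumes "0 < e" shows "(LINT z|lborel. mollifier e (z::'a::euclidean_space)) = 1"
  using mollifier_mass_pos[OF assms, where 'a='a]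
  by (simp add: mollifier_def) (simp add: mollifier_mass_def)

lemma mollifier_has_derivative:
  "(mollifier e has_derivative (\<lambda>h. mollifier_grad e z \<bullet> h)) (at z)"
proof -
  have "((\<lambda>x. flat_exp 0 (e\<^sup>2 - (x - 0) \<bullet> (x - 0)) * (1 / mollifier_mass TYPE('a) e)) has_derivative
    (\<lambda>h. (flat_exp (0 + 2) (e\<^sup>2 - (z - 0) \<bullet> (z - 0)) - real 0 * flat_exp (0 + 1) (e\<^sup>2 - (z - 0) \<bullet> (z - 0)))
       * (- 2 * ((z - 0) \<bullet> h)) * (1 / mollifier_mass TYPE('a) e))) (at z)"
    by (rule has_derivative_mult_left[OF flat_exp_compose_has_derivative])
  moreover have "(\<lambda>x::'a. flat_exp 0 (e\<^sup>2 - (x - 0) \<bullet> (x - 0)) * (1 / mollifier_mass TYPE('a) e))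
      = mollifier e"
    by (simp add: mollifier_def[abs_def])
  moreover have "(\<lambda>h. (flat_exp (0 + 2) (e\<^sup>2 - (z - 0) \<bullet> (z - 0)) - real 0 * flat_exp (0
      + 1) (e\<^sup>2 - (z - 0) \<bullet> (z - 0)))
       * (- 2 * ((z - 0) \<bullet> h)) * (1 / mollifier_mass TYPE('a) e)) = (\<lambda>h. mollifier_grad e z \<bullet> h)"
    by (simp add: mollifier_grad_def[abs_def] fun_eq_iff field_simps numeral_2_eq_2)
  ultimately show ?thesis by simp
qed

lemma mollifier_grad_continuous: "continuous_on UNIV (mollifier_grad e)"
  unfolding mollifier_grad_def[abs_def] divide_inverse
  by (intro continuous_intros continuous_on_compose2[OF flat_exp_continuous]) auto

lemma mollifier_continuous: "continuous_on UNIV (mollifier e)"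
  using mollifier_has_derivative has_derivative_continuous
  by (blast intro: continuous_at_imp_continuous_on)

lemma mollifier_borel[measurable]: "mollifier e \<in> borel_measurable borel"
  by (intro borel_measurable_continuous_onI mollifier_continuous)

lemma mollifier_grad_borel[measurable]: "mollifier_grad e \<in> borel_measurable borel"
  by (intro borel_measurable_continuous_onI mollifier_grad_continuous)

lemma mollifier_bounded: "mollifier e (z::'a::euclidean_space) \<le> 1 / \<bar>mollifier_mass TYPE('a) e\<bar>"
proof -
  have "mollifier e z \<le> \<bar>flat_exp 0 (e\<^sup>2 - z \<bullet> z)\<bar> / \<bar>mollifier_mass TYPE('a) e\<bar>"
    unfolding mollifier_def by (metis abs_divide abs_ge_self)
  also have "\<dots> \<le> 1 / \<bar>mollifier_mass TYPE('a) e\<bar>"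
    using flat_exp_bounded[of 0] by (intro divide_right_mono) (auto simp: flat_exp_nonneg)
  finally show ?thesis .
qed

lemma mollifier_norm_bounded: "0 < e \<Longrightarrow> norm (mollifier e (z::'a::euclidean_space))
    \<le> 1 / \<bar>mollifier_mass TYPE('a) e\<bar>"
  using mollifier_bounded[of e z] mollifier_nonneg[of e z] by simp

text \<open>The 8 is the factor 2 of \<open>mollifier_grad\<close> times the bound 2^2 of
  \<open>flat_exp 2\<close>; the last factor e bounds |z| on the support.\<close>

definition mollifier_lip :: "'a::euclidean_space itself \<Rightarrow> real \<Rightarrow> real" where
  "mollifier_lip _ e = 8 / mollifier_mass TYPE('a) e * e"

lemma mollifier_grad_bounded:
  assumes "0 < e" shows "norm (mollifier_grad e (z::'a::euclidean_space)) \<le> mollifier_lip TYPE('a) e"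
proof (cases "e \<le> norm z")
  case True
  then show ?thesis using assms mollifier_mass_pos[OF assms, where 'a='a]
      by (simp add: mollifier_grad_eq_0 mollifier_lip_def)
next
  case False
  have "norm (mollifier_grad e z) = 2 * flat_exp 2 (e\<^sup>2 - z \<bullet> z) / mollifier_mass TYPE('a) e * norm z"
    using mollifier_mass_pos[OF assms, where 'a='a] by (simp add: mollifier_grad_def flat_exp_nonneg)
  also have "\<dots> \<le> 8 / mollifier_mass TYPE('a) e * e"
    using mollifier_mass_pos[OF assms, where 'a='a] False assms flat_exp_bounded[of 2] flat_exp_nonneg[of 2]
    by (intro mult_mono divide_right_mono) auto
  finally show ?thesis by (simp add: mollifier_lip_def)
qed

lemma mollifier_Lipschitz:
  assumes "0 < e"
  shows "\<bar>mollifier e x - mollifier e (y::'a::euclidean_space)\<bar> \<le> mollifier_lip TYPE('a) e * norm (x - y)"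
proof -
  have "norm (mollifier e x - mollifier e y) \<le> mollifier_lip TYPE('a) e * norm (x - y)"
  proof (rule differentiable_bound[of UNIV])
    show "onorm ((\<bullet>) (mollifier_grad e z)) \<le> mollifier_lip TYPE('a) e" for z :: 'a
    proof (rule onorm_le)
      show "norm (mollifier_grad e z \<bullet> h) \<le> mollifier_lip TYPE('a) e * norm h" for h
        using Cauchy_Schwarz_ineq2[of "mollifier_grad e z" h] mollifier_grad_bounded[OF assms, of z]
        by (smt (verit) mult_right_mono norm_ge_zero real_norm_def)
    qed
  qed (use mollifier_has_derivative in \<open>auto simp: has_derivative_at_withinI\<close>)
  then show ?thesis by simp
qed

lemma mollifier_integrable:
  assumes "0 < e" shows "integrable lborel (mollifier e)"
  by (rule bounded_support_integrable[where R = e, OF _ mollifier_norm_bounded[OF assms]])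
    (use assms in \<open>auto intro: mollifier_eq_0\<close>)

lemma mollifier_translate_has_derivative:
  "((\<lambda>y. mollifier e (x - y)) has_derivative (\<lambda>h. - (mollifier_grad e (x - y) \<bullet> h))) (at y)"
proof -
  have "((\<lambda>y. x - y) has_derivative (\<lambda>h. - h)) (at y)"
    by (auto intro!: derivative_eq_intros)
  from has_derivative_compose[OF this mollifier_has_derivative]
  show ?thesis by simp
qed

text \<open>Makes the mollifier centred at x an admissible test function in the definition of a weak
  gradient; everything known about weak gradients is extracted through these test functions.\<close>

lemma mollifier_test_function:
  assumes "0 < e"
  shows "test_function (\<lambda>y. mollifier e (x - y))"
  unfolding test_function_def
proof (intro conjI allI)
  have "mollifier e (x - y) = flat_exp 0 (e\<^sup>2 - (y - x) \<bullet> (y - x)) * (1 / mollifier_mass TYPE('a) e)" for y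
    by (simp add: mollifier_def inner_diff inner_commute add.commute)
  then show "C_k k (\<lambda>y. mollifier e (x - y))" for k
    by (simp only:) (rule C_k_mult[OF C_k_flat_exp_compose C_k_const])
  have "{y. mollifier e (x - y) \<noteq> 0} \<subseteq> cball x e"
    using mollifier_eq_0[OF assms] by (force simp: dist_norm not_le[symmetric])
  then show "compact (closure {y. mollifier e (x - y) \<noteq> 0})"
    by (meson bounded_cball bounded_subset compact_closure)
qed

section \<open>Mollification of integrable functions\<close>

lemma nn_integral_lborel_reflect:
  fixes f :: "'a::euclidean_space \<Rightarrow> ennreal"
  assumes [measurable]: "f \<in> borel_measurable borel"
  shows "(\<integral>\<^sup>+x. f (t - x) \<partial>lborel) = (\<integral>\<^sup>+x. f x \<partial>lborel)"
proof -
  have "lborel = distr lborel borel (\<lambda>x::'a. t - x)"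
    using lborel_affine[of "-1" t] by (simp add: density_1)
  then have "(\<integral>\<^sup>+x. f x \<partial>lborel) = (\<integral>\<^sup>+x. f x \<partial>distr lborel borel (\<lambda>x::'a. t - x))" by simp
  then show ?thesis by (simp add: nn_integral_distr)
qed

lemma nn_integral_lborel_translate:
  fixes f :: "'a::euclidean_space \<Rightarrow> ennreal"
  assumes [measurable]: "f \<in> borel_measurable borel"
  shows "(\<integral>\<^sup>+x. f (x - t) \<partial>lborel) = (\<integral>\<^sup>+x. f x \<partial>lborel)"
proof -
  have "lborel = distr lborel borel (\<lambda>x::'a. x - t)"
    using lborel_affine[of "1" "-t"] by (simp add: density_1)
  then have "(\<integral>\<^sup>+x. f x \<partial>lborel) = (\<integral>\<^sup>+x. f x \<partial>distr lborel borel (\<lambda>x::'a. x - t))" by simp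
  then show ?thesis by (simp add: nn_integral_distr)
qed

lemma integral_lborel_reflect:
  fixes f :: "'a::euclidean_space \<Rightarrow> 'b::{banach, second_countable_topology}"
  assumes [measurable]: "f \<in> borel_measurable borel"
  shows "(LINT x|lborel. f (t - x)) = (LINT x|lborel. f x)"
proof -
  have "lborel = distr lborel borel (\<lambda>x::'a. t - x)"
    using lborel_affine[of "-1" t] by (simp add: density_1)
  then have "(LINT x|lborel. f x) = (LINT x|distr lborel borel (\<lambda>x::'a. t - x). f x)" by simp
  then show ?thesis by (simp add: integral_distr)
qed

lemma integral_lborel_translate:
  fixes f :: "'a::euclidean_space \<Rightarrow> 'b::{banach, second_countable_topology}"
  assumes [measurable]: "f \<in> borel_measurable borel"
  shows "(LINT x|lborel. f (x - t)) = (LINT x|lborel. f x)"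
proof -
  have "lborel = distr lborel borel (\<lambda>x::'a. x - t)"
    using lborel_affine[of "1" "-t"] by (simp add: density_1)
  then have "(LINT x|lborel. f x) = (LINT x|distr lborel borel (\<lambda>x::'a. x - t). f x)" by simp
  then show ?thesis by (simp add: integral_distr)
qed

lemma integrable_lborel_reflect:
  fixes f :: "'a::euclidean_space \<Rightarrow> 'b::{banach, second_countable_topology}"
  assumes "integrable lborel f"
  shows "integrable lborel (\<lambda>x. f (t - x))"
proof -
  have [measurable]: "f \<in> borel_measurable borel" using assms by auto
  show ?thesis using assms nn_integral_lborel_reflect[of "\<lambda>x. ennreal (norm (f x))" t]
    by (simp add: integrable_iff_bounded)
qed

lemma integrable_lborel_translate:
  fixes f :: "'a::euclidean_space \<Rightarrow> 'b::{banach, second_countable_topology}"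
  assumes "integrable lborel f"
  shows "integrable lborel (\<lambda>x. f (x - t))"
proof -
  have [measurable]: "f \<in> borel_measurable borel" using assms by auto
  show ?thesis using assms nn_integral_lborel_translate[of "\<lambda>x. ennreal (norm (f x))" t]
    by (simp add: integrable_iff_bounded)
qed

section \<open>Continuity of translations in L^1\<close>

definition L1_translation_continuous :: "('a::euclidean_space \<Rightarrow> 'b::euclidean_space) \<Rightarrow> bool" where
  "L1_translation_continuous f \<longleftrightarrow>
     (\<forall>e>0. \<exists>d>0. \<forall>z. norm z < d \<longrightarrow> (LINT x|lborel. norm (f (x - z) - f x)) \<le> e)"

lemma L1_translation_triangle:
  fixes f g :: "'a::euclidean_space \<Rightarrow> 'b::euclidean_space"
  assumes f: "integrable lborel f" and g: "integrable lborel g"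
  shows "(LINT x|lborel. norm (f (x - z) - f x)) \<le>
    (LINT x|lborel. norm (g (x - z) - g x)) + 2 * (LINT x|lborel. norm (f x - g x))"
proof -
  have [measurable]: "f \<in> borel_measurable borel" "g \<in> borel_measurable borel"
    using borel_measurable_integrable[OF f] borel_measurable_integrable[OF g] by simp_all
  have i: "integrable lborel (\<lambda>x. norm (f (x - z) - g (x - z)))" "integrable lborel (\<lambda>x. norm (g (x - z) - g
      x))"
    "integrable lborel (\<lambda>x. norm (f x - g x))" "integrable lborel (\<lambda>x. norm (f (x - z) - f x))"
    by (intro integrable_norm Bochner_Integration.integrable_diff integrable_lborel_translate f g)+
  have "(LINT x|lborel. norm (f (x - z) - f x)) \<le>
    (LINT x|lborel. norm (f (x - z) - g (x - z)) + (norm (g (x - z) - g x) + norm (f x - g x)))"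
  proof (intro integral_mono Bochner_Integration.integrable_add i)
    fix x
    have "norm ((f (x - z) - g (x - z)) + ((g (x - z) - g x) - (f x - g x))) \<le>
        norm (f (x - z) - g (x - z)) + (norm (g (x - z) - g x) + norm (f x - g x))"
      using norm_triangle_ineq[of "f (x - z) - g (x - z)" "(g (x - z) - g x) - (f x - g x)"]
        norm_triangle_ineq4[of "g (x - z) - g x" "f x - g x"] by linarith
    then show "norm (f (x - z) - f x) \<le> norm (f (x - z) - g (x - z)) + (norm (g (x - z) - g x)
        + norm (f x - g x))"
      by simp
  qed
  also have "\<dots> = (LINT x|lborel. norm (f (x - z) - g (x - z))) + ((LINT x|lborel. norm (g (x - z) - g x))
      + (LINT x|lborel. norm (f x - g x)))"
    by (simp only: Bochner_Integration.integral_add[OF i(1) Bochner_Integration.integrable_add[OF i(2,3)]]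
        Bochner_Integration.integral_add[OF i(2,3)])
  also have "(LINT x|lborel. norm (f (x - z) - g (x - z))) = (LINT x|lborel. norm (f x - g x))"
    using integral_lborel_translate[of "\<lambda>x. norm (f x - g x)" z] by simp
  finally show ?thesis by simp
qed

lemma L1_translation_continuous_approx:
  fixes f :: "'a::euclidean_space \<Rightarrow> 'b::euclidean_space"
  assumes "integrable lborel f"
    and "\<And>e. e > 0 \<Longrightarrow> \<exists>g. integrable lborel g \<and> L1_translation_continuous g
        \<and> (LINT x|lborel. norm (f x - g x)) \<le> e"
  shows "L1_translation_continuous f"
  unfolding L1_translation_continuous_def
proof (intro allI impI)
  fix e :: real assume "e > 0"
  then obtain g where g: "integrable lborel g" "L1_translation_continuous g" "(LINT x|lborel. norm (f x - g
      x)) \<le> e / 4"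
    using assms(2)[of "e / 4"] by auto
  from g(2) \<open>e > 0\<close> obtain d where d: "d > 0" "\<And>z. norm z < d \<Longrightarrow> (LINT x|lborel. norm (g (x - z) - g x))
      \<le> e / 2"
    unfolding L1_translation_continuous_def by (metis half_gt_zero)
  show "\<exists>d>0. \<forall>z. norm z < d \<longrightarrow> (LINT x|lborel. norm (f (x - z) - f x)) \<le> e"
  proof (intro exI[of _ d] conjI allI impI d)
    fix z :: 'a assume "norm z < d"
    then show "(LINT x|lborel. norm (f (x - z) - f x)) \<le> e"
      using L1_translation_triangle[OF assms(1) g(1), of z] g(3) d(2)[of z] by linarith
  qed
qed

text \<open>A point of an open set stays in it under small shifts, so dominated convergence handles
  the part of U that a shift moves out of U, whatever the boundary looks like. The part that is
  moved in is the same quantity for the opposite shift.\<close>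

lemma L1_translation_continuous_open:
  fixes U :: "'a::euclidean_space set"
  assumes U: "open U" "emeasure lborel U < \<infinity>"
  shows "L1_translation_continuous (\<lambda>x. indicator U x :: real)"
proof -
  have [measurable]: "U \<in> sets borel" using U by auto
  have int: "integrable lborel (\<lambda>x. indicator U x :: real)" using U by (simp add: integrable_real_indicator)
  note int' = integrable_lborel_translate[OF int]
  \<comment> \<open>The measure of the points of U that are not in U + z. The symmetric difference
    of U and U + z has measure F z + F (- z) by translation invariance.\<close>
  define F where "F z = (LINT x|lborel. indicator U x * (1 - indicator U (x - z)) :: real)" for z
  have *: "(LINT x|lborel. norm (indicator U (x - z) - indicator U x :: real)) = F z + F (- z)" for z
  proof -
    have i: "integrable lborel (\<lambda>x. indicator U x * (1 - indicator U (x - z)) :: real)" for z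
      by (rule Bochner_Integration.integrable_bound[OF int]) (auto simp: indicator_def)
    have "F (-z) = (LINT x|lborel. indicator U (x - z) * (1 - indicator U x) :: real)"
      unfolding F_def using integral_lborel_translate[of "\<lambda>x. indicator U x * (1 - indicator U (x
          + z)) :: real" z]
      by simp
    moreover have "(LINT x|lborel. norm (indicator U (x - z) - indicator U x :: real)) =
        (LINT x|lborel. indicator U x * (1 - indicator U (x - z))
            + indicator U (x - z) * (1 - indicator U x) :: real)"
      by (intro Bochner_Integration.integral_cong) (auto simp: indicator_def)
    ultimately show ?thesis
      using i[of z] integrable_lborel_translate[OF i[of "-z"], of z] unfolding F_def
      by (subst (asm) Bochner_Integration.integral_add) simp_all
  qed
  have "F \<midarrow>0\<rightarrow> 0"
    unfolding tendsto_at_iff_sequentially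
  proof safe
    fix X :: "nat \<Rightarrow> 'a" assume X: "X \<longlonglongrightarrow> 0"
    have "(\<lambda>n. F (X n)) \<longlonglongrightarrow> (LINT x|(lborel :: 'a measure). (0 :: real))"
      unfolding F_def
    proof (rule integral_dominated_convergence[where w = "\<lambda>x. indicator U x"])
      show "AE x in lborel. (\<lambda>n. indicator U x * (1 - indicator U (x - X n)) :: real) \<longlonglongrightarrow> 0"
      proof (rule AE_I2)
        fix x
        show "(\<lambda>n. indicator U x * (1 - indicator U (x - X n)) :: real) \<longlonglongrightarrow> 0"
        proof (cases "x \<in> U")
          case True
          have "(\<lambda>n. x - X n) \<longlonglongrightarrow> x - 0" by (intro tendsto_intros X)
          then have "\<forall>\<^sub>F n in sequentially. x - X n \<in> U"
            using U(1) True by (simp add: topological_tendstoD)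
          then have "\<forall>\<^sub>F n in sequentially. (indicator U x * (1 - indicator U (x - X n)) :: real) = 0"
            by eventually_elim auto
          then show ?thesis by (rule tendsto_eventually)
        qed auto
      qed
    qed (use int in \<open>auto simp: indicator_def\<close>)
    then show "(F \<circ> X) \<longlonglongrightarrow> 0" by (simp add: o_def)
  qed
  then have F0: "\<exists>d>0. \<forall>z. z \<noteq> 0 \<and> norm z < d \<longrightarrow> \<bar>F z\<bar> < e" if "e > 0" for e
    using that by (force simp: LIM_def)
  have "(\<lambda>x. indicator U x * (1 - indicator U x)) = (\<lambda>x. 0 :: real)" by (auto simp: indicator_def)
  then have F00: "F 0 = 0" by (simp add: F_def)
  show ?thesis
    unfolding L1_translation_continuous_def *
  proof (intro allI impI)
    fix e :: real assume "e > 0"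
    then obtain d where d: "d > 0" "\<And>z. z \<noteq> 0 \<Longrightarrow> norm z < d \<Longrightarrow> \<bar>F z\<bar> < e / 2"
      using F0[of "e / 2"] by auto
    show "\<exists>d>0. \<forall>z. norm z < d \<longrightarrow> F z + F (- z) \<le> e"
    proof (intro exI[of _ d] conjI allI impI d(1))
      fix z :: 'a assume "norm z < d"
      then show "F z + F (- z) \<le> e"
        using d(2)[of z] d(2)[of "-z"] F00 \<open>e > 0\<close> by (cases "z = 0") auto
    qed
  qed
qed

lemma L1_translation_continuous_scaleR:
  assumes "L1_translation_continuous (f :: 'a::euclidean_space \<Rightarrow> real)"
  shows "L1_translation_continuous (\<lambda>x. f x *\<^sub>R c)"
  unfolding L1_translation_continuous_def
proof (intro allI impI)
  fix e :: real assume "e > 0"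
  then obtain d where "d > 0" "\<And>z. norm z < d \<Longrightarrow> (LINT x|lborel. norm (f (x - z) - f x)) \<le> e / (1 + norm c)"
    using assms unfolding L1_translation_continuous_def
    by (metis add_pos_nonneg divide_pos_pos norm_ge_zero zero_less_one)
  moreover have "(LINT x|lborel. norm (f (x - z) *\<^sub>R c - f x *\<^sub>R c))
      = (LINT x|lborel. norm (f (x - z) - f x)) * norm c" for z
    by (simp flip: scaleR_left_diff_distrib)
  moreover have "(e / (1 + norm c)) * norm c \<le> e"
    using \<open>e > 0\<close> by (simp add: field_simps add_pos_nonneg)
  ultimately show "\<exists>d>0. \<forall>z. norm z < d \<longrightarrow> (LINT x|lborel. norm (f (x - z) *\<^sub>R c - f x *\<^sub>R c)) \<le> e"
    by (smt (verit, best) mult_right_mono norm_ge_zero)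
qed

text \<open>By outer regularity a set of finite measure is approximated in L^1 by open sets, the
  only sets treated directly; sums and limits are then absorbed by the approximation lemma and the
  triangle inequality.\<close>

theorem integrable_imp_L1_translation_continuous:
  fixes f :: "'a::euclidean_space \<Rightarrow> 'b::euclidean_space"
  assumes "integrable lborel f"
  shows "L1_translation_continuous f"
  using assms
proof (induction rule: integrable_induct)
  case (base A c)
  have "L1_translation_continuous (\<lambda>x. indicator A x :: real)"
  proof (rule L1_translation_continuous_approx)
    fix e :: real assume "e > 0"
    obtain U where U: "open U" "A \<subseteq> U" "emeasure lborel (U - A) < ennreal e"
      using outer_regular_lborel[of A e] base \<open>e > 0\<close> by auto
    have fin: "emeasure lborel U < \<infinity>"
    proof -
      have "emeasure lborel (A \<union> (U - A)) \<le> emeasure lborel A + emeasure lborel (U - A)"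
        using base U by (intro emeasure_subadditive) auto
      also have "\<dots> < \<infinity>" using base U by (auto simp: less_top intro: order_less_trans)
      finally show ?thesis using U by (simp add: Un_absorb1)
    qed
    have "(LINT x|lborel. norm (indicator A x - indicator U x :: real))
        = (LINT x|lborel. indicator (U - A) x)"
      using U by (intro Bochner_Integration.integral_cong) (auto simp: indicator_def)
    also have "\<dots> \<le> e"
      using U(3) \<open>e > 0\<close> by (simp add: measure_def enn2real_leI less_imp_le)
    finally show "\<exists>g. integrable lborel g \<and> L1_translation_continuous g
        \<and> (LINT x|lborel. norm (indicator A x - g x :: real)) \<le> e"
      using L1_translation_continuous_open[OF U(1) fin] U fin
      by (intro exI[of _ "\<lambda>x. indicator U x"]) (auto simp: integrable_real_indicator)
  qed (use base in \<open>auto simp: integrable_real_indicator\<close>)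
  then show ?case by (rule L1_translation_continuous_scaleR)
next
  case (add f g)
  show ?case
    unfolding L1_translation_continuous_def
  proof (intro allI impI)
    fix e :: real assume "e > 0"
    obtain d1 where d1: "d1 > 0" "\<And>z. norm z < d1 \<Longrightarrow> (LINT x|lborel. norm (f (x - z) - f x)) \<le> e / 2"
      using add.IH(1) \<open>e > 0\<close> unfolding L1_translation_continuous_def by (metis half_gt_zero)
    obtain d2 where d2: "d2 > 0" "\<And>z. norm z < d2 \<Longrightarrow> (LINT x|lborel. norm (g (x - z) - g x)) \<le> e / 2"
      using add.IH(2) \<open>e > 0\<close> unfolding L1_translation_continuous_def by (metis half_gt_zero)
    have "(LINT x|lborel. norm (f (x - z) + g (x - z) - (f x + g x))) \<le> e" if "norm z < min d1 d2" for z
    proof -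
      note [simp] = integrable_lborel_translate[OF add.hyps(1)] integrable_lborel_translate[OF add.hyps(2)]
          add.hyps
      have "(LINT x|lborel. norm (f (x - z) + g (x - z) - (f x + g x))) \<le>
            (LINT x|lborel. norm (f (x - z) - f x) + norm (g (x - z) - g x))"
        by (intro integral_mono norm_diff_triangle_ineq) auto
      also have "\<dots> = (LINT x|lborel. norm (f (x - z) - f x)) + (LINT x|lborel. norm (g (x - z) - g x))"
        by (intro Bochner_Integration.integral_add) auto
      also have "\<dots> \<le> e" using d1(2)[of z] d2(2)[of z] that by auto
      finally show ?thesis .
    qed
    then show "\<exists>d>0. \<forall>z. norm z < d \<longrightarrow> (LINT x|lborel. norm (f (x - z) + g (x - z) - (f x + g x))) \<le> e"
      using d1(1) d2(1) by (intro exI[of _ "min d1 d2"]) auto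
  qed
next
  case (lim f s)
  show ?case
  proof (rule L1_translation_continuous_approx[OF \<open>integrable lborel f\<close>])
    fix e :: real assume "e > 0"
    have "(\<lambda>i. LINT x|lborel. norm (f x - s i x)) \<longlonglongrightarrow> (LINT x|(lborel :: 'a measure). (0::real))"
    proof (rule integral_dominated_convergence[where w = "\<lambda>x. 3 * norm (f x)"])
      show "AE x in lborel. (\<lambda>i. norm (f x - s i x)) \<longlonglongrightarrow> 0"
      proof (rule AE_I2)
        fix x
        have "(\<lambda>i. norm (f x - s i x)) \<longlonglongrightarrow> norm (f x - f x)"
          using lim.hyps(2)[of x] by (intro tendsto_intros) auto
        then show "(\<lambda>i. norm (f x - s i x)) \<longlonglongrightarrow> 0" by simp
      qed
      show "AE x in lborel. norm (norm (f x - s i x)) \<le> 3 * norm (f x)" for i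
      proof (rule AE_I2)
        fix x
        show "norm (norm (f x - s i x)) \<le> 3 * norm (f x)"
          using lim.hyps(3)[of x i] norm_triangle_ineq4[of "f x" "s i x"] by simp
      qed
    qed (use lim.hyps in auto)
    then have "\<forall>\<^sub>F i in sequentially. (LINT x|lborel. norm (f x - s i x)) < e"
      using \<open>e > 0\<close> by (intro order_tendstoD) auto
    then obtain i where "(LINT x|lborel. norm (f x - s i x)) < e"
      by (auto simp: eventually_sequentially)
    then show "\<exists>g. integrable lborel g \<and> L1_translation_continuous g \<and> (LINT x|lborel. norm (f x - g x))
        \<le> e"
      using lim.hyps(1) lim.IH by (intro exI[of _ "s i"]) auto
  qed
qed

section \<open>Mollification as an average of translates\<close>

definition moll :: "real \<Rightarrow> ('a::euclidean_space \<Rightarrow> 'b::euclidean_space) \<Rightarrow> 'a \<Rightarrow> 'b" where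
  "moll e f x = (LINT y|lborel. mollifier e (x - y) *\<^sub>R f y)"

context
  fixes f :: "'a::euclidean_space \<Rightarrow> 'b::euclidean_space" and e :: real
  assumes f: "integrable lborel f" and e: "0 < e"
begin

lemma moll_f_borel[measurable]: "f \<in> borel_measurable borel"
  using borel_measurable_integrable[OF f] by simp

lemma moll_integrable_times:
  assumes [measurable]: "k \<in> borel_measurable borel" and "\<And>y. \<bar>k y\<bar> \<le> B"
  shows "integrable lborel (\<lambda>y. k y *\<^sub>R f y)"
proof (rule Bochner_Integration.integrable_bound[where f = "\<lambda>y. B * norm (f y)"])
  show "AE y in lborel. norm (k y *\<^sub>R f y) \<le> norm (B * norm (f y))"
  proof (rule AE_I2)
    fix y
    have "\<bar>k y\<bar> * norm (f y) \<le> \<bar>B\<bar> * norm (f y)"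
      using assms(2)[of y] by (intro mult_right_mono) auto
    then show "norm (k y *\<^sub>R f y) \<le> norm (B * norm (f y))" by (simp add: abs_mult)
  qed
qed (use f in auto)

lemma moll_integrand_integrable: "integrable lborel (\<lambda>y. mollifier e (x - y) *\<^sub>R f y)"
  using mollifier_norm_bounded[OF e, of "x - _"] by (intro moll_integrable_times) auto

lemma moll_norm_le: "norm (moll e f x) \<le> (LINT y|lborel. mollifier e (x - y) * norm (f y))"
  using integral_norm_bound[of lborel "\<lambda>y. mollifier e (x - y) *\<^sub>R f y"]
  by (simp add: moll_def mollifier_nonneg[OF e])

lemma moll_bounded: "norm (moll e f x) \<le> 1 / \<bar>mollifier_mass TYPE('a) e\<bar> * (LINT y|lborel. norm (f y))"
proof -
  have "(LINT y|lborel. mollifier e (x - y) * norm (f y)) \<le> (LINT y|lborel. 1 / \<bar>mollifier_mass TYPE('a) e\<bar>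
      * norm (f y))"
  proof (rule integral_mono)
    show "integrable lborel (\<lambda>y. mollifier e (x - y) * norm (f y))"
      using integrable_norm[OF moll_integrand_integrable[of x]] by (simp add: mollifier_nonneg[OF e])
    show "mollifier e (x - y) * norm (f y) \<le> 1 / \<bar>mollifier_mass TYPE('a) e\<bar> * norm (f y)" for y
      by (rule mult_right_mono[OF mollifier_bounded]) simp
  qed (use f in simp)
  then show ?thesis using moll_norm_le[of x] by simp
qed

text \<open>The function enters only through its L^1 norm. At a fixed scale the mollifications of an
  L^1-bounded sequence are thus equi-Lipschitz, which \<open>moll_sequence_compact\<close>
  exploits.\<close>

lemma moll_Lipschitz:
  "norm (moll e f x - moll e f x') \<le> mollifier_lip TYPE('a) e * norm (x - x') * (LINT y|lborel. norm (f y))"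
proof -
  have "moll e f x - moll e f x' = (LINT y|lborel. (mollifier e (x - y) - mollifier e (x' - y)) *\<^sub>R f y)"
    unfolding moll_def scaleR_left_diff_distrib
    by (intro Bochner_Integration.integral_diff[symmetric] moll_integrand_integrable)
  also have "norm \<dots> \<le> (LINT y|lborel. norm ((mollifier e (x - y) - mollifier e (x' - y)) *\<^sub>R f y))"
    by (rule integral_norm_bound)
  also have "\<dots> \<le> (LINT y|lborel. mollifier_lip TYPE('a) e * norm (x - x') * norm (f y))"
  proof (intro integral_mono)
    show "integrable lborel (\<lambda>y. norm ((mollifier e (x - y) - mollifier e (x' - y)) *\<^sub>R f y))"
      unfolding scaleR_left_diff_distrib
      by (intro integrable_norm Bochner_Integration.integrable_diff moll_integrand_integrable)
    show "norm ((mollifier e (x - y) - mollifier e (x' - y)) *\<^sub>R f y)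
        \<le> mollifier_lip TYPE('a) e * norm (x - x') * norm (f y)" for y
      using mollifier_Lipschitz[OF e, of "x - y" "x' - y"] by (auto intro!: mult_right_mono)
  qed (use f in auto)
  finally show ?thesis by simp
qed

lemma moll_continuous: "continuous_on UNIV (moll e f)"
proof (rule lipschitz_on_continuous_on)
  let ?L = "\<bar>mollifier_lip TYPE('a) e\<bar> * (LINT y|lborel. norm (f y))"
  show "?L-lipschitz_on UNIV (moll e f)"
  proof (rule lipschitz_onI)
    fix x y
    have "norm (moll e f x - moll e f y) \<le> mollifier_lip TYPE('a) e * norm (x - y) * (LINT y|lborel. norm (f
        y))"
      by (rule moll_Lipschitz)
    also have "\<dots> \<le> \<bar>mollifier_lip TYPE('a) e\<bar> * norm (x - y) * (LINT y|lborel. norm (f y))"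
      by (intro mult_right_mono) auto
    finally show "dist (moll e f x) (moll e f y) \<le> ?L * dist x y" by (simp add: dist_norm mult_ac)
  qed simp
qed

lemma moll_borel: "moll e f \<in> borel_measurable borel"
  by (intro borel_measurable_continuous_onI moll_continuous)

lemma moll_inner: "moll e f x \<bullet> b = moll e (\<lambda>y. f y \<bullet> b) x"
  using integral_inner_left[of b lborel "\<lambda>y. mollifier e (x - y) *\<^sub>R f y"] moll_integrand_integrable
  by (simp add: moll_def)

lemma moll_eq_0:
  assumes "\<And>y. R < norm y \<Longrightarrow> f y = 0" "R + e < norm x"
  shows "moll e f x = 0"
proof -
  have "mollifier e (x - y) *\<^sub>R f y = 0" for y
  proof (cases "R < norm y")
    case False
    then have "e \<le> norm (x - y)" using norm_triangle_ineq2[of x y] assms(2) by linarith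
    then show ?thesis by (simp add: mollifier_eq_0[OF e])
  qed (simp add: assms(1))
  then show ?thesis by (simp add: moll_def del: scaleR_eq_0_iff)
qed

lemma moll_shift_integrable: "integrable lborel (\<lambda>z. mollifier e z *\<^sub>R f (x - z))"
  using integrable_lborel_reflect[OF moll_integrand_integrable, of x x] by simp

lemma moll_shift: "moll e f x = (LINT z|lborel. mollifier e z *\<^sub>R f (x - z))"
  using integral_lborel_reflect[of "\<lambda>y. mollifier e (x - y) *\<^sub>R f y" x] by (simp add: moll_def)

lemma moll_diff_le:
  "ennreal (norm (moll e f x - f x)) \<le> (\<integral>\<^sup>+z. ennreal (mollifier e z * norm (f (x - z) - f x)) \<partial>lborel)"
proof -
  have i: "integrable lborel (\<lambda>z::'a. mollifier e z *\<^sub>R f x)"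
    by (rule integrable_scaleR_left) (rule mollifier_integrable[OF e])
  have "f x = (LINT z|lborel. mollifier e (z :: 'a) *\<^sub>R f x)"
    using integral_scaleR_left[OF mollifier_integrable[OF e, where 'a='a], of "f x"]
        by (simp add: mollifier_integral[OF e])
  then have "moll e f x - f x = (LINT z|lborel. mollifier e z *\<^sub>R (f (x - z) - f x))"
    unfolding moll_shift scaleR_right_diff_distrib
    by (subst Bochner_Integration.integral_diff[OF moll_shift_integrable i]) simp
  then have "ennreal (norm (moll e f x - f x)) \<le> (\<integral>\<^sup>+z. ennreal (norm (mollifier e z *\<^sub>R (f (x - z) - f x)))
      \<partial>lborel)"
    using integral_norm_bound_ennreal[OF Bochner_Integration.integrable_diff[OF moll_shift_integrable i]]
    by (simp add: scaleR_right_diff_distrib)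
  then show ?thesis by (simp add: mollifier_nonneg[OF e])
qed

lemma mollifier_nn_integral: "(\<integral>\<^sup>+z. ennreal (mollifier e (z::'a)) \<partial>lborel) = 1"
  using nn_integral_eq_integral[OF mollifier_integrable[OF e, where 'a='a]]
  by (simp add: mollifier_nonneg[OF e] mollifier_integral[OF e])

text \<open>By Fubini's theorem the error is an average, with weight \<open>mollifier e\<close>, of
  translation differences over shifts shorter than \<open>e\<close>.\<close>

lemma moll_L1_diff_le:
  assumes C: "\<And>z. norm z < e \<Longrightarrow> (LINT x|lborel. norm (f (x - z) - f x)) \<le> C"
  shows "(\<integral>\<^sup>+x. ennreal (norm (moll e f x - f x)) \<partial>lborel) \<le> ennreal C"
proof -
  have [measurable]: "moll e f \<in> borel_measurable borel" by (rule moll_borel)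
  have "(\<integral>\<^sup>+x. ennreal (norm (moll e f x - f x)) \<partial>lborel) \<le>
        (\<integral>\<^sup>+x. (\<integral>\<^sup>+z. ennreal (mollifier e z * norm (f (x - z) - f x)) \<partial>lborel) \<partial>lborel)"
    by (intro nn_integral_mono moll_diff_le)
  also have "\<dots> = (\<integral>\<^sup>+z. (\<integral>\<^sup>+x. ennreal (mollifier e z * norm (f (x - z) - f x)) \<partial>lborel) \<partial>lborel)"
    by (rule lborel_pair.Fubini') measurable
  also have "\<dots> = (\<integral>\<^sup>+z. ennreal (mollifier e z) * (\<integral>\<^sup>+x. ennreal (norm (f (x - z) - f x)) \<partial>lborel) \<partial>lborel)"
    by (intro nn_integral_cong) (simp add: mollifier_nonneg[OF e] ennreal_mult nn_integral_cmult)
  also have "\<dots> \<le> (\<integral>\<^sup>+z. ennreal (mollifier e (z::'a)) * ennreal C \<partial>lborel)"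
  proof (intro nn_integral_mono)
    fix z :: 'a
    show "ennreal (mollifier e z) * (\<integral>\<^sup>+x. ennreal (norm (f (x - z) - f x)) \<partial>lborel)
        \<le> ennreal (mollifier e z) * ennreal C"
    proof (cases "norm z < e")
      case True
      have "(\<integral>\<^sup>+x. ennreal (norm (f (x - z) - f x)) \<partial>lborel) = ennreal (LINT x|lborel. norm (f (x - z) - f
          x))"
        using f integrable_lborel_translate[OF f] by (intro nn_integral_eq_integral) auto
      then show ?thesis using C[OF True] by (auto intro!: mult_left_mono ennreal_leI)
    qed (simp add: mollifier_eq_0[OF e])
  qed
  also have "\<dots> = ennreal C"
    by (subst nn_integral_multc) (simp_all add: mollifier_nn_integral)
  finally show ?thesis .
qed

text \<open>Jensen's inequality for the probability density \<open>mollifier e (x - y)\<close> in y: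
  the tangent of t^p at the mean value c lies below t^p, and its linear term integrates to
  0.\<close>

lemma moll_powr_le:
  assumes p: "1 \<le> p"
  shows "ennreal (norm (moll e f x) powr p) \<le> (\<integral>\<^sup>+y. ennreal (mollifier e (x - y) * norm (f y) powr p)
      \<partial>lborel)"
proof (cases "(\<integral>\<^sup>+y. ennreal (mollifier e (x - y) * norm (f y) powr p) \<partial>lborel) = \<infinity>")
  case False
  define c where "c = (LINT y|lborel. mollifier e (x - y) * norm (f y))"
  have i: "integrable lborel (\<lambda>y. mollifier e (x - y) * norm (f y))"
    using integrable_norm[OF moll_integrand_integrable[of x]] by (simp add: mollifier_nonneg[OF e])
  have ip: "integrable lborel (\<lambda>y. mollifier e (x - y) * norm (f y) powr p)"
    using False by (intro integrableI_nonneg) (auto simp: mollifier_nonneg[OF e] less_top)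
  have ie: "integrable lborel (\<lambda>y. mollifier e (x - y))"
    by (rule integrable_lborel_reflect[OF mollifier_integrable[OF e]])
  have c0: "0 \<le> c" unfolding c_def by (intro integral_nonneg_AE) (simp add: mollifier_nonneg[OF e])
  have tangent: "c powr p + p * c powr (p - 1) * (a - c) \<le> a powr p" if "0 \<le> a" for a
  proof (cases "c = 0")
    case False
    then have "c > 0" using c0 by simp
    show ?thesis
    proof (cases "a = 0")
      case True
      have "c powr p = c powr (p - 1) * c" using \<open>c > 0\<close> by (simp add: powr_diff)
      then have "c powr p + p * c powr (p - 1) * (a - c) = (1 - p) * (c powr (p - 1) * c)" using True
          by (simp add: algebra_simps)
      also have "\<dots> \<le> 0" using p \<open>c > 0\<close> by (intro mult_nonpos_nonneg) auto
      finally show ?thesis using True by simp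
    next
      case False
      then have "a > 0" using that by simp
      have "a powr p - c powr p \<ge> p * c powr (p - 1) * (a - c)"
        by (rule convex_on_imp_above_tangent[OF powr_convex[OF p]])
           (use \<open>a > 0\<close> \<open>c > 0\<close> in \<open>auto intro!: derivative_eq_intros simp: interior_open\<close>)
      then show ?thesis by simp
    qed
  qed (use p in simp)
  have eq: "mollifier e (x - y) * (c powr p + p * c powr (p - 1) * (norm (f y) - c)) =
      (c powr p - p * c powr (p - 1) * c) * mollifier e (x - y)
          + p * c powr (p - 1) * (mollifier e (x - y) * norm (f y))" for y
    by (simp add: algebra_simps)
  have "c powr p = (LINT y|lborel. mollifier e (x - y) * (c powr p
      + p * c powr (p - 1) * (norm (f y) - c)))"
  proof -
    have "(LINT y|lborel. mollifier e (x - y) * (c powr p + p * c powr (p - 1) * (norm (f y) - c))) =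
      (LINT y|lborel. (c powr p - p * c powr (p - 1) * c) * mollifier e (x - y)
          + p * c powr (p - 1) * (mollifier e (x - y) * norm (f y)))"
      by (simp only: eq)
    also have "\<dots> = (c powr p - p * c powr (p - 1) * c) * (LINT y|lborel. mollifier e (x - y))
        + p * c powr (p - 1) * c"
      using i ie by (simp add: c_def)
    also have "(LINT y|lborel. mollifier e (x - y)) = 1"
      using integral_lborel_reflect[of "mollifier e" x] by (simp add: mollifier_integral[OF e])
    finally show ?thesis by simp
  qed
  also have "\<dots> \<le> (LINT y|lborel. mollifier e (x - y) * norm (f y) powr p)"
  proof (intro integral_mono ip)
    show "integrable lborel (\<lambda>y. mollifier e (x - y) * (c powr p + p * c powr (p - 1) * (norm (f y) - c)))"
      unfolding eq by (intro Bochner_Integration.integrable_add integrable_mult_right i ie)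
    show "mollifier e (x - y) * (c powr p + p * c powr (p - 1) * (norm (f y) - c))
        \<le> mollifier e (x - y) * norm (f y) powr p" for y
      by (intro mult_left_mono tangent mollifier_nonneg[OF e]) simp
  qed
  finally have "norm (moll e f x) powr p \<le> (LINT y|lborel. mollifier e (x - y) * norm (f y) powr p)"
    using moll_norm_le[of x] powr_mono2[of p "norm (moll e f x)" c] p by (simp add: c_def)
  then show ?thesis
    by (subst nn_integral_eq_integral[OF ip]) (auto simp: mollifier_nonneg[OF e] intro!: ennreal_leI)
qed simp

lemma moll_nn_integral_powr_le:
  assumes p: "1 \<le> p"
  shows "(\<integral>\<^sup>+x. ennreal (norm (moll e f x) powr p) \<partial>lborel) \<le> (\<integral>\<^sup>+x. ennreal (norm (f x) powr p) \<partial>lborel)"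
proof -
  have "(\<integral>\<^sup>+x. ennreal (norm (moll e f x) powr p) \<partial>lborel) \<le>
        (\<integral>\<^sup>+x. (\<integral>\<^sup>+y. ennreal (mollifier e (x - y) * norm (f y) powr p) \<partial>lborel) \<partial>lborel)"
    by (intro nn_integral_mono moll_powr_le p)
  also have "\<dots> = (\<integral>\<^sup>+y. (\<integral>\<^sup>+x. ennreal (mollifier e (x - y) * norm (f y) powr p) \<partial>lborel) \<partial>lborel)"
    by (rule lborel_pair.Fubini') measurable
  also have "\<dots> = (\<integral>\<^sup>+y. ennreal (norm (f y) powr p) * (\<integral>\<^sup>+x. ennreal (mollifier e (x - y)) \<partial>lborel)
      \<partial>lborel)"
    by (intro nn_integral_cong) (simp add: mollifier_nonneg[OF e] ennreal_mult nn_integral_multc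
        mult.commute)
  also have "\<dots> = (\<integral>\<^sup>+x. ennreal (norm (f x) powr p) \<partial>lborel)"
    using nn_integral_lborel_translate[of "\<lambda>x. ennreal (mollifier e (x :: 'a))"]
        by (simp add: mollifier_nn_integral)
  finally show ?thesis .
qed

end


section \<open>Gradients of mollified functions\<close>

lemma moll_has_derivative:
  fixes u :: "'a::euclidean_space \<Rightarrow> real"
  assumes u: "integrable lborel u" and e: "0 < e"
  shows "(moll e u has_derivative (\<lambda>h. LINT y|lborel. (mollifier_grad e (x - y) \<bullet> h) * u y)) (at x)"
proof -
  have [measurable]: "u \<in> borel_measurable borel" using borel_measurable_integrable[OF u] by simp
  let ?L = "mollifier_lip TYPE('a) e"
  define V where "V = (LINT y|lborel. u y *\<^sub>R mollifier_grad e (x - y))"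
  have iV: "integrable lborel (\<lambda>y. u y *\<^sub>R mollifier_grad e (x - y))"
  proof (rule Bochner_Integration.integrable_bound[where f = "\<lambda>y. ?L * norm (u y)"])
    have "norm (u y) * norm (mollifier_grad e (x - y)) \<le> norm (u y) * \<bar>?L\<bar>" for y
      using mollifier_grad_bounded[OF e, of "x - y"] by (intro mult_left_mono) auto
    then show "AE y in lborel. norm (u y *\<^sub>R mollifier_grad e (x - y)) \<le> norm (?L * norm (u y))"
      by (intro AE_I2) (simp add: abs_mult mult.commute)
  qed (use u in auto)
  have V: "V \<bullet> h = (LINT y|lborel. (mollifier_grad e (x - y) \<bullet> h) * u y)" for h
    unfolding V_def using iV by (subst integral_inner_left[symmetric]) (auto simp: mult.commute)
  have iVh: "integrable lborel (\<lambda>y. (mollifier_grad e (x - y) \<bullet> h) * u y)" for h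
    using integrable_inner_left[OF iV, of h] by (simp add: mult.commute)
  note int = moll_integrand_integrable[OF u e]
  have "(moll e u has_derivative (\<lambda>h. V \<bullet> h)) (at x)"
    unfolding has_derivative_at
  proof (intro conjI)
    show "(\<lambda>h. norm (moll e u (x + h) - moll e u x - V \<bullet> h) / norm h) \<midarrow>0\<rightarrow> 0"
      unfolding tendsto_at_iff_sequentially
    proof safe
      fix X :: "nat \<Rightarrow> 'a" assume X0: "\<forall>i. X i \<in> UNIV - {0}" and X: "X \<longlonglongrightarrow> 0"
      define q where "q n y = (mollifier e (x + X n - y) - mollifier e (x - y) - mollifier_grad e (x - y) \<bullet>
          X n) / norm (X n)" for n y
      have q: "(moll e u (x + X n) - moll e u x - V \<bullet> X n) / norm (X n) = (LINT y|lborel. q n y * u y)"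
          for n
      proof -
        have "moll e u (x + X n) - moll e u x - V \<bullet> X n =
            (LINT y|lborel. (mollifier e (x + X n - y) *\<^sub>R u y - mollifier e (x - y) *\<^sub>R u y) -
                (mollifier_grad e (x - y) \<bullet> X n) * u y)"
          unfolding V moll_def using int[of "x + X n"] int[of x] iVh[of "X n"]
          by (simp only: Bochner_Integration.integral_diff Bochner_Integration.integrable_diff)
        also have "\<dots> = (LINT y|lborel. norm (X n) * (q n y * u y))"
        proof (intro Bochner_Integration.integral_cong refl)
          fix y
          have "norm (X n) * q n y = mollifier e (x + X n - y) - mollifier e (x - y) - mollifier_grad e (x -
              y) \<bullet> X n"
            using X0 by (simp add: q_def)
          then show "mollifier e (x + X n - y) *\<^sub>R u y - mollifier e (x - y) *\<^sub>R u y - (mollifier_grad e (x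
              - y) \<bullet> X n) * u y =
            norm (X n) * (q n y * u y)"
            unfolding mult.assoc[symmetric] by (simp add: left_diff_distrib)
        qed
        finally show ?thesis using X0 by simp
      qed
      have "(\<lambda>n. LINT y|lborel. q n y * u y) \<longlonglongrightarrow> (LINT y|(lborel :: 'a measure). (0 :: real))"
      \<comment> \<open>The remainder quotient is bounded by the Lipschitz constant twice: once for
        the increment of the mollifier and once for its linear part.\<close>
      proof (rule integral_dominated_convergence[where w = "\<lambda>y. 2 * ?L * norm (u y)"])
        show "AE y in lborel. (\<lambda>n. q n y * u y) \<longlonglongrightarrow> 0"
        proof (rule AE_I2)
          fix y
          have "(\<lambda>h. norm (mollifier e (x - y + h) - mollifier e (x - y) - mollifier_grad e (x - y) \<bullet> h) /
              norm h) \<midarrow>0\<rightarrow> 0"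
            using mollifier_has_derivative[of e "x - y"] unfolding has_derivative_at by simp
          then have "((\<lambda>h. norm (mollifier e (x - y + h) - mollifier e (x - y) - mollifier_grad e (x - y) \<bullet>
              h) / norm h) \<circ> X) \<longlonglongrightarrow> 0"
            using X0 X unfolding tendsto_at_iff_sequentially by blast
          then have "(\<lambda>n. norm (q n y)) \<longlonglongrightarrow> 0"
            by (simp add: o_def q_def diff_add_eq)
          then have "(\<lambda>n. q n y) \<longlonglongrightarrow> 0" by (rule tendsto_norm_zero_cancel)
          then show "(\<lambda>n. q n y * u y) \<longlonglongrightarrow> 0" by (rule tendsto_mult_left_zero)
        qed
        show "AE y in lborel. norm (q n y * u y) \<le> 2 * ?L * norm (u y)" for n
        proof (rule AE_I2)
          fix y
          have "\<bar>mollifier e (x + X n - y) - mollifier e (x - y)\<bar> \<le> ?L * norm (X n)"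
            using mollifier_Lipschitz[OF e, of "x + X n - y" "x - y"] by simp
          moreover have "\<bar>mollifier_grad e (x - y) \<bullet> X n\<bar> \<le> ?L * norm (X n)"
            using Cauchy_Schwarz_ineq2[of "mollifier_grad e (x - y)" "X n"] mollifier_grad_bounded[OF e, of
                "x - y"]
            by (smt (verit) mult_right_mono norm_ge_zero)
          ultimately have "\<bar>mollifier e (x + X n - y) - mollifier e (x - y) - mollifier_grad e (x - y) \<bullet> X
              n\<bar> \<le> 2 * ?L * norm (X n)"
            by linarith
          then have "\<bar>q n y\<bar> \<le> 2 * ?L"
            using X0 by (simp add: q_def field_simps)
          then show "norm (q n y * u y) \<le> 2 * ?L * norm (u y)"
            by (simp add: abs_mult mult_right_mono)
        qed
      qed (use u in \<open>auto simp: q_def\<close>)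
      then have "(\<lambda>n. norm ((moll e u (x + X n) - moll e u x - V \<bullet> X n) / norm (X n))) \<longlonglongrightarrow> 0"
        unfolding q by (intro tendsto_norm_zero) simp
      then show "((\<lambda>h. norm (moll e u (x + h) - moll e u x - V \<bullet> h) / norm h) \<circ> X) \<longlonglongrightarrow> 0"
        by (simp add: o_def)
    qed
  qed (rule bounded_linear_inner_right)
  then show ?thesis by (simp add: V)
qed

text \<open>The distributional gradient for functions that are integrable with respect to the Borel
  measure, for which Fubini's theorem is available (\<open>lebesgue\<close> is not a product measure).\<close>

definition grad_lborel :: "('a::euclidean_space \<Rightarrow> real) \<Rightarrow> ('a \<Rightarrow> 'a) \<Rightarrow> bool" where
  "grad_lborel u G \<longleftrightarrow> integrable lborel u \<and> integrable lborel G \<and>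
     (\<forall>\<phi>. test_function \<phi> \<longrightarrow> (\<forall>b\<in>Basis.
        (LINT x|lborel. u x * frechet_derivative \<phi> (at x) b) = - (LINT x|lborel. (G x \<bullet> b) * \<phi> x)))"

lemma grad_lborelD:
  assumes "grad_lborel u G"
  shows "integrable lborel u" "integrable lborel G" "u \<in> borel_measurable borel" "G \<in> borel_measurable
      borel"
  using assms borel_measurable_integrable[of lborel u] borel_measurable_integrable[of lborel G]
  by (auto simp: grad_lborel_def)

text \<open>Mollification commutes with the weak gradient. In the test function
  \<open>mollifier e (x - y)\<close> the variable y has a minus sign, which cancels the sign of the
  integration by parts.\<close>

lemma moll_has_gradient:
  assumes uG: "grad_lborel u G" and e: "0 < e"
  shows "(moll e u has_derivative (\<lambda>h. moll e G x \<bullet> h)) (at x)"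
proof -
  note u = grad_lborelD(1)[OF uG] and G = grad_lborelD(2)[OF uG]
  note D = moll_has_derivative[OF u e, of x]
  have lin: "linear (\<lambda>h. LINT y|lborel. (mollifier_grad e (x - y) \<bullet> h) * u y)"
    using has_derivative_linear[OF D] .
  have "(LINT y|lborel. (mollifier_grad e (x - y) \<bullet> b) * u y) = moll e G x \<bullet> b" if "b \<in> Basis" for b
  proof -
    have "frechet_derivative (\<lambda>y. mollifier e (x - y)) (at y) b = - (mollifier_grad e (x - y) \<bullet> b)" for y
      using frechet_derivative_at[OF mollifier_translate_has_derivative, of e x y] by metis
    moreover have "(LINT y|lborel. u y * frechet_derivative (\<lambda>y. mollifier e (x - y)) (at y) b) =
        - (LINT y|lborel. (G y \<bullet> b) * mollifier e (x - y))"
      using uG that mollifier_test_function[OF e, of x] unfolding grad_lborel_def by blast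
    ultimately have "(LINT y|lborel. u y * (mollifier_grad e (x - y) \<bullet> b))
        = (LINT y|lborel. (G y \<bullet> b) * mollifier e (x - y))"
      by simp
    then show ?thesis
      unfolding moll_inner[OF G e] by (simp add: moll_def mult.commute)
  qed
  then have "(\<lambda>h. LINT y|lborel. (mollifier_grad e (x - y) \<bullet> h) * u y) = (\<lambda>h. moll e G x \<bullet> h)"
    by (intro linear_eq_stdbasis lin linear_compose bounded_linear.linear bounded_linear_inner_right) auto
  then show ?thesis using D by simp
qed

lemma moll_L1_tendsto:
  fixes f :: "'a::euclidean_space \<Rightarrow> 'b::euclidean_space"
  assumes f: "integrable lborel f" and c: "0 < c"
  shows "\<exists>d>0. \<forall>e. 0 < e \<and> e < d \<longrightarrow> (\<integral>\<^sup>+x. ennreal (norm (moll e f x - f x)) \<partial>lborel) \<le> ennreal c"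
proof -
  obtain d where d: "d > 0" "\<And>z. norm z < d \<Longrightarrow> (LINT x|lborel. norm (f (x - z) - f x)) \<le> c"
    using integrable_imp_L1_translation_continuous[OF f] c unfolding L1_translation_continuous_def by blast
  have "(\<integral>\<^sup>+x. ennreal (norm (moll e f x - f x)) \<partial>lborel) \<le> ennreal c" if "0 < e" "e < d" for e
    using that d(2) by (intro moll_L1_diff_le[OF f]) auto
  then show ?thesis using d(1) by blast
qed

lemma moll_integrable:
  fixes f :: "'a::euclidean_space \<Rightarrow> 'b::euclidean_space"
  assumes f: "integrable lborel f" and e: "0 < e"
  shows "integrable lborel (moll e f)"
proof -
  have "(\<integral>\<^sup>+x. ennreal (norm (moll e f x) powr 1) \<partial>lborel) \<le> (\<integral>\<^sup>+x. ennreal (norm (f x) powr 1) \<partial>lborel)"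
    by (rule moll_nn_integral_powr_le[OF f e]) simp
  then have "(\<integral>\<^sup>+x. ennreal (norm (moll e f x)) \<partial>lborel) \<le> (\<integral>\<^sup>+x. ennreal (norm (f x)) \<partial>lborel)"
    by simp
  also have "\<dots> < \<infinity>" using f unfolding integrable_iff_bounded by blast
  finally show ?thesis
    using moll_borel[OF f e] unfolding integrable_iff_bounded by simp
qed

lemma moll_L1_seq:
  fixes f :: "'a::euclidean_space \<Rightarrow> 'b::euclidean_space"
  assumes f: "integrable lborel f"
  shows "(\<lambda>n. LINT x|lborel. norm (moll (1 / Suc n) f x - f x)) \<longlonglongrightarrow> 0"
proof (rule LIMSEQ_I)
  fix c :: real assume "0 < c"
  obtain d where d: "d > 0" "\<And>e. 0 < e \<Longrightarrow> e < d \<Longrightarrow> (\<integral>\<^sup>+x. ennreal (norm (moll e f x - f x)) \<partial>lborel)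
      \<le> ennreal (c / 2)"
    using moll_L1_tendsto[OF f, of "c / 2"] \<open>0 < c\<close> by auto
  obtain N where N: "1 / real (Suc N) < d" using reals_Archimedean[OF d(1)]
      by (auto simp: inverse_eq_divide)
  have "(LINT x|lborel. norm (moll (1 / Suc n) f x - f x)) \<le> c / 2" if "n \<ge> N" for n
  proof -
    have "1 / real (Suc n) \<le> 1 / real (Suc N)" using that by (simp add: field_simps)
    then have "(\<integral>\<^sup>+x. ennreal (norm (moll (1 / Suc n) f x - f x)) \<partial>lborel) \<le> ennreal (c / 2)"
      using N by (intro d(2)) auto
    moreover have "integrable lborel (\<lambda>x. norm (moll (1 / Suc n) f x - f x))"
      by (intro integrable_norm Bochner_Integration.integrable_diff moll_integrable f) simp
    ultimately show ?thesis
      using \<open>0 < c\<close> by (subst (asm) nn_integral_eq_integral) auto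
  qed
  then show "\<exists>N. \<forall>n\<ge>N. norm ((LINT x|lborel. norm (moll (1 / Suc n) f x - f x)) - 0) < c"
    using \<open>0 < c\<close> by (intro exI[of _ N]) (force simp: integral_nonneg_AE abs_of_nonneg)
qed

text \<open>For a mollification, the fundamental theorem of calculus along the segment from x to x -
  z and translation invariance give the bound; mollifying does not increase the L^1 norm of the
  gradient, and the approximation error is at most the arbitrary c.\<close>

lemma gradient_translation_le:
  assumes uG: "grad_lborel u G"
  shows "(LINT x|lborel. norm (u (x - z) - u x)) \<le> norm z * (LINT x|lborel. norm (G x))"
proof (rule field_le_epsilon)
  fix c :: real assume "0 < c"
  note u = grad_lborelD(1)[OF uG] and G = grad_lborelD(2)[OF uG]
  \<comment> \<open>Half of c, since \<open>L1_translation_triangle\<close> counts the distance to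
    the approximation twice.\<close>
  obtain d where d: "d > 0" "\<And>e. 0 < e \<Longrightarrow> e < d \<Longrightarrow> (\<integral>\<^sup>+x. ennreal (norm (moll e u x - u x)) \<partial>lborel)
      \<le> ennreal (c / 2)"
    using moll_L1_tendsto[OF u, of "c / 2"] \<open>0 < c\<close> by auto
  define e where "e = d / 2"
  have e: "0 < e" "e < d" using d by (auto simp: e_def)
  define w where "w = moll e u"
  define W where "W = moll e G"
  have w: "integrable lborel w" and W: "integrable lborel W"
    unfolding w_def W_def by (intro moll_integrable u G e)+
  have [measurable]: "W \<in> borel_measurable borel" "w \<in> borel_measurable borel"
    using borel_measurable_integrable[OF W] borel_measurable_integrable[OF w] by simp_all
  have "(LINT x|lborel. norm (w x - u x)) \<le> c / 2"
  proof -
    have "integrable lborel (\<lambda>x. norm (w x - u x))"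
      by (intro integrable_norm Bochner_Integration.integrable_diff w u)
    then show ?thesis using d(2)[OF e] \<open>0 < c\<close> unfolding w_def
      by (subst (asm) nn_integral_eq_integral) auto
  qed
  moreover have "(LINT x|lborel. norm (w (x - z) - w x)) \<le> norm z * (LINT x|lborel. norm (W x))"
  proof -
    have contW: "continuous_on UNIV W" unfolding W_def by (rule moll_continuous[OF G e(1)])
    have *: "ennreal (norm (w (x - z) - w x)) \<le> (\<integral>\<^sup>+t. ennreal (norm z * norm (W (x - t *\<^sub>R z))) * indicator
        {0..1} t \<partial>lborel)" for x
    proof -
      have D: "((\<lambda>t. w (x - t *\<^sub>R z)) has_real_derivative W (x - t *\<^sub>R z) \<bullet> (- z)) (at t)" for t
      proof -
        have "((\<lambda>t. x - t *\<^sub>R z) has_derivative (\<lambda>h. - (h *\<^sub>R z))) (at t)"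
          by (auto intro!: derivative_eq_intros)
        from has_derivative_compose[OF this moll_has_gradient[OF uG e(1)]]
        show ?thesis unfolding w_def W_def has_field_derivative_def
          by (rule has_derivative_eq_rhs) (auto simp: fun_eq_iff mult.commute)
      qed
      have cont: "isCont (\<lambda>t. W (x - t *\<^sub>R z) \<bullet> (- z)) t" for t
      proof -
        have "continuous_on UNIV (\<lambda>t. W (x - t *\<^sub>R z) \<bullet> (- z))"
          by (intro continuous_intros continuous_on_compose2[OF contW]) auto
        then show ?thesis by (simp add: continuous_on_eq_continuous_at)
      qed
      have eq: "(LINT t|lborel. (W (x - t *\<^sub>R z) \<bullet> (- z)) * indicator {0..1} t)
          = w (x - 1 *\<^sub>R z) - w (x - 0 *\<^sub>R z)"
        by (rule integral_FTC_Icc_real[OF _ D cont]) simp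
      have i: "integrable lborel (\<lambda>t. (W (x - t *\<^sub>R z) \<bullet> (- z)) * indicator {0..1} t)"
        using has_bochner_integral_FTC_Icc_real[OF _ D cont, of 0 1] by (simp add: has_bochner_integral_iff)
      have "ennreal (norm (w (x - z) - w x)) \<le> (\<integral>\<^sup>+t. ennreal (norm ((W (x - t *\<^sub>R z) \<bullet> (- z)) * indicator
          {0..1} t)) \<partial>lborel)"
        using integral_norm_bound_ennreal[OF i] unfolding eq by simp
      also have "\<dots> \<le> (\<integral>\<^sup>+t. ennreal (norm z * norm (W (x - t *\<^sub>R z))) * indicator {0..1} t \<partial>lborel)"
        using Cauchy_Schwarz_ineq2[of "W (x - _ *\<^sub>R z)" "z"]
        by (intro nn_integral_mono) (auto simp: indicator_def mult.commute intro!: ennreal_leI)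
      finally show ?thesis .
    qed
    have "(\<integral>\<^sup>+x. ennreal (norm (w (x - z) - w x)) \<partial>lborel) \<le>
      (\<integral>\<^sup>+x. (\<integral>\<^sup>+t. ennreal (norm z * norm (W (x - t *\<^sub>R z))) * indicator {0..1} t \<partial>lborel) \<partial>lborel)"
      by (intro nn_integral_mono *)
    also have "\<dots> = (\<integral>\<^sup>+t. (\<integral>\<^sup>+x. ennreal (norm z * norm (W (x - t *\<^sub>R z))) * indicator {0..1} t \<partial>lborel)
        \<partial>lborel)"
      by (rule lborel_pair.Fubini') measurable
    also have "\<dots> = (\<integral>\<^sup>+t. ennreal (norm z * (LINT x|lborel. norm (W x))) * indicator {0..1} (t::real)
        \<partial>lborel)"
    proof (intro nn_integral_cong)
      fix t :: real
      have "(\<integral>\<^sup>+x. ennreal (norm z * norm (W (x - t *\<^sub>R z))) * indicator {0..1} t \<partial>lborel) =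
        (\<integral>\<^sup>+x. ennreal (norm z * norm (W x)) * indicator {0..1} t \<partial>lborel)"
        using nn_integral_lborel_translate[of "\<lambda>x. ennreal (norm z * norm (W x)) * indicator {0..1} t" "t
            *\<^sub>R z"] by simp
      also have "\<dots> = ennreal (LINT x|lborel. norm z * norm (W x)) * indicator {0..1} t"
        using W nn_integral_eq_integral[of lborel "\<lambda>x. norm z * norm (W x)"]
            by (subst nn_integral_multc) auto
      finally show "(\<integral>\<^sup>+x. ennreal (norm z * norm (W (x - t *\<^sub>R z))) * indicator {0..1} t \<partial>lborel) =
        ennreal (norm z * (LINT x|lborel. norm (W x))) * indicator {0..1} t" by simp
    qed
    also have "\<dots> = ennreal (norm z * (LINT x|lborel. norm (W x)))"
      by (simp add: nn_integral_cmult)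
    finally have "(\<integral>\<^sup>+x. ennreal (norm (w (x - z) - w x)) \<partial>lborel)
        \<le> ennreal (norm z * (LINT x|lborel. norm (W x)))" .
    moreover have "integrable lborel (\<lambda>x. norm (w (x - z) - w x))"
      by (intro integrable_norm Bochner_Integration.integrable_diff w integrable_lborel_translate)
    ultimately show ?thesis
      by (subst (asm) nn_integral_eq_integral) (auto simp: integral_nonneg_AE)
  qed
  moreover have "(LINT x|lborel. norm (W x)) \<le> (LINT x|lborel. norm (G x))"
  proof -
    have "(\<integral>\<^sup>+x. ennreal (norm (W x) powr 1) \<partial>lborel) \<le> (\<integral>\<^sup>+x. ennreal (norm (G x) powr 1) \<partial>lborel)"
      unfolding W_def by (rule moll_nn_integral_powr_le[OF G e(1)]) simp
    then show ?thesis using G W by (simp add: nn_integral_eq_integral integral_nonneg_AE)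
  qed
  moreover have "(LINT x|lborel. norm (u (x - z) - u x)) \<le>
    (LINT x|lborel. norm (w (x - z) - w x)) + 2 * (LINT x|lborel. norm (u x - w x))"
    by (rule L1_translation_triangle[OF u w])
  ultimately show "(LINT x|lborel. norm (u (x - z) - u x)) \<le> norm z * (LINT x|lborel. norm (G x)) + c"
    using mult_left_mono[of "LINT x|lborel. norm (W x)" "LINT x|lborel. norm (G x)" "norm z"]
    by (simp add: abs_minus_commute[of "u _" "w _"])
qed

text \<open>Gives mollification a rate that is uniform over families with bounded gradients; plain
  L^1 convergence would not suffice for compactness.\<close>

lemma moll_L1_gradient_le:
  assumes uG: "grad_lborel u G" and e: "0 < e"
  shows "(LINT x|lborel. norm (moll e u x - u x)) \<le> e * (LINT x|lborel. norm (G x))"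
proof -
  note u = grad_lborelD(1)[OF uG]
  have "(\<integral>\<^sup>+x. ennreal (norm (moll e u x - u x)) \<partial>lborel) \<le> ennreal (e * (LINT x|lborel. norm (G x)))"
  proof (rule moll_L1_diff_le[OF u e])
    fix z :: 'a assume "norm z < e"
    then show "(LINT x|lborel. norm (u (x - z) - u x)) \<le> e * (LINT x|lborel. norm (G x))"
      using gradient_translation_le[OF uG, of z]
      mult_right_mono[of "norm z" e "LINT x|lborel. norm (G x)"] by (simp add: integral_nonneg_AE)
  qed
  moreover have "integrable lborel (\<lambda>x. norm (moll e u x - u x))"
    by (intro integrable_norm Bochner_Integration.integrable_diff moll_integrable u e)
  ultimately show ?thesis
    using e by (subst (asm) nn_integral_eq_integral) (auto simp: integral_nonneg_AE)
qed

section \<open>The Gagliardo--Nirenberg--Sobolev inequality\<close>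

text \<open>The convention \<open>0\<^sup>0 = 1\<close> matters: \<open>grid_lines_lborel\<close> drops a factor with exponent \<open>0\<close>.\<close>

definition epow :: "ennreal \<Rightarrow> real \<Rightarrow> ennreal" where
  "epow x a = (if a = 0 then 1 else if x = \<infinity> then \<infinity> else ennreal (enn2real x powr a))"

lemma epow_0 [simp]: "epow x 0 = 1" by (simp add: epow_def)

lemma epow_ennreal: "0 \<le> t \<Longrightarrow> a \<noteq> 0 \<Longrightarrow> epow (ennreal t) a = ennreal (t powr a)"
  by (simp add: epow_def)

lemma epow_zero: "a \<noteq> 0 \<Longrightarrow> epow 0 a = 0"
  by (simp add: epow_def)

lemma epow_add: "0 \<le> a \<Longrightarrow> 0 \<le> b \<Longrightarrow> epow x (a + b) = epow x a * epow x b"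
  by (cases x) (auto simp: epow_def powr_add ennreal_mult ennreal_top_mult add_nonneg_eq_0_iff)

lemma epow_mono: "0 \<le> a \<Longrightarrow> x \<le> y \<Longrightarrow> epow x a \<le> epow y a"
  by (cases x; cases y) (auto simp: epow_def top_unique intro!: ennreal_leI powr_mono2)

lemma epow_mult: "0 \<le> a \<Longrightarrow> epow (x * y) a = epow x a * epow y a"
  by (cases x; cases y; cases "x = 0"; cases "y = 0")
     (auto simp: epow_def powr_mult ennreal_mult_top ennreal_top_mult ennreal_mult[symmetric]
       enn2real_mult ennreal_mult_eq_top_iff)

lemma epow_borel[measurable]: "f \<in> borel_measurable M \<Longrightarrow> (\<lambda>x. epow (f x) a) \<in> borel_measurable M"
  for f :: "'c \<Rightarrow> ennreal"
proof (cases "a = 0")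
  case False
  assume [measurable]: "f \<in> borel_measurable M"
  have "(\<lambda>x. if f x = \<infinity> then \<infinity> else ennreal (enn2real (f x) powr a)) \<in> borel_measurable M"
    by measurable
  then show ?thesis using False by (simp add: epow_def)
qed simp

text \<open>The weighted inequality between geometric and arithmetic mean is convexity of exp at the
  points ln (y k); the values 0 and \<infinity>, which have no logarithm, are settled
  beforehand.\<close>

lemma epow_weighted_mean_le:
  assumes "finite K" "\<And>k. k \<in> K \<Longrightarrow> 0 < w k" "(\<Sum>k\<in>K. w k) = 1"
  shows "(\<Prod>k\<in>K. epow (x k) (w k)) \<le> (\<Sum>k\<in>K. ennreal (w k) * x k)"
proof -
  consider "\<exists>k\<in>K. x k = 0" | "\<forall>k\<in>K. x k \<noteq> 0" "\<exists>k\<in>K. x k = \<infinity>" | "\<forall>k\<in>K. x k \<noteq> 0 \<and> x k \<noteq> \<infinity>" by blast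
  then show ?thesis
  proof cases
    case 1
    then obtain k where k: "k \<in> K" "x k = 0" by blast
    then have "epow (x k) (w k) = 0" using assms(2)[OF k(1)] by (simp add: epow_def)
    then have "(\<Prod>k\<in>K. epow (x k) (w k)) = 0" using k(1) assms(1) by (meson prod_zero)
    then show ?thesis by (simp only: zero_le)
  next
    case 2
    then obtain k where k: "k \<in> K" "x k = \<infinity>" by blast
    then have "ennreal (w k) * x k = \<infinity>" using assms(2)[OF k(1)] by (simp add: ennreal_mult_top)
    then have "(\<Sum>k\<in>K. ennreal (w k) * x k) = \<infinity>"
      using k(1) assms(1) by (simp add: ennreal_sum_eq_top) blast
    then show ?thesis by simp
  next
    case 3
    define y where "y k = enn2real (x k)" for k
    have xy: "x k = ennreal (y k)" "y k > 0" if "k \<in> K" for k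
      using 3 that by (cases "x k"; auto simp: y_def less_le)+
    have "(\<Prod>k\<in>K. epow (x k) (w k)) = (\<Prod>k\<in>K. ennreal (y k powr w k))"
      using xy assms(2) by (intro prod.cong) (auto simp: epow_ennreal less_imp_le less_imp_neq[symmetric])
    also have "\<dots> = ennreal (\<Prod>k\<in>K. y k powr w k)"
      by (simp add: prod_ennreal)
    also have "(\<Prod>k\<in>K. y k powr w k) = exp (\<Sum>k\<in>K. w k * ln (y k))"
      using xy(2) assms(1) by (auto simp: exp_sum powr_def less_imp_neq[symmetric] intro!: prod.cong)
    also have "\<dots> \<le> (\<Sum>k\<in>K. w k * exp (ln (y k)))"
      using convex_on_sum[OF assms(1) _ exp_convex assms(3), of "\<lambda>k. ln (y k)"] assms(2,3)
      by (cases "K = {}") (auto simp: less_imp_le)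
    also have "\<dots> = (\<Sum>k\<in>K. w k * y k)"
      using xy(2) by (intro sum.cong) auto
    finally have "(\<Prod>k\<in>K. epow (x k) (w k)) \<le> ennreal (\<Sum>k\<in>K. w k * y k)" by (simp add: ennreal_leI)
    also have "\<dots> = (\<Sum>k\<in>K. ennreal (w k) * x k)"
      using xy assms(2) by (subst sum_ennreal[symmetric]) (auto intro!: sum.cong simp: less_imp_le
          ennreal_mult)
    finally show ?thesis .
  qed
qed

text \<open>After each factor is divided by its integral, the weighted mean inequality applies
  pointwise and the integrated right-hand side is the sum of the weights. If an integral is 0 the
  product vanishes almost everywhere; if one is \<infinity> and none is 0, the right-hand side is
  \<infinity>.\<close>

theorem nn_integral_Hoelder:
  assumes K: "finite K" "\<And>k. k \<in> K \<Longrightarrow> 0 \<le> w k" "(\<Sum>k\<in>K. w k) = 1"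
    and [measurable]: "\<And>k. k \<in> K \<Longrightarrow> f k \<in> borel_measurable M"
  shows "(\<integral>\<^sup>+x. (\<Prod>k\<in>K. epow (f k x) (w k)) \<partial>M) \<le> (\<Prod>k\<in>K. epow (\<integral>\<^sup>+x. f k x \<partial>M) (w k))"
proof -
  \<comment> \<open>Factors of weight 0 are 1 on both sides by the convention for exponent 0;
    without them all weights are positive.\<close>
  define L where "L = {k \<in> K. w k \<noteq> 0}"
  have L: "finite L" "\<And>k. k \<in> L \<Longrightarrow> 0 < w k" "\<And>k. k \<in> L \<Longrightarrow> w k \<noteq> 0" "L \<subseteq> K"
    using K by (auto simp: L_def less_le)
  have [measurable]: "f k \<in> borel_measurable M" if "k \<in> L" for k using that L(4) assms(4) by blast
  have sL: "(\<Sum>k\<in>L. w k) = 1"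
    using K(3) sum.mono_neutral_left[OF K(1) L(4), of w] by (auto simp: L_def)
  have pr: "(\<Prod>k\<in>K. epow (g k) (w k)) = (\<Prod>k\<in>L. epow (g k) (w k))" for g
    using K(1) L(4) by (intro prod.mono_neutral_right) (auto simp: L_def)
  define c where "c k = (\<integral>\<^sup>+x. f k x \<partial>M)" for k
  consider k where "k \<in> L" "c k = 0" | "\<forall>k\<in>L. c k \<noteq> 0" "\<exists>k\<in>L. c k = \<infinity>" | "\<forall>k\<in>L. c k \<noteq> 0 \<and> c k \<noteq> \<infinity>" by blast
  then show ?thesis
  proof cases
    case 1
    have "AE x in M. f k x = 0"
      using 1 by (simp add: c_def nn_integral_0_iff_AE)
    then have "AE x in M. (\<Prod>k\<in>L. epow (f k x) (w k)) = 0"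
    proof (rule AE_mp, intro AE_I2 impI)
      fix x assume "f k x = 0"
      then have "epow (f k x) (w k) = 0" using L(3)[OF 1(1)] by (simp add: epow_zero)
      then show "(\<Prod>k\<in>L. epow (f k x) (w k)) = 0" using 1(1) L(1) by (meson prod_zero)
    qed
    then have "(\<integral>\<^sup>+x. (\<Prod>k\<in>L. epow (f k x) (w k)) \<partial>M) = 0"
      by (subst nn_integral_0_iff_AE) auto
    then show ?thesis by (simp add: pr)
  next
    case 2
    then obtain k where k: "k \<in> L" "c k = \<infinity>" by blast
    have "(\<Prod>j\<in>L. epow (c j) (w j)) = epow (c k) (w k) * (\<Prod>j\<in>L - {k}. epow (c j) (w j))"
      using k L(1) by (simp add: prod.remove)
    also have "epow (c k) (w k) = \<infinity>" using k L(3)[OF k(1)] by (simp add: epow_def)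
    finally have "(\<Prod>j\<in>L. epow (c j) (w j)) = \<infinity> * (\<Prod>j\<in>L - {k}. epow (c j) (w j))" .
    moreover have "(\<Prod>j\<in>L - {k}. epow (c j) (w j)) \<noteq> 0"
    proof -
      have "epow (c j) (w j) \<noteq> 0" if "j \<in> L" for j
        using 2(1) that by (cases "c j") (auto simp: epow_def)
      then show ?thesis using L(1) by simp
    qed
    ultimately have "(\<Prod>j\<in>L. epow (c j) (w j)) = \<infinity>" by (simp only: ennreal_top_mult infinity_ennreal_def
        if_False)
    then show ?thesis by (simp add: pr c_def)
  next
    case 3
    have split: "epow (f k x) (w k) = epow (c k) (w k) * epow (f k x / c k) (w k)" if "k \<in> L" for k x
    proof -
      have "c k * (f k x / c k) = f k x"
        using 3 that ennreal_mult_divide_eq[of "c k" "f k x"]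
        by (simp add: ennreal_times_divide mult.commute[of "c k"] less_top)
      then show ?thesis using epow_mult[of "w k" "c k" "f k x / c k"] L(2)[OF that] by simp
    qed
    have "(\<integral>\<^sup>+x. (\<Prod>k\<in>L. epow (f k x) (w k)) \<partial>M) =
       (\<integral>\<^sup>+x. (\<Prod>k\<in>L. epow (c k) (w k)) * (\<Prod>k\<in>L. epow (f k x / c k) (w k)) \<partial>M)"
      by (intro nn_integral_cong) (simp add: split prod.distrib[symmetric])
    also have "\<dots> = (\<Prod>k\<in>L. epow (c k) (w k)) * (\<integral>\<^sup>+x. (\<Prod>k\<in>L. epow (f k x / c k) (w k)) \<partial>M)"
      by (intro nn_integral_cmult) auto
    also have "\<dots> \<le> (\<Prod>k\<in>L. epow (c k) (w k)) * (\<integral>\<^sup>+x. (\<Sum>k\<in>L. ennreal (w k) * (f k x / c k)) \<partial>M)"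
      by (intro mult_left_mono nn_integral_mono epow_weighted_mean_le L sL) auto
    also have "(\<integral>\<^sup>+x. (\<Sum>k\<in>L. ennreal (w k) * (f k x / c k)) \<partial>M)
        = (\<Sum>k\<in>L. ennreal (w k) * ((\<integral>\<^sup>+x. f k x \<partial>M) / c k))"
      by (subst nn_integral_sum) (auto simp: nn_integral_cmult nn_integral_divide intro!: sum.cong)
    also have "\<dots> = (\<Sum>k\<in>L. ennreal (w k))"
    proof (intro sum.cong refl)
      fix k assume "k \<in> L"
      then have "c k / c k = 1" using 3 by (simp add: ennreal_divide_self less_top)
      then show "ennreal (w k) * ((\<integral>\<^sup>+x. f k x \<partial>M) / c k) = ennreal (w k)" by (simp add: c_def)
    qed
    also have "\<dots> = 1" using L(2) sL by (simp add: sum_ennreal less_imp_le)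
    finally show ?thesis by (simp add: pr c_def)
  qed
qed

section \<open>Integrals along coordinate lines\<close>

interpretation lborel_product: product_sigma_finite "\<lambda>i. lborel :: real measure"
  by standard

lemma line_integral_PiM_measurable:
  assumes [measurable]: "F \<in> borel_measurable (Pi\<^sub>M S (\<lambda>i. lborel :: real measure))" and i: "i \<in> S"
  shows "(\<lambda>x. \<integral>\<^sup>+t. F (x(i := t)) \<partial>lborel) \<in> borel_measurable (Pi\<^sub>M S (\<lambda>i. lborel))"
proof -
  have "(\<lambda>(x, t). x(i := t)) \<in> Pi\<^sub>M S (\<lambda>i. lborel) \<Otimes>\<^sub>M lborel \<rightarrow>\<^sub>M Pi\<^sub>M (insert i S) (\<lambda>i. lborel :: real
      measure)"
    by (rule measurable_add_dim)
  then have [measurable]: "(\<lambda>(x, t). x(i := t)) \<in> Pi\<^sub>M S (\<lambda>i. lborel) \<Otimes>\<^sub>M lborel \<rightarrow>\<^sub>M Pi\<^sub>M S (\<lambda>i. lborel ::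
      real measure)"
    using i by (simp add: insert_absorb)
  show ?thesis by measurable
qed

text \<open>Integrating out the coordinate \<open>i\<close> by Hoelder's inequality turns the left-hand side for \<open>insert i S\<close>
  and \<open>F\<close> into the one for \<open>S\<close> and the \<open>i\<close>-th marginal of \<open>F\<close>.\<close>

theorem grid_lines_inequality:
  assumes "finite S" "0 \<le> a" "(real (card S) - 1) * a \<le> 1"
    and "F \<in> borel_measurable (Pi\<^sub>M S (\<lambda>i. lborel :: real measure))"
  shows "(\<integral>\<^sup>+x. epow (F x) (1 - (real (card S) - 1) * a) * (\<Prod>i\<in>S. epow (\<integral>\<^sup>+t. F (x(i := t)) \<partial>lborel) a)
      \<partial>Pi\<^sub>M S (\<lambda>i. lborel))
    \<le> epow (\<integral>\<^sup>+x. F x \<partial>Pi\<^sub>M S (\<lambda>i. lborel)) (1 + a)"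
  using assms
proof (induction S arbitrary: F rule: finite_induct)
  case empty
  then show ?case by (simp add: lborel_product.nn_integral_empty)
next
  case (insert i S)
  note [measurable] = insert.prems(3)
  have a: "0 \<le> a" by fact
  have card: "real (card (insert i S)) - 1 = real (card S)" using insert.hyps by simp
  have a1: "0 \<le> 1 - real (card S) * a" using insert.prems(2) card by simp
  define f1 where "f1 x = (\<integral>\<^sup>+t. F (x(i := t)) \<partial>lborel)" for x
  have upd[measurable]: "(\<lambda>(x, t). x(i := t)) \<in> Pi\<^sub>M S (\<lambda>i. lborel) \<Otimes>\<^sub>M lborel \<rightarrow>\<^sub>M Pi\<^sub>M (insert i S) (\<lambda>i.
      lborel :: real measure)"
    by (rule measurable_add_dim)
  have [measurable]: "f1 \<in> borel_measurable (Pi\<^sub>M S (\<lambda>i. lborel))"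
    unfolding f1_def[abs_def] by measurable
  have lm: "(\<lambda>x. \<integral>\<^sup>+t. F (x(j := t)) \<partial>lborel) \<in> borel_measurable (Pi\<^sub>M (insert i S) (\<lambda>i. lborel))"
      if "j \<in> insert i S" for j
    using that by (intro line_integral_PiM_measurable insert.prems) 
  have lm2: "(\<lambda>y. G (x(i := y))) \<in> borel_measurable lborel"
    if "x \<in> space (Pi\<^sub>M S (\<lambda>i. lborel))" "G \<in> borel_measurable (Pi\<^sub>M (insert i S) (\<lambda>i. lborel))"
    for x and G :: "('a \<Rightarrow> real) \<Rightarrow> ennreal"
  proof -
    note [measurable] = that(2)
    have "(\<lambda>y. x(i := y)) \<in> lborel \<rightarrow>\<^sub>M Pi\<^sub>M (insert i S) (\<lambda>i. lborel :: real measure)"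
      using measurable_component_update[OF that(1) insert.hyps(2)] .
    then show ?thesis by measurable
  qed
  let ?P = "\<lambda>x. epow (F x) (1 - (real (card (insert i S)) - 1) * a) * (\<Prod>j\<in>insert i S. epow (\<integral>\<^sup>+t. F (x(j :=
      t)) \<partial>lborel) a)"
  have Pm: "?P \<in> borel_measurable (Pi\<^sub>M (insert i S) (\<lambda>i. lborel))"
    using lm by (intro borel_measurable_times_ennreal borel_measurable_prod_ennreal epow_borel insert.prems)
        auto
  have "(\<integral>\<^sup>+x. ?P x \<partial>Pi\<^sub>M (insert i S) (\<lambda>i. lborel)) = (\<integral>\<^sup>+x. (\<integral>\<^sup>+y. ?P (x(i := y)) \<partial>lborel) \<partial>Pi\<^sub>M S (\<lambda>i.
      lborel))"
    by (rule lborel_product.product_nn_integral_insert[OF insert.hyps Pm])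
  also have "\<dots> \<le> (\<integral>\<^sup>+x. epow (f1 x) (1 - (real (card S) - 1) * a) * (\<Prod>j\<in>S. epow (\<integral>\<^sup>+t. f1 (x(j := t))
      \<partial>lborel) a) \<partial>Pi\<^sub>M S (\<lambda>i. lborel))"
  proof (intro nn_integral_mono)
    fix x assume x: "x \<in> space (Pi\<^sub>M S (\<lambda>i. lborel :: real measure))"
    \<comment> \<open>The factors of Hoelder's inequality in the coordinate y: F itself with weight
      1 - card S * a, and the line integrals in the directions of S with weight a each. The line
      integral in direction i does not depend on y and stays in front as
      \<open>epow (f1 x) a\<close>.\<close>
    define h where "h k y = (if k = i then F (x(i := y)) else \<integral>\<^sup>+t. F (x(i := y, k := t)) \<partial>lborel)" for k y
    define w where "w k = (if k = i then 1 - real (card S) * a else a)" for k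
    have hm: "h k \<in> borel_measurable lborel" if "k \<in> insert i S" for k
      using lm2[OF x insert.prems(3)] lm2[OF x lm[OF that]] by (cases "k
          = i") (simp_all add: h_def[abs_def] fun_upd_def)
    have h_int: "(\<integral>\<^sup>+y. h j y \<partial>lborel) = (\<integral>\<^sup>+t. f1 (x(j := t)) \<partial>lborel)" if j: "j \<in> S" for j
    proof -
      have ji: "j \<noteq> i" using j insert.hyps by auto
      have "(\<lambda>(y, t). x(i := y, j := t)) \<in> lborel \<Otimes>\<^sub>M lborel \<rightarrow>\<^sub>M Pi\<^sub>M (insert i S) (\<lambda>i. lborel :: real
          measure)"
      proof (rule measurable_PiM_single')
        fix k assume "k \<in> insert i S"
        show "(\<lambda>\<omega>. (case \<omega> of (y, t) \<Rightarrow> x(i := y, j := t)) k) \<in> lborel \<Otimes>\<^sub>M lborel \<rightarrow>\<^sub>M lborel"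
          by (cases "k = j"; cases "k = i") (auto simp: case_prod_beta)
      next
        show "(\<lambda>(y, t). x(i := y, j := t)) \<in> space (lborel \<Otimes>\<^sub>M lborel) \<rightarrow> (\<Pi>\<^sub>E i\<in>insert i S. space lborel)"
          using x j by (auto simp: space_PiM PiE_def extensional_def)
      qed
      then have [measurable]: "(\<lambda>(y, t). F (x(i := y, j := t))) \<in> borel_measurable (lborel \<Otimes>\<^sub>M lborel)"
        using measurable_compose[OF _ insert.prems(3)] by (simp add: case_prod_beta)
      have "(\<integral>\<^sup>+y. h j y \<partial>lborel) = (\<integral>\<^sup>+y. (\<integral>\<^sup>+t. F (x(i := y, j := t)) \<partial>lborel) \<partial>lborel)"
        using ji by (simp add: h_def)
      also have "\<dots> = (\<integral>\<^sup>+t. (\<integral>\<^sup>+y. F (x(i := y, j := t)) \<partial>lborel) \<partial>lborel)"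
        by (rule lborel_pair.Fubini') measurable
      also have "\<dots> = (\<integral>\<^sup>+t. f1 (x(j := t)) \<partial>lborel)"
        using ji by (simp add: f1_def fun_upd_twist)
      finally show ?thesis .
    qed
    have "(\<integral>\<^sup>+y. ?P (x(i := y)) \<partial>lborel) = (\<integral>\<^sup>+y. epow (f1 x) a * (\<Prod>k\<in>insert i S. epow (h k y) (w k))
        \<partial>lborel)"
    proof (intro nn_integral_cong)
      fix y
      have "(\<Prod>j\<in>S. epow (\<integral>\<^sup>+t. F (x(i := y, j := t)) \<partial>lborel) a) = (\<Prod>k\<in>S. epow (h k y) (w k))"
        using insert.hyps by (intro prod.cong) (auto simp: h_def w_def)
      then show "?P (x(i := y)) = epow (f1 x) a * (\<Prod>k\<in>insert i S. epow (h k y) (w k))"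
        using insert.hyps by (simp add: h_def w_def f1_def mult_ac)
    qed
    also have "\<dots> = epow (f1 x) a * (\<integral>\<^sup>+y. (\<Prod>k\<in>insert i S. epow (h k y) (w k)) \<partial>lborel)"
      by (intro nn_integral_cmult borel_measurable_prod_ennreal epow_borel hm)
    also have "\<dots> \<le> epow (f1 x) a * (\<Prod>k\<in>insert i S. epow (\<integral>\<^sup>+y. h k y \<partial>lborel) (w k))"
    proof (intro mult_left_mono nn_integral_Hoelder hm)
      have "(\<Sum>k\<in>S. w k) = (\<Sum>k\<in>S. a)"
        using insert.hyps by (intro sum.cong) (auto simp: w_def)
      then show "(\<Sum>k\<in>insert i S. w k) = 1" using insert.hyps by (simp add: w_def)
    qed (use insert.hyps a a1 in \<open>auto simp: w_def\<close>)
    also have "(\<Prod>k\<in>insert i S. epow (\<integral>\<^sup>+y. h k y \<partial>lborel) (w k)) =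
        epow (f1 x) (1 - real (card S) * a) * (\<Prod>j\<in>S. epow (\<integral>\<^sup>+t. f1 (x(j := t)) \<partial>lborel) a)"
    proof -
      have "(\<Prod>k\<in>S. epow (\<integral>\<^sup>+y. h k y \<partial>lborel) (w k)) = (\<Prod>j\<in>S. epow (\<integral>\<^sup>+t. f1 (x(j := t)) \<partial>lborel) a)"
        using insert.hyps h_int by (intro prod.cong) (auto simp: w_def)
      moreover have "(\<integral>\<^sup>+y. h i y \<partial>lborel) = f1 x" by (simp add: h_def f1_def)
      ultimately show ?thesis using insert.hyps by (simp add: w_def)
    qed
    \<comment> \<open>The exponents of \<open>f1 x\<close> add up: a + (1 - card S * a) = 1 - (card
      S - 1) * a, the exponent of the induction hypothesis.\<close>
    also have "epow (f1 x) a * (epow (f1 x) (1 - real (card S) * a) * (\<Prod>j\<in>S. epow (\<integral>\<^sup>+t. f1 (x(j := t))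
        \<partial>lborel) a)) =
        epow (f1 x) (1 - (real (card S) - 1) * a) * (\<Prod>j\<in>S. epow (\<integral>\<^sup>+t. f1 (x(j := t)) \<partial>lborel) a)"
      using epow_add[OF a a1, of "f1 x"] by (simp add: mult_ac algebra_simps)
    finally show "(\<integral>\<^sup>+y. ?P (x(i := y)) \<partial>lborel) \<le>
        epow (f1 x) (1 - (real (card S) - 1) * a) * (\<Prod>j\<in>S. epow (\<integral>\<^sup>+t. f1 (x(j := t)) \<partial>lborel) a)" .
  qed
  also have "\<dots> \<le> epow (\<integral>\<^sup>+x. f1 x \<partial>Pi\<^sub>M S (\<lambda>i. lborel)) (1 + a)"
    using a a1 by (intro insert.IH) (auto simp: algebra_simps)
  also have "(\<integral>\<^sup>+x. f1 x \<partial>Pi\<^sub>M S (\<lambda>i. lborel)) = (\<integral>\<^sup>+x. F x \<partial>Pi\<^sub>M (insert i S) (\<lambda>i. lborel))"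
    unfolding f1_def by (rule lborel_product.product_nn_integral_insert[OF insert.hyps, symmetric]) fact
  finally show ?case .
qed


section \<open>Sobolev's inequality for compactly supported C^1 functions\<close>

lemma abs_powr_has_derivative:
  assumes "1 < t"
  shows "((\<lambda>y. \<bar>y\<bar> powr t) has_real_derivative t * (\<bar>y\<bar> powr (t - 2) * y)) (at y)"
proof -
  consider "y > 0" | "y < 0" | "y = 0" by linarith
  then show ?thesis
  proof cases
    case 1
    then have "((\<lambda>y. y powr t) has_real_derivative t * (\<bar>y\<bar> powr (t - 2) * y)) (at y)"
      by (auto intro!: derivative_eq_intros simp: powr_diff field_simps power2_eq_square)
    then show ?thesis
      by (rule has_field_derivative_transform_within_open[of _ _ _ "{0<..}"]) (use 1 in auto)
  next
    case 2
    then have "((\<lambda>y. (- y) powr t) has_real_derivative t * (\<bar>y\<bar> powr (t - 2) * y)) (at y)"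
      by (auto intro!: derivative_eq_intros simp: powr_diff field_simps power2_eq_square)
    then show ?thesis
      by (rule has_field_derivative_transform_within_open[of _ _ _ "{..<0}"]) (use 2 in auto)
  next
    case 3
    have "(\<lambda>h. (\<bar>0 + h\<bar> powr t - \<bar>0\<bar> powr t) / h) \<midarrow>0\<rightarrow> 0"
    proof (rule Lim_null_comparison)
      show "(\<lambda>h::real. \<bar>h\<bar> powr (t - 1)) \<midarrow>0\<rightarrow> 0"
        using assms by (intro tendsto_zero_powrI[where b = "t - 1"] tendsto_eq_intros refl) auto
      have "norm ((\<bar>0 + h\<bar> powr t - \<bar>0\<bar> powr t) / h) \<le> \<bar>h\<bar> powr (t - 1)" for h :: real
        by (cases "h = 0") (auto simp: powr_diff)
      then show "\<forall>\<^sub>F h in at 0. norm ((\<bar>0 + h\<bar> powr t - \<bar>0\<bar> powr t) / h) \<le> \<bar>h\<bar> powr (t - 1)"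
        by simp
    qed
    then show ?thesis using 3 by (simp add: DERIV_def)
  qed
qed

lemma abs_powr_minus_two: "\<bar>\<bar>y::real\<bar> powr (t - 2) * y\<bar> = \<bar>y\<bar> powr (t - 1)"
  by (cases "y = 0") (auto simp: abs_mult powr_diff power2_eq_square)

lemma abs_powr_sgn_continuous:
  assumes "1 < t"
  shows "continuous_on UNIV (\<lambda>y::real. \<bar>y\<bar> powr (t - 2) * y)"
proof -
  have "isCont (\<lambda>y::real. \<bar>y\<bar> powr (t - 2) * y) y" for y
  proof (cases "y = 0")
    case True
    have "(\<lambda>h::real. \<bar>h\<bar> powr (t - 2) * h) \<midarrow>0\<rightarrow> 0"
    proof (rule Lim_null_comparison)
      show "(\<lambda>h::real. \<bar>h\<bar> powr (t - 1)) \<midarrow>0\<rightarrow> 0"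
        using assms by (intro tendsto_zero_powrI[where b = "t - 1"] tendsto_eq_intros refl) auto
      show "\<forall>\<^sub>F h in at (0::real). norm (\<bar>h\<bar> powr (t - 2) * h) \<le> \<bar>h\<bar> powr (t - 1)"
        by (simp add: abs_powr_minus_two)
    qed
    then show ?thesis using True by (simp add: isCont_def)
  qed (auto intro!: continuous_intros)
  then show ?thesis by (simp add: continuous_on_eq_continuous_at)
qed

text \<open>The fundamental theorem of calculus for |w|^t along the line through x in direction b,
  started outside the support. Extending the integral to the whole line makes the bound independent
  of the coordinate \<open>x \<bullet> b\<close>, as the grid inequality requires.\<close>

lemma C1_line_bound:
  fixes w :: "'a::euclidean_space \<Rightarrow> real"
  assumes D: "\<And>x. (w has_derivative (\<lambda>h. W x \<bullet> h)) (at x)" and W: "continuous_on UNIV W"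
    and supp: "\<And>x. R < norm x \<Longrightarrow> w x = 0" and t: "1 < t" and b: "b \<in> Basis"
  shows "ennreal (\<bar>w x\<bar> powr t) \<le>
    (\<integral>\<^sup>+\<tau>. ennreal (t * \<bar>w (x + (\<tau> - x \<bullet> b) *\<^sub>R b)\<bar> powr (t - 1) * norm (W (x
        + (\<tau> - x \<bullet> b) *\<^sub>R b))) \<partial>lborel)"
proof -
  let ?y = "\<lambda>\<tau>. x + (\<tau> - x \<bullet> b) *\<^sub>R b"
  \<comment> \<open>Below -|R|, so that the starting point is outside the support, and not above
    \<open>x \<bullet> b\<close>, so that the interval of integration is ordered.\<close>
  define a where "a = min (- \<bar>R\<bar> - 1) (x \<bullet> b)"
  let ?f = "\<lambda>\<tau>. t * (\<bar>w (?y \<tau>)\<bar> powr (t - 2) * w (?y \<tau>)) * (W (?y \<tau>) \<bullet> b)"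
  have w: "continuous_on UNIV w"
    using has_derivative_continuous[OF D] by (blast intro: continuous_at_imp_continuous_on)
  have d: "((\<lambda>\<tau>. \<bar>w (?y \<tau>)\<bar> powr t) has_real_derivative ?f \<tau>) (at \<tau>)" for \<tau>
  proof -
    have "(?y has_derivative (\<lambda>h. h *\<^sub>R b)) (at \<tau>)" by (auto intro!: derivative_eq_intros)
    from has_derivative_compose[OF this D]
    have "((\<lambda>\<tau>. w (?y \<tau>)) has_real_derivative (W (?y \<tau>) \<bullet> b)) (at \<tau>)"
      unfolding has_field_derivative_def by (rule has_derivative_eq_rhs) (auto simp: fun_eq_iff)
    from DERIV_chain2[OF abs_powr_has_derivative[OF t] this] show ?thesis .
  qed
  have "continuous_on UNIV ?f"
    by (intro continuous_intros continuous_on_compose2[OF abs_powr_sgn_continuous[OF t], of UNIV "\<lambda>\<tau>. w (?y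
        \<tau>)"]
        continuous_on_compose2[OF w] continuous_on_compose2[OF W]) auto
  then have c: "isCont ?f \<tau>" for \<tau> by (simp add: continuous_on_eq_continuous_at)
  have "a \<le> x \<bullet> b" by (simp add: a_def)
  note FTC = has_bochner_integral_FTC_Icc_real[OF this d c]
  have "norm (?y a) \<ge> \<bar>?y a \<bullet> b\<bar>" using b by (rule Basis_le_norm)
  also have "?y a \<bullet> b = a" using b by (simp add: inner_add_left)
  finally have "w (?y a) = 0" by (intro supp) (auto simp: a_def)
  then have eq: "(LINT \<tau>|lborel. ?f \<tau> * indicator {a..x \<bullet> b} \<tau>) = \<bar>w x\<bar> powr t"
    using FTC t by (simp add: has_bochner_integral_iff)
  have "ennreal (norm (\<bar>w x\<bar> powr t)) \<le> (\<integral>\<^sup>+\<tau>. ennreal (norm (?f \<tau> * indicator {a..x \<bullet> b} \<tau>)) \<partial>lborel)"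
    using integral_norm_bound_ennreal[of lborel "\<lambda>\<tau>. ?f \<tau> * indicator {a..x \<bullet> b} \<tau>"] FTC
    unfolding eq by (auto simp: has_bochner_integral_iff)
  also have "\<dots> \<le> (\<integral>\<^sup>+\<tau>. ennreal (t * \<bar>w (?y \<tau>)\<bar> powr (t - 1) * norm (W (?y \<tau>))) \<partial>lborel)"
  proof (intro nn_integral_mono ennreal_leI)
    fix \<tau>
    have "\<bar>W (?y \<tau>) \<bullet> b\<bar> \<le> norm (W (?y \<tau>))" using b by (rule Basis_le_norm)
    then have "\<bar>?f \<tau>\<bar> \<le> t * \<bar>w (?y \<tau>)\<bar> powr (t - 1) * norm (W (?y \<tau>))"
      using t by (subst abs_mult) (auto simp: abs_mult[of t] abs_powr_minus_two intro!: mult_left_mono)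
    then show "norm (?f \<tau> * indicator {a..x \<bullet> b} \<tau>) \<le> t * \<bar>w (?y \<tau>)\<bar> powr (t - 1) * norm (W (?y \<tau>))"
      using t by (auto simp: indicator_def)
  qed
  finally show ?thesis by simp
qed

text \<open>For a = 1 / (N - 1) the exponent of F in \<open>grid_lines_inequality\<close> is 0 and
  its factor becomes 1. What remains is the lemma of Gagliardo and Nirenberg, transported from the
  product of real lines to the Euclidean space.\<close>

lemma grid_lines_lborel:
  fixes F :: "'a::euclidean_space \<Rightarrow> ennreal"
  assumes [measurable]: "F \<in> borel_measurable borel" and N: "2 \<le> DIM('a)"
  shows "(\<integral>\<^sup>+x. (\<Prod>b\<in>Basis. epow (\<integral>\<^sup>+\<tau>. F (x + (\<tau> - x \<bullet> b) *\<^sub>R b) \<partial>lborel) (1 / (real DIM('a) - 1))) \<partial>lborel)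
     \<le> epow (\<integral>\<^sup>+x. F x \<partial>lborel) (real DIM('a) / (real DIM('a) - 1))"
proof -
  let ?N = "real DIM('a)"
  let ?a = "1 / (?N - 1)"
  let ?P = "Pi\<^sub>M (Basis :: 'a set) (\<lambda>_. lborel :: real measure)"
  let ?T = "\<lambda>f. \<Sum>b\<in>Basis. f b *\<^sub>R b :: 'a"
  have "(\<lambda>f. f b) \<in> borel_measurable ?P" if "b \<in> Basis" for b
    using measurable_component_singleton[OF that, of "\<lambda>_. lborel :: real measure"] by simp
  then have T[measurable]: "?T \<in> ?P \<rightarrow>\<^sub>M borel"
    by (intro borel_measurable_sum borel_measurable_scaleR) auto
  have upd: "?T (f(b := \<tau>)) = ?T f + (\<tau> - ?T f \<bullet> b) *\<^sub>R b" if "b \<in> Basis" for f b \<tau>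
  proof (rule euclidean_eqI)
    fix c :: 'a assume "c \<in> Basis"
    then show "?T (f(b := \<tau>)) \<bullet> c = (?T f + (\<tau> - ?T f \<bullet> b) *\<^sub>R b) \<bullet> c"
      using that by (simp add: inner_add_left inner_Basis)
  qed
  have L: "lborel = distr ?P borel ?T" by (rule lborel_eq)
  have [measurable]: "(\<lambda>x. \<integral>\<^sup>+\<tau>. F (x + (\<tau> - x \<bullet> b) *\<^sub>R b) \<partial>lborel) \<in> borel_measurable borel" for b
      by measurable
  have "(\<integral>\<^sup>+x. (\<Prod>b\<in>Basis. epow (\<integral>\<^sup>+\<tau>. F (x + (\<tau> - x \<bullet> b) *\<^sub>R b) \<partial>lborel) ?a) \<partial>lborel) =
     (\<integral>\<^sup>+x. (\<Prod>b\<in>Basis. epow (\<integral>\<^sup>+\<tau>. F (?T x + (\<tau> - ?T x \<bullet> b) *\<^sub>R b) \<partial>lborel) ?a) \<partial>?P)"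
    by (subst L, subst nn_integral_distr) auto
  also have "\<dots> = (\<integral>\<^sup>+x. epow (F (?T x)) (1 - (real (card (Basis :: 'a set)) - 1) * ?a) *
      (\<Prod>b\<in>Basis. epow (\<integral>\<^sup>+\<tau>. F (?T (x(b := \<tau>))) \<partial>lborel) ?a) \<partial>?P)"
    using N by (intro nn_integral_cong) (simp add: upd del: fun_upd_apply)
  also have "\<dots> \<le> epow (\<integral>\<^sup>+x. F (?T x) \<partial>?P) (1 + ?a)"
    using N by (intro grid_lines_inequality) (auto simp: field_simps)
  also have "(\<integral>\<^sup>+x. F (?T x) \<partial>?P) = (\<integral>\<^sup>+x. F x \<partial>lborel)"
    by (subst L, subst nn_integral_distr) auto
  also have "1 + ?a = ?N / (?N - 1)" using N by (simp add: field_simps)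
  finally show ?thesis .
qed

text \<open>The base is the power t to which |w| is raised in the proof of
  \<open>sobolev_inequality_C1\<close>. The exponent appears because the inequality is stated for
  integrals and not for norms.\<close>

definition sobolev_const :: "nat \<Rightarrow> real \<Rightarrow> real" where
  "sobolev_const N p = (p * (real N - 1) / (real N - p)) powr crit_exp N p"

theorem sobolev_inequality_C1:
  fixes w :: "'a::euclidean_space \<Rightarrow> real"
  assumes D: "\<And>x. (w has_derivative (\<lambda>h. W x \<bullet> h)) (at x)" and W: "continuous_on UNIV W"
    and supp: "\<And>x. R < norm x \<Longrightarrow> w x = 0" and p: "1 < p" "p < real DIM('a)"
    and Q: "(\<integral>\<^sup>+x. ennreal (norm (W x) powr p) \<partial>lborel) \<le> ennreal Q" "0 \<le> Q"
  shows "(\<integral>\<^sup>+x. ennreal (\<bar>w x\<bar> powr crit_exp DIM('a) p) \<partial>lborel)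
    \<le> ennreal (sobolev_const DIM('a) p * Q powr (crit_exp DIM('a) p / p))"
proof -
  define N where "N = real DIM('a)"
  define r where "r = crit_exp DIM('a) p"
  \<comment> \<open>Chosen so that t * N / (N - 1) = r and t - 1 = r * (1 - 1 / p). Then the
    left-hand side of the grid inequality and one of the two Hoelder factors on its right are powers
    of the same integral I.\<close>
  define t where "t = p * (N - 1) / (N - p)"
  define I where "I = (LINT x|lborel. \<bar>w x\<bar> powr r)"
  have N2: "2 \<le> DIM('a)" "1 < N" "p < N" using p by (auto simp: N_def)
  have r: "r = p * N / (N - p)" "0 < r" using p N2 by (auto simp: r_def crit_exp_def N_def)
  have t1: "1 < t" using p N2 by (simp add: t_def field_simps)
  have w: "continuous_on UNIV w"
    using has_derivative_continuous[OF D] by (blast intro: continuous_at_imp_continuous_on)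
  note [measurable] = borel_measurable_continuous_onI[OF w] borel_measurable_continuous_onI[OF W]
  obtain B where B: "\<And>x. \<bar>w x\<bar> \<le> B" using continuous_compact_support_bounded[OF w supp] by blast
  have int: "integrable lborel (\<lambda>x. \<bar>w x\<bar> powr r)"
  proof (rule bounded_support_integrable[where B = "B powr r" and R = R])
    show "norm (\<bar>w x\<bar> powr r) \<le> B powr r" for x
      using powr_mono2[of r "\<bar>w x\<bar>" B] B[of x] r by auto
  qed (use supp in auto)
  have I: "(\<integral>\<^sup>+x. ennreal (\<bar>w x\<bar> powr r) \<partial>lborel) = ennreal I"
    unfolding I_def by (intro nn_integral_eq_integral int) auto
  have I0: "0 \<le> I" unfolding I_def by (intro integral_nonneg_AE) auto
  define F where "F x = ennreal (t * \<bar>w x\<bar> powr (t - 1) * norm (W x))" for x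
  have [measurable]: "F \<in> borel_measurable borel" unfolding F_def[abs_def] by measurable
  have exp1: "t * (N / (N - 1)) = r" using N2 by (simp add: t_def r)
  have "ennreal I \<le> (\<integral>\<^sup>+x. (\<Prod>b\<in>Basis. epow (\<integral>\<^sup>+\<tau>. F (x + (\<tau> - x \<bullet> b) *\<^sub>R b) \<partial>lborel) (1 / (real DIM('a) -
      1))) \<partial>lborel)"
    unfolding I[symmetric]
  proof (intro nn_integral_mono)
    fix x
    have "ennreal (\<bar>w x\<bar> powr r) = ennreal ((\<bar>w x\<bar> powr (t * (1 / (N - 1)))) ^ DIM('a))"
    proof -
      have "(\<bar>w x\<bar> powr (t * (1 / (N - 1)))) ^ DIM('a) = \<bar>w x\<bar> powr (t * (1 / (N - 1)) * N)"
        using N2 by (cases "w x = 0") (auto simp: N_def powr_powr powr_realpow[symmetric])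
      also have "t * (1 / (N - 1)) * N = r" using exp1 by simp
      finally show ?thesis by simp
    qed
    also have "\<dots> = (\<Prod>b\<in>(Basis :: 'a set). epow (ennreal (\<bar>w x\<bar> powr t)) (1 / (real DIM('a) - 1)))"
      using N2 by (simp add: epow_ennreal powr_powr N_def ennreal_power)
    also have "\<dots> \<le> (\<Prod>b\<in>Basis. epow (\<integral>\<^sup>+\<tau>. F (x + (\<tau> - x \<bullet> b) *\<^sub>R b) \<partial>lborel) (1 / (real DIM('a) - 1)))"
      using C1_line_bound[OF D W supp t1] N2 unfolding F_def
      by (intro prod_mono_ennreal epow_mono) auto
    finally show "ennreal (\<bar>w x\<bar> powr r) \<le> (\<Prod>b\<in>Basis. epow (\<integral>\<^sup>+\<tau>. F (x
        + (\<tau> - x \<bullet> b) *\<^sub>R b) \<partial>lborel) (1 / (real DIM('a) - 1)))" .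
  qed
  also have "\<dots> \<le> epow (\<integral>\<^sup>+x. F x \<partial>lborel) (N / (N - 1))"
    unfolding N_def by (intro grid_lines_lborel N2) measurable
  also have "\<dots> \<le> epow (ennreal (t * I powr (1 - 1 / p) * Q powr (1 / p))) (N / (N - 1))"
  proof (rule epow_mono)
    show "0 \<le> N / (N - 1)" using N2 by simp
    have e2: "r * (1 - 1 / p) = t - 1" using N2 p by (simp add: r t_def field_simps)
    have pw: "\<bar>w x\<bar> powr (t - 1) = (\<bar>w x\<bar> powr r) powr (1 - 1 / p)" for x
      by (simp add: powr_powr e2)
    have pW: "norm (W x) = (norm (W x) powr p) powr (1 / p)" for x
      using p by (simp add: powr_powr)
    \<comment> \<open>Hoelder's inequality for two factors, indexed by \<open>bool\<close>:
      \<open>True\<close> stands for |w|^r, \<open>False\<close> for the gradient.\<close>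
    define f where "f k x = (if k then ennreal (\<bar>w x\<bar> powr r) else ennreal (norm (W x) powr p))" for k x
    define v where "v k = (if k then 1 - 1 / p else 1 / p)" for k
    have "(\<integral>\<^sup>+x. F x \<partial>lborel) = (\<integral>\<^sup>+x. ennreal t * (\<Prod>k\<in>UNIV. epow (f k x) (v k)) \<partial>lborel)"
    proof (intro nn_integral_cong)
      fix x
      show "F x = ennreal t * (\<Prod>k\<in>UNIV. epow (f k x) (v k))"
        using p t1 pw[of x] pW[of x] unfolding F_def f_def v_def
        by (simp add: UNIV_bool epow_ennreal ennreal_mult mult_ac)
    qed
    also have "\<dots> = ennreal t * (\<integral>\<^sup>+x. (\<Prod>k\<in>UNIV. epow (f k x) (v k)) \<partial>lborel)"
      by (intro nn_integral_cmult borel_measurable_prod_ennreal epow_borel) (auto simp: f_def)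
    also have "\<dots> \<le> ennreal t * (\<Prod>k\<in>UNIV. epow (\<integral>\<^sup>+x. f k x \<partial>lborel) (v k))"
      using p by (intro mult_left_mono nn_integral_Hoelder) (auto simp: v_def UNIV_bool f_def)
    also have "\<dots> \<le> ennreal t * (ennreal (I powr (1 - 1 / p)) * ennreal (Q powr (1 / p)))"
    proof (intro mult_left_mono)
      have "epow (\<integral>\<^sup>+x. f False x \<partial>lborel) (v False) \<le> epow (ennreal Q) (1 / p)"
        using Q p by (auto simp: f_def v_def intro!: epow_mono)
      also have "\<dots> = ennreal (Q powr (1 / p))" using p Q by (intro epow_ennreal) auto
      finally have "epow (\<integral>\<^sup>+x. f False x \<partial>lborel) (v False) \<le> ennreal (Q powr (1 / p))" .
      moreover have "epow (\<integral>\<^sup>+x. f True x \<partial>lborel) (v True) = ennreal (I powr (1 - 1 / p))"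
        using p I0 by (simp add: f_def v_def I epow_ennreal)
      ultimately show "(\<Prod>k\<in>UNIV. epow (\<integral>\<^sup>+x. f k x \<partial>lborel) (v k))
          \<le> ennreal (I powr (1 - 1 / p)) * ennreal (Q powr (1 / p))"
        by (simp add: UNIV_bool mult.commute[of "ennreal (I powr (1 - 1 / p))"] mult_right_mono)
    qed auto
    also have "\<dots> = ennreal (t * I powr (1 - 1 / p) * Q powr (1 / p))"
      using t1 by (simp add: ennreal_mult mult.assoc)
    finally show "(\<integral>\<^sup>+x. F x \<partial>lborel) \<le> ennreal (t * I powr (1 - 1 / p) * Q powr (1 / p))" .
  qed
  also have "\<dots> = ennreal ((t * I powr (1 - 1 / p) * Q powr (1 / p)) powr (N / (N - 1)))"
    using N2 t1 by (intro epow_ennreal) auto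
  finally have main: "I \<le> (t * I powr (1 - 1 / p) * Q powr (1 / p)) powr (N / (N - 1))"
    using I0 by (simp add: ennreal_le_iff)
  \<comment> \<open>The power of I on the right can be divided out because I is finite, w being
    bounded with compact support. The exponent that remains on the left is (N - 1) / N - (1 - 1 / p)
    = 1 / r.\<close>
  have "I \<le> t powr r * Q powr (r / p)"
  proof (cases "I = 0")
    case False
    then have Ipos: "0 < I" using I0 by simp
    have "I powr ((N - 1) / N) \<le> ((t * I powr (1 - 1 / p) * Q powr (1 / p)) powr (N / (N - 1))) powr ((N -
        1) / N)"
      using N2 I0 by (intro powr_mono2 main) auto
    also have "\<dots> = t * I powr (1 - 1 / p) * Q powr (1 / p)"
      using N2 t1 by (simp add: powr_powr)
    finally have "I powr ((N - 1) / N) / I powr (1 - 1 / p) \<le> t * Q powr (1 / p)"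
      using Ipos by (simp add: field_simps)
    also have "I powr ((N - 1) / N) / I powr (1 - 1 / p) = I powr (1 / r)"
    proof -
      have "(N - 1) / N - (1 - 1 / p) = 1 / r" using N2 p by (simp add: r field_simps)
      then show ?thesis by (simp add: powr_diff[symmetric])
    qed
    finally have "(I powr (1 / r)) powr r \<le> (t * Q powr (1 / p)) powr r"
      using r by (intro powr_mono2) auto
    then show ?thesis
      using r(2) Ipos t1 by (simp add: powr_powr powr_mult)
  qed simp
  then show ?thesis
    using I unfolding r_def[symmetric] sobolev_const_def N_def[symmetric] t_def[symmetric]
        by (simp add: ennreal_leI)
qed

section \<open>Weak gradients\<close>

lemma lebesgue_imp_borel_rep:
  fixes f :: "'a::euclidean_space \<Rightarrow> 'b::euclidean_space"
  assumes "f \<in> borel_measurable lebesgue"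
  obtains g where "g \<in> borel_measurable borel" "AE x in lebesgue. f x = g x"
proof -
  have "\<exists>g\<in>borel_measurable lborel. AE x in lborel. f x \<bullet> b = g x" for b
    by (intro completion_ex_borel_measurable_real) (use assms in measurable)
  then obtain g where g: "\<And>b. g b \<in> borel_measurable lborel" "\<And>b. AE x in lborel. f x \<bullet> b = g b x"
    by metis
  have "AE x in lborel. \<forall>b\<in>Basis. f x \<bullet> b = g b x"
    using g(2) by (simp add: AE_ball_countable countable_finite)
  then have "AE x in lborel. f x = (\<Sum>b\<in>Basis. g b x *\<^sub>R b)"
  proof (rule AE_mp, intro AE_I2 impI)
    fix x assume "\<forall>b\<in>Basis. f x \<bullet> b = g b x"
    then have "(\<Sum>b\<in>Basis. (f x \<bullet> b) *\<^sub>R b) = (\<Sum>b\<in>Basis. g b x *\<^sub>R b)" by simp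
    then show "f x = (\<Sum>b\<in>Basis. g b x *\<^sub>R b)" by (simp add: euclidean_representation)
  qed
  then have "AE x in lebesgue. f x = (\<Sum>b\<in>Basis. g b x *\<^sub>R b)" by (rule AE_completion)
  moreover have "(\<lambda>x. \<Sum>b\<in>Basis. g b x *\<^sub>R b) \<in> borel_measurable borel"
    using g(1) by (intro borel_measurable_sum borel_measurable_scaleR) auto
  ultimately show ?thesis using that by blast
qed

lemma borel_imp_lebesgue_measurable: "f \<in> borel_measurable borel \<Longrightarrow> f \<in> borel_measurable lebesgue"
  by (intro measurable_completion) simp

lemma integral_lebesgue_lborel:
  fixes f :: "'a::euclidean_space \<Rightarrow> 'b::{banach, second_countable_topology}"
  shows "f \<in> borel_measurable borel \<Longrightarrow> (LINT x|lebesgue. f x) = (LINT x|lborel. f x)"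
  by (rule integral_completion) simp

lemma integrable_lebesgue_lborel:
  fixes f :: "'a::euclidean_space \<Rightarrow> 'b::{banach, second_countable_topology}"
  shows "f \<in> borel_measurable borel \<Longrightarrow> integrable lebesgue f \<longleftrightarrow> integrable lborel f"
  by (rule integrable_completion) simp

lemma integrable_borel_rep:
  fixes f :: "'a::euclidean_space \<Rightarrow> 'b::euclidean_space"
  assumes "integrable lebesgue f"
  obtains g where "g \<in> borel_measurable borel" "integrable lborel g" "AE x in lebesgue. f x = g x"
proof -
  obtain g where g: "g \<in> borel_measurable borel" "AE x in lebesgue. f x = g x"
    using lebesgue_imp_borel_rep[of f] assms by auto
  have "integrable lebesgue g"
    by (rule integrable_cong_AE_imp[OF assms]) (use g in \<open>auto simp: borel_imp_lebesgue_measurable\<close>)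
  then show ?thesis using g that integrable_lebesgue_lborel by blast
qed

lemma locally_integrable_measurable:
  fixes f :: "'a::euclidean_space \<Rightarrow> 'b::{banach, second_countable_topology}"
  assumes "locally_integrable f"
  shows "f \<in> borel_measurable lebesgue"
proof (rule borel_measurable_LIMSEQ_metric)
  show "(\<lambda>x. indicator (cball 0 (real n)) x *\<^sub>R f x) \<in> borel_measurable lebesgue" for n
    using assms[unfolded locally_integrable_def set_integrable_def, rule_format, OF compact_cball]
    by (rule borel_measurable_integrable)
  fix x :: 'a
  obtain n where n: "norm x \<le> real n" using real_arch_simple by blast
  have "\<forall>\<^sub>F k in sequentially. indicator (cball 0 (real k)) x *\<^sub>R f x = f x"
    using eventually_ge_at_top[of n] by eventually_elim (use n in auto)
  then show "(\<lambda>n. indicator (cball 0 (real n)) x *\<^sub>R f x) \<longlonglongrightarrow> f x" by (rule tendsto_eventually)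
qed

section \<open>Test functions; uniqueness and locality of weak gradients\<close>

lemma test_function_borel:
  assumes "test_function \<phi>"
  shows "\<phi> \<in> borel_measurable borel" "b \<in> Basis \<Longrightarrow> (\<lambda>x. frechet_derivative \<phi> (at x) b) \<in> borel_measurable
      borel"
proof -
  have "C_k 0 \<phi>" "C_k (Suc 0) \<phi>" using assms unfolding test_function_def by blast+
  then show "\<phi> \<in> borel_measurable borel" "b \<in> Basis \<Longrightarrow> (\<lambda>x. frechet_derivative \<phi> (at x) b) \<in> borel_measurable
      borel"
    by (auto intro: borel_measurable_continuous_onI)
qed

lemma test_function_support:
  assumes "test_function \<phi>"
  obtains R B where "\<And>x. R < norm x \<Longrightarrow> \<phi> x = 0"
    "\<And>x b. R < norm x \<Longrightarrow> frechet_derivative \<phi> (at x) b = 0"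
    "\<And>x. \<bar>\<phi> x\<bar> \<le> B" "\<And>x b. b \<in> Basis \<Longrightarrow> \<bar>frechet_derivative \<phi> (at x) b\<bar> \<le> B"
proof -
  have bdd: "bounded {x. \<phi> x \<noteq> 0}"
    using assms unfolding test_function_def by (meson bounded_subset closure_subset compact_imp_bounded)
  then obtain R where R: "\<And>x. \<phi> x \<noteq> 0 \<Longrightarrow> norm x \<le> R" unfolding bounded_iff by auto
  then have z: "\<phi> x = 0" if "R < norm x" for x using that by (meson not_less)
  have dz: "frechet_derivative \<phi> (at x) b = 0" if "R < norm x" for x b
  proof -
    have "(\<phi> has_derivative (\<lambda>_. 0)) (at x)"
    proof (rule has_derivative_transform_within_open[of "\<lambda>_. 0"])
      show "open (- cball 0 R)" by auto
    qed (use that z in auto)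
    then have "frechet_derivative \<phi> (at x) = (\<lambda>_. 0)" by (metis frechet_derivative_at)
    then show ?thesis by simp
  qed
  have "C_k 0 \<phi>" "C_k (Suc 0) \<phi>" using assms unfolding test_function_def by blast+
  then have c: "continuous_on UNIV \<phi>" "\<And>b. b \<in> Basis \<Longrightarrow> continuous_on UNIV (\<lambda>x. frechet_derivative \<phi> (at x)
      b)" by auto
  have bd: "\<exists>B. \<forall>x. \<bar>f x\<bar> \<le> B" if "continuous_on UNIV f" "\<And>x. R < norm x \<Longrightarrow> f x = 0" for f :: "'a \<Rightarrow> real"
    using continuous_compact_support_bounded[OF that] by blast
  obtain B0 where B0: "\<And>x. \<bar>\<phi> x\<bar> \<le> B0" using bd[OF c(1) z] by blast
  have "\<forall>b\<in>Basis. \<exists>B. \<forall>x. \<bar>frechet_derivative \<phi> (at x) b\<bar> \<le> B" using bd[OF c(2) dz] by blast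
  then obtain B1 where B1: "\<And>b x. b \<in> Basis \<Longrightarrow> \<bar>frechet_derivative \<phi> (at x) b\<bar> \<le> B1 b" by metis
  define B where "B = max B0 (Max (B1 ` Basis))"
  show ?thesis
  proof (rule that[of R B])
    show "\<bar>\<phi> x\<bar> \<le> B" for x using B0[of x] by (simp add: B_def)
    show "\<bar>frechet_derivative \<phi> (at x) b\<bar> \<le> B" if "b \<in> Basis" for x b
    proof -
      have "B1 b \<le> Max (B1 ` Basis)" using that by (intro Max_ge) auto
      then show ?thesis using B1[OF that, of x] by (simp add: B_def)
    qed
  qed (use z dz in auto)
qed

lemma integrable_mult_bounded:
  fixes f k :: "'a \<Rightarrow> real"
  assumes "integrable M f" "k \<in> borel_measurable M" "\<And>x. \<bar>k x\<bar> \<le> B"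
  shows "integrable M (\<lambda>x. f x * k x)"
proof (rule Bochner_Integration.integrable_bound[where f = "\<lambda>x. B * f x"])
  have "\<bar>f x\<bar> * \<bar>k x\<bar> \<le> \<bar>f x\<bar> * \<bar>B\<bar>" for x
    using assms(3)[of x] by (intro mult_left_mono) auto
  then show "AE x in M. norm (f x * k x) \<le> norm (B * f x)"
    by (intro AE_I2) (simp add: abs_mult mult.commute)
qed (use assms in auto)

text \<open>The fundamental lemma of the calculus of variations with mollifiers as the only test
  functions: at a point of U the mollifications vanish for small scales, yet along a subsequence
  they converge to f almost everywhere. The open set is the whole space for uniqueness and the
  exterior of a ball for locality.\<close>

lemma locally_integrable_fundamental:
  fixes f :: "'a::euclidean_space \<Rightarrow> real"
  assumes f: "locally_integrable f" and U: "open U"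
    and 0: "\<And>x e. 0 < e \<Longrightarrow> cball x e \<subseteq> U \<Longrightarrow> (LINT y|lebesgue. f y * mollifier e (x - y)) = 0"
  shows "AE x in lebesgue. x \<in> U \<longrightarrow> f x = 0"
proof -
  have "AE x in lebesgue. x \<in> U \<and> norm x < real M \<longrightarrow> f x = 0" for M :: nat
  proof -
    \<comment> \<open>Cutting off to a ball turns local integrability into integrability; near a
      point inside the ball small mollifications do not see the cut.\<close>
    define f1 where "f1 x = indicator (cball 0 (real M)) x * f x" for x
    have "integrable lebesgue f1"
      using f by (auto simp: locally_integrable_def set_integrable_def f1_def[abs_def])
    then obtain g where g: "g \<in> borel_measurable borel" "integrable lborel g"
        and fg: "AE x in lebesgue. f1 x = g x"
      by (rule integrable_borel_rep)
    have "(\<lambda>n. LINT x|lborel. norm (moll (1 / Suc n) g x - g x)) \<longlonglongrightarrow> 0"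
      by (rule moll_L1_seq[OF g(2)])
    then obtain r :: "nat \<Rightarrow> nat" where r: "strict_mono r" "AE x in lborel. (\<lambda>n. moll (1 / Suc (r n)) g x - g
        x) \<longlonglongrightarrow> 0"
      using tendsto_L1_AE_subseq[of lborel "\<lambda>n x. moll (1 / Suc n) g x - g x"] moll_integrable[OF g(2)] g(2)
          by auto
    have r0: "(\<lambda>n. 1 / real (Suc (r n))) \<longlonglongrightarrow> 0"
      using LIMSEQ_subseq_LIMSEQ[OF LIMSEQ_inverse_real_of_nat r(1)] by (simp add: o_def inverse_eq_divide)
    have "AE x in lebesgue. (\<lambda>n. moll (1 / Suc (r n)) g x - g x) \<longlonglongrightarrow> 0"
      using r(2) by (rule AE_completion)
    then show ?thesis using fg
    proof eventually_elim
      case (elim x)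
      show ?case
      proof
        assume x: "x \<in> U \<and> norm x < real M"
        then have "x \<in> U \<inter> ball 0 (real M)" by simp
        moreover have "open (U \<inter> ball 0 (real M))" using U by auto
        ultimately obtain d where d: "0 < d" "cball x d \<subseteq> U \<inter> ball 0 (real M)"
          by (meson open_contains_cball)
        have "moll e g x = 0" if "0 < e" "e < d" for e
        proof -
          have "cball x e \<subseteq> U" using d(2) that by (auto simp: subset_iff)
          have "moll e g x = (LINT y|lebesgue. mollifier e (x - y) * g y)"
            using g(1) by (simp add: moll_def integral_lebesgue_lborel)
          also have "\<dots> = (LINT y|lebesgue. f y * mollifier e (x - y))"
          proof (rule integral_cong_AE)
            show "AE y in lebesgue. mollifier e (x - y) * g y = f y * mollifier e (x - y)"
              using fg
            proof eventually_elim
              case (elim y)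
              show ?case
              proof (cases "norm (x - y) < e")
                case True
                then have "y \<in> ball 0 (real M)" using d(2) that by (auto simp: subset_iff dist_norm)
                then show ?thesis using elim by (auto simp: f1_def)
              qed (use that in \<open>simp add: mollifier_eq_0\<close>)
            qed
          qed (use g(1) locally_integrable_measurable[OF f] in \<open>auto simp: borel_imp_lebesgue_measurable
              intro!: borel_measurable_times\<close>)
          also have "\<dots> = 0" by (rule 0[OF that(1)]) fact
          finally show ?thesis .
        qed
        then have "\<forall>\<^sub>F n in sequentially. moll (1 / Suc (r n)) g x - g x = - g x"
          by (intro eventually_mono[OF order_tendstoD(2)[OF r0 d(1)]]) simp
        then have "(\<lambda>n. moll (1 / Suc (r n)) g x - g x) \<longlonglongrightarrow> - g x" by (rule tendsto_eventually)
        with elim(1) have "g x = 0" using LIMSEQ_unique by force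
        then show "f x = 0" using elim(2) x by (auto simp: f1_def)
      qed
    qed
  qed
  then have "AE x in lebesgue. \<forall>M::nat. x \<in> U \<and> norm x < real M \<longrightarrow> f x = 0"
    unfolding AE_all_countable by blast
  then show ?thesis
  proof eventually_elim
    case (elim x)
    then show ?case using reals_Archimedean2[of "norm x"] by blast
  qed
qed

lemma weak_gradient_mollifier:
  assumes "is_weak_gradient u G" "0 < e" "b \<in> Basis"
  shows "(LINT y|lebesgue. (G y \<bullet> b) * mollifier e (x - y)) = (LINT y|lebesgue. u y * (mollifier_grad e (x -
      y) \<bullet> b))"
proof -
  have "frechet_derivative (\<lambda>y. mollifier e (x - y)) (at y) b = - (mollifier_grad e (x - y) \<bullet> b)" for y
    using frechet_derivative_at[OF mollifier_translate_has_derivative, of e x y] by metis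
  moreover have "(LINT y|lebesgue. u y * frechet_derivative (\<lambda>y. mollifier e (x - y)) (at y) b) =
        - (LINT y|lebesgue. (G y \<bullet> b) * mollifier e (x - y))"
    using assms mollifier_test_function[OF assms(2), of x] unfolding is_weak_gradient_def by blast
  ultimately show ?thesis by simp
qed

lemma locally_integrable_inner:
  fixes G :: "'a::euclidean_space \<Rightarrow> 'a"
  shows "locally_integrable G \<Longrightarrow> locally_integrable (\<lambda>x. G x \<bullet> b)"
  unfolding locally_integrable_def set_integrable_def
  by (auto dest!: spec intro: integrable_inner_left simp flip: inner_scaleR_left)

lemma locally_integrable_add:
  "locally_integrable f \<Longrightarrow> locally_integrable g \<Longrightarrow> locally_integrable (\<lambda>x. f x + g x)"
  unfolding locally_integrable_def by (auto intro: set_integral_add)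

lemma locally_integrable_scale:
  "locally_integrable f \<Longrightarrow> locally_integrable (\<lambda>x. c *\<^sub>R f x)"
  unfolding locally_integrable_def set_integrable_def
  by (simp add: scaleR_left_commute[of _ c] del: scaleR_scaleR)

lemma AE_inner_Basis_eq_0:
  assumes "\<And>b. b \<in> Basis \<Longrightarrow> AE x in M. P x \<longrightarrow> f x \<bullet> b = 0"
  shows "AE x in M. P x \<longrightarrow> f x = (0 :: 'b::euclidean_space)"
proof -
  have "AE x in M. \<forall>b\<in>Basis. P x \<longrightarrow> f x \<bullet> b = 0"
    using assms by (intro AE_ball_countable') (auto intro: countable_finite)
  then show ?thesis by eventually_elim (metis euclidean_all_zero_iff)
qed

text \<open>Lets a weak gradient obtained by construction be exchanged for the one that
  \<open>weak_grad\<close> selects.\<close>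

theorem weak_gradient_unique:
  assumes "is_weak_gradient u G" "is_weak_gradient u H"
  shows "AE x in lebesgue. G x = H x"
proof -
  have lG: "locally_integrable G" "locally_integrable H" using assms by (auto simp: is_weak_gradient_def)
  have "AE x in lebesgue. True \<longrightarrow> G x - H x = 0"
  proof (rule AE_inner_Basis_eq_0)
    fix b :: 'a assume b: "b \<in> Basis"
    have l: "locally_integrable (\<lambda>x. (G x - H x) \<bullet> b)"
      using locally_integrable_inner[OF locally_integrable_add[OF lG(1) locally_integrable_scale[OF lG(2),
          of "-1"]], of b] by simp
    have "AE x in lebesgue. x \<in> UNIV \<longrightarrow> (G x - H x) \<bullet> b = 0"
    proof (rule locally_integrable_fundamental[OF l])
      fix x :: 'a and e :: real assume e: "0 < e"
      have i: "integrable lebesgue (\<lambda>y. (F y \<bullet> b) * mollifier e (x - y))" if F: "locally_integrable F"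
          for F :: "'a \<Rightarrow> 'a"
      proof -
        have "integrable lebesgue (\<lambda>y. (indicator (cball x e) y * (F y \<bullet> b)) * mollifier e (x - y))"
        proof (rule integrable_mult_bounded)
          show "integrable lebesgue (\<lambda>y. indicator (cball x e) y * (F y \<bullet> b))"
            using locally_integrable_inner[OF F, of b] by (simp add: locally_integrable_def
                set_integrable_def)
          show "\<bar>mollifier e (x - y)\<bar> \<le> 1 / \<bar>mollifier_mass TYPE('a) e\<bar>" for y
            using mollifier_norm_bounded[OF e, of "x - y"] by simp
        qed (auto intro: borel_imp_lebesgue_measurable)
        moreover have "(indicator (cball x e) y * (F y \<bullet> b)) * mollifier e (x - y)
            = (F y \<bullet> b) * mollifier e (x - y)" for y
          using mollifier_eq_0[OF e, of "x - y"] by (auto simp: indicator_def dist_norm)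
        ultimately show ?thesis by simp
      qed
      show "(LINT y|lebesgue. ((G y - H y) \<bullet> b) * mollifier e (x - y)) = 0"
        using weak_gradient_mollifier[OF assms(1) e b, of x] weak_gradient_mollifier[OF assms(2) e b, of x]
            i[OF lG(1)] i[OF lG(2)]
        by (simp add: inner_diff_left left_diff_distrib)
    qed auto
    then show "AE x in lebesgue. True \<longrightarrow> (G x - H x) \<bullet> b = 0" by simp
  qed
  then show ?thesis by simp
qed

text \<open>Justifies truncating G to a ball in \<open>weak_gradient_borel_rep\<close>. Vanishing
  outside \<Omega> itself is finer, because the complement of \<Omega> is closed, and comes from
  \<open>gradient_eq_0_on_zero_set\<close>.\<close>

lemma weak_gradient_zero_outside:
  fixes u :: "'a::euclidean_space \<Rightarrow> real"
  assumes "is_weak_gradient u G" "\<And>x. R < norm x \<Longrightarrow> u x = 0"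
  shows "AE x in lebesgue. R < norm x \<longrightarrow> G x = 0"
proof (rule AE_inner_Basis_eq_0)
  fix b :: 'a assume b: "b \<in> Basis"
  have "AE x in lebesgue. x \<in> - cball 0 R \<longrightarrow> G x \<bullet> b = 0"
  proof (rule locally_integrable_fundamental)
    show "locally_integrable (\<lambda>x. G x \<bullet> b)"
      using assms(1) by (auto simp: is_weak_gradient_def intro: locally_integrable_inner)
    fix x :: 'a and e :: real assume e: "0 < e" and sub: "cball x e \<subseteq> - cball 0 R"
    have "u y * (mollifier_grad e (x - y) \<bullet> b) = 0" for y
    proof (cases "norm (x - y) < e")
      case True
      then have "y \<in> - cball 0 R" using sub by (auto simp: subset_iff dist_norm)
      then show ?thesis using assms(2)[of y] by simp
    qed (simp add: mollifier_grad_eq_0[OF e])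
    then have "(\<lambda>y. u y * (mollifier_grad e (x - y) \<bullet> b)) = (\<lambda>y. 0)" by blast
    then show "(LINT y|lebesgue. (G y \<bullet> b) * mollifier e (x - y)) = 0"
      unfolding weak_gradient_mollifier[OF assms(1) e b, of x] by simp
  qed auto
  then show "AE x in lebesgue. R < norm x \<longrightarrow> G x \<bullet> b = 0" by (simp add: not_le)
qed

text \<open>The passage from \<open>lebesgue\<close> to \<open>lborel\<close>. Compact support turns
  local integrability into integrability, and the explicit truncation makes the representatives
  vanish outside the ball everywhere and not just almost everywhere.\<close>

lemma weak_gradient_borel_rep:
  fixes u :: "'a::euclidean_space \<Rightarrow> real"
  assumes uG: "is_weak_gradient u G" and supp: "\<And>x. R < norm x \<Longrightarrow> u x = 0"
  obtains u' G' where "grad_lborel u' G'" "AE x in lebesgue. u x = u' x" "AE x in lebesgue. G x = G' x"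
    "\<And>x. R < norm x \<Longrightarrow> u' x = 0" "\<And>x. R < norm x \<Longrightarrow> G' x = 0"
proof -
  have i: "integrable lebesgue (\<lambda>x. indicator (cball 0 R) x * u x)" "integrable lebesgue (\<lambda>x. indicator
      (cball 0 R) x *\<^sub>R G x)"
    using uG by (auto simp: is_weak_gradient_def locally_integrable_def set_integrable_def)
  obtain v where v: "v \<in> borel_measurable borel" "integrable lborel v" "AE x in lebesgue. indicator (cball 0
      R) x * u x = v x"
    using integrable_borel_rep[OF i(1)] .
  obtain F where F: "F \<in> borel_measurable borel" "integrable lborel F" "AE x in lebesgue. indicator (cball 0
      R) x *\<^sub>R G x = F x"
    using integrable_borel_rep[OF i(2)] .
  define u' where "u' x = indicator (cball 0 R) x *\<^sub>R v x" for x
  define G' where "G' x = indicator (cball 0 R) x *\<^sub>R F x" for x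
  have [measurable]: "u' \<in> borel_measurable borel" "G' \<in> borel_measurable borel"
    unfolding u'_def[abs_def] G'_def[abs_def] by (intro borel_measurable_scaleR borel_measurable_indicator
        v(1) F(1); simp)+
  have int: "integrable lborel u'" "integrable lborel G'"
    unfolding u'_def[abs_def] G'_def[abs_def] using v(2) F(2) by (intro integrable_mult_indicator; simp)+
  have uu': "AE x in lebesgue. u x = u' x" using v(3)
  proof eventually_elim
    case (elim x) then show ?case using supp[of x] by (cases "norm x \<le> R") (auto simp: u'_def)
  qed
  have "AE x in lebesgue. R < norm x \<longrightarrow> G x = 0" by (rule weak_gradient_zero_outside[OF uG supp])
  with F(3) have GG': "AE x in lebesgue. G x = G' x"
  proof eventually_elim
    case (elim x) then show ?case by (cases "norm x \<le> R") (auto simp: G'_def)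
  qed
  have meas: "u \<in> borel_measurable lebesgue" "G \<in> borel_measurable lebesgue"
    using uG by (auto simp: is_weak_gradient_def intro: locally_integrable_measurable)
  have "grad_lborel u' G'"
    unfolding grad_lborel_def
  proof (intro conjI int allI impI ballI)
    fix \<phi> :: "'a \<Rightarrow> real" and b :: 'a assume \<phi>: "test_function \<phi>" and b: "b \<in> Basis"
    note [measurable] = test_function_borel(1)[OF \<phi>] test_function_borel(2)[OF \<phi> b]
    have "(LINT x|lborel. u' x * frechet_derivative \<phi> (at x) b)
        = (LINT x|lebesgue. u' x * frechet_derivative \<phi> (at x) b)"
      by (rule integral_lebesgue_lborel[symmetric]) measurable
    also have "\<dots> = (LINT x|lebesgue. u x * frechet_derivative \<phi> (at x) b)"
    proof (rule integral_cong_AE)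
      show "AE x in lebesgue. u' x * frechet_derivative \<phi> (at x) b = u x * frechet_derivative \<phi> (at x) b"
        using uu' by eventually_elim simp
    qed (intro borel_measurable_times meas borel_imp_lebesgue_measurable; measurable)+
    also have "\<dots> = - (LINT x|lebesgue. (G x \<bullet> b) * \<phi> x)"
      using uG \<phi> b unfolding is_weak_gradient_def by blast
    also have "(LINT x|lebesgue. (G x \<bullet> b) * \<phi> x) = (LINT x|lebesgue. (G' x \<bullet> b) * \<phi> x)"
    proof (rule integral_cong_AE)
      show "AE x in lebesgue. (G x \<bullet> b) * \<phi> x = (G' x \<bullet> b) * \<phi> x"
        using GG' by eventually_elim simp
    qed (intro borel_measurable_times borel_measurable_inner meas borel_measurable_const
        borel_imp_lebesgue_measurable; measurable)+
    also have "\<dots> = (LINT x|lborel. (G' x \<bullet> b) * \<phi> x)"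
      by (rule integral_lebesgue_lborel) measurable
    finally show "(LINT x|lborel. u' x * frechet_derivative \<phi> (at x) b)
        = - (LINT x|lborel. (G' x \<bullet> b) * \<phi> x)" .
  qed
  then show ?thesis using uu' GG' by (intro that[of u' G']) (auto simp: u'_def G'_def)
qed


text \<open>The C^1 inequality applies to mollifications, whose gradients are mollifications of G
  and hence no larger in L^p; Fatou's lemma along an almost everywhere convergent subsequence
  removes the mollifier.\<close>

theorem sobolev_inequality:
  fixes u :: "'a::euclidean_space \<Rightarrow> real"
  assumes uG: "grad_lborel u G" and supp: "\<And>x. R < norm x \<Longrightarrow> u x = 0"
    and p: "1 < p" "p < real DIM('a)"
    and Q: "(\<integral>\<^sup>+x. ennreal (norm (G x) powr p) \<partial>lborel) \<le> ennreal Q" "0 \<le> Q"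
  shows "(\<integral>\<^sup>+x. ennreal (\<bar>u x\<bar> powr crit_exp DIM('a) p) \<partial>lborel)
    \<le> ennreal (sobolev_const DIM('a) p * Q powr (crit_exp DIM('a) p / p))"
proof -
  note u = grad_lborelD(1)[OF uG] and G = grad_lborelD(2)[OF uG]
  note [measurable] = grad_lborelD(3)[OF uG]
  let ?r = "crit_exp DIM('a) p"
  have r: "0 < ?r" using p by (simp add: crit_exp_def)
  define w where "w n = moll (1 / Suc n) u" for n :: nat
  have [measurable]: "w n \<in> borel_measurable borel" for n
    unfolding w_def by (intro moll_borel u) simp
  have wm: "(\<lambda>x. ennreal (\<bar>w n x\<bar> powr ?r)) \<in> borel_measurable borel" for n
    by measurable
  have bound: "(\<integral>\<^sup>+x. ennreal (\<bar>w n x\<bar> powr ?r) \<partial>lborel) \<le> ennreal (sobolev_const DIM('a) p * Q powr (?r /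
      p))" for n
    unfolding w_def
  proof (rule sobolev_inequality_C1[OF moll_has_gradient[OF uG] moll_continuous[OF G]])
    show "moll (1 / Suc n) u x = 0" if "R + 1 / Suc n < norm x" for x
      using that by (intro moll_eq_0[OF u _ supp]) auto
    show "(\<integral>\<^sup>+x. ennreal (norm (moll (1 / Suc n) G x) powr p) \<partial>lborel) \<le> ennreal Q"
      using p by (intro order_trans[OF moll_nn_integral_powr_le[OF G] Q(1)]) auto
  qed (use p Q in auto)
  obtain s :: "nat \<Rightarrow> nat" where s: "strict_mono s" "AE x in lborel. (\<lambda>n. w (s n) x - u x) \<longlonglongrightarrow> 0"
    using tendsto_L1_AE_subseq[of lborel "\<lambda>n x. w n x - u x"] moll_L1_seq[OF u] moll_integrable[OF u] u
    unfolding w_def by auto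
  have "(\<integral>\<^sup>+x. ennreal (\<bar>u x\<bar> powr ?r) \<partial>lborel) \<le> (\<integral>\<^sup>+x. liminf (\<lambda>n. ennreal (\<bar>w (s n) x\<bar> powr ?r))
      \<partial>lborel)"
  proof (intro nn_integral_mono_AE, use s(2) in eventually_elim)
    case (elim x)
    then have "(\<lambda>n. w (s n) x) \<longlonglongrightarrow> u x" by (simp add: LIM_zero_iff)
    then have "(\<lambda>n. ennreal (\<bar>w (s n) x\<bar> powr ?r)) \<longlonglongrightarrow> ennreal (\<bar>u x\<bar> powr ?r)"
      using r by (intro tendsto_ennrealI tendsto_powr' tendsto_rabs tendsto_const) auto
    then have "liminf (\<lambda>n. ennreal (\<bar>w (s n) x\<bar> powr ?r)) = ennreal (\<bar>u x\<bar> powr ?r)"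
      by (intro lim_imp_Liminf) auto
    then show ?case by simp
  qed
  also have "\<dots> \<le> liminf (\<lambda>n. \<integral>\<^sup>+x. ennreal (\<bar>w (s n) x\<bar> powr ?r) \<partial>lborel)"
    by (rule nn_integral_liminf) (simp add: wm)
  also have "\<dots> \<le> liminf (\<lambda>n::nat. ennreal (sobolev_const DIM('a) p * Q powr (?r / p)))"
    by (intro Liminf_mono always_eventually allI bound)
  also have "\<dots> = ennreal (sobolev_const DIM('a) p * Q powr (?r / p))"
    by (intro Liminf_const) simp
  finally show ?thesis .
qed

section \<open>Vanishing of the weak gradient on the zero set\<close>

lemma continuous_compact_support_integrable:
  fixes f :: "'a::euclidean_space \<Rightarrow> real"
  assumes "continuous_on UNIV f" "\<And>x. R < norm x \<Longrightarrow> f x = 0"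
  shows "integrable lborel f"
proof -
  obtain B where "\<And>x. \<bar>f x\<bar> \<le> B" using continuous_compact_support_bounded[OF assms] by blast
  then show ?thesis
    using assms by (intro bounded_support_integrable[where B = B and R
        = R]) (auto intro: borel_measurable_continuous_onI)
qed

text \<open>The integral of the difference quotients vanishes by translation invariance.\<close>

lemma integral_directional_derivative_eq_0:
  fixes \<psi> :: "'a::euclidean_space \<Rightarrow> real"
  assumes D: "\<And>x. (\<psi> has_derivative D x) (at x)" and c: "continuous_on UNIV (\<lambda>x. D x b)"
    and supp: "\<And>x. R < norm x \<Longrightarrow> \<psi> x = 0" "\<And>x. R < norm x \<Longrightarrow> D x b = 0" and b: "norm b = 1"
  shows "(LINT x|lborel. D x b) = 0"
proof -
  have c\<psi>: "continuous_on UNIV \<psi>"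
    using has_derivative_continuous[OF D] by (blast intro: continuous_at_imp_continuous_on)
  note int = continuous_compact_support_integrable[OF c\<psi> supp(1)]
  note [measurable] = borel_measurable_continuous_onI[OF c] borel_measurable_continuous_onI[OF c\<psi>]
  obtain B where B: "\<And>x. \<bar>D x b\<bar> \<le> B" using continuous_compact_support_bounded[OF c supp(2)] by blast
  define h where "h n = 1 / real (Suc n)" for n
  have h: "0 < h n" "h n \<le> 1" for n by (auto simp: h_def)
  have hne: "\<forall>n. h n \<in> UNIV - {0}" by (simp add: h_def)
  have h0: "h \<longlonglongrightarrow> 0" using LIMSEQ_inverse_real_of_nat by (simp add: h_def[abs_def] inverse_eq_divide)
  define q where "q n x = (\<psi> (x - - (h n *\<^sub>R b)) - \<psi> x) / h n" for n x
  have d: "((\<lambda>t. \<psi> (x + t *\<^sub>R b)) has_real_derivative D (x + t *\<^sub>R b) b) (at t)" for x t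
  proof -
    have "((\<lambda>t. x + t *\<^sub>R b) has_derivative (\<lambda>h. h *\<^sub>R b)) (at t)" by (auto intro!: derivative_eq_intros)
    from has_derivative_compose[OF this D]
    show ?thesis unfolding has_field_derivative_def
      by (rule has_derivative_eq_rhs) (auto simp: fun_eq_iff linear_scale[OF has_derivative_linear[OF D]])
  qed
  have "(LINT x|lborel. q n x) = 0" for n
    unfolding q_def using int integrable_lborel_translate[OF int, where t = "- (h n *\<^sub>R b)"]
      integral_lborel_translate[where f = \<psi> and t = "- (h n *\<^sub>R b)"] by simp
  \<comment> \<open>The mean value theorem bounds the quotients by B, and steps of length at most 1
    keep their supports in the ball of radius R + 1.\<close>
  moreover have "(\<lambda>n. LINT x|lborel. q n x) \<longlonglongrightarrow> (LINT x|lborel. D x b)"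
  proof (rule integral_dominated_convergence[where w = "\<lambda>x. indicator (cball 0 (R + 1)) x * B"])
    show "AE x in lborel. (\<lambda>n. q n x) \<longlonglongrightarrow> D x b"
    proof (rule AE_I2)
      fix x
      have "(\<lambda>t. (\<psi> (x + (0 + t) *\<^sub>R b) - \<psi> (x + 0 *\<^sub>R b)) / t) \<midarrow>0\<rightarrow> D (x + 0 *\<^sub>R b) b"
        using d[of x 0] unfolding DERIV_def .
      then have "((\<lambda>t. (\<psi> (x + (0 + t) *\<^sub>R b) - \<psi> (x + 0 *\<^sub>R b)) / t) \<circ> h) \<longlonglongrightarrow> D (x + 0 *\<^sub>R b) b"
        using h0 hne unfolding tendsto_at_iff_sequentially by blast
      then show "(\<lambda>n. q n x) \<longlonglongrightarrow> D x b" by (simp add: o_def q_def)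
    qed
    show "AE x in lborel. norm (q n x) \<le> indicator (cball 0 (R + 1)) x * B" for n
    proof (rule AE_I2)
      fix x
      obtain z where "\<psi> (x + h n *\<^sub>R b) - \<psi> (x + 0 *\<^sub>R b) = (h n - 0) * D (x + z *\<^sub>R b) b"
        using MVT2[OF h(1) d] by blast
      then have 1: "\<bar>q n x\<bar> \<le> B" using B[of "x + z *\<^sub>R b"] h(1)[of n] by (simp add: q_def)
      show "norm (q n x) \<le> indicator (cball 0 (R + 1)) x * B"
      proof (cases "norm x \<le> R + 1")
        case False
        have "norm (h n *\<^sub>R b) \<le> 1" using h[of n] b by simp
        then have "R < norm (x + h n *\<^sub>R b)"
          using False norm_triangle_ineq2[of x "- (h n *\<^sub>R b)"] by simp
        then show ?thesis using False supp(1) by (auto simp: q_def)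
      qed (use 1 in simp)
    qed
    show "integrable lborel (\<lambda>x::'a. indicator (cball 0 (R + 1)) x * B)"
      by (intro integrable_mult_left integrable_real_indicator) (auto simp:
          emeasure_lborel_cball_finite[unfolded infinity_ennreal_def])
  qed (auto simp: q_def)
  ultimately show ?thesis by (simp add: LIMSEQ_const_iff)
qed

text \<open>The directional derivative of the product of \<open>k (moll e u)\<close> and the test
  function integrates to 0, the product having compact support because the test function has. The
  chain rule is needed in this tested form only.\<close>

lemma moll_chain_rule:
  fixes k k' :: "real \<Rightarrow> real"
  assumes uG: "grad_lborel u G" and e: "0 < e" and \<phi>: "test_function \<phi>" and b: "b \<in> Basis"
    and k: "\<And>y. (k has_real_derivative k' y) (at y)" "continuous_on UNIV k'"
  shows "(LINT x|lborel. k (moll e u x) * frechet_derivative \<phi> (at x) b) =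
    - (LINT x|lborel. k' (moll e u x) * (moll e G x \<bullet> b) * \<phi> x)"
proof -
  obtain R B where R: "\<And>x. R < norm x \<Longrightarrow> \<phi> x = 0" "\<And>x b. R < norm x \<Longrightarrow> frechet_derivative \<phi> (at x) b = 0"
    using test_function_support[OF \<phi>] by metis
  have C: "C_k 0 \<phi>" "C_k (Suc 0) \<phi>" using \<phi> unfolding test_function_def by blast+
  have ck: "continuous_on UNIV k" using k(1) by (meson DERIV_isCont continuous_at_imp_continuous_on)
  note cont = moll_continuous[OF grad_lborelD(1)[OF uG] e] moll_continuous[OF grad_lborelD(2)[OF uG] e]
  have c: "continuous_on UNIV \<phi>" "continuous_on UNIV (\<lambda>x. frechet_derivative \<phi> (at x) b)" using C b by auto
  have c1: "continuous_on UNIV (\<lambda>x. k (moll e u x) * frechet_derivative \<phi> (at x) b)"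
    and c2: "continuous_on UNIV (\<lambda>x. k' (moll e u x) * (moll e G x \<bullet> b) * \<phi> x)"
    by (intro continuous_intros c cont continuous_on_compose2[OF ck cont(1)] continuous_on_compose2[OF k(2)
        cont(1)]; simp)+
  have i: "integrable lborel (\<lambda>x. k (moll e u x) * frechet_derivative \<phi> (at x) b)"
    "integrable lborel (\<lambda>x. k' (moll e u x) * (moll e G x \<bullet> b) * \<phi> x)"
    by (rule continuous_compact_support_integrable[OF c1, of R]; simp add: R)
       (rule continuous_compact_support_integrable[OF c2, of R]; simp add: R)
  define D where "D x h = k (moll e u x) * frechet_derivative \<phi> (at x) h
      + k' (moll e u x) * (moll e G x \<bullet> h) * \<phi> x" for x h
  have "(LINT x|lborel. D x b) = 0"
  proof (rule integral_directional_derivative_eq_0)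
    fix x
    have "((\<lambda>x. k (moll e u x)) has_derivative (\<lambda>h. k' (moll e u x) * (moll e G x \<bullet> h))) (at x)"
      using has_derivative_compose[OF moll_has_gradient[OF uG e] k(1)[unfolded has_field_derivative_def]]
          by simp
    from has_derivative_mult[OF this C_k_frechet[OF C(2)]]
    show "((\<lambda>x. k (moll e u x) * \<phi> x) has_derivative D x) (at x)"
      by (simp add: D_def[abs_def])
  next
    show "continuous_on UNIV (\<lambda>x. D x b)" unfolding D_def by (intro continuous_on_add c1 c2)
  qed (use R b in \<open>auto simp: D_def\<close>)
  then show ?thesis unfolding D_def using i by simp
qed

text \<open>Test the chain rule for \<open>d arctan (u / d)\<close> and let \<open>d \<longlonglongrightarrow> 0\<close>: the function tends to \<open>0\<close> uniformly,
  the factor \<open>1 / (1 + (u / d)\<^sup>2)\<close> in front of the gradient to the indicator of \<open>{u = 0}\<close>.\<close>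

theorem gradient_eq_0_on_zero_set:
  assumes uG: "grad_lborel u G"
  shows "AE x in lborel. u x = 0 \<longrightarrow> G x = 0"
proof (rule AE_inner_Basis_eq_0)
  fix b :: 'a assume b: "b \<in> Basis"
  note u = grad_lborelD(1)[OF uG] and G = grad_lborelD(2)[OF uG]
  note [measurable] = grad_lborelD(3)[OF uG] grad_lborelD(4)[OF uG]
  define w where "w n = moll (1 / Suc n) u" for n :: nat
  define W where "W n = moll (1 / Suc n) G" for n :: nat
  have W_int: "integrable lborel (W n)" for n unfolding W_def by (intro moll_integrable G) simp
  have [measurable]: "w n \<in> borel_measurable borel" "W n \<in> borel_measurable borel" for n
    unfolding w_def W_def by (intro moll_borel u G; simp)+
  obtain s :: "nat \<Rightarrow> nat" where s: "strict_mono s" "AE x in lborel. (\<lambda>n. w (s n) x - u x) \<longlonglongrightarrow> 0"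
    using tendsto_L1_AE_subseq[of lborel "\<lambda>n x. w n x - u x"] moll_L1_seq[OF u] moll_integrable[OF u] u
    unfolding w_def by auto
  have WG: "(\<lambda>n. LINT x|lborel. norm (W (s n) x - G x)) \<longlonglongrightarrow> 0"
    using LIMSEQ_subseq_LIMSEQ[OF moll_L1_seq[OF G] s(1)] by (simp add: o_def W_def)
  \<comment> \<open>The chain rule for u itself, as the limit of \<open>moll_chain_rule\<close>
    along a subsequence of scales tending to 0. It is available because k is bounded by d * pi and
    its derivative by 1.\<close>
  have chain: "(LINT x|lborel. d * arctan (u x / d) * frechet_derivative \<phi> (at x) b) =
      - (LINT x|lborel. (G x \<bullet> b) * (1 / (1 + (u x / d)\<^sup>2) * \<phi> x))"
    if d: "0 < d" and \<phi>: "test_function \<phi>" for d \<phi>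
  proof -
    define k where "k y = d * arctan (y / d)" for y
    define k' where "k' y = 1 / (1 + (y / d)\<^sup>2)" for y
    have pos: "0 < 1 + (y / d)\<^sup>2" for y by (simp add: add_pos_nonneg)
    have k: "(k has_real_derivative k' y) (at y)" for y
      unfolding k_def[abs_def] k'_def using d by (auto intro!: derivative_eq_intros simp: inverse_eq_divide)
    have ck': "continuous_on UNIV k'"
      unfolding k'_def[abs_def] using d pos by (intro continuous_intros) (auto simp:
          less_imp_neq[symmetric])
    have ck: "continuous_on UNIV k" using k by (meson DERIV_isCont continuous_at_imp_continuous_on)
    have kb: "\<bar>k y\<bar> \<le> d * pi" for y
    proof -
      have "\<bar>arctan (y / d)\<bar> \<le> pi" using arctan_bounded[of "y / d"] by auto
      then show ?thesis using d by (simp add: k_def abs_mult)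
    qed
    have k'b: "\<bar>k' y\<bar> \<le> 1" for y using pos[of y] by (simp add: k'_def)
    obtain R B where R: "\<And>x. R < norm x \<Longrightarrow> \<phi> x = 0" "\<And>x b. R < norm x \<Longrightarrow> frechet_derivative \<phi> (at x) b = 0"
       and B: "\<And>x. \<bar>\<phi> x\<bar> \<le> B"
      using test_function_support[OF \<phi>] by metis
    have C: "C_k (Suc 0) \<phi>" using \<phi> unfolding test_function_def by blast
    have i\<phi>: "integrable lborel (\<lambda>x. frechet_derivative \<phi> (at x) b)"
      using C b R by (intro continuous_compact_support_integrable[of _ R]) auto
    note [measurable] = test_function_borel(1)[OF \<phi>] test_function_borel(2)[OF \<phi> b]
      borel_measurable_continuous_onI[OF ck] borel_measurable_continuous_onI[OF ck']
    have L: "(\<lambda>n. LINT x|lborel. k (w (s n) x) * frechet_derivative \<phi> (at x) b)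
        \<longlonglongrightarrow> (LINT x|lborel. k (u x) * frechet_derivative \<phi> (at x) b)"
    proof (rule integral_dominated_convergence[where w = "\<lambda>x. d * pi * norm (frechet_derivative \<phi> (at x)
        b)"])
      show "AE x in lborel. (\<lambda>n. k (w (s n) x) * frechet_derivative \<phi> (at x) b)
          \<longlonglongrightarrow> k (u x) * frechet_derivative \<phi> (at x) b"
        using s(2)
      proof eventually_elim
        case (elim x)
        then have "(\<lambda>n. w (s n) x) \<longlonglongrightarrow> u x" by (simp add: LIM_zero_iff)
        then show ?case
          by (intro tendsto_mult tendsto_const continuous_on_tendsto_compose[OF ck]) auto
      qed
      show "AE x in lborel. norm (k (w (s n) x) * frechet_derivative \<phi> (at x) b)
          \<le> d * pi * norm (frechet_derivative \<phi> (at x) b)" for n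
        using kb by (intro AE_I2) (simp add: abs_mult mult_right_mono)
    qed (use i\<phi> in auto)
    have R2: "(\<lambda>n. LINT x|lborel. (G x \<bullet> b) * (k' (w (s n) x) * \<phi> x))
        \<longlonglongrightarrow> (LINT x|lborel. (G x \<bullet> b) * (k' (u x) * \<phi> x))"
    proof (rule integral_dominated_convergence[where w = "\<lambda>x. norm (G x \<bullet> b) * (1 * B)"])
      show "AE x in lborel. (\<lambda>n. (G x \<bullet> b) * (k' (w (s n) x) * \<phi> x)) \<longlonglongrightarrow> (G x \<bullet> b) * (k' (u x) * \<phi> x)"
        using s(2)
      proof eventually_elim
        case (elim x)
        then have "(\<lambda>n. w (s n) x) \<longlonglongrightarrow> u x" by (simp add: LIM_zero_iff)
        then show ?case
          by (intro tendsto_mult tendsto_const continuous_on_tendsto_compose[OF ck']) auto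
      qed
      show "AE x in lborel. norm ((G x \<bullet> b) * (k' (w (s n) x) * \<phi> x)) \<le> norm (G x \<bullet> b) * (1 * B)" for n
      proof (rule AE_I2)
        fix x
        have "\<bar>k' (w (s n) x)\<bar> * \<bar>\<phi> x\<bar> \<le> 1 * B" by (intro mult_mono k'b B) auto
        then show "norm ((G x \<bullet> b) * (k' (w (s n) x) * \<phi> x)) \<le> norm (G x \<bullet> b) * (1 * B)"
          unfolding norm_mult by (intro mult_left_mono) (auto simp: abs_mult)
      qed
    qed (use G in auto)
    have iG: "integrable lborel (\<lambda>x. (F x \<bullet> b) * (k' (w n x) * \<phi> x))" if "integrable lborel F"
        for F :: "'a \<Rightarrow> 'a" and n
    proof (rule integrable_mult_bounded)
      show "\<bar>k' (w n x) * \<phi> x\<bar> \<le> 1 * B" for x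
        unfolding abs_mult by (intro mult_mono k'b B) auto
    qed (use that in auto)
    \<comment> \<open>Exchanging W for G costs at most B times their L^1 distance, since the
      remaining factor is bounded by B; the limit in the argument of k' is already settled by
      R2.\<close>
    have R1: "(\<lambda>n. (LINT x|lborel. (W (s n) x \<bullet> b) * (k' (w (s n) x) * \<phi> x)) - (LINT x|lborel. (G x \<bullet> b) *
        (k' (w (s n) x) * \<phi> x))) \<longlonglongrightarrow> 0"
    proof (rule Lim_null_comparison)
      show "(\<lambda>n. (LINT x|lborel. norm (W (s n) x - G x)) * B) \<longlonglongrightarrow> 0"
        using tendsto_mult_left_zero[OF WG] by simp
      have "norm ((LINT x|lborel. (W n x \<bullet> b) * (k' (w n x) * \<phi> x)) - (LINT x|lborel. (G x \<bullet> b) * (k' (w n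
          x) * \<phi> x)))
          \<le> (LINT x|lborel. norm (W n x - G x)) * B" for n
      proof -
        note j = iG[OF W_int, of n n] iG[OF G, of n]
        have "(LINT x|lborel. (W n x \<bullet> b) * (k' (w n x) * \<phi> x)) - (LINT x|lborel. (G x \<bullet> b) * (k' (w n x) *
            \<phi> x)) =
          (LINT x|lborel. ((W n x - G x) \<bullet> b) * (k' (w n x) * \<phi> x))"
          using j by (simp add: inner_diff_left left_diff_distrib)
        also have "norm \<dots> \<le> (LINT x|lborel. norm (((W n x - G x) \<bullet> b) * (k' (w n x) * \<phi> x)))"
          by (rule integral_norm_bound)
        also have "\<dots> \<le> (LINT x|lborel. norm (W n x - G x) * B)"
        proof (rule integral_mono)
          show "integrable lborel (\<lambda>x. norm (((W n x - G x) \<bullet> b) * (k' (w n x) * \<phi> x)))"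
            by (intro integrable_norm iG Bochner_Integration.integrable_diff W_int G)
          show "norm (((W n x - G x) \<bullet> b) * (k' (w n x) * \<phi> x)) \<le> norm (W n x - G x) * B" for x
          proof -
            have "\<bar>k' (w n x)\<bar> * \<bar>\<phi> x\<bar> \<le> 1 * B" by (intro mult_mono k'b B) auto
            moreover have "\<bar>(W n x - G x) \<bullet> b\<bar> \<le> norm (W n x - G x)" using b by (rule Basis_le_norm)
            ultimately show ?thesis by (simp add: abs_mult mult_mono)
          qed
        qed (intro integrable_mult_left integrable_norm Bochner_Integration.integrable_diff W_int G)
        finally show ?thesis by simp
      qed
      then show "\<forall>\<^sub>F n in sequentially. norm ((LINT x|lborel. (W (s n) x \<bullet> b) * (k' (w (s n) x) * \<phi> x)) -
          (LINT x|lborel. (G x \<bullet> b) * (k' (w (s n) x) * \<phi> x)))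
          \<le> (LINT x|lborel. norm (W (s n) x - G x)) * B" by simp
    qed
    have "(\<lambda>n. - (LINT x|lborel. (W (s n) x \<bullet> b) * (k' (w (s n) x) * \<phi> x)))
        \<longlonglongrightarrow> - (LINT x|lborel. (G x \<bullet> b) * (k' (u x) * \<phi> x))"
      using tendsto_minus[OF tendsto_add[OF R1 R2]] by simp
    moreover have "(LINT x|lborel. k (w n x) * frechet_derivative \<phi> (at x) b)
        = - (LINT x|lborel. (W n x \<bullet> b) * (k' (w n x) * \<phi> x))" for n
      using moll_chain_rule[OF uG _ \<phi> b k ck', of "1 / Suc n"] unfolding w_def W_def by (simp add: mult_ac)
    ultimately have "(LINT x|lborel. k (u x) * frechet_derivative \<phi> (at x) b)
        = - (LINT x|lborel. (G x \<bullet> b) * (k' (u x) * \<phi> x))"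
      using L by (simp add: LIMSEQ_unique)
    then show ?thesis by (simp add: k_def k'_def)
  qed
  define f where "f x = (if u x = 0 then G x \<bullet> b else 0)" for x
  have [measurable]: "f \<in> borel_measurable borel" unfolding f_def[abs_def] by measurable
  have f: "integrable lborel f"
    by (rule Bochner_Integration.integrable_bound[where f = "\<lambda>x. G x \<bullet> b"]) (use G in \<open>auto simp: f_def\<close>)
  have f0: "(LINT x|lborel. f x * \<phi> x) = 0" if \<phi>: "test_function \<phi>" for \<phi>
  proof -
    obtain R B where R: "\<And>x. R < norm x \<Longrightarrow> frechet_derivative \<phi> (at x) b = 0"
       and B: "\<And>x. \<bar>\<phi> x\<bar> \<le> B"
      using test_function_support[OF \<phi>] by metis
    have C: "C_k (Suc 0) \<phi>" using \<phi> unfolding test_function_def by blast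
    have i\<phi>: "integrable lborel (\<lambda>x. frechet_derivative \<phi> (at x) b)"
      using C b R by (intro continuous_compact_support_integrable[of _ R]) auto
    note [measurable] = test_function_borel(1)[OF \<phi>] test_function_borel(2)[OF \<phi> b]
    define d where "d n = 1 / real (Suc n)" for n
    have d: "0 < d n" "d n \<le> 1" for n by (auto simp: d_def)
    have d0: "d \<longlonglongrightarrow> 0" using LIMSEQ_inverse_real_of_nat by (simp add: d_def[abs_def] inverse_eq_divide)
    have ab: "\<bar>arctan y\<bar> \<le> pi" for y using arctan_bounded[of y] by auto
    have [measurable]: "arctan \<in> borel_measurable borel"
      by (intro borel_measurable_continuous_onI continuous_intros)
    have "(\<lambda>n. LINT x|lborel. d n * arctan (u x / d n) * frechet_derivative \<phi> (at x) b)
        \<longlonglongrightarrow> (LINT x|(lborel::'a measure). (0::real))"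
    proof (rule integral_dominated_convergence[where w = "\<lambda>x. pi * norm (frechet_derivative \<phi> (at x) b)"])
      show "AE x in lborel. (\<lambda>n. d n * arctan (u x / d n) * frechet_derivative \<phi> (at x) b) \<longlonglongrightarrow> 0"
      proof (rule AE_I2)
        fix x
        have "(\<lambda>n. d n * arctan (u x / d n)) \<longlonglongrightarrow> 0"
        proof (rule Lim_null_comparison)
          show "(\<lambda>n. d n * pi) \<longlonglongrightarrow> 0" using tendsto_mult_left_zero[OF d0] by simp
          show "\<forall>\<^sub>F n in sequentially. norm (d n * arctan (u x / d n)) \<le> d n * pi"
            using ab d(1) by (simp add: abs_mult less_imp_le)
        qed
        then show "(\<lambda>n. d n * arctan (u x / d n) * frechet_derivative \<phi> (at x) b) \<longlonglongrightarrow> 0"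
          by (rule tendsto_mult_left_zero)
      qed
      show "AE x in lborel. norm (d n * arctan (u x / d n) * frechet_derivative \<phi> (at x) b)
          \<le> pi * norm (frechet_derivative \<phi> (at x) b)" for n
      proof (rule AE_I2)
        fix x
        have "\<bar>d n\<bar> * \<bar>arctan (u x / d n)\<bar> \<le> 1 * pi" using d[of n] by (intro mult_mono ab) auto
        then show "norm (d n * arctan (u x / d n) * frechet_derivative \<phi> (at x) b)
            \<le> pi * norm (frechet_derivative \<phi> (at x) b)"
          by (simp add: abs_mult mult_right_mono)
      qed
    qed (use i\<phi> in auto)
    moreover have "(\<lambda>n. LINT x|lborel. (G x \<bullet> b) * (1 / (1 + (u x / d n)\<^sup>2) * \<phi> x))
        \<longlonglongrightarrow> (LINT x|lborel. f x * \<phi> x)"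
    proof (rule integral_dominated_convergence[where w = "\<lambda>x. norm (G x \<bullet> b) * (1 * B)"])
      show "AE x in lborel. (\<lambda>n. (G x \<bullet> b) * (1 / (1 + (u x / d n)\<^sup>2) * \<phi> x)) \<longlonglongrightarrow> f x * \<phi> x"
      proof (rule AE_I2)
        fix x
        have "(\<lambda>n. 1 / (1 + (u x / d n)\<^sup>2)) \<longlonglongrightarrow> 0" if "u x \<noteq> 0"
        proof (rule Lim_null_comparison)
          show "(\<lambda>n. (d n / u x)\<^sup>2) \<longlonglongrightarrow> 0"
            using that by (auto intro!: tendsto_eq_intros d0)
          have "norm (1 / (1 + (u x / d n)\<^sup>2)) \<le> (d n / u x)\<^sup>2" for n
          proof -
            have "1 / (1 + (u x / d n)\<^sup>2) \<le> 1 / (u x / d n)\<^sup>2"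
              using that d(1)[of n] by (intro divide_left_mono) (auto simp: add_pos_pos)
            then show ?thesis by (simp add: power_divide)
          qed
          then show "\<forall>\<^sub>F n in sequentially. norm (1 / (1 + (u x / d n)\<^sup>2)) \<le> (d n / u x)\<^sup>2" by simp
        qed
        then have "(\<lambda>n. 1 / (1 + (u x / d n)\<^sup>2)) \<longlonglongrightarrow> (if u x = 0 then 1 else 0)" by auto
        then have "(\<lambda>n. (G x \<bullet> b) * (1 / (1 + (u x / d n)\<^sup>2) * \<phi> x)) \<longlonglongrightarrow> (G x \<bullet> b) * ((if u x
            = 0 then 1 else 0) * \<phi> x)"
          by (intro tendsto_intros)
        moreover have "(G x \<bullet> b) * ((if u x = 0 then 1 else 0) * \<phi> x) = f x * \<phi> x" by (simp add: f_def)
        ultimately show "(\<lambda>n. (G x \<bullet> b) * (1 / (1 + (u x / d n)\<^sup>2) * \<phi> x)) \<longlonglongrightarrow> f x * \<phi> x" by simp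
      qed
      show "AE x in lborel. norm ((G x \<bullet> b) * (1 / (1 + (u x / d n)\<^sup>2) * \<phi> x)) \<le> norm (G x \<bullet> b) * (1 * B)"
          for n
      proof (rule AE_I2)
        fix x
        have "\<bar>1 / (1 + (u x / d n)\<^sup>2)\<bar> * \<bar>\<phi> x\<bar> \<le> 1 * B"
          by (intro mult_mono B) (auto simp: add_pos_nonneg)
        then show "norm ((G x \<bullet> b) * (1 / (1 + (u x / d n)\<^sup>2) * \<phi> x)) \<le> norm (G x \<bullet> b) * (1 * B)"
          unfolding norm_mult by (intro mult_left_mono) (auto simp: abs_mult)
      qed
    qed (use G in auto)
    ultimately show ?thesis
      using chain[OF d(1) \<phi>] LIMSEQ_unique tendsto_minus by fastforce
  qed
  \<comment> \<open>All mollifications of f vanish, while they converge to f in L^1.\<close>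
  have "moll e f x = 0" if "0 < e" for e x
    using f0[OF mollifier_test_function[OF that, of x]] by (simp add: moll_def mult.commute)
  then have "(\<lambda>n::nat. LINT x|lborel. norm (f x)) \<longlonglongrightarrow> 0"
    using moll_L1_seq[OF f] by simp
  then have "(LINT x|lborel. norm (f x)) = 0" by (simp add: LIMSEQ_const_iff)
  then have "AE x in lborel. norm (f x) = 0"
    using f by (subst (asm) integral_nonneg_eq_0_iff_AE) auto
  then show "AE x in lborel. u x = 0 \<longrightarrow> G x \<bullet> b = 0"
    by eventually_elim (auto simp: f_def)
qed

section \<open>Compactness\<close>

text \<open>The argument of Arzela and Ascoli: a diagonal subsequence converges on a countable dense
  set for all scales at once, and the equi-Lipschitz bound carries convergence over to every
  point.\<close>

lemma moll_sequence_compact: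
  fixes u :: "nat \<Rightarrow> 'a::euclidean_space \<Rightarrow> real"
  assumes u: "\<And>n. integrable lborel (u n)" and C: "\<And>n. (LINT x|lborel. norm (u n x)) \<le> C"
  obtains s :: "nat \<Rightarrow> nat" where "strict_mono s"
    "\<And>k x. convergent (\<lambda>n. moll (1 / Suc k) (u (s n)) x)"
proof -
  have C0: "0 \<le> C" by (rule order_trans[OF _ C[of 0]]) (simp add: integral_nonneg_AE)
  obtain D :: "'a set" where D: "countable D" "\<And>X. open X \<Longrightarrow> X \<noteq> {} \<Longrightarrow> \<exists>d\<in>D. d \<in> X"
    using countable_dense_setE by blast
  define e where "e k = 1 / real (Suc k)" for k
  have e: "0 < e k" for k by (simp add: e_def)
  define c where "c k = mollifier_mass TYPE('a) (e k)" for k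
  have c: "0 < c k" for k unfolding c_def by (intro mollifier_mass_pos e)
  \<comment> \<open>The mollification at scale \<open>e k\<close> is bounded by C / c k, which
    depends on k; the factor c k gives the bound C for all scales, as the diagonal argument asks for
    a single bound.\<close>
  define f where "f n = (\<lambda>(x, k). c k * moll (e k) (u n) x)" for n
  have bd: "norm (f n z) \<le> C" if "z \<in> D \<times> UNIV" for n z
  proof -
    obtain x k where z: "z = (x, k)" by (cases z)
    have "norm (moll (e k) (u n) x) \<le> 1 / c k * (LINT y|lborel. norm (u n y))"
      using moll_bounded[OF u e[of k], of n x] c[of k] unfolding c_def by simp
    also have "\<dots> \<le> 1 / c k * C" using c[of k] by (intro mult_left_mono C) auto
    finally show ?thesis using c[of k] by (simp add: z f_def abs_mult field_simps)
  qed
  obtain s :: "nat \<Rightarrow> nat" where s: "strict_mono s" "\<And>z. z \<in> D \<times> UNIV \<Longrightarrow> \<exists>l. (\<lambda>n. f (s n) z) \<longlonglongrightarrow> l"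
    using function_convergent_subsequence[of "D \<times> (UNIV :: nat set)" f C] D(1) bd by auto
  have convD: "Cauchy (\<lambda>n. moll (e k) (u (s n)) x)" if x: "x \<in> D" for k x
  proof -
    obtain l where "(\<lambda>n. f (s n) (x, k)) \<longlonglongrightarrow> l" using s(2)[of "(x, k)"] x by auto
    then have "(\<lambda>n. f (s n) (x, k) / c k) \<longlonglongrightarrow> l / c k" using c[of k] by (intro tendsto_intros) auto
    then show ?thesis using c[of k] by (auto simp: f_def intro: LIMSEQ_imp_Cauchy)
  qed
  have "Cauchy (\<lambda>n. moll (e k) (u (s n)) x)" for k x
  proof (rule metric_CauchyI)
    fix \<epsilon> :: real assume "0 < \<epsilon>"
    define L where "L = \<bar>mollifier_lip TYPE('a) (e k)\<bar> * C + 1"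
    have L: "0 < L" using C0 by (simp add: L_def add_nonneg_pos)
    have "0 < \<epsilon> / (4 * L)" using \<open>0 < \<epsilon>\<close> L by simp
    then have "ball x (\<epsilon> / (4 * L)) \<noteq> {}" by (simp only: ball_eq_empty not_le)
    then obtain d where d: "d \<in> D" "d \<in> ball x (\<epsilon> / (4 * L))"
      using D(2)[OF open_ball] by blast
    have lip: "dist (moll (e k) (u n) x) (moll (e k) (u n) d) \<le> \<epsilon> / 4" for n
    proof -
      have "norm (moll (e k) (u n) x - moll (e k) (u n) d) \<le> mollifier_lip TYPE('a) (e k) * norm (x - d) *
          (LINT y|lborel. norm (u n y))"
        by (rule moll_Lipschitz[OF u e])
      also have "\<dots> \<le> \<bar>mollifier_lip TYPE('a) (e k)\<bar> * norm (x - d) * C"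
        using C0 C[of n] by (intro mult_mono) (auto simp: integral_nonneg_AE)
      also have "\<dots> \<le> L * norm (x - d)" by (simp add: L_def algebra_simps)
      also have "\<dots> \<le> L * (\<epsilon> / (4 * L))" using d(2) L by (intro mult_left_mono) (auto simp: dist_norm)
      finally show ?thesis using L by (simp add: dist_norm)
    qed
    obtain M where M: "\<And>m n. m \<ge> M \<Longrightarrow> n \<ge> M \<Longrightarrow> dist (moll (e k) (u (s m)) d) (moll (e k) (u (s n)) d) < \<epsilon> / 4"
      using metric_CauchyD[OF convD[OF d(1), of k], of "\<epsilon> / 4"] \<open>0 < \<epsilon>\<close> by auto
    have "dist (moll (e k) (u (s m)) x) (moll (e k) (u (s n)) x) < \<epsilon>" if "m \<ge> M" "n \<ge> M" for m n
      using M[OF that] lip[of "s m"] lip[of "s n"] \<open>0 < \<epsilon>\<close> unfolding dist_real_def by linarith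
    then show "\<exists>M. \<forall>m\<ge>M. \<forall>n\<ge>M. dist (moll (e k) (u (s m)) x) (moll (e k) (u (s n)) x) < \<epsilon>" by blast
  qed
  then have "convergent (\<lambda>n. moll (1 / Suc k) (u (s n)) x)" for k x
    by (simp add: real_Cauchy_convergent e_def)
  then show ?thesis using s(1) that by blast
qed

text \<open>Rellich's theorem. At a fixed scale the mollifications converge in L^1, being uniformly
  bounded with a common compact support, and the mollification error is at most the scale times the
  gradient bound, uniformly in n.\<close>

theorem gradient_bounded_compact:
  fixes u :: "nat \<Rightarrow> 'a::euclidean_space \<Rightarrow> real"
  assumes uG: "\<And>n. grad_lborel (u n) (G n)"
    and supp: "\<And>n x. R < norm x \<Longrightarrow> u n x = 0"
    and C: "\<And>n. (LINT x|lborel. norm (u n x)) \<le> C" "\<And>n. (LINT x|lborel. norm (G n x)) \<le> C"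
  obtains s :: "nat \<Rightarrow> nat" where "strict_mono s" "AE x in lborel. convergent (\<lambda>n. u (s n) x)"
    "\<And>\<epsilon>. 0 < \<epsilon> \<Longrightarrow> \<exists>M. \<forall>i\<ge>M. \<forall>j\<ge>M. (LINT x|lborel. norm (u (s i) x - u (s j) x)) < \<epsilon>"
proof -
  note u = grad_lborelD(1)[OF uG]
  have C0: "0 \<le> C" by (rule order_trans[OF _ C(1)[of 0]]) (simp add: integral_nonneg_AE)
  obtain s :: "nat \<Rightarrow> nat" where s: "strict_mono s" "\<And>k x. convergent (\<lambda>n. moll (1 / Suc k) (u (s n)) x)"
    by (rule moll_sequence_compact[where u = u and C = C, OF u C(1)]) blast
  have L1: "\<exists>M. \<forall>i\<ge>M. \<forall>j\<ge>M. (LINT x|lborel. norm (u (s i) x - u (s j) x)) < \<epsilon>" if "0 < \<epsilon>" for \<epsilon>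
  proof -
    \<comment> \<open>The distance of two terms is split into four parts, each at most \<epsilon> /
      8. The summand 1 in C + 1 guards against C = 0.\<close>
    obtain k where k: "1 / real (Suc k) < \<epsilon> / (8 * (C + 1))"
      using reals_Archimedean[of "\<epsilon> / (8 * (C + 1))"] \<open>0 < \<epsilon>\<close> C0 by (auto simp: inverse_eq_divide)
    define e where "e = 1 / real (Suc k)"
    have e: "0 < e" "e \<le> 1" by (auto simp: e_def)
    have eC: "e * C \<le> \<epsilon> / 8"
    proof -
      have "e * C \<le> \<epsilon> / (8 * (C + 1)) * C" using k C0 unfolding e_def by (intro mult_right_mono) auto
      also have "\<dots> \<le> \<epsilon> / 8" using C0 \<open>0 < \<epsilon>\<close> by (simp add: field_simps)
      finally show ?thesis .
    qed
    define w where "w n = moll e (u (s n))" for n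
    define l where "l x = lim (\<lambda>n. w n x)" for x
    have wl: "(\<lambda>n. w n x) \<longlonglongrightarrow> l x" for x
      using s(2)[of k x] unfolding l_def w_def e_def by (simp add: convergent_LIMSEQ_iff)
    have wint: "integrable lborel (w n)" for n unfolding w_def by (rule moll_integrable[OF u e(1)])
    have [measurable]: "w n \<in> borel_measurable lborel" for n using wint
        by (rule borel_measurable_integrable)
    have [measurable]: "l \<in> borel_measurable lborel" by (rule borel_measurable_LIMSEQ_real[OF wl])
        measurable
    define B where "B = 1 / \<bar>mollifier_mass TYPE('a) e\<bar> * C"
    have wB: "\<bar>w n x\<bar> \<le> indicator (cball 0 (R + 1)) x * B" for n x
    proof (cases "norm x \<le> R + 1")
      case True
      have "norm (w n x) \<le> 1 / \<bar>mollifier_mass TYPE('a) e\<bar> * (LINT y|lborel. norm (u (s n) y))"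
        unfolding w_def by (rule moll_bounded[OF u e(1)])
      also have "\<dots> \<le> B" unfolding B_def by (intro mult_left_mono C) auto
      finally show ?thesis using True by simp
    next
      case False
      then have "w n x = 0" unfolding w_def using e by (intro moll_eq_0[OF u e(1) supp]) auto
      then show ?thesis using False by simp
    qed
    have lB: "\<bar>l x\<bar> \<le> indicator (cball 0 (R + 1)) x * B" for x
      by (rule LIMSEQ_le_const2[OF tendsto_rabs[OF wl]]) (use wB in auto)
    have ib: "integrable lborel (\<lambda>x::'a. indicator (cball 0 (R + 1)) x * B)"
      by (intro integrable_mult_left integrable_real_indicator) (auto simp:
          emeasure_lborel_cball_finite[unfolded infinity_ennreal_def])
    have lint: "integrable lborel l"
      by (rule Bochner_Integration.integrable_bound[OF ib]) (use lB in \<open>auto intro!: AE_I2 intro: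
          order_trans[OF _ abs_ge_self]\<close>)
    have "(\<lambda>n. LINT x|lborel. norm (w n x - l x)) \<longlonglongrightarrow> (LINT x|(lborel :: 'a measure). (0::real))"
    proof (rule integral_dominated_convergence[where w = "\<lambda>x. 2 * (indicator (cball 0 (R + 1)) x * B)"])
      show "AE x in lborel. (\<lambda>n. norm (w n x - l x)) \<longlonglongrightarrow> 0"
        using wl by (intro AE_I2 tendsto_norm_zero) (simp add: LIM_zero_iff)
      show "AE x in lborel. norm (norm (w n x - l x)) \<le> 2 * (indicator (cball 0 (R + 1)) x * B)" for n
      proof (rule AE_I2)
        fix x
        show "norm (norm (w n x - l x)) \<le> 2 * (indicator (cball 0 (R + 1)) x * B)"
          using wB[of n x] lB[of x] unfolding real_norm_def by linarith
      qed
    qed (use ib in auto)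
    then have "\<forall>\<^sub>F n in sequentially. (LINT x|lborel. norm (w n x - l x)) < \<epsilon> / 8"
      using \<open>0 < \<epsilon>\<close> by (intro order_tendstoD) auto
    then obtain M where M: "\<And>n. n \<ge> M \<Longrightarrow> (LINT x|lborel. norm (w n x - l x)) < \<epsilon> / 8"
      by (auto simp: eventually_sequentially)
    have wu: "(LINT x|lborel. norm (w n x - u (s n) x)) \<le> \<epsilon> / 8" for n
    proof -
      have "(LINT x|lborel. norm (w n x - u (s n) x)) \<le> e * (LINT x|lborel. norm (G (s n) x))"
        unfolding w_def by (rule moll_L1_gradient_le[OF uG e(1)])
      also have "\<dots> \<le> e * C" using e by (intro mult_left_mono C) auto
      finally show ?thesis using eC by linarith
    qed
    have "(LINT x|lborel. norm (u (s i) x - u (s j) x)) < \<epsilon>" if "i \<ge> M" "j \<ge> M" for i j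
    proof -
      note i1 = integrable_norm[OF Bochner_Integration.integrable_diff[OF wint u]]
        and i2 = integrable_norm[OF Bochner_Integration.integrable_diff[OF wint lint]]
      have "(LINT x|lborel. norm (u (s i) x - u (s j) x)) \<le>
        (LINT x|lborel. (norm (w i x - u (s i) x) + norm (w i x - l x)) + (norm (w j x - u (s j) x)
            + norm (w j x - l x)))"
      proof (intro integral_mono integrable_norm Bochner_Integration.integrable_diff
          Bochner_Integration.integrable_add u wint lint)
        show "norm (u (s i) x - u (s j) x) \<le> (norm (w i x - u (s i) x) + norm (w i x - l x))
            + (norm (w j x - u (s j) x) + norm (w j x - l x))" for x
          unfolding real_norm_def by linarith
      qed
      also have "\<dots> = ((LINT x|lborel. norm (w i x - u (s i) x)) + (LINT x|lborel. norm (w i x - l x))) +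
          ((LINT x|lborel. norm (w j x - u (s j) x)) + (LINT x|lborel. norm (w j x - l x)))"
        by (simp only: Bochner_Integration.integral_add Bochner_Integration.integrable_add i1 i2)
      also have "\<dots> < \<epsilon>" using wu[of i] wu[of j] M[OF that(1)] M[OF that(2)] \<open>0 < \<epsilon>\<close> by linarith
      finally show ?thesis .
    qed
    then show ?thesis by blast
  qed
  obtain r :: "nat \<Rightarrow> nat" where r: "strict_mono r" "AE x in lborel. Cauchy (\<lambda>i. u (s (r i)) x)"
    using cauchy_L1_AE_cauchy_subseq[of lborel "\<lambda>n. u (s n)"] u L1 by auto
  have "AE x in lborel. convergent (\<lambda>n. u ((s \<circ> r) n) x)"
    using r(2) by eventually_elim (simp add: real_Cauchy_convergent)
  moreover have "\<exists>M. \<forall>i\<ge>M. \<forall>j\<ge>M. (LINT x|lborel. norm (u ((s \<circ> r) i) x - u ((s \<circ> r) j) x)) < \<epsilon>"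
      if \<epsilon>: "0 < \<epsilon>" for \<epsilon>
  proof -
    obtain N where N: "\<And>i j. i \<ge> N \<Longrightarrow> j \<ge> N \<Longrightarrow> (LINT x|lborel. norm (u (s i) x - u (s j) x)) < \<epsilon>"
      using L1[OF \<epsilon>] by blast
    show ?thesis
    proof (intro exI[of _ N] allI impI)
      fix i j assume "N \<le> i" "N \<le> j"
      then have "N \<le> r i" "N \<le> r j" using seq_suble[OF r(1)] order_trans by blast+
      then show "(LINT x|lborel. norm (u ((s \<circ> r) i) x - u ((s \<circ> r) j) x)) < \<epsilon>"
        using N by simp
    qed
  qed
  moreover have "strict_mono (s \<circ> r)" using s(1) r(1) by (rule strict_mono_o)
  ultimately show ?thesis using that by blast
qed

section \<open>Integrals of \<open>p\<close>-th powers\<close>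

text \<open>At an argument 0 the claim reduces to c^p <= c for c between 0 and 1; for positive
  arguments it is the convexity of t^p.\<close>

lemma powr_convex_le:
  fixes p x y c :: real
  assumes p: "1 \<le> p" and "0 \<le> x" "0 \<le> y" "0 < c" "c < 1"
  shows "((1 - c) * x + c * y) powr p \<le> (1 - c) * x powr p + c * y powr p"
proof -
  have le: "a powr p \<le> a" if "0 < a" "a < 1" for a :: real
    using powr_mono'[of 1 p a] that p by simp
  consider "x = 0" | "y = 0" | "0 < x" "0 < y" using assms by fastforce
  then show ?thesis
  proof cases
    case 1
    then show ?thesis using le[of c] assms by (simp add: powr_mult mult_right_mono)
  next
    case 2
    then show ?thesis using le[of "1 - c"] assms by (simp add: powr_mult mult_right_mono)
  next
    case 3
    then show ?thesis using convex_onD[OF powr_convex[OF p], of c x y] assms by simp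
  qed
qed

lemma powr_superadditive:
  assumes "1 \<le> p" "0 \<le> x" "0 \<le> (y::real)"
  shows "x powr p + y powr p \<le> (x + y) powr p"
proof -
  have *: "a powr p = a * a powr (p - 1)" if "0 \<le> a" for a :: real
    using that by (cases "a = 0") (auto simp: powr_diff)
  have "x powr p + y powr p = x * x powr (p - 1) + y * y powr (p - 1)" using assms * by simp
  also have "\<dots> \<le> x * (x + y) powr (p - 1) + y * (x + y) powr (p - 1)"
    using assms by (intro add_mono mult_left_mono powr_mono2) auto
  also have "\<dots> = (x + y) powr p" using assms *[of "x + y"] by (simp add: distrib_right)
  finally show ?thesis .
qed

text \<open>The parallelogram law links two properties of t^(p/2) valid for p >= 2: superadditivity,
  applied to the squares on the left, and convexity, applied to the mean of the squares on the
  right. Stated for inner product spaces, it serves both the gradient and the scalar difference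
  quotient.\<close>

lemma norm_powr_Clarkson:
  fixes a b :: "'b::real_inner"
  assumes p: "2 \<le> p"
  shows "norm ((1/2) *\<^sub>R (a + b)) powr p + norm ((1/2) *\<^sub>R (a - b)) powr p \<le> (norm a powr p
      + norm b powr p) / 2"
proof -
  have sq: "(t\<^sup>2) powr (p / 2) = t powr p" if "0 \<le> t" for t :: real
    using that by (cases "t = 0") (auto simp: powr_powr simp flip: powr_numeral)
  let ?x = "norm ((1/2) *\<^sub>R (a + b))" and ?y = "norm ((1/2) *\<^sub>R (a - b))"
  have "?x powr p + ?y powr p = (?x\<^sup>2) powr (p / 2) + (?y\<^sup>2) powr (p / 2)" by (simp only: sq norm_ge_zero)
  also have "\<dots> \<le> (?x\<^sup>2 + ?y\<^sup>2) powr (p / 2)" using p by (intro powr_superadditive) auto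
  also have "?x\<^sup>2 + ?y\<^sup>2 = (1 - 1/2) * (norm a)\<^sup>2 + 1/2 * (norm b)\<^sup>2"
    by (simp add: power2_norm_eq_inner inner_add inner_diff inner_commute algebra_simps power_mult_distrib
        power_divide)
  also have "\<dots> powr (p / 2) \<le> (1 - 1/2) * ((norm a)\<^sup>2) powr (p / 2) + 1/2 * ((norm b)\<^sup>2) powr (p / 2)"
    using p by (intro powr_convex_le) auto
  also have "\<dots> = (norm a powr p + norm b powr p) / 2" by (simp add: sq)
  finally show ?thesis .
qed

text \<open>Takes the place of the triangle inequality for powers of norms. The weight c stays free
  because the first factor tends to 1 as c tends to 0.\<close>

lemma norm_powr_add_le:
  fixes a b :: "'b::real_normed_vector"
  assumes p: "1 \<le> p" and c: "0 < c" "c < 1"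
  shows "norm (a + b) powr p \<le> (1 - c) powr (1 - p) * norm a powr p + c powr (1 - p) * norm b powr p"
proof -
  have "norm (a + b) powr p \<le> ((1 - c) * (norm a / (1 - c)) + c * (norm b / c)) powr p"
    using p c norm_triangle_ineq[of a b] by (intro powr_mono2) auto
  also have "\<dots> \<le> (1 - c) * (norm a / (1 - c)) powr p + c * (norm b / c) powr p"
    using p c by (intro powr_convex_le) auto
  also have "\<dots> = (1 - c) powr (1 - p) * norm a powr p + c powr (1 - p) * norm b powr p"
    using c by (simp add: powr_divide powr_diff field_simps)
  finally show ?thesis .
qed

lemma norm_powr_add_le2:
  fixes a b :: "'b::real_normed_vector"
  assumes "1 \<le> p"
  shows "norm (a + b) powr p \<le> 2 powr p * (norm a powr p + norm b powr p)"
proof -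
  have "norm (a + b) powr p \<le> (1/2) powr (1 - p) * norm a powr p + (1/2) powr (1 - p) * norm b powr p"
    using norm_powr_add_le[OF assms, of "1/2" a b] by simp
  also have "(1/2::real) powr (1 - p) = 2 powr (p - 1)" by (simp add: powr_divide powr_diff)
  also have "2 powr (p - 1) * norm a powr p + 2 powr (p - 1) * norm b powr p \<le> 2 powr p * norm a powr p
      + 2 powr p * norm b powr p"
    by (intro add_mono mult_right_mono powr_mono) auto
  finally show ?thesis by (simp add: distrib_left)
qed

lemma norm_powr_has_derivative:
  fixes a b :: "'b::real_inner"
  assumes p: "1 < p"
  shows "((\<lambda>t. norm (a + t *\<^sub>R b) powr p) has_real_derivative
    p * norm (a + t *\<^sub>R b) powr (p - 2) * ((a + t *\<^sub>R b) \<bullet> b)) (at t)"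
proof (cases "a + t *\<^sub>R b = 0")
  case False
  define y where "y = a + t *\<^sub>R b"
  have y: "norm y > 0" using False by (simp add: y_def)
  have l: "((\<lambda>t. a + t *\<^sub>R b) has_derivative (\<lambda>h. h *\<^sub>R b)) (at t)" by (auto intro!: derivative_eq_intros)
  have "(norm has_derivative (\<lambda>h. h \<bullet> sgn y)) (at y)" using y by (intro has_derivative_norm) auto
  from has_derivative_compose[OF l this[unfolded y_def]]
  have "((\<lambda>t. norm (a + t *\<^sub>R b)) has_real_derivative (b \<bullet> sgn y)) (at t)"
    unfolding has_field_derivative_def y_def by (rule has_derivative_eq_rhs) (auto simp: fun_eq_iff)
  from DERIV_powr[OF this _ DERIV_const[of p]] y
  have "((\<lambda>t. norm (a + t *\<^sub>R b) powr p) has_real_derivative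
     (norm y powr p * (0 * ln (norm y) + b \<bullet> sgn y * p / norm y))) (at t)"
    by (simp add: y_def)
  moreover have "norm y powr p * (0 * ln (norm y) + b \<bullet> sgn y * p / norm y)
      = p * norm y powr (p - 2) * (y \<bullet> b)"
    using y by (simp add: sgn_div_norm powr_diff inner_commute power2_eq_square field_simps)
  ultimately show ?thesis by (simp add: y_def)
next
  case True
  have *: "a + (t + h) *\<^sub>R b = h *\<^sub>R b" for h
    using True by (metis add.assoc add_cancel_left_left scaleR_left_distrib)
  have "(\<lambda>h. (norm (a + (t + h) *\<^sub>R b) powr p - norm (a + t *\<^sub>R b) powr p) / h) \<midarrow>0\<rightarrow> 0"
  proof (rule Lim_null_comparison)
    have "(\<lambda>h::real. \<bar>h\<bar> powr (p - 1)) \<midarrow>0\<rightarrow> 0"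
      using p by (intro tendsto_zero_powrI[where b = "p - 1"] tendsto_eq_intros refl) auto
    then show "(\<lambda>h::real. \<bar>h\<bar> powr (p - 1) * norm b powr p) \<midarrow>0\<rightarrow> 0"
      by (rule tendsto_mult_left_zero)
    have "norm ((norm (a + (t + h) *\<^sub>R b) powr p - norm (a + t *\<^sub>R b) powr p) / h)
        \<le> \<bar>h\<bar> powr (p - 1) * norm b powr p" for h
      unfolding * True by (cases "h = 0") (auto simp: powr_mult powr_diff)
    then show "\<forall>\<^sub>F h in at 0. norm ((norm (a + (t + h) *\<^sub>R b) powr p - norm (a + t *\<^sub>R b) powr p) / h)
        \<le> \<bar>h\<bar> powr (p - 1) * norm b powr p"
      by simp
  qed
  then show ?thesis using True by (simp add: DERIV_def)
qed

text \<open>The mean value inequality turns the bound on the derivatives into a majorant of the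
  difference quotients, and dominated convergence applies.\<close>

theorem has_derivative_integral_at_0:
  fixes F :: "real \<Rightarrow> 'a \<Rightarrow> real"
  assumes int: "\<And>t. \<bar>t\<bar> < 1 \<Longrightarrow> integrable M (F t)" and B: "integrable M B"
    and meas: "F' 0 \<in> borel_measurable M"
    and D: "AE x in M. \<forall>t. \<bar>t\<bar> < 1 \<longrightarrow> ((\<lambda>t. F t x) has_real_derivative F' t x) (at t) \<and> \<bar>F' t x\<bar> \<le> B x"
  shows "integrable M (F' 0)" "((\<lambda>t. LINT x|M. F t x) has_real_derivative (LINT x|M. F' 0 x)) (at 0)"
proof -
  show "integrable M (F' 0)"
  proof (rule Bochner_Integration.integrable_bound[OF B meas])
    show "AE x in M. norm (F' 0 x) \<le> norm (B x)"
      using D by eventually_elim (auto dest!: spec[of _ 0])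
  qed
  have "(\<lambda>h. ((LINT x|M. F (0 + h) x) - (LINT x|M. F 0 x)) / h) \<midarrow>0\<rightarrow> (LINT x|M. F' 0 x)"
    unfolding tendsto_at_iff_sequentially
  proof safe
    fix X :: "nat \<Rightarrow> real" assume X0: "\<forall>i. X i \<in> UNIV - {0}" and X: "X \<longlonglongrightarrow> 0"
    have "\<forall>\<^sub>F n in sequentially. \<bar>X n\<bar> < 1"
      using order_tendstoD(2)[OF tendsto_rabs_zero[OF X], of 1] by simp
    then obtain K where K: "\<And>n. n \<ge> K \<Longrightarrow> \<bar>X n\<bar> < 1" by (auto simp: eventually_sequentially)
    \<comment> \<open>A tail of the sequence, because integrability and the majorant are assumed for
      |t| < 1 only.\<close>
    define Y where "Y n = X (n + K)" for n
    have Y: "\<bar>Y n\<bar> < 1" "Y n \<noteq> 0" for n using K X0 by (auto simp: Y_def)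
    have YL: "Y \<longlonglongrightarrow> 0" using LIMSEQ_ignore_initial_segment[OF X, of K] by (simp add: Y_def[abs_def])
    have "(\<lambda>n. LINT x|M. (F (Y n) x - F 0 x) / Y n) \<longlonglongrightarrow> (LINT x|M. F' 0 x)"
    proof (rule integral_dominated_convergence[OF meas _ B])
      show "(\<lambda>x. (F (Y n) x - F 0 x) / Y n) \<in> borel_measurable M" for n
        using int[OF Y(1)[of n]] int[of 0] by (intro borel_measurable_divide borel_measurable_diff
            borel_measurable_integrable) auto
      show "AE x in M. (\<lambda>n. (F (Y n) x - F 0 x) / Y n) \<longlonglongrightarrow> F' 0 x" using D
      proof eventually_elim
        case (elim x)
        then have "((\<lambda>t. F t x) has_real_derivative F' 0 x) (at 0)" by (auto dest!: spec[of _ 0])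
        then have "(\<lambda>h. (F (0 + h) x - F 0 x) / h) \<midarrow>0\<rightarrow> F' 0 x" unfolding DERIV_def .
        then have "((\<lambda>h. (F (0 + h) x - F 0 x) / h) \<circ> Y) \<longlonglongrightarrow> F' 0 x"
          using Y(2) YL unfolding tendsto_at_iff_sequentially by auto
        then show ?case by (simp add: o_def)
      qed
      show "AE x in M. norm ((F (Y n) x - F 0 x) / Y n) \<le> B x" for n using D
      proof eventually_elim
        case (elim x)
        have "norm (F (Y n) x - F 0 x) \<le> B x * norm (Y n - 0)"
        proof (rule field_differentiable_bound[of "{-1<..<1}" "\<lambda>t. F t x" "\<lambda>t. F' t x" "B x"])
          show "((\<lambda>t. F t x) has_field_derivative F' t x) (at t within {-1<..<1})" if "t \<in> {-1<..<1}" for t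
            using elim that by (auto intro: has_field_derivative_at_within)
          show "norm (F' t x) \<le> B x" if "t \<in> {-1<..<1}" for t
            using elim that by auto
        qed (use Y(1)[of n] in auto)
        then show ?case using Y(2)[of n] by (simp add: divide_simps)
      qed
    qed
    moreover have "(LINT x|M. (F (Y n) x - F 0 x) / Y n) = ((LINT x|M. F (Y n) x) - (LINT x|M. F 0 x)) / Y
        n" for n
      using int[OF Y(1)[of n]] int[of 0] by simp
    ultimately have "(\<lambda>n. ((LINT x|M. F (X (n + K)) x) - (LINT x|M. F 0 x)) / X (n + K))
        \<longlonglongrightarrow> (LINT x|M. F' 0 x)"
      unfolding Y_def by (simp only:)
    then show "((\<lambda>h. ((LINT x|M. F (0 + h) x) - (LINT x|M. F 0 x)) / h) \<circ> X) \<longlonglongrightarrow> (LINT x|M. F' 0 x)"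
      unfolding o_def by (simp add: LIMSEQ_offset[where k = K])
  qed
  then show "((\<lambda>t. LINT x|M. F t x) has_real_derivative (LINT x|M. F' 0 x)) (at 0)"
    unfolding DERIV_def .
qed

section \<open>Calculus of integrals of p-th powers\<close>

definition Lp :: "'a measure \<Rightarrow> real \<Rightarrow> ('a \<Rightarrow> 'b::euclidean_space) \<Rightarrow> bool" where
  "Lp M p f \<longleftrightarrow> f \<in> borel_measurable M \<and> integrable M (\<lambda>x. norm (f x) powr p)"

text \<open>No p-th root is taken, because \<open>X_norm\<close> is built from the sum of two such
  integrals.\<close>

definition Lp_int :: "'a measure \<Rightarrow> real \<Rightarrow> ('a \<Rightarrow> 'b::euclidean_space) \<Rightarrow> real" where
  "Lp_int M p f = (LINT x|M. norm (f x) powr p)"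

lemma Lp_int_nonneg: "0 \<le> Lp_int M p f"
  unfolding Lp_int_def by (intro integral_nonneg_AE) auto

lemma Lp_scaleR: "Lp M p f \<Longrightarrow> Lp M p (\<lambda>x. c *\<^sub>R f x)"
  unfolding Lp_def by (auto simp: powr_mult)

lemma Lp_int_scaleR: "Lp_int M p (\<lambda>x. c *\<^sub>R f x) = \<bar>c\<bar> powr p * Lp_int M p f"
  by (simp add: Lp_int_def powr_mult)

lemma Lp_add:
  assumes "1 \<le> p" "Lp M p f" "Lp M p g"
  shows "Lp M p (\<lambda>x. f x + g x)"
  unfolding Lp_def
proof
  have m: "f \<in> borel_measurable M" "g \<in> borel_measurable M" using assms by (auto simp: Lp_def)
  note [measurable] = m
  show "(\<lambda>x. f x + g x) \<in> borel_measurable M" by measurable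
  show "integrable M (\<lambda>x. norm (f x + g x) powr p)"
  proof (rule Bochner_Integration.integrable_bound[where f = "\<lambda>x. 2 powr p * (norm (f x) powr p
      + norm (g x) powr p)"])
    show "AE x in M. norm (norm (f x + g x) powr p) \<le> norm (2 powr p * (norm (f x) powr p
        + norm (g x) powr p))"
      using norm_powr_add_le2[OF assms(1)] by (intro AE_I2) (simp add: abs_mult)
  qed (use assms in \<open>auto simp: Lp_def\<close>)
qed

lemma Lp_diff:
  assumes "1 \<le> p" "Lp M p f" "Lp M p g"
  shows "Lp M p (\<lambda>x. f x - g x)"
  using Lp_add[OF assms(1,2) Lp_scaleR[OF assms(3), of "-1"]] by simp

lemma Lp_int_Clarkson:
  assumes "2 \<le> p" "Lp M p f" "Lp M p g"
  shows "Lp_int M p (\<lambda>x. (1/2) *\<^sub>R (f x + g x)) + Lp_int M p (\<lambda>x. (1/2) *\<^sub>R (f x - g x)) \<le> (Lp_int M p f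
      + Lp_int M p g) / 2"
proof -
  have p: "1 \<le> p" using assms by simp
  have i: "integrable M (\<lambda>x. norm ((1/2) *\<^sub>R (f x + g x)) powr p)" "integrable M (\<lambda>x. norm ((1/2) *\<^sub>R (f x -
      g x)) powr p)"
    using Lp_scaleR[OF Lp_add[OF p assms(2,3)], of "1/2"] Lp_scaleR[OF Lp_diff[OF p assms(2,3)], of "1/2"]
        by (auto simp only: Lp_def)
  have j: "integrable M (\<lambda>x. norm (f x) powr p)" "integrable M (\<lambda>x. norm (g x) powr p)" using assms
      by (auto simp: Lp_def)
  have "Lp_int M p (\<lambda>x. (1/2) *\<^sub>R (f x + g x)) + Lp_int M p (\<lambda>x. (1/2) *\<^sub>R (f x - g x)) =
    (LINT x|M. norm ((1/2) *\<^sub>R (f x + g x)) powr p + norm ((1/2) *\<^sub>R (f x - g x)) powr p)"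
    unfolding Lp_int_def by (rule Bochner_Integration.integral_add[OF i, symmetric])
  also have "\<dots> \<le> (LINT x|M. (norm (f x) powr p + norm (g x) powr p) / 2)"
    by (intro integral_mono Bochner_Integration.integrable_add i integrable_divide j norm_powr_Clarkson
        assms(1))
  also have "\<dots> = (Lp_int M p f + Lp_int M p g) / 2" using j by (simp add: Lp_int_def)
  finally show ?thesis .
qed

lemma Lp_int_add_le:
  assumes "1 \<le> p" "Lp M p f" "Lp M p g" "0 < c" "c < 1"
  shows "Lp_int M p (\<lambda>x. f x + g x) \<le> (1 - c) powr (1 - p) * Lp_int M p f + c powr (1 - p) * Lp_int M p g"
proof -
  have j: "integrable M (\<lambda>x. norm (f x) powr p)" "integrable M (\<lambda>x. norm (g x) powr p)" using assms
      by (auto simp: Lp_def)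
  have "Lp_int M p (\<lambda>x. f x + g x) \<le> (LINT x|M. (1 - c) powr (1 - p) * norm (f x) powr p
      + c powr (1 - p) * norm (g x) powr p)"
    unfolding Lp_int_def using Lp_add[OF assms(1-3)] j
    by (intro integral_mono norm_powr_add_le assms) (auto simp: Lp_def)
  also have "\<dots> = (1 - c) powr (1 - p) * Lp_int M p f + c powr (1 - p) * Lp_int M p g" using j
      by (simp add: Lp_int_def)
  finally show ?thesis .
qed

lemma Lp_int_has_derivative:
  assumes p: "1 < p" and f: "Lp M p f" and g: "Lp M p g"
  shows "((\<lambda>t. Lp_int M p (\<lambda>x. f x + t *\<^sub>R g x)) has_real_derivative
    p * (LINT x|M. norm (f x) powr (p - 2) * (f x \<bullet> g x))) (at 0)"
proof -
  note [measurable] = f[unfolded Lp_def, THEN conjunct1] g[unfolded Lp_def, THEN conjunct1]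
  define F where "F t x = norm (f x + t *\<^sub>R g x) powr p" for t x
  define F' where "F' t x = p * norm (f x + t *\<^sub>R g x) powr (p - 2) * ((f x + t *\<^sub>R g x) \<bullet> g x)" for t x
  \<comment> \<open>Cauchy-Schwarz bounds the derivative by p * m^p with m = |f x| + |g x|, for all
    |t| < 1 at once; the factor 2^p separates the two summands of m.\<close>
  define B where "B x = p * (2 powr p * (norm (f x) powr p + norm (g x) powr p))" for x
  have B: "integrable M B" unfolding B_def using f g by (simp add: Lp_def)
  have b: "\<bar>F' t x\<bar> \<le> B x" if "\<bar>t\<bar> < 1" for t x
  proof -
    let ?y = "f x + t *\<^sub>R g x" and ?m = "norm (f x) + norm (g x)"
    have y: "norm ?y \<le> ?m"
    proof -
      have "norm (t *\<^sub>R g x) \<le> norm (g x)" using that by (simp add: mult_left_le_one_le)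
      then show ?thesis using norm_triangle_ineq[of "f x" "t *\<^sub>R g x"] by linarith
    qed
    have "\<bar>F' t x\<bar> \<le> p * norm ?y powr (p - 2) * (norm ?y * norm (g x))"
      unfolding F'_def using p by (simp add: abs_mult mult_left_mono Cauchy_Schwarz_ineq2)
    also have "\<dots> = p * (norm ?y powr (p - 1) * norm (g x))"
      using abs_powr_minus_two[of "norm ?y" p] by simp
    also have "\<dots> \<le> p * (?m powr (p - 1) * ?m)"
      using p y by (intro mult_left_mono mult_mono powr_mono2) auto
    also have "?m powr (p - 1) * ?m = ?m powr p"
      by (cases "?m = 0") (auto simp: powr_diff)
    also have "?m powr p \<le> 2 powr p * (norm (f x) powr p + norm (g x) powr p)"
      using norm_powr_add_le2[of p "norm (f x)" "norm (g x)"] p by simp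
    finally show ?thesis using p by (simp add: B_def mult_left_mono)
  qed
  have D: "((\<lambda>t. F t x) has_real_derivative F' t x) (at t)" for t x
    unfolding F_def F'_def by (rule norm_powr_has_derivative[OF p])
  have "((\<lambda>t. LINT x|M. F t x) has_real_derivative (LINT x|M. F' 0 x)) (at 0)"
  proof (rule has_derivative_integral_at_0[OF _ B])
    show "integrable M (F t)" for t
      using Lp_add[OF _ f Lp_scaleR[OF g, of t]] p by (simp add: F_def[abs_def] Lp_def)
    show "F' 0 \<in> borel_measurable M" unfolding F'_def[abs_def] by measurable
  qed (use D b in auto)
  then show ?thesis by (simp add: F_def F'_def Lp_int_def mult.assoc)
qed

text \<open>The bound is asked for eventually only, which fits sequences of differences u i - u j
  with i fixed and j large; the limit then inherits the estimate for u i minus the limit.\<close>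

lemma Lp_Fatou:
  assumes [measurable]: "\<And>n. f n \<in> borel_measurable M" and meas: "g \<in> borel_measurable M" and p: "0 < p"
    and lim: "AE x in M. (\<lambda>n. f n x) \<longlonglongrightarrow> g x"
    and K: "\<forall>\<^sub>F n in sequentially. Lp M p (f n) \<and> Lp_int M p (f n) \<le> K"
  shows "Lp M p g \<and> Lp_int M p g \<le> K"
proof -
  note [measurable] = meas
  obtain n where "Lp_int M p (f n) \<le> K" using K by (auto simp: eventually_sequentially)
  then have K0: "0 \<le> K" using Lp_int_nonneg[of M p "f n"] by linarith
  have "(\<integral>\<^sup>+x. ennreal (norm (g x) powr p) \<partial>M) \<le> (\<integral>\<^sup>+x. liminf (\<lambda>n. ennreal (norm (f n x) powr p)) \<partial>M)"
  proof (intro nn_integral_mono_AE, use lim in eventually_elim)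
    case (elim x)
    then have "(\<lambda>n. ennreal (norm (f n x) powr p)) \<longlonglongrightarrow> ennreal (norm (g x) powr p)"
      using p by (intro tendsto_ennrealI tendsto_powr' tendsto_norm tendsto_const) auto
    then have "liminf (\<lambda>n. ennreal (norm (f n x) powr p)) = ennreal (norm (g x) powr p)"
      by (intro lim_imp_Liminf) auto
    then show ?case by simp
  qed
  also have "\<dots> \<le> liminf (\<lambda>n. \<integral>\<^sup>+x. ennreal (norm (f n x) powr p) \<partial>M)"
    by (rule nn_integral_liminf) measurable
  also have "\<dots> \<le> liminf (\<lambda>n::nat. ennreal K)"
  proof (rule Liminf_mono, use K in eventually_elim)
    case (elim n)
    then show ?case
      by (subst nn_integral_eq_integral) (auto simp: Lp_def Lp_int_def intro!: ennreal_leI)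
  qed
  also have "\<dots> = ennreal K" by (intro Liminf_const) simp
  finally have *: "(\<integral>\<^sup>+x. ennreal (norm (g x) powr p) \<partial>M) \<le> ennreal K" .
  then have "integrable M (\<lambda>x. norm (g x) powr p)"
    by (intro integrableI_nonneg) (auto intro: le_less_trans)
  moreover from this have "Lp_int M p g \<le> K"
    using * K0 unfolding Lp_int_def by (subst (asm) nn_integral_eq_integral) (auto simp: integral_nonneg_AE)
  ultimately show ?thesis by (simp add: Lp_def)
qed

section \<open>The space \<open>X(\<Omega>)\<close>\<close>

text \<open>\<open>lebesgue\<close> on a product space is not the product measure, so the null set
  is first enlarged to a Borel one, whose product with the whole space is null for
  \<open>lborel\<close>.\<close>

lemma AE_lebesgue_fst:
  assumes "AE x in (lebesgue :: 'a::euclidean_space measure). P x"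
  shows "AE z in (lebesgue :: ('a \<times> 'b::euclidean_space) measure). P (fst z)"
proof -
  obtain N' where N': "{x \<in> space lebesgue. \<not> P x} \<subseteq> N'" "N' \<in> null_sets (lebesgue :: 'a measure)"
    using assms by (auto simp: eventually_ae_filter)
  then obtain N where N: "{x \<in> space lborel. \<not> P x} \<subseteq> N" "N \<in> null_sets (lborel :: 'a measure)"
    by (auto simp: null_sets_completion_iff2)
  have "N \<times> (UNIV :: 'b set) \<in> null_sets (lborel \<Otimes>\<^sub>M lborel)"
    using N(2) by (intro null_setsI) (auto simp: null_sets_def lborel.emeasure_pair_measure_Times)
  then have "N \<times> UNIV \<in> null_sets (lborel :: ('a \<times> 'b) measure)" by (simp only: lborel_prod)
  then have "AE z in (lborel :: ('a \<times> 'b) measure). P (fst z)"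
    by (rule AE_I') (use N(1) in \<open>auto simp: subset_iff\<close>)
  then show ?thesis by (rule AE_completion)
qed

lemma AE_lebesgue_snd:
  assumes "AE x in (lebesgue :: 'b::euclidean_space measure). P x"
  shows "AE z in (lebesgue :: ('a::euclidean_space \<times> 'b) measure). P (snd z)"
proof -
  obtain N' where N': "{x \<in> space lebesgue. \<not> P x} \<subseteq> N'" "N' \<in> null_sets (lebesgue :: 'b measure)"
    using assms by (auto simp: eventually_ae_filter)
  then obtain N where N: "{x \<in> space lborel. \<not> P x} \<subseteq> N" "N \<in> null_sets (lborel :: 'b measure)"
    by (auto simp: null_sets_completion_iff2)
  have "(UNIV :: 'a set) \<times> N \<in> null_sets (lborel \<Otimes>\<^sub>M lborel)"
    using N(2) by (intro null_setsI) (auto simp: null_sets_def lborel.emeasure_pair_measure_Times)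
  then have "UNIV \<times> N \<in> null_sets (lborel :: ('a \<times> 'b) measure)" by (simp only: lborel_prod)
  then have "AE z in (lborel :: ('a \<times> 'b) measure). P (snd z)"
    by (rule AE_I') (use N(1) in \<open>auto simp: subset_iff\<close>)
  then show ?thesis by (rule AE_completion)
qed

text \<open>With the exponent N + s p divided by p, the Gagliardo seminorm is, up to its constant,
  the L^p norm of a function on the product space that is linear in u. All results on
  \<open>Lp\<close> then apply to it.\<close>

definition frac_quot :: "real \<Rightarrow> real \<Rightarrow> ('a::euclidean_space \<Rightarrow> real) \<Rightarrow> 'a \<times> 'a \<Rightarrow> real" where
  "frac_quot s p u z = (u (fst z) - u (snd z)) / norm (fst z - snd z) powr ((real DIM('a) + s * p) / p)"

text \<open>A Borel representative of u has a Borel quotient, and the quotient of u differs from it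
  only on a null set of the product space.\<close>

lemma frac_quot_measurable:
  fixes u :: "'a::euclidean_space \<Rightarrow> real"
  assumes "u \<in> borel_measurable lebesgue"
  shows "frac_quot s p u \<in> borel_measurable lebesgue"
proof -
  obtain v where v: "v \<in> borel_measurable borel" "AE x in lebesgue. u x = v x"
    using lebesgue_imp_borel_rep[OF assms] .
  note [measurable] = v(1)
  have "(\<lambda>z :: 'a \<times> 'a. (v (fst z) - v (snd z)) / norm (fst z - snd z) powr ((real DIM('a)
      + s * p) / p)) \<in> borel_measurable (borel \<Otimes>\<^sub>M borel)"
    by measurable
  then have m: "frac_quot s p v \<in> borel_measurable lebesgue"
    unfolding frac_quot_def by (intro borel_imp_lebesgue_measurable) (simp add: borel_prod)
  have "AE z in lebesgue. frac_quot s p v z = frac_quot s p u z"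
    using AE_lebesgue_fst[OF v(2), where 'b='a] AE_lebesgue_snd[OF v(2), where 'a='a]
    by eventually_elim (simp add: frac_quot_def)
  then show ?thesis using m by (rule borel_measurable_AE[rotated])
qed

lemma frac_quot_lin:
  "frac_quot s p (\<lambda>x. a * u x + b * v x) z = a *\<^sub>R frac_quot s p u z + b *\<^sub>R frac_quot s p v z"
  by (simp add: frac_quot_def add_divide_distrib[symmetric] algebra_simps)

lemma gagliardo_integrand_frac_quot:
  assumes "0 < p"
  shows "gagliardo_integrand s p u z = norm (frac_quot s p u z) powr p"
proof -
  obtain x y where z: "z = (x, y)" by (cases z)
  have "\<bar>(u x - u y) / norm (x - y) powr ((real DIM('a) + s * p) / p)\<bar> powr p =
      \<bar>u x - u y\<bar> powr p / norm (x - y) powr ((real DIM('a) + s * p) / p * p)"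
    by (simp add: powr_divide powr_powr)
  then show ?thesis using assms by (simp add: z gagliardo_integrand_def frac_quot_def)
qed

lemma frac_form_frac_quot:
  fixes u v :: "'a::euclidean_space \<Rightarrow> real"
  assumes "0 < p"
  shows "\<bar>u x - u y\<bar> powr (p - 2) * (u x - u y) * (v x - v y) / norm (x - y) powr (real DIM('a) + s * p) =
    norm (frac_quot s p u (x, y)) powr (p - 2) * (frac_quot s p u (x, y) \<bullet> frac_quot s p v (x, y))"
proof (cases "x = y")
  case False
  define k where "k = norm (x - y) powr ((real DIM('a) + s * p) / p)"
  have k: "0 < k" using False by (simp add: k_def)
  have q: "frac_quot s p w (x, y) = (w x - w y) / k" for w
    by (simp add: frac_quot_def k_def)
  have "norm (x - y) powr (real DIM('a) + s * p) = k powr p"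
    using assms by (simp add: k_def powr_powr)
  also have "\<dots> = k powr (p - 2) * k * k"
    using k by (simp add: powr_diff power2_eq_square)
  finally show ?thesis
    using k by (simp add: q powr_divide)
qed (simp add: frac_quot_def)

lemma is_weak_gradient_lin:
  assumes u: "is_weak_gradient u F" and v: "is_weak_gradient v G"
  shows "is_weak_gradient (\<lambda>x. a * u x + b * v x) (\<lambda>x. a *\<^sub>R F x + b *\<^sub>R G x)"
  unfolding is_weak_gradient_def
proof (intro conjI allI impI ballI)
  have l: "locally_integrable u" "locally_integrable v" "locally_integrable F" "locally_integrable G"
    using u v by (auto simp: is_weak_gradient_def)
  show "locally_integrable (\<lambda>x. a * u x + b * v x)"
    using locally_integrable_add[OF locally_integrable_scale[OF l(1), of a] locally_integrable_scale[OF
        l(2), of b]] by simp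
  show "locally_integrable (\<lambda>x. a *\<^sub>R F x + b *\<^sub>R G x)"
    by (intro locally_integrable_add locally_integrable_scale l)
  fix \<phi> :: "'a \<Rightarrow> real" and c :: 'a assume \<phi>: "test_function \<phi>" and c: "c \<in> Basis"
  obtain R B where R: "\<And>x. R < norm x \<Longrightarrow> \<phi> x = 0" "\<And>x b. R < norm x \<Longrightarrow> frechet_derivative \<phi> (at x) b = 0"
    and B: "\<And>x. \<bar>\<phi> x\<bar> \<le> B" "\<And>x b. b \<in> Basis \<Longrightarrow> \<bar>frechet_derivative \<phi> (at x) b\<bar> \<le> B"
    using test_function_support[OF \<phi>] by blast
  have int: "integrable lebesgue (\<lambda>x. h x * k x)"
    if h: "locally_integrable h" and k: "k \<in> borel_measurable borel" "\<And>x. \<bar>k x\<bar> \<le> B" "\<And>x. R < norm x \<Longrightarrow> k x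
        = 0"
    for h k :: "'a \<Rightarrow> real"
  proof -
    have "integrable lebesgue (\<lambda>x. (indicator (cball 0 R) x * h x) * k x)"
    proof (rule integrable_mult_bounded[OF _ borel_imp_lebesgue_measurable[OF k(1)] k(2)])
      show "integrable lebesgue (\<lambda>x. indicator (cball 0 R) x * h x)"
        using h by (simp add: locally_integrable_def set_integrable_def)
    qed
    moreover have "(indicator (cball 0 R) x * h x) * k x = h x * k x" for x
      using k(3)[of x] by (cases "norm x \<le> R") auto
    ultimately show ?thesis by simp
  qed
  note i = int[OF l(1) test_function_borel(2)[OF \<phi> c] B(2)[OF c] R(2)] int[OF l(2) test_function_borel(2)[OF
      \<phi> c] B(2)[OF c] R(2)]
    int[OF locally_integrable_inner[OF l(3), of c] test_function_borel(1)[OF \<phi>] B(1) R(1)]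
    int[OF locally_integrable_inner[OF l(4), of c] test_function_borel(1)[OF \<phi>] B(1) R(1)]
  have "(LINT x|lebesgue. u x * frechet_derivative \<phi> (at x) c) = - (LINT x|lebesgue. (F x \<bullet> c) * \<phi> x)"
    "(LINT x|lebesgue. v x * frechet_derivative \<phi> (at x) c) = - (LINT x|lebesgue. (G x \<bullet> c) * \<phi> x)"
    using u v \<phi> c unfolding is_weak_gradient_def by blast+
  then show "(LINT x|lebesgue. (a * u x + b * v x) * frechet_derivative \<phi> (at x) c) =
      - (LINT x|lebesgue. ((a *\<^sub>R F x + b *\<^sub>R G x) \<bullet> c) * \<phi> x)"
    using i by (simp add: distrib_right inner_add_left mult.assoc)
qed

lemma C_const_pos:
  assumes "0 < s" "s < 1" "0 < p" "0 < N"
  shows "0 < C_const N p s"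
  unfolding C_const_def using assms by (intro mult_pos_pos divide_pos_pos Gamma_real_pos) (auto intro:
      add_pos_pos)

section \<open>The fractional part of the norm\<close>

locale sobolev_setting =
  fixes \<Omega> :: "'a::euclidean_space set" and s p :: real
  assumes bounded_\<Omega>: "bounded \<Omega>" and open_\<Omega>: "open \<Omega>"
    and s: "0 \<le> s" "s < 1" and p2: "2 \<le> p" and pN: "p < real DIM('a)"
begin

abbreviation X :: "('a \<Rightarrow> real) set" where "X \<equiv> X_space \<Omega> s p"

definition r :: real where "r = crit_exp DIM('a) p"

lemma p1: "1 < p" "1 \<le> p" "0 < p" using p2 by auto

lemma r: "p < r" "2 < r" "1 < r"
proof -
  have "p * (real DIM('a) - p) < p * real DIM('a)" using p1 by (intro mult_strict_left_mono) auto
  then show "p < r" using pN by (simp add: r_def crit_exp_def field_simps)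
  then show "2 < r" "1 < r" using p2 by auto
qed

definition radius :: real where "radius = (SOME R. 0 < R \<and> (\<forall>x\<in>\<Omega>. norm x \<le> R))"

lemma radius: "0 < radius" "x \<in> \<Omega> \<Longrightarrow> norm x \<le> radius"
proof -
  have "\<exists>R. 0 < R \<and> (\<forall>x\<in>\<Omega>. norm x \<le> R)"
    using bounded_\<Omega> by (metis bounded_pos)
  then have "0 < radius \<and> (\<forall>x\<in>\<Omega>. norm x \<le> radius)" unfolding radius_def by (rule someI_ex)
  then show "0 < radius" "x \<in> \<Omega> \<Longrightarrow> norm x \<le> radius" by auto
qed

lemma \<Omega>_sets [measurable]: "\<Omega> \<in> sets lebesgue" "\<Omega> \<in> sets borel"
  using open_\<Omega> by auto

lemma \<Omega>_integrable: "integrable lebesgue (\<lambda>x. indicator \<Omega> x :: real)"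
  using lmeasurable_open[OF bounded_\<Omega> open_\<Omega>] by (intro integrable_real_indicator) (auto simp:
      fmeasurable_def)

definition frac_fun_finite :: "('a \<Rightarrow> real) \<Rightarrow> bool" where
  "frac_fun_finite u \<longleftrightarrow> (if s = 0 then Lp lebesgue p u else Lp lebesgue p (frac_quot s p u))"

definition frac_int :: "('a \<Rightarrow> real) \<Rightarrow> real" where
  "frac_int u = (if s = 0 then Lp_int lebesgue p u else C_const DIM('a) p s * Lp_int lebesgue p (frac_quot s
      p u))"

lemma frac_0:
  assumes "s = 0"
  shows "frac_fun_finite u \<longleftrightarrow> Lp lebesgue p u" "frac_int u = Lp_int lebesgue p u"
  by (simp_all only: frac_fun_finite_def frac_int_def if_P[OF assms])

lemma frac_finite_iff:
  assumes "u \<in> borel_measurable lebesgue"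
  shows "frac_seminorm_finite s p u \<longleftrightarrow> frac_fun_finite u"
  using assms frac_quot_measurable[OF assms, of s p] p1(3)
    ext[where f = "gagliardo_integrand s p u", OF gagliardo_integrand_frac_quot[OF p1(3), of s u]]
  by (simp add: frac_seminorm_finite_def frac_fun_finite_def Lp_def)

lemma C_pos: "s \<noteq> 0 \<Longrightarrow> 0 < C_const DIM('a) p s"
  using s p1 by (intro C_const_pos) auto

lemma frac_int_nonneg: "0 \<le> frac_int u"
  using C_pos by (auto simp: frac_int_def Lp_int_nonneg less_imp_le)

lemma frac_seminorm_powr: "frac_seminorm s p u powr p = frac_int u"
proof (cases "s = 0")
  case True
  show ?thesis using p1 Lp_int_nonneg[of lebesgue p u]
    unfolding frac_seminorm_def frac_0[OF True] if_P[OF True] by (simp add: powr_powr Lp_int_def)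
next
  case False
  then show ?thesis using p1 C_pos frac_int_nonneg[of u]
      ext[where f = "gagliardo_integrand s p u", OF gagliardo_integrand_frac_quot[OF p1(3), of s u]]
    by (simp add: frac_seminorm_def frac_int_def powr_powr Lp_int_def)
qed

lemma frac_fun_finite_lin:
  assumes "frac_fun_finite u" "frac_fun_finite v"
  shows "frac_fun_finite (\<lambda>x. a * u x + b * v x)"
proof (cases "s = 0")
  case True
  then show ?thesis
    using assms Lp_add[OF p1(2) Lp_scaleR[of lebesgue p u a] Lp_scaleR[of lebesgue p v b]]
    unfolding frac_0[OF True] by simp
next
  case False
  then show ?thesis
    using assms Lp_add[OF p1(2) Lp_scaleR[of lebesgue p "frac_quot s p u" a] Lp_scaleR[of lebesgue p
        "frac_quot s p v" b]]
    by (simp add: frac_fun_finite_def frac_quot_lin[abs_def])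
qed

lemma frac_int_scale: "frac_int (\<lambda>x. c * u x) = \<bar>c\<bar> powr p * frac_int u"
  using Lp_int_scaleR[of lebesgue p c u] Lp_int_scaleR[of lebesgue p c "frac_quot s p u"] ext[where f
      = "frac_quot s p (\<lambda>x. c * u x + 0 * u x)", OF frac_quot_lin[of s p c u 0 u]]
  by (simp add: frac_int_def)

lemma frac_int_Clarkson:
  assumes "frac_fun_finite u" "frac_fun_finite v"
  shows "frac_int (\<lambda>x. 1/2 * u x + 1/2 * v x) + frac_int (\<lambda>x. 1/2 * u x + (-1/2) * v x) \<le> (frac_int u
      + frac_int v) / 2"
proof (cases "s = 0")
  case True
  then show ?thesis
    using assms Lp_int_Clarkson[OF p2, of lebesgue u v]
    unfolding frac_0[OF True] by (simp add: distrib_left right_diff_distrib)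
next
  case False
  let ?C = "C_const DIM('a) p s" and ?U = "frac_quot s p u" and ?V = "frac_quot s p v"
  have "Lp_int lebesgue p (\<lambda>z. (1/2) *\<^sub>R (?U z + ?V z)) + Lp_int lebesgue p (\<lambda>z. (1/2) *\<^sub>R (?U z - ?V z))
      \<le> (Lp_int lebesgue p ?U + Lp_int lebesgue p ?V) / 2"
    using assms False by (intro Lp_int_Clarkson[OF p2]) (auto simp: frac_fun_finite_def)
  then have "?C * (Lp_int lebesgue p (\<lambda>z. (1/2) *\<^sub>R (?U z + ?V z))
      + Lp_int lebesgue p (\<lambda>z. (1/2) *\<^sub>R (?U z - ?V z))) \<le> ?C * ((Lp_int lebesgue p ?U
      + Lp_int lebesgue p ?V) / 2)"
    using C_pos[OF False] by (intro mult_left_mono) auto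
  moreover have "frac_quot s p (\<lambda>x. 1/2 * u x + 1/2 * v x) = (\<lambda>z. (1/2) *\<^sub>R (?U z + ?V z))"
    "frac_quot s p (\<lambda>x. 1/2 * u x + (-1/2) * v x) = (\<lambda>z. (1/2) *\<^sub>R (?U z - ?V z))"
    using frac_quot_lin[of s p "1/2" u "1/2" v] frac_quot_lin[of s p "1/2" u "-1/2" v]
    by (auto simp: fun_eq_iff scaleR_right_distrib scaleR_right_diff_distrib)
  ultimately show ?thesis using False by (simp add: frac_int_def distrib_left)
qed

lemma frac_int_add_le:
  assumes "frac_fun_finite u" "frac_fun_finite v" "0 < c" "c < 1"
  shows "frac_int (\<lambda>x. u x + v x) \<le> (1 - c) powr (1 - p) * frac_int u + c powr (1 - p) * frac_int v"
proof (cases "s = 0")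
  case True
  then show ?thesis
    using assms Lp_int_add_le[OF p1(2), of lebesgue u v c]
    unfolding frac_0[OF True] by simp
next
  case False
  let ?C = "C_const DIM('a) p s" and ?U = "frac_quot s p u" and ?V = "frac_quot s p v"
  have "Lp_int lebesgue p (\<lambda>z. ?U z + ?V z) \<le> (1 - c) powr (1 - p) * Lp_int lebesgue p ?U
      + c powr (1 - p) * Lp_int lebesgue p ?V"
    using assms False by (intro Lp_int_add_le[OF p1(2)]) (auto simp: frac_fun_finite_def)
  then have "?C * Lp_int lebesgue p (\<lambda>z. ?U z + ?V z) \<le> ?C * ((1 - c) powr (1 - p) * Lp_int lebesgue p ?U
      + c powr (1 - p) * Lp_int lebesgue p ?V)"
    using C_pos[OF False] by (intro mult_left_mono) auto
  moreover have "frac_quot s p (\<lambda>x. u x + v x) = (\<lambda>z. ?U z + ?V z)"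
    using frac_quot_lin[of s p 1 u 1 v] by (auto simp: fun_eq_iff)
  ultimately show ?thesis using False by (simp add: frac_int_def distrib_left mult.left_commute)
qed

lemma frac_int_has_derivative:
  assumes fin: "frac_fun_finite u" "frac_fun_finite v" and supp: "\<And>x. x \<notin> \<Omega> \<Longrightarrow> u x = 0"
  shows "((\<lambda>t. frac_int (\<lambda>x. u x + t * v x)) has_real_derivative p * frac_form \<Omega> s p u v) (at 0)"
proof (cases "s = 0")
  case True
  \<comment> \<open>For s = 0 the form is an integral over \<Omega> and \<open>frac_int\<close> one
    over the whole space; they match because u vanishes outside \<Omega>.\<close>
  have "(\<lambda>x. indicator \<Omega> x *\<^sub>R (\<bar>u x\<bar> powr (p - 2) * u x * v x))
      = (\<lambda>x. norm (u x) powr (p - 2) * (u x \<bullet> v x))"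
    using supp by (auto simp: indicator_def fun_eq_iff)
  then show ?thesis
    using fin Lp_int_has_derivative[OF p1(1), of lebesgue u v]
    unfolding frac_0[OF True] frac_form_def if_P[OF True] set_lebesgue_integral_def by simp
next
  case False
  let ?C = "C_const DIM('a) p s" and ?U = "frac_quot s p u" and ?V = "frac_quot s p v"
  have "((\<lambda>t. Lp_int lebesgue p (\<lambda>z. ?U z + t *\<^sub>R ?V z)) has_real_derivative p * (LINT z|lebesgue. norm (?U
      z) powr (p - 2) * (?U z \<bullet> ?V z))) (at 0)"
    using fin False by (intro Lp_int_has_derivative[OF p1(1)]) (auto simp: frac_fun_finite_def)
  from DERIV_cmult[OF this, of ?C]
  have "((\<lambda>t. ?C * Lp_int lebesgue p (\<lambda>z. ?U z + t *\<^sub>R ?V z)) has_real_derivative p * (?C * (LINT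
      z|lebesgue. norm (?U z) powr (p - 2) * (?U z \<bullet> ?V z)))) (at 0)"
    by (simp add: mult_ac)
  moreover have "frac_quot s p (\<lambda>x. u x + t * v x) = (\<lambda>z. ?U z + t *\<^sub>R ?V z)" for t
    using frac_quot_lin[of s p 1 u t v] by (auto simp: fun_eq_iff)
  moreover have "frac_form \<Omega> s p u v = ?C * (LINT z|lebesgue. norm (?U z) powr (p - 2) * (?U z \<bullet> ?V z))"
  proof -
    have "(case z of (x, y) \<Rightarrow> \<bar>u x - u y\<bar> powr (p - 2) * (u x - u y) * (v x - v y) / norm (x - y) powr (real
        DIM('a) + s * p)) =
        norm (?U z) powr (p - 2) * (?U z \<bullet> ?V z)" for z
      by (cases z) (simp only: prod.case frac_form_frac_quot[OF p1(3)])
    then show ?thesis unfolding frac_form_def if_not_P[OF False] by (intro arg_cong2[where f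
        = "(*)"] refl Bochner_Integration.integral_cong) blast
  qed
  ultimately show ?thesis using False by (simp add: frac_int_def)
qed

lemma frac_Fatou:
  assumes f: "\<And>n. f n \<in> borel_measurable lebesgue" and g: "g \<in> borel_measurable lebesgue"
    and lim: "AE x in lebesgue. (\<lambda>n. f n x) \<longlonglongrightarrow> g x"
    and K: "\<forall>\<^sub>F n in sequentially. frac_fun_finite (f n) \<and> frac_int (f n) \<le> K"
  shows "frac_fun_finite g \<and> frac_int g \<le> K"
proof (cases "s = 0")
  case True
  then show ?thesis
    using Lp_Fatou[OF f g p1(3) lim, of K] K unfolding frac_0[OF True] by simp
next
  case False
  let ?C = "C_const DIM('a) p s"
  have C: "0 < ?C" by (rule C_pos[OF False])
  have "AE z in lebesgue. (\<lambda>n. frac_quot s p (f n) z) \<longlonglongrightarrow> frac_quot s p g z"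
    using AE_lebesgue_fst[OF lim, where 'b='a] AE_lebesgue_snd[OF lim, where 'a='a]
  proof eventually_elim
    case (elim z)
    show ?case unfolding frac_quot_def divide_inverse by (intro tendsto_intros elim)
  qed
  moreover have "\<forall>\<^sub>F n in sequentially. Lp lebesgue p (frac_quot s p (f n))
      \<and> Lp_int lebesgue p (frac_quot s p (f n)) \<le> K / ?C"
    using K by eventually_elim (use False C in \<open>simp add: frac_fun_finite_def frac_int_def field_simps\<close>)
  ultimately have "Lp lebesgue p (frac_quot s p g) \<and> Lp_int lebesgue p (frac_quot s p g) \<le> K / ?C"
    by (intro Lp_Fatou[of "\<lambda>n. frac_quot s p (f n)"] frac_quot_measurable f g p1)
  then show ?thesis using False C by (simp add: frac_fun_finite_def frac_int_def field_simps)
qed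

section \<open>Linear structure of \<open>X\<close> and the functional \<open>P\<close>\<close>

lemma X_D:
  assumes "u \<in> X"
  shows "u \<in> borel_measurable lebesgue" "x \<notin> \<Omega> \<Longrightarrow> u x = 0" "is_weak_gradient u (weak_grad u)"
    "Lp lebesgue p (weak_grad u)" "frac_fun_finite u"
proof -
  show u: "u \<in> borel_measurable lebesgue" "x \<notin> \<Omega> \<Longrightarrow> u x = 0" using assms by (auto simp: X_space_def)
  have "\<exists>G. is_weak_gradient u G" using assms by (auto simp: X_space_def)
  then show g: "is_weak_gradient u (weak_grad u)" unfolding weak_grad_def by (rule someI_ex)
  show "Lp lebesgue p (weak_grad u)"
    using assms g locally_integrable_measurable by (auto simp: Lp_def X_space_def is_weak_gradient_def)
  show "frac_fun_finite u" using assms frac_finite_iff[OF u(1)] by (auto simp: X_space_def)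
qed

lemma X_I:
  assumes u: "u \<in> borel_measurable lebesgue" "\<And>x. x \<notin> \<Omega> \<Longrightarrow> u x = 0" and G: "is_weak_gradient u G"
    and L: "Lp lebesgue p G" "frac_fun_finite u"
  shows "u \<in> X" "AE x in lebesgue. weak_grad u x = G x"
proof -
  have g: "is_weak_gradient u (weak_grad u)" unfolding weak_grad_def
      by (rule someI[of "is_weak_gradient u", OF G])
  show ae: "AE x in lebesgue. weak_grad u x = G x" by (rule weak_gradient_unique[OF g G])
  have [measurable]: "weak_grad u \<in> borel_measurable lebesgue"
    using g by (auto simp: is_weak_gradient_def intro: locally_integrable_measurable)
  have "integrable lebesgue (\<lambda>x. norm (weak_grad u x) powr p)"
  proof (rule integrable_cong_AE_imp)
    show "integrable lebesgue (\<lambda>x. norm (G x) powr p)" using L by (simp add: Lp_def)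
    show "AE x in lebesgue. norm (G x) powr p = norm (weak_grad u x) powr p"
      using ae by eventually_elim simp
  qed measurable
  then show "u \<in> X" using assms frac_finite_iff[OF u(1)] by (auto simp: X_space_def)
qed

text \<open>The gradient identity holds almost everywhere only, since \<open>weak_grad\<close> makes
  a separate choice for every function.\<close>

lemma X_lin:
  assumes "u \<in> X" "v \<in> X"
  shows "(\<lambda>x. a * u x + b * v x) \<in> X"
    "AE x in lebesgue. weak_grad (\<lambda>x. a * u x + b * v x) x = a *\<^sub>R weak_grad u x + b *\<^sub>R weak_grad v x"
proof -
  note u = X_D[OF assms(1)] and v = X_D[OF assms(2)]
  note * = X_I[of "\<lambda>x. a * u x + b * v x" "\<lambda>x. a *\<^sub>R weak_grad u x + b *\<^sub>R weak_grad v x"]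
  have 1: "(\<lambda>x. a * u x + b * v x) \<in> borel_measurable lebesgue"
    using u(1) v(1) by measurable
  have 2: "Lp lebesgue p (\<lambda>x. a *\<^sub>R weak_grad u x + b *\<^sub>R weak_grad v x)"
    by (intro Lp_add p1 Lp_scaleR u v)
  show "(\<lambda>x. a * u x + b * v x) \<in> X"
    "AE x in lebesgue. weak_grad (\<lambda>x. a * u x + b * v x) x = a *\<^sub>R weak_grad u x + b *\<^sub>R weak_grad v x"
    using u(2) v(2) by (intro * 1 2 is_weak_gradient_lin u(3) v(3) frac_fun_finite_lin u(5) v(5); simp)+
qed

lemma X_diff: "u \<in> X \<Longrightarrow> v \<in> X \<Longrightarrow> (\<lambda>x. u x - v x) \<in> X"
  using X_lin(1)[of u v 1 "-1"] by simp

definition P :: "('a \<Rightarrow> real) \<Rightarrow> real" where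
  "P u = Lp_int lebesgue p (weak_grad u) + frac_int u"

lemma P_nonneg: "0 \<le> P u"
  by (simp add: P_def Lp_int_nonneg frac_int_nonneg)

lemma X_norm_P: "X_norm s p u = P u powr (1 / p)"
  by (simp add: X_norm_def P_def frac_seminorm_powr Lp_int_def)

lemma Lp_int_cong_AE:
  assumes "AE x in M. f x = g x" "f \<in> borel_measurable M" "g \<in> borel_measurable M"
  shows "Lp_int M p f = Lp_int M p g"
  unfolding Lp_int_def
proof (rule integral_cong_AE)
  show "AE x in M. norm (f x) powr p = norm (g x) powr p" using assms(1) by eventually_elim simp
qed (use assms in measurable)

lemma weak_grad_measurable: "u \<in> X \<Longrightarrow> weak_grad u \<in> borel_measurable lebesgue"
  using X_D(4) by (simp add: Lp_def)

lemma Lp_int_weak_grad_lin: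
  assumes "u \<in> X" "v \<in> X"
  shows "Lp_int lebesgue p (weak_grad (\<lambda>x. a * u x + b * v x)) = Lp_int lebesgue p (\<lambda>x. a *\<^sub>R weak_grad u x
      + b *\<^sub>R weak_grad v x)"
  by (intro Lp_int_cong_AE X_lin(2)[OF assms] weak_grad_measurable X_lin(1)[OF assms]
      borel_measurable_add borel_measurable_scaleR borel_measurable_const assms)

lemma P_scale: assumes "u \<in> X" shows "P (\<lambda>x. c * u x) = \<bar>c\<bar> powr p * P u"
  using Lp_int_weak_grad_lin[OF assms assms, of c 0] Lp_int_scaleR[of lebesgue p c "weak_grad u"]
      frac_int_scale[of c u]
  by (simp add: P_def distrib_left)

lemma P_Clarkson:
  assumes "u \<in> X" "v \<in> X"
  shows "P (\<lambda>x. 1/2 * u x + 1/2 * v x) + (1/2) powr p * P (\<lambda>x. u x - v x) \<le> (P u + P v) / 2"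
proof -
  have 1: "Lp_int lebesgue p (weak_grad (\<lambda>x. 1/2 * u x + 1/2 * v x))
      + Lp_int lebesgue p (weak_grad (\<lambda>x. 1/2 * u x + (-1/2) * v x))
    \<le> (Lp_int lebesgue p (weak_grad u) + Lp_int lebesgue p (weak_grad v)) / 2"
    using Lp_int_Clarkson[OF p2 X_D(4)[OF assms(1)] X_D(4)[OF assms(2)]]
    unfolding Lp_int_weak_grad_lin[OF assms] by (simp add: scaleR_right_distrib scaleR_right_diff_distrib)
  have "P (\<lambda>x. 1/2 * u x + (-1/2) * v x) = (1/2) powr p * P (\<lambda>x. u x - v x)"
    using P_scale[OF X_diff[OF assms], of "1/2"] by (simp add: right_diff_distrib)
  then show ?thesis
    using 1 frac_int_Clarkson[OF X_D(5)[OF assms(1)] X_D(5)[OF assms(2)]] unfolding P_def by simp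
qed

lemma P_add_le:
  assumes "u \<in> X" "v \<in> X" "0 < c" "c < 1"
  shows "P (\<lambda>x. u x + v x) \<le> (1 - c) powr (1 - p) * P u + c powr (1 - p) * P v"
proof -
  have "Lp_int lebesgue p (weak_grad (\<lambda>x. u x + v x)) \<le> (1 - c) powr (1 - p) * Lp_int lebesgue p (weak_grad
      u) + c powr (1 - p) * Lp_int lebesgue p (weak_grad v)"
    using Lp_int_add_le[OF p1(2) X_D(4)[OF assms(1)] X_D(4)[OF assms(2)] assms(3,4)] Lp_int_weak_grad_lin[OF
        assms(1,2), of 1 1] by simp
  then show ?thesis
    using frac_int_add_le[OF X_D(5)[OF assms(1)] X_D(5)[OF assms(2)] assms(3,4)] unfolding P_def
        by (simp add: distrib_left)
qed

lemma P_has_derivative: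
  assumes "u \<in> X" "v \<in> X"
  shows "((\<lambda>t. P (\<lambda>x. u x + t * v x)) has_real_derivative
    p * ((LINT x|lebesgue. norm (weak_grad u x) powr (p - 2) * (weak_grad u x \<bullet> weak_grad v x))
        + frac_form \<Omega> s p u v)) (at 0)"
proof -
  have "Lp_int lebesgue p (weak_grad (\<lambda>x. u x + t * v x)) = Lp_int lebesgue p (\<lambda>x. weak_grad u x
      + t *\<^sub>R weak_grad v x)" for t
    using Lp_int_weak_grad_lin[OF assms, of 1 t] by simp
  then show ?thesis
    using DERIV_add[OF Lp_int_has_derivative[OF p1(1) X_D(4)[OF assms(1)] X_D(4)[OF assms(2)]]
      frac_int_has_derivative[OF X_D(5)[OF assms(1)] X_D(5)[OF assms(2)] X_D(2)[OF assms(1)]]]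
    by (simp add: P_def distrib_left)
qed

lemma X_borel_rep:
  assumes "u \<in> X"
  obtains u' G' where "grad_lborel u' G'" "AE x in lebesgue. u x = u' x" "AE x in lebesgue. weak_grad u x
      = G' x"
    "\<And>x. radius < norm x \<Longrightarrow> u' x = 0" "\<And>x. radius < norm x \<Longrightarrow> G' x = 0"
proof (rule weak_gradient_borel_rep[OF X_D(3)[OF assms], of radius])
  show "u x = 0" if "radius < norm x" for x
    using that radius(2)[of x] by (intro X_D(2)[OF assms]) auto
qed (use that in blast)

text \<open>Locality on open sets says nothing on the boundary of \<Omega>, which may have positive
  measure. There u is still 0, and the gradient vanishes almost everywhere where the function
  does.\<close>

lemma weak_grad_outside:
  assumes "u \<in> X"
  shows "AE x in lebesgue. x \<notin> \<Omega> \<longrightarrow> weak_grad u x = 0"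
proof -
  obtain u' G' where *: "grad_lborel u' G'" "AE x in lebesgue. u x = u' x" "AE x in lebesgue. weak_grad u x
      = G' x"
    using X_borel_rep[OF assms] by metis
  have "AE x in lebesgue. u' x = 0 \<longrightarrow> G' x = 0"
    by (rule AE_completion[OF gradient_eq_0_on_zero_set[OF *(1)]])
  with *(2,3) show ?thesis
    by eventually_elim (use X_D(2)[OF assms] in auto)
qed

section \<open>Sobolev and L^1 bounds in \<open>X\<close>\<close>

definition Sob :: real where "Sob = sobolev_const DIM('a) p"

lemma Sob_nonneg: "0 \<le> Sob" by (simp add: Sob_def sobolev_const_def)

lemma X_sobolev:
  assumes u: "u \<in> X"
  shows "integrable lebesgue (\<lambda>x. \<bar>u x\<bar> powr r)" "(LINT x|lebesgue. \<bar>u x\<bar> powr r) \<le> Sob * P u powr (r / p)"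
proof -
  obtain u' G' where *: "grad_lborel u' G'" "AE x in lebesgue. u x = u' x" "AE x in lebesgue. weak_grad u x
      = G' x"
    "\<And>x. radius < norm x \<Longrightarrow> u' x = 0"
    using X_borel_rep[OF assms] by metis
  have [measurable]: "u \<in> borel_measurable lebesgue" by (rule X_D(1)[OF u])
  have "(\<integral>\<^sup>+x. ennreal (norm (G' x) powr p) \<partial>lborel) = (\<integral>\<^sup>+x. ennreal (norm (G' x) powr p) \<partial>lebesgue)"
    by (rule nn_integral_completion[symmetric])
  also have "\<dots> = (\<integral>\<^sup>+x. ennreal (norm (weak_grad u x) powr p) \<partial>lebesgue)"
    by (rule nn_integral_cong_AE) (use *(3) in \<open>eventually_elim, simp\<close>)
  also have "\<dots> = ennreal (Lp_int lebesgue p (weak_grad u))"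
    unfolding Lp_int_def using X_D(4)[OF u] by (intro nn_integral_eq_integral) (auto simp: Lp_def)
  finally have "(\<integral>\<^sup>+x. ennreal (norm (G' x) powr p) \<partial>lborel) \<le> ennreal (Lp_int lebesgue p (weak_grad u))"
      by simp
  from sobolev_inequality[OF *(1,4) p1(1) pN this Lp_int_nonneg]
  have le: "(\<integral>\<^sup>+x. ennreal (\<bar>u' x\<bar> powr r) \<partial>lborel) \<le> ennreal (Sob * Lp_int lebesgue p (weak_grad u) powr (r
      / p))"
    by (simp add: r_def Sob_def)
  have "(\<integral>\<^sup>+x. ennreal (\<bar>u x\<bar> powr r) \<partial>lebesgue) = (\<integral>\<^sup>+x. ennreal (\<bar>u' x\<bar> powr r) \<partial>lebesgue)"
    by (rule nn_integral_cong_AE) (use *(2) in \<open>eventually_elim, simp\<close>)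
  also have "\<dots> = (\<integral>\<^sup>+x. ennreal (\<bar>u' x\<bar> powr r) \<partial>lborel)" by (rule nn_integral_completion)
  also note le
  also have "ennreal (Sob * Lp_int lebesgue p (weak_grad u) powr (r / p))
      \<le> ennreal (Sob * P u powr (r / p))"
    using r p1 by (intro ennreal_leI mult_left_mono Sob_nonneg powr_mono2) (auto simp: P_def Lp_int_nonneg
        frac_int_nonneg)
  finally have le2: "(\<integral>\<^sup>+x. ennreal (\<bar>u x\<bar> powr r) \<partial>lebesgue) \<le> ennreal (Sob * P u powr (r / p))" .
  then show i: "integrable lebesgue (\<lambda>x. \<bar>u x\<bar> powr r)"
    by (intro integrableI_nonneg) (auto intro: le_less_trans)
  show "(LINT x|lebesgue. \<bar>u x\<bar> powr r) \<le> Sob * P u powr (r / p)"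
    using le2 Sob_nonneg by (subst (asm) nn_integral_eq_integral[OF i]) auto
qed

definition vol :: real where "vol = (LINT x|lebesgue. indicator \<Omega> x)"

lemma vol_nonneg: "0 \<le> vol" unfolding vol_def by (intro integral_nonneg_AE) auto

text \<open>Where |y| exceeds \<delta>, the factor |y|^(1 - a) is at most \<delta>^(1 - a).\<close>

lemma norm_le_powr:
  assumes "1 \<le> a" "0 < \<delta>"
  shows "norm y \<le> \<delta> + \<delta> powr (1 - a) * norm y powr a"
proof (cases "norm y \<le> \<delta>")
  case False
  then have y: "\<delta> < norm y" "0 < norm y" using assms(2) by auto
  have "norm y = norm y powr (1 - a) * norm y powr a" using y by (simp add: powr_add[symmetric])
  also have "\<dots> \<le> \<delta> powr (1 - a) * norm y powr a"
    using y assms by (intro mult_right_mono powr_mono2') auto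
  finally show ?thesis using assms(2) by linarith
qed (use assms in \<open>simp add: add_increasing2\<close>)

text \<open>Does the work of Hoelder's inequality on the bounded set \<Omega>: \<delta> = 1 gives
  boundedness in L^1, while a small \<delta>, fixed before the integral of the a-th power is made
  small, gives smallness.\<close>

lemma L1_le_powr:
  fixes d :: "'a \<Rightarrow> 'b::euclidean_space"
  assumes a: "1 \<le> a" "0 < \<delta>" and d: "Lp lebesgue a d" "AE x in lebesgue. x \<notin> \<Omega> \<longrightarrow> d x = 0"
  shows "integrable lebesgue d" "(LINT x|lebesgue. norm (d x)) \<le> \<delta> * vol
      + \<delta> powr (1 - a) * Lp_int lebesgue a d"
proof -
  define h where "h x = \<delta> * indicator \<Omega> x + \<delta> powr (1 - a) * norm (d x) powr a" for x
  have d': "d \<in> borel_measurable lebesgue" "integrable lebesgue (\<lambda>x. norm (d x) powr a)" using d(1)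
      by (auto simp: Lp_def)
  have h: "integrable lebesgue h"
    unfolding h_def by (intro Bochner_Integration.integrable_add integrable_mult_right \<Omega>_integrable d'(2))
  have ae: "AE x in lebesgue. norm (d x) \<le> h x" using d(2)
  proof eventually_elim
    case (elim x)
    then show ?case using norm_le_powr[OF a, of "d x"] a(2) by (cases "x \<in> \<Omega>") (auto simp: h_def)
  qed
  show i: "integrable lebesgue d"
  proof (rule Bochner_Integration.integrable_bound[OF h d'(1)])
    show "AE x in lebesgue. norm (d x) \<le> norm (h x)"
      using ae by eventually_elim (simp add: order_trans[OF _ abs_ge_self])
  qed
  have "(LINT x|lebesgue. norm (d x)) \<le> (LINT x|lebesgue. h x)"
    by (intro integral_mono_AE integrable_norm i h ae)
  also have "\<dots> = \<delta> * vol + \<delta> powr (1 - a) * Lp_int lebesgue a d"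
    unfolding h_def vol_def Lp_int_def using d'(2) \<Omega>_integrable by simp
  finally show "(LINT x|lebesgue. norm (d x)) \<le> \<delta> * vol + \<delta> powr (1 - a) * Lp_int lebesgue a d" .
qed

lemma X_Lp_r: "u \<in> X \<Longrightarrow> Lp lebesgue r u"
  using X_sobolev(1) X_D(1) by (simp add: Lp_def)

lemma X_integrable:
  assumes u: "u \<in> X"
  shows "integrable lebesgue u" "(LINT x|lebesgue. norm (u x)) \<le> vol + Sob * P u powr (r / p)"
    "(LINT x|lebesgue. norm (weak_grad u x)) \<le> vol + P u"
proof -
  have o: "AE x in lebesgue. x \<notin> \<Omega> \<longrightarrow> u x = 0" by (intro AE_I2 impI X_D(2)[OF u])
  show "integrable lebesgue u" by (rule L1_le_powr(1)[OF less_imp_le[OF r(3)] zero_less_one X_Lp_r[OF u] o])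
  have "(LINT x|lebesgue. norm (u x)) \<le> 1 * vol + 1 powr (1 - r) * Lp_int lebesgue r u"
    by (rule L1_le_powr(2)[OF _ _ X_Lp_r[OF u] o]) (use r in auto)
  then show "(LINT x|lebesgue. norm (u x)) \<le> vol + Sob * P u powr (r / p)"
    using X_sobolev(2)[OF u] by (simp add: Lp_int_def)
  have "(LINT x|lebesgue. norm (weak_grad u x)) \<le> 1 * vol + 1 powr (1 - p) * Lp_int lebesgue p (weak_grad
      u)"
    by (rule L1_le_powr(2)[OF _ _ X_D(4)[OF u] weak_grad_outside[OF u]]) (use p1 in auto)
  then show "(LINT x|lebesgue. norm (weak_grad u x)) \<le> vol + P u"
    using frac_int_nonneg[of u] by (simp add: P_def)
qed

lemma borel_rep_integral_norm:
  fixes f g :: "'a \<Rightarrow> 'b::euclidean_space"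
  assumes "AE x in lebesgue. f x = g x" "g \<in> borel_measurable borel" "f \<in> borel_measurable lebesgue"
  shows "(LINT x|lborel. norm (g x)) = (LINT x|lebesgue. norm (f x))"
proof -
  have "(LINT x|lborel. norm (g x)) = (LINT x|lebesgue. norm (g x))"
    by (rule integral_lebesgue_lborel[symmetric]) (use assms(2) in measurable)
  also have "\<dots> = (LINT x|lebesgue. norm (f x))"
  proof (rule integral_cong_AE)
    show "AE x in lebesgue. norm (g x) = norm (f x)" using assms(1) by eventually_elim simp
  qed (use assms(3) borel_imp_lebesgue_measurable[OF assms(2)] in measurable)
  finally show ?thesis .
qed

text \<open>Nothing is claimed about a gradient of the limit. It arises later, in
  \<open>X_complete\<close>, from the Cauchy property that the minimising sequence turns out to
  have.\<close>

theorem X_compact: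
  assumes u: "\<And>n. u n \<in> X" and K: "\<And>n. P (u n) \<le> K"
  obtains \<sigma> :: "nat \<Rightarrow> nat" and w where "strict_mono \<sigma>" "integrable lebesgue w" "\<And>x. x \<notin> \<Omega> \<Longrightarrow> w x = 0"
    "AE x in lebesgue. (\<lambda>n. u (\<sigma> n) x) \<longlonglongrightarrow> w x" "(\<lambda>n. LINT x|lebesgue. norm (u (\<sigma> n) x - w x)) \<longlonglongrightarrow> 0"
proof -
  define Q where "Q n v G \<longleftrightarrow> grad_lborel v G \<and> (AE x in lebesgue. u n x = v x)
      \<and> (AE x in lebesgue. weak_grad (u n) x = G x) \<and>
    (\<forall>x. radius < norm x \<longrightarrow> v x = 0)" for n v G
  have "\<forall>n. \<exists>v G. Q n v G"
    unfolding Q_def by (intro allI, rule X_borel_rep[OF u]) blast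
  then obtain v G where "\<And>n. Q n (v n) (G n)" by metis
  then have vG: "\<And>n. grad_lborel (v n) (G n)" "\<And>n. AE x in lebesgue. u n x = v n x"
    "\<And>n. AE x in lebesgue. weak_grad (u n) x = G n x" "\<And>n x. radius < norm x \<Longrightarrow> v n x = 0"
    unfolding Q_def by blast+
  have K0: "0 \<le> K" using K[of 0] P_nonneg[of "u 0"] by linarith
  define C where "C = vol + Sob * K powr (r / p) + K"
  have Pr: "Sob * P (u n) powr (r / p) \<le> Sob * K powr (r / p)" for n
    using r p1 K P_nonneg by (intro mult_left_mono powr_mono2 Sob_nonneg) auto
  have bv: "(LINT x|lborel. norm (v n x)) \<le> C" for n
    using borel_rep_integral_norm[OF vG(2) grad_lborelD(3)[OF vG(1)] X_D(1)[OF u]] X_integrable(2)[OF u, of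
        n] Pr[of n] K0
    by (simp add: C_def)
  have bG: "(LINT x|lborel. norm (G n x)) \<le> C" for n
    using borel_rep_integral_norm[OF vG(3) grad_lborelD(4)[OF vG(1)] weak_grad_measurable[OF u]]
        X_integrable(3)[OF u, of n] K[of n]
      mult_nonneg_nonneg[OF Sob_nonneg, of "K powr (r / p)"] by (simp add: C_def)
  obtain \<sigma> :: "nat \<Rightarrow> nat" where \<sigma>: "strict_mono \<sigma>" "AE x in lborel. convergent (\<lambda>n. v (\<sigma> n) x)"
    "\<And>\<epsilon>. 0 < \<epsilon> \<Longrightarrow> \<exists>M. \<forall>i\<ge>M. \<forall>j\<ge>M. (LINT x|lborel. norm (v (\<sigma> i) x - v (\<sigma> j) x)) < \<epsilon>"
  proof (rule gradient_bounded_compact[where u = v and G = G and R = radius and C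
      = C, OF vG(1) vG(4) bv bG])
    fix t :: "nat \<Rightarrow> nat"
    assume t: "strict_mono t" "AE x in lborel. convergent (\<lambda>n. v (t n) x)"
      "\<And>\<epsilon>. 0 < \<epsilon> \<Longrightarrow> \<exists>M. \<forall>i\<ge>M. \<forall>j\<ge>M. (LINT x|lborel. norm (v (t i) x - v (t j) x)) < \<epsilon>"
    show thesis by (rule that[OF t])
  qed
  have um[measurable]: "u n \<in> borel_measurable lebesgue" for n by (rule X_D(1)[OF u])
  \<comment> \<open>The indicator makes the limit vanish outside \<Omega> everywhere, as membership
    in \<open>X\<close> demands.\<close>
  define w where "w x = indicator \<Omega> x * lim (\<lambda>n. u (\<sigma> n) x)" for x
  have [measurable]: "(\<lambda>x. lim (\<lambda>n. u (\<sigma> n) x)) \<in> borel_measurable lebesgue"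
    by (intro borel_measurable_lim_metric um)
  have wm[measurable]: "w \<in> borel_measurable lebesgue" unfolding w_def by measurable
  have w0: "w x = 0" if "x \<notin> \<Omega>" for x using that by (simp add: w_def)
  have "AE x in lebesgue. \<forall>n. u n x = v n x" using vG(2) by (simp add: AE_all_countable)
  moreover have "AE x in lebesgue. convergent (\<lambda>n. v (\<sigma> n) x)" by (rule AE_completion[OF \<sigma>(2)])
  ultimately have lim: "AE x in lebesgue. (\<lambda>n. u (\<sigma> n) x) \<longlonglongrightarrow> w x"
  proof eventually_elim
    case (elim x)
    then have "convergent (\<lambda>n. u (\<sigma> n) x)" by simp
    then show ?case
      using X_D(2)[OF u, of x] by (cases "x \<in> \<Omega>") (auto simp: w_def convergent_LIMSEQ_iff)
  qed
  have L1: "\<exists>M. \<forall>i\<ge>M. Lp lebesgue 1 (\<lambda>x. u (\<sigma> i) x - w x) \<and> Lp_int lebesgue 1 (\<lambda>x. u (\<sigma> i) x - w x) \<le> \<epsilon>"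
      if \<epsilon>: "0 < \<epsilon>" for \<epsilon>
  proof -
    obtain M where M: "\<And>i j. i \<ge> M \<Longrightarrow> j \<ge> M \<Longrightarrow> (LINT x|lborel. norm (v (\<sigma> i) x - v (\<sigma> j) x)) < \<epsilon>"
      using \<sigma>(3)[OF \<epsilon>] by blast
    have "Lp lebesgue 1 (\<lambda>x. u (\<sigma> i) x - w x) \<and> Lp_int lebesgue 1 (\<lambda>x. u (\<sigma> i) x - w x) \<le> \<epsilon>" if i: "i \<ge> M"
        for i
    proof (rule Lp_Fatou[where f = "\<lambda>j x. u (\<sigma> i) x - u (\<sigma> j) x"])
      show "AE x in lebesgue. (\<lambda>j. u (\<sigma> i) x - u (\<sigma> j) x) \<longlonglongrightarrow> u (\<sigma> i) x - w x"
        using lim by eventually_elim (intro tendsto_intros)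
      have "Lp lebesgue 1 (\<lambda>x. u (\<sigma> i) x - u (\<sigma> j) x) \<and> Lp_int lebesgue 1 (\<lambda>x. u (\<sigma> i) x - u (\<sigma> j) x) \<le> \<epsilon>"
          if j: "j \<ge> M" for j
      proof
        show "Lp lebesgue 1 (\<lambda>x. u (\<sigma> i) x - u (\<sigma> j) x)"
          using X_integrable(1)[OF u] by (simp add: Lp_def)
        have "AE x in lebesgue. u (\<sigma> i) x - u (\<sigma> j) x = v (\<sigma> i) x - v (\<sigma> j) x"
          using vG(2)[of "\<sigma> i"] vG(2)[of "\<sigma> j"] by eventually_elim simp
        from borel_rep_integral_norm[OF this] grad_lborelD(3)[OF vG(1)]
        show "Lp_int lebesgue 1 (\<lambda>x. u (\<sigma> i) x - u (\<sigma> j) x) \<le> \<epsilon>"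
          using M[OF i j] by (simp add: Lp_int_def)
      qed
      then show "\<forall>\<^sub>F j in sequentially. Lp lebesgue 1 (\<lambda>x. u (\<sigma> i) x - u (\<sigma> j) x)
          \<and> Lp_int lebesgue 1 (\<lambda>x. u (\<sigma> i) x - u (\<sigma> j) x) \<le> \<epsilon>"
        by (auto simp: eventually_sequentially)
    qed auto
    then show ?thesis by blast
  qed
  obtain i where "Lp lebesgue 1 (\<lambda>x. u (\<sigma> i) x - w x)" using L1[of 1] by auto
  then have "integrable lebesgue (\<lambda>x. norm (u (\<sigma> i) x - w x))" by (simp add: Lp_def)
  then have "integrable lebesgue (\<lambda>x. u (\<sigma> i) x - w x)" by (subst (asm) integrable_norm_iff) auto
  from Bochner_Integration.integrable_diff[OF X_integrable(1)[OF u[of "\<sigma> i"]] this]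
  have wi: "integrable lebesgue w" by simp
  have "(\<lambda>n. LINT x|lebesgue. norm (u (\<sigma> n) x - w x)) \<longlonglongrightarrow> 0"
  proof (rule LIMSEQ_I)
    fix \<epsilon> :: real assume \<epsilon>: "0 < \<epsilon>"
    obtain M where M: "\<And>i. i \<ge> M \<Longrightarrow> Lp_int lebesgue 1 (\<lambda>x. u (\<sigma> i) x - w x) \<le> \<epsilon> / 2" using L1[of "\<epsilon> / 2"] \<epsilon>
        by auto
    have "norm ((LINT x|lebesgue. norm (u (\<sigma> n) x - w x)) - 0) < \<epsilon>" if "n \<ge> M" for n
      using M[OF that] \<epsilon> by (simp add: Lp_int_def integral_nonneg_AE)
    then show "\<exists>M. \<forall>n\<ge>M. norm ((LINT x|lebesgue. norm (u (\<sigma> n) x - w x)) - 0) < \<epsilon>" by blast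
  qed
  then show ?thesis using that \<sigma>(1) wi w0 lim by blast
qed

lemma Lp_int_weak_grad_diff:
  assumes "u \<in> X" "v \<in> X"
  shows "Lp_int lebesgue p (\<lambda>x. weak_grad u x - weak_grad v x)
      = Lp_int lebesgue p (weak_grad (\<lambda>x. u x - v x))"
  using Lp_int_weak_grad_lin[OF assms, of 1 "-1"] by simp

lemma is_weak_gradient_limit:
  assumes u: "\<And>n. is_weak_gradient (u n) (G n)" "\<And>n. integrable lebesgue (u n)" "\<And>n. integrable lebesgue (G
      n)"
    and w: "integrable lebesgue w" "integrable lebesgue H"
    and lim: "(\<lambda>n. LINT x|lebesgue. norm (u n x - w x)) \<longlonglongrightarrow> 0" "(\<lambda>n. LINT x|lebesgue. norm (G n x - H x)) \<longlonglongrightarrow> 0"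
  shows "is_weak_gradient w (H :: 'a \<Rightarrow> 'a)"
  unfolding is_weak_gradient_def
proof (intro conjI allI impI ballI)
  show "locally_integrable w" "locally_integrable H"
    unfolding locally_integrable_def set_integrable_def
    by (intro allI impI integrable_mult_indicator[OF fmeasurableD[OF lmeasurable_compact]] w; assumption)+
  fix \<phi> :: "'a \<Rightarrow> real" and b :: 'a assume \<phi>: "test_function \<phi>" and b: "b \<in> Basis"
  obtain R B where B: "\<And>x. \<bar>\<phi> x\<bar> \<le> B" "\<And>x b. b \<in> Basis \<Longrightarrow> \<bar>frechet_derivative \<phi> (at x) b\<bar> \<le> B"
    using test_function_support[OF \<phi>] by metis
  have conv: "(\<lambda>n. LINT x|lebesgue. f n x * k x) \<longlonglongrightarrow> (LINT x|lebesgue. g x * k x)"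
    if f: "\<And>n. integrable lebesgue (f n)" and g: "integrable lebesgue g"
        and k: "k \<in> borel_measurable borel" "\<And>x. \<bar>k x\<bar> \<le> B"
      and l: "\<And>n. (LINT x|lebesgue. norm (f n x - g x)) \<le> a n" and a: "a \<longlonglongrightarrow> 0"
    for f :: "nat \<Rightarrow> 'a \<Rightarrow> real" and g k :: "'a \<Rightarrow> real" and a :: "nat \<Rightarrow> real"
  proof -
    note k' = borel_imp_lebesgue_measurable[OF k(1)]
    have i: "integrable lebesgue (\<lambda>x. h x * k x)" if "integrable lebesgue h" for h
      by (rule integrable_mult_bounded[OF that k' k(2)])
    have "(\<lambda>n. (LINT x|lebesgue. f n x * k x) - (LINT x|lebesgue. g x * k x)) \<longlonglongrightarrow> 0"
    proof (rule Lim_null_comparison)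
      show "(\<lambda>n. a n * B) \<longlonglongrightarrow> 0" by (rule tendsto_mult_left_zero[OF a])
      have "norm ((LINT x|lebesgue. f n x * k x) - (LINT x|lebesgue. g x * k x)) \<le> a n * B" for n
      proof -
        have fg: "integrable lebesgue (\<lambda>x. f n x - g x)" by (intro Bochner_Integration.integrable_diff f g)
        have "(LINT x|lebesgue. f n x * k x) - (LINT x|lebesgue. g x * k x)
            = (LINT x|lebesgue. (f n x - g x) * k x)"
          unfolding left_diff_distrib by (rule Bochner_Integration.integral_diff[OF i[OF f] i[OF g],
              symmetric])
        also have "norm \<dots> \<le> (LINT x|lebesgue. norm ((f n x - g x) * k x))" by (rule integral_norm_bound)
        also have "\<dots> \<le> (LINT x|lebesgue. norm (f n x - g x) * B)"
          by (intro integral_mono integrable_norm i[OF fg] integrable_mult_left fg)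
             (auto simp: abs_mult intro: mult_left_mono k(2))
        also have "\<dots> = (LINT x|lebesgue. norm (f n x - g x)) * B" by simp
        also have "\<dots> \<le> a n * B" using order_trans[OF abs_ge_zero k(2)] by (intro mult_right_mono l)
        finally show ?thesis .
      qed
      then show "\<forall>\<^sub>F n in sequentially. norm ((LINT x|lebesgue. f n x * k x) - (LINT x|lebesgue. g x * k x))
          \<le> a n * B" by simp
    qed
    then show ?thesis by (rule LIM_zero_cancel)
  qed
  have 1: "(\<lambda>n. LINT x|lebesgue. u n x * frechet_derivative \<phi> (at x) b)
      \<longlonglongrightarrow> (LINT x|lebesgue. w x * frechet_derivative \<phi> (at x) b)"
    by (rule conv[OF u(2) w(1) test_function_borel(2)[OF \<phi> b] B(2)[OF b] order_refl lim(1)])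
  have 2: "(\<lambda>n. LINT x|lebesgue. (G n x \<bullet> b) * \<phi> x) \<longlonglongrightarrow> (LINT x|lebesgue. (H x \<bullet> b) * \<phi> x)"
  proof (rule conv[OF integrable_inner_left integrable_inner_left test_function_borel(1)[OF \<phi>] B(1) _
      lim(2)])
    fix n
    show "(LINT x|lebesgue. norm (G n x \<bullet> b - H x \<bullet> b)) \<le> (LINT x|lebesgue. norm (G n x - H x))"
    proof (rule integral_mono)
      show "integrable lebesgue (\<lambda>x. norm (G n x \<bullet> b - H x \<bullet> b))"
        by (intro integrable_norm Bochner_Integration.integrable_diff integrable_inner_left u w)
      show "integrable lebesgue (\<lambda>x. norm (G n x - H x))"
        by (intro integrable_norm Bochner_Integration.integrable_diff u w)
      show "norm (G n x \<bullet> b - H x \<bullet> b) \<le> norm (G n x - H x)" for x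
        using Basis_le_norm[OF b, of "G n x - H x"] by (simp add: inner_diff_left)
    qed
  qed (use u w in auto)
  have "(LINT x|lebesgue. u n x * frechet_derivative \<phi> (at x) b) = - (LINT x|lebesgue. (G n x \<bullet> b) * \<phi> x)"
      for n
    using u(1)[of n] \<phi> b unfolding is_weak_gradient_def by blast
  then show "(LINT x|lebesgue. w x * frechet_derivative \<phi> (at x) b) = - (LINT x|lebesgue. (H x \<bullet> b) * \<phi> x)"
    using LIMSEQ_unique[OF 1] tendsto_minus[OF 2] by simp
qed

text \<open>The limit function is given, so only a limit of the gradients has to be found. On the
  bounded set \<Omega> a Cauchy sequence in L^p is Cauchy in L^1, whence an almost everywhere
  convergent subsequence; Fatou's lemma turns its limit into a limit in L^p.\<close>

theorem X_complete:
  assumes u: "\<And>n. u n \<in> X" and w: "integrable lebesgue w" "\<And>x. x \<notin> \<Omega> \<Longrightarrow> w x = 0"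
    and lim: "AE x in lebesgue. (\<lambda>n. u n x) \<longlonglongrightarrow> w x" "(\<lambda>n. LINT x|lebesgue. norm (u n x - w x)) \<longlonglongrightarrow> 0"
    and C: "\<And>\<epsilon>. 0 < \<epsilon> \<Longrightarrow> \<exists>M. \<forall>i\<ge>M. \<forall>j\<ge>M. P (\<lambda>x. u i x - u j x) \<le> \<epsilon>"
  shows "w \<in> X" "(\<lambda>n. P (\<lambda>x. u n x - w x)) \<longlonglongrightarrow> 0"
proof -
  define G where "G n = weak_grad (u n)" for n
  have um[measurable]: "u n \<in> borel_measurable lebesgue" for n by (rule X_D(1)[OF u])
  have wm[measurable]: "w \<in> borel_measurable lebesgue" using w(1) by (rule borel_measurable_integrable)
  have Gm[measurable]: "G n \<in> borel_measurable lebesgue" for n unfolding G_def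
      by (rule weak_grad_measurable[OF u])
  have GL: "Lp lebesgue p (G n)" for n unfolding G_def by (rule X_D(4)[OF u])
  have Go: "AE x in lebesgue. x \<notin> \<Omega> \<longrightarrow> G n x = 0" for n unfolding G_def by (rule weak_grad_outside[OF u])
  have Gi: "integrable lebesgue (G n)" for n
    by (rule L1_le_powr(1)[OF p1(2) zero_less_one GL Go])
  have GP: "Lp_int lebesgue p (\<lambda>x. G i x - G j x) \<le> P (\<lambda>x. u i x - u j x)" for i j
    unfolding G_def Lp_int_weak_grad_diff[OF u u] P_def using frac_int_nonneg by simp
  \<comment> \<open>First \<delta> makes the volume term of \<open>L1_le_powr\<close> at most
    \<epsilon> / 4, then \<eta> does the same for the other term.\<close>
  have small: "\<exists>\<eta>>0. \<forall>d :: 'a \<Rightarrow> 'a. Lp lebesgue p d \<and> (AE x in lebesgue. x \<notin> \<Omega> \<longrightarrow> d x = 0)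
      \<and> Lp_int lebesgue p d \<le> \<eta>
      \<longrightarrow> (LINT x|lebesgue. norm (d x)) < \<epsilon>" if \<epsilon>: "0 < \<epsilon>" for \<epsilon>
  proof -
    define \<delta> where "\<delta> = \<epsilon> / (4 * (vol + 1))"
    have \<delta>: "0 < \<delta>" using \<epsilon> vol_nonneg by (simp add: \<delta>_def)
    have \<delta>v: "\<delta> * vol \<le> \<epsilon> / 4"
      using \<epsilon> vol_nonneg by (simp add: \<delta>_def field_simps)
    define \<eta> where "\<eta> = \<epsilon> / (4 * \<delta> powr (1 - p))"
    have \<eta>: "0 < \<eta>" "\<delta> powr (1 - p) * \<eta> = \<epsilon> / 4" using \<epsilon> \<delta> by (auto simp: \<eta>_def)
    have "(LINT x|lebesgue. norm (d x)) < \<epsilon>"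
      if d: "Lp lebesgue p d" "AE x in lebesgue. x \<notin> \<Omega> \<longrightarrow> d x = 0" "Lp_int lebesgue p d \<le> \<eta>"
          for d :: "'a \<Rightarrow> 'a"
    proof -
      have "\<delta> powr (1 - p) * Lp_int lebesgue p d \<le> \<epsilon> / 4"
        using mult_left_mono[OF d(3), of "\<delta> powr (1 - p)"] \<eta>(2) by simp
      then show ?thesis using L1_le_powr(2)[OF p1(2) \<delta> d(1,2)] \<delta>v \<epsilon> by linarith
    qed
    then show ?thesis using \<eta>(1) by blast
  qed
  have cG: "\<exists>M. \<forall>i\<ge>M. \<forall>j\<ge>M. (LINT x|lebesgue. norm (G i x - G j x)) < \<epsilon>" if \<epsilon>: "0 < \<epsilon>" for \<epsilon>
  proof -
    obtain \<eta> where \<eta>: "0 < \<eta>" "\<And>d :: 'a \<Rightarrow> 'a. Lp lebesgue p d \<Longrightarrow> (AE x in lebesgue. x \<notin> \<Omega> \<longrightarrow> d x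
        = 0) \<Longrightarrow> Lp_int lebesgue p d \<le> \<eta>
      \<Longrightarrow> (LINT x|lebesgue. norm (d x)) < \<epsilon>" using small[OF \<epsilon>] by blast
    obtain M where M: "\<And>i j. i \<ge> M \<Longrightarrow> j \<ge> M \<Longrightarrow> P (\<lambda>x. u i x - u j x) \<le> \<eta>" using C[OF \<eta>(1)] by blast
    have "(LINT x|lebesgue. norm (G i x - G j x)) < \<epsilon>" if "i \<ge> M" "j \<ge> M" for i j
    proof (rule \<eta>(2)[OF Lp_diff[OF p1(2) GL GL] _ order_trans[OF GP M[OF that]]])
      show "AE x in lebesgue. x \<notin> \<Omega> \<longrightarrow> G i x - G j x = 0"
        using Go[of i] Go[of j] by eventually_elim simp
    qed
    then show ?thesis by blast
  qed
  obtain \<rho> :: "nat \<Rightarrow> nat" where \<rho>: "strict_mono \<rho>" "AE x in lebesgue. Cauchy (\<lambda>i. G (\<rho> i) x)"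
    by (rule cauchy_L1_AE_cauchy_subseq[OF Gi cG])
  define H where "H x = lim (\<lambda>n. G (\<rho> n) x)" for x
  have Hm[measurable]: "H \<in> borel_measurable lebesgue"
    unfolding H_def by (intro borel_measurable_lim_metric Gm)
  have GH: "AE x in lebesgue. (\<lambda>n. G (\<rho> n) x) \<longlonglongrightarrow> H x"
    using \<rho>(2) by eventually_elim (simp add: H_def Cauchy_convergent_iff convergent_LIMSEQ_iff)
  have main: "\<exists>M. \<forall>i\<ge>M. (Lp lebesgue p (\<lambda>x. G i x - H x) \<and> Lp_int lebesgue p (\<lambda>x. G i x - H x) \<le> \<epsilon>) \<and>
      (frac_fun_finite (\<lambda>x. u i x - w x) \<and> frac_int (\<lambda>x. u i x - w x) \<le> \<epsilon>)" if \<epsilon>: "0 < \<epsilon>" for \<epsilon>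
  proof -
    obtain M where M: "\<And>i j. i \<ge> M \<Longrightarrow> j \<ge> M \<Longrightarrow> P (\<lambda>x. u i x - u j x) \<le> \<epsilon>" using C[OF \<epsilon>] by blast
    have "Lp lebesgue p (\<lambda>x. G i x - H x) \<and> Lp_int lebesgue p (\<lambda>x. G i x - H x) \<le> \<epsilon>" if i: "i \<ge> M" for i
    proof (rule Lp_Fatou[where f = "\<lambda>j x. G i x - G (\<rho> j) x"])
      show "AE x in lebesgue. (\<lambda>j. G i x - G (\<rho> j) x) \<longlonglongrightarrow> G i x - H x"
        using GH by eventually_elim (intro tendsto_intros)
      have "Lp lebesgue p (\<lambda>x. G i x - G (\<rho> j) x) \<and> Lp_int lebesgue p (\<lambda>x. G i x - G (\<rho> j) x) \<le> \<epsilon>"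
          if "j \<ge> M" for j
        using order_trans[OF GP M[OF i order_trans[OF that seq_suble[OF \<rho>(1)]]]] Lp_diff[OF p1(2) GL GL]
            by blast
      then show "\<forall>\<^sub>F j in sequentially. Lp lebesgue p (\<lambda>x. G i x - G (\<rho> j) x)
          \<and> Lp_int lebesgue p (\<lambda>x. G i x - G (\<rho> j) x) \<le> \<epsilon>"
        by (auto simp: eventually_sequentially)
    qed (use p1 in auto)
    moreover have "frac_fun_finite (\<lambda>x. u i x - w x) \<and> frac_int (\<lambda>x. u i x - w x) \<le> \<epsilon>" if i: "i \<ge> M" for i
    proof (rule frac_Fatou[where f = "\<lambda>j x. u i x - u j x"])
      show "AE x in lebesgue. (\<lambda>j. u i x - u j x) \<longlonglongrightarrow> u i x - w x"
        using lim(1) by eventually_elim (intro tendsto_intros)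
      have "frac_fun_finite (\<lambda>x. u i x - u j x) \<and> frac_int (\<lambda>x. u i x - u j x) \<le> \<epsilon>" if "j \<ge> M" for j
        using M[OF i that] X_D(5)[OF X_diff[OF u u]] Lp_int_nonneg[of lebesgue p "weak_grad (\<lambda>x. u i x - u j
            x)"]
        by (auto simp: P_def)
      then show "\<forall>\<^sub>F j in sequentially. frac_fun_finite (\<lambda>x. u i x - u j x) \<and> frac_int (\<lambda>x. u i x - u j x)
          \<le> \<epsilon>"
        by (auto simp: eventually_sequentially)
    qed auto
    ultimately show ?thesis by blast
  qed
  obtain i where i: "Lp lebesgue p (\<lambda>x. G i x - H x)" "frac_fun_finite (\<lambda>x. u i x - w x)" using main[of 1]
      by auto
  have HL: "Lp lebesgue p H" using Lp_diff[OF p1(2) GL[of i] i(1)] by simp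
  have wF: "frac_fun_finite w" using frac_fun_finite_lin[OF X_D(5)[OF u[of i]] i(2), of 1 "-1"] by simp
  have "AE x in lebesgue. \<forall>n. x \<notin> \<Omega> \<longrightarrow> G n x = 0" unfolding AE_all_countable using Go by blast
  with GH have Ho: "AE x in lebesgue. x \<notin> \<Omega> \<longrightarrow> H x = 0"
  proof eventually_elim
    case (elim x)
    show ?case
    proof
      assume "x \<notin> \<Omega>"
      then have "(\<lambda>n. 0) \<longlonglongrightarrow> H x" using elim by simp
      then show "H x = 0" by (simp add: LIMSEQ_const_iff)
    qed
  qed
  have Hi: "integrable lebesgue H" by (rule L1_le_powr(1)[OF p1(2) zero_less_one HL Ho])
  have limG: "(\<lambda>n. LINT x|lebesgue. norm (G n x - H x)) \<longlonglongrightarrow> 0"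
  proof (rule LIMSEQ_I)
    fix \<epsilon> :: real assume \<epsilon>: "0 < \<epsilon>"
    obtain \<eta> where \<eta>: "0 < \<eta>" "\<And>d :: 'a \<Rightarrow> 'a. Lp lebesgue p d \<Longrightarrow> (AE x in lebesgue. x \<notin> \<Omega> \<longrightarrow> d x
        = 0) \<Longrightarrow> Lp_int lebesgue p d \<le> \<eta>
      \<Longrightarrow> (LINT x|lebesgue. norm (d x)) < \<epsilon>" using small[OF \<epsilon>] by blast
    obtain M where M: "\<And>i. i \<ge> M \<Longrightarrow> Lp lebesgue p (\<lambda>x. G i x - H x) \<and> Lp_int lebesgue p (\<lambda>x. G i x - H x)
        \<le> \<eta>"
      using main[OF \<eta>(1)] by blast
    have "norm ((LINT x|lebesgue. norm (G n x - H x)) - 0) < \<epsilon>" if n: "n \<ge> M" for n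
    proof -
      have "AE x in lebesgue. x \<notin> \<Omega> \<longrightarrow> G n x - H x = 0" using Go[of n] Ho by eventually_elim simp
      then have "(LINT x|lebesgue. norm (G n x - H x)) < \<epsilon>" using M[OF n] by (intro \<eta>(2)) auto
      then show ?thesis by (simp add: integral_nonneg_AE)
    qed
    then show "\<exists>M. \<forall>n\<ge>M. norm ((LINT x|lebesgue. norm (G n x - H x)) - 0) < \<epsilon>" by blast
  qed
  have wg: "is_weak_gradient w H"
    by (rule is_weak_gradient_limit[of u G, OF _ X_integrable(1)[OF u] Gi w(1) Hi lim(2) limG])
       (simp add: G_def X_D(3)[OF u])
  have wX: "w \<in> X" "AE x in lebesgue. weak_grad w x = H x"
    by (rule X_I[OF wm _ wg HL wF]; simp add: w(2))+
  show "w \<in> X" by (rule wX(1))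
  show "(\<lambda>n. P (\<lambda>x. u n x - w x)) \<longlonglongrightarrow> 0"
  proof (rule LIMSEQ_I)
    fix \<epsilon> :: real assume \<epsilon>: "0 < \<epsilon>"
    obtain M where M: "\<And>i. i \<ge> M \<Longrightarrow> Lp_int lebesgue p (\<lambda>x. G i x - H x) \<le> \<epsilon> / 4 \<and> frac_int (\<lambda>x. u i x - w x)
        \<le> \<epsilon> / 4"
      using main[of "\<epsilon> / 4"] \<epsilon> by auto
    have "norm (P (\<lambda>x. u n x - w x) - 0) < \<epsilon>" if "n \<ge> M" for n
    proof -
      have "Lp_int lebesgue p (weak_grad (\<lambda>x. u n x - w x)) = Lp_int lebesgue p (\<lambda>x. G n x - H x)"
        unfolding Lp_int_weak_grad_diff[OF u wX(1), symmetric]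
      proof (rule Lp_int_cong_AE)
        show "AE x in lebesgue. weak_grad (u n) x - weak_grad w x = G n x - H x"
          using wX(2) by eventually_elim (simp add: G_def)
      qed (intro borel_measurable_diff weak_grad_measurable u wX(1) Gm Hm)+
      then show ?thesis using M[OF that] \<epsilon> P_nonneg[of "\<lambda>x. u n x - w x"] by (simp add: P_def)
    qed
    then show "\<exists>M. \<forall>n\<ge>M. norm (P (\<lambda>x. u n x - w x) - 0) < \<epsilon>" by blast
  qed
qed

end

section \<open>Minimisation on small balls\<close>

text \<open>The excess of |h n| over Z n is dominated by W and tends to 0 pointwise. With critical
  growth there is no fixed integrable majorant, and Z n collects the part that may fail to
  converge.\<close>

lemma dominated_convergence_up_to:
  fixes h :: "nat \<Rightarrow> 'a \<Rightarrow> real"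
  assumes h: "\<And>n. h n \<in> borel_measurable M" "AE x in M. (\<lambda>n. h n x) \<longlonglongrightarrow> 0"
    and Z: "\<And>n. integrable M (Z n)" "\<And>n x. 0 \<le> Z n x" and W: "integrable M W"
    and b: "\<And>n. AE x in M. \<bar>h n x\<bar> \<le> W x + Z n x" and \<epsilon>: "0 < (\<epsilon>::real)"
  shows "\<forall>\<^sub>F n in sequentially. (LINT x|M. \<bar>h n x\<bar>) \<le> \<epsilon> + (LINT x|M. Z n x)"
proof -
  have m[measurable]: "Z n \<in> borel_measurable M" "h n \<in> borel_measurable M" for n
    using Z(1) h(1) by auto
  define f where "f n x = max 0 (\<bar>h n x\<bar> - Z n x)" for n x
  have fm[measurable]: "f n \<in> borel_measurable M" for n unfolding f_def by measurable
  have fW: "AE x in M. norm (f n x) \<le> norm (W x)" for n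
    using b[of n] by eventually_elim (auto simp: f_def)
  have fi: "integrable M (f n)" for n
    by (rule Bochner_Integration.integrable_bound[OF W fm fW])
  have "(\<lambda>n. LINT x|M. f n x) \<longlonglongrightarrow> (LINT x|M. 0)"
  proof (rule integral_dominated_convergence[where w = "\<lambda>x. norm (W x)"])
    show "AE x in M. (\<lambda>n. f n x) \<longlonglongrightarrow> 0" using h(2)
    proof eventually_elim
      case (elim x)
      show ?case
      proof (rule Lim_null_comparison)
        show "(\<lambda>n. \<bar>h n x\<bar>) \<longlonglongrightarrow> 0" using tendsto_rabs_zero[OF elim] .
        show "\<forall>\<^sub>F n in sequentially. norm (f n x) \<le> \<bar>h n x\<bar>"
          using Z(2)[of _ x] by (auto simp: f_def max_def)
      qed
    qed
  qed (use W fW in auto)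
  then have "\<forall>\<^sub>F n in sequentially. (LINT x|M. f n x) < \<epsilon>"
    using \<epsilon> by (intro order_tendstoD) auto
  then show ?thesis
  proof eventually_elim
    case (elim n)
    have hi: "integrable M (\<lambda>x. \<bar>h n x\<bar>)"
    proof (rule Bochner_Integration.integrable_bound[where f = "\<lambda>x. W x + Z n x"])
      show "AE x in M. norm \<bar>h n x\<bar> \<le> norm (W x + Z n x)" using b[of n] by eventually_elim auto
    qed (use W Z in auto)
    have "(LINT x|M. \<bar>h n x\<bar>) \<le> (LINT x|M. f n x + Z n x)"
      by (intro integral_mono hi Bochner_Integration.integrable_add fi Z) (auto simp: f_def)
    also have "\<dots> = (LINT x|M. f n x) + (LINT x|M. Z n x)" using fi Z by simp
    finally show ?case using elim by linarith
  qed
qed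

text \<open>Let c tend to 0. Combined with \<open>P_add_le\<close> this yields sharp limits and
  strict inequalities for \<open>P\<close> without passing to the norm.\<close>

lemma le_of_forall_powr_factor:
  fixes a b p :: real
  assumes "\<And>c. 0 < c \<Longrightarrow> c < 1 \<Longrightarrow> a \<le> (1 - c) powr (1 - p) * b"
  shows "a \<le> b"
proof -
  define d where "d n = 1 / real (Suc (Suc n))" for n
  have d: "0 < d n" "d n < 1" for n by (auto simp: d_def)
  have "(\<lambda>n. 1 / real (Suc n)) \<longlonglongrightarrow> 0" using LIMSEQ_inverse_real_of_nat by (simp add: inverse_eq_divide)
  then have "d \<longlonglongrightarrow> 0" unfolding d_def[abs_def] using LIMSEQ_Suc by fastforce
  then have "(\<lambda>n. (1 - d n) powr (1 - p) * b) \<longlonglongrightarrow> (1 - 0) powr (1 - p) * b"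
    by (intro tendsto_intros) auto
  then have "a \<le> (1 - 0) powr (1 - p) * b"
    by (rule LIMSEQ_le_const) (use assms[OF d] in auto)
  then show ?thesis by simp
qed

text \<open>H stands for the whole integrand of the lower-order part and k for its derivative in t;
  the perturbation and the critical power are not distinguished here. Measurability is required of
  compositions only, which is all that the integrals use.\<close>

locale critical_functional = sobolev_setting \<Omega> s p for \<Omega> :: "'a::euclidean_space set" and s p +
  fixes H k :: "'a \<Rightarrow> real \<Rightarrow> real" and K :: real
  assumes Hm: "\<And>w. w \<in> borel_measurable lebesgue \<Longrightarrow> (\<lambda>x. indicator \<Omega> x * H x (w x)) \<in> borel_measurable
      lebesgue"
    and km: "\<And>w. w \<in> borel_measurable lebesgue \<Longrightarrow> (\<lambda>x. indicator \<Omega> x * k x (w x)) \<in> borel_measurable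
        lebesgue"
    and Hk: "AE x in lebesgue. x \<in> \<Omega> \<longrightarrow> H x 0 = 0 \<and>
      (\<forall>t. (H x has_real_derivative k x t) (at t) \<and> \<bar>k x t\<bar> \<le> K * (1 + \<bar>t\<bar> powr (r - 1)))"
    and K: "0 < K"
begin

lemma abs_le_one_plus_powr: "\<bar>t\<bar> \<le> 1 + \<bar>t\<bar> powr r"
  using norm_le_powr[of r 1 t] r by simp

lemma powr_r: "\<bar>t\<bar> powr (r - 1) * \<bar>t\<bar> = \<bar>t\<bar> powr r" for t :: real
  by (cases "t = 0") (auto simp: powr_diff)

lemma primitive_growth:
  fixes F f :: "real \<Rightarrow> real"
  assumes D: "\<And>y. (F has_real_derivative f y) (at y)" and F0: "F 0 = 0"
    and f: "\<And>y. \<bar>f y\<bar> \<le> c * (1 + \<bar>y\<bar> powr (r - 1))" and c: "0 \<le> c"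
  shows "\<bar>F t\<bar> \<le> 2 * c * (1 + \<bar>t\<bar> powr r)"
proof -
  have "norm (F t - F 0) \<le> c * (1 + \<bar>t\<bar> powr (r - 1)) * norm (t - 0)"
  proof (rule field_differentiable_bound[where S = "{- \<bar>t\<bar>..\<bar>t\<bar>}" and f' = f])
    fix y assume y: "y \<in> {- \<bar>t\<bar>..\<bar>t\<bar>}"
    show "(F has_field_derivative f y) (at y within {- \<bar>t\<bar>..\<bar>t\<bar>})"
      using D by (rule has_field_derivative_at_within)
    have "\<bar>y\<bar> powr (r - 1) \<le> \<bar>t\<bar> powr (r - 1)" using y r by (intro powr_mono2) auto
    then have "c * (1 + \<bar>y\<bar> powr (r - 1)) \<le> c * (1 + \<bar>t\<bar> powr (r - 1))" using c
        by (simp add: mult_left_mono)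
    then show "norm (f y) \<le> c * (1 + \<bar>t\<bar> powr (r - 1))" using f[of y] by simp
  qed auto
  also have "\<dots> = c * (\<bar>t\<bar> + \<bar>t\<bar> powr r)" using powr_r[of t] by (simp add: algebra_simps)
  also have "\<dots> \<le> c * (2 * (1 + \<bar>t\<bar> powr r))"
  proof (rule mult_left_mono)
    have "y + z \<le> 2 * (1 + z)" if "y \<le> 1 + z" "0 \<le> z" for y z :: real using that by simp
    from this[OF abs_le_one_plus_powr powr_ge_zero]
    show "\<bar>t\<bar> + \<bar>t\<bar> powr r \<le> 2 * (1 + \<bar>t\<bar> powr r)" .
  qed (use c in simp)
  finally show ?thesis using F0 by (simp add: algebra_simps)
qed

lemma H_bound: "AE x in lebesgue. x \<in> \<Omega> \<longrightarrow> (\<forall>t. \<bar>H x t\<bar> \<le> 2 * K * (1 + \<bar>t\<bar> powr r))"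
  using Hk
proof eventually_elim
  case (elim x)
  then show ?case using K by (auto intro!: primitive_growth[of "H x" "k x"])
qed

definition HI :: "('a \<Rightarrow> real) \<Rightarrow> real" where "HI u = (LINT x|lebesgue. indicator \<Omega> x * H x (u x))"

definition J :: "('a \<Rightarrow> real) \<Rightarrow> real" where "J u = P u / p - HI u"

lemma H_int:
  assumes "Lp lebesgue r u"
  shows "integrable lebesgue (\<lambda>x. indicator \<Omega> x * H x (u x))" "\<bar>HI u\<bar> \<le> 2 * K * (vol + Lp_int lebesgue r u)"
proof -
  have u: "u \<in> borel_measurable lebesgue" "integrable lebesgue (\<lambda>x. \<bar>u x\<bar> powr r)" using assms
      by (auto simp: Lp_def)
  define B where "B x = 2 * K * (indicator \<Omega> x + \<bar>u x\<bar> powr r)" for x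
  have B: "integrable lebesgue B" unfolding B_def by (intro integrable_mult_right
      Bochner_Integration.integrable_add \<Omega>_integrable u)
  have b: "AE x in lebesgue. \<bar>indicator \<Omega> x * H x (u x)\<bar> \<le> B x"
    using H_bound by eventually_elim (use K in \<open>auto simp: B_def indicator_def\<close>)
  show i: "integrable lebesgue (\<lambda>x. indicator \<Omega> x * H x (u x))"
  proof (rule Bochner_Integration.integrable_bound[OF B Hm[OF u(1)]])
    show "AE x in lebesgue. norm (indicator \<Omega> x * H x (u x)) \<le> norm (B x)"
      using b by eventually_elim (simp add: order_trans[OF _ abs_ge_self])
  qed
  have "\<bar>HI u\<bar> \<le> (LINT x|lebesgue. \<bar>indicator \<Omega> x * H x (u x)\<bar>)"
    unfolding HI_def using integral_norm_bound[of lebesgue "\<lambda>x. indicator \<Omega> x * H x (u x)"] by simp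
  also have "\<dots> \<le> (LINT x|lebesgue. B x)"
    using integrable_norm[OF i] by (intro integral_mono_AE B b) simp
  also have "\<dots> = 2 * K * (vol + Lp_int lebesgue r u)"
    using u(2) \<Omega>_integrable by (simp add: B_def vol_def Lp_int_def)
  finally show "\<bar>HI u\<bar> \<le> 2 * K * (vol + Lp_int lebesgue r u)" .
qed

lemma powr_add_le: "\<bar>a + b\<bar> powr r \<le> 2 powr r * (\<bar>a\<bar> powr r + \<bar>b\<bar> powr r)" for a b :: real
  using norm_powr_add_le2[of r a b] r by simp

lemma HI_has_derivative:
  assumes "Lp lebesgue r u" "Lp lebesgue r v"
  shows "integrable lebesgue (\<lambda>x. indicator \<Omega> x * k x (u x) * v x)"
    "((\<lambda>t. HI (\<lambda>x. u x + t * v x)) has_real_derivative (LINT x|lebesgue. indicator \<Omega> x * k x (u x) * v x))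
        (at 0)"
proof -
  have u: "u \<in> borel_measurable lebesgue" "integrable lebesgue (\<lambda>x. \<bar>u x\<bar> powr r)" using assms
      by (auto simp: Lp_def)
  have v: "v \<in> borel_measurable lebesgue" "integrable lebesgue (\<lambda>x. \<bar>v x\<bar> powr r)" using assms
      by (auto simp: Lp_def)
  define F where "F t x = indicator \<Omega> x * H x (u x + t * v x)" for t x
  define F' where "F' t x = indicator \<Omega> x * k x (u x + t * v x) * v x" for t x
  \<comment> \<open>With m = |u x| + |v x| the derivative is at most K * (1 + m^(r-1)) * m. Then m
    <= 1 + m^r, and m^r is split at the cost of 2^r.\<close>
  define B where "B x = K * (indicator \<Omega> x + 2 * (2 powr r * (\<bar>u x\<bar> powr r + \<bar>v x\<bar> powr r)))" for x
  have B: "integrable lebesgue B"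
    unfolding B_def by (intro integrable_mult_right Bochner_Integration.integrable_add \<Omega>_integrable u v)
  have Fi: "integrable lebesgue (F t)" for t
  proof -
    have "Lp lebesgue r (\<lambda>x. u x + t * v x)"
      using Lp_add[OF _ assms(1) Lp_scaleR[OF assms(2), of t]] r by simp
    from H_int(1)[OF this] show ?thesis by (simp add: F_def[abs_def])
  qed
  have F'm: "F' 0 \<in> borel_measurable lebesgue"
    using borel_measurable_times[OF km[OF u(1)] v(1)] by (simp add: F'_def[abs_def])
  have D: "AE x in lebesgue. \<forall>t. \<bar>t\<bar> < 1 \<longrightarrow> ((\<lambda>t. F t x) has_real_derivative F' t x) (at t) \<and> \<bar>F' t x\<bar> \<le> B x"
    using Hk
  proof eventually_elim
    case (elim x)
    show ?case
    proof (intro allI impI conjI)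
      fix t :: real assume t: "\<bar>t\<bar> < 1"
      let ?y = "u x + t * v x"
      show "((\<lambda>t. F t x) has_real_derivative F' t x) (at t)"
      proof (cases "x \<in> \<Omega>")
        case True
        then have "(H x has_real_derivative k x ?y) (at ?y)" using elim by blast
        moreover have "((\<lambda>t. u x + t * v x) has_real_derivative v x) (at t)"
          by (auto intro!: derivative_eq_intros)
        ultimately have "((\<lambda>t. H x (u x + t * v x)) has_real_derivative k x ?y * v x) (at t)"
          by (rule DERIV_chain2)
        then show ?thesis using True by (simp add: F_def F'_def)
      qed (simp add: F_def F'_def)
      show "\<bar>F' t x\<bar> \<le> B x"
      proof (cases "x \<in> \<Omega>")
        case True
        define m where "m = \<bar>u x\<bar> + \<bar>v x\<bar>"
        have "\<bar>t * v x\<bar> \<le> 1 * \<bar>v x\<bar>" unfolding abs_mult using t by (intro mult_right_mono) auto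
        then have y: "\<bar>?y\<bar> \<le> m" unfolding m_def by linarith
        have "\<bar>F' t x\<bar> = \<bar>k x ?y\<bar> * \<bar>v x\<bar>" using True by (simp add: F'_def abs_mult)
        also have "\<dots> \<le> (K * (1 + m powr (r - 1))) * m"
        proof (rule mult_mono)
          have "\<bar>k x ?y\<bar> \<le> K * (1 + \<bar>?y\<bar> powr (r - 1))" using elim True by blast
          also have "\<dots> \<le> K * (1 + m powr (r - 1))"
            using K y r by (intro mult_left_mono add_left_mono powr_mono2) auto
          finally show "\<bar>k x ?y\<bar> \<le> K * (1 + m powr (r - 1))" .
        qed (use K in \<open>auto simp: m_def\<close>)
        also have "\<dots> = K * (m + m powr r)"
          using powr_r[of m] by (simp add: m_def algebra_simps)
        also have "\<dots> \<le> K * (1 + 2 * m powr r)"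
          using abs_le_one_plus_powr[of m] K by (intro mult_left_mono) (auto simp: m_def)
        also have "\<dots> \<le> B x"
          using powr_add_le[of "\<bar>u x\<bar>" "\<bar>v x\<bar>"] K True by (auto simp: B_def m_def intro!: mult_left_mono)
        finally show ?thesis .
      qed (use K in \<open>auto simp: F'_def B_def\<close>)
    qed
  qed
  note * = has_derivative_integral_at_0[OF Fi B F'm D]
  show "integrable lebesgue (\<lambda>x. indicator \<Omega> x * k x (u x) * v x)"
    using *(1) by (simp add: F'_def[abs_def])
  show "((\<lambda>t. HI (\<lambda>x. u x + t * v x)) has_real_derivative (LINT x|lebesgue. indicator \<Omega> x * k x (u x) * v
      x)) (at 0)"
    using *(2) by (simp add: F_def F'_def HI_def)
qed

lemma H_continuous: "AE x in lebesgue. x \<in> \<Omega> \<longrightarrow> (\<forall>t. isCont (H x) t)"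
  using Hk by eventually_elim (meson DERIV_isCont)

lemma mid_powr_le: "\<bar>(a + b) / 2\<bar> powr r \<le> \<bar>a\<bar> powr r + \<bar>b\<bar> powr r" for a b :: real
proof -
  have "\<bar>(a + b) / 2\<bar> powr r \<le> (max \<bar>a\<bar> \<bar>b\<bar>) powr r" using r by (intro powr_mono2) auto
  also have "\<dots> \<le> \<bar>a\<bar> powr r + \<bar>b\<bar> powr r" by (auto simp: max_def)
  finally show ?thesis .
qed

lemma Lp_r_diff: "Lp lebesgue r u \<Longrightarrow> Lp lebesgue r v \<Longrightarrow> Lp lebesgue r (\<lambda>x. u x - v x :: real)"
  using Lp_diff[of r lebesgue u v] r by simp

lemma Lp_r_mid: "Lp lebesgue r u \<Longrightarrow> Lp lebesgue r v \<Longrightarrow> Lp lebesgue r (\<lambda>x. (u x + v x) / 2 :: real)"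
  using Lp_scaleR[OF Lp_add[of r lebesgue u v], of "1/2"] r by simp

text \<open>The factor 2^r comes from splitting |a|^r into |a - w|^r and |w|^r. The 8 is a common
  upper bound for the factors 3 in \<open>midpoint_defect\<close> and 2 in
  \<open>HI_tendsto\<close>.\<close>

definition C0 :: real where "C0 = 8 * K * 2 powr r"

lemma C0_nonneg: "0 \<le> C0" using K by (simp add: C0_def)

text \<open>At the pointwise limit both arguments coincide and the defect is 0. What can survive is
  the mass that a n and b n lose to concentration, measured by their distances to w in L^r, which
  are not assumed to tend to 0.\<close>

lemma midpoint_defect:
  assumes a: "\<And>n. Lp lebesgue r (a n)" and b: "\<And>n. Lp lebesgue r (b n)" and w: "Lp lebesgue r w"
    and lim: "AE x in lebesgue. (\<lambda>n. a n x) \<longlonglongrightarrow> w x" "AE x in lebesgue. (\<lambda>n. b n x) \<longlonglongrightarrow> w x" and \<epsilon>: "0 < \<epsilon>"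
  shows "\<forall>\<^sub>F n in sequentially. (HI (a n) + HI (b n)) / 2 - HI (\<lambda>x. (a n x + b n x) / 2) \<le>
    \<epsilon> + C0 * (Lp_int lebesgue r (\<lambda>x. a n x - w x) + Lp_int lebesgue r (\<lambda>x. b n x - w x))"
proof -
  define h where "h n x = (indicator \<Omega> x * H x (a n x) + indicator \<Omega> x * H x (b n x)) / 2 - indicator \<Omega> x *
      H x ((a n x + b n x) / 2)" for n x
  define Z where "Z n x = C0 * (\<bar>a n x - w x\<bar> powr r + \<bar>b n x - w x\<bar> powr r)" for n x
  define W where "W x = 4 * K * indicator \<Omega> x + 2 * C0 * \<bar>w x\<bar> powr r" for x
  have i: "integrable lebesgue (\<lambda>x. indicator \<Omega> x * H x (a n x))" "integrable lebesgue (\<lambda>x. indicator \<Omega> x *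
      H x (b n x))"
    "integrable lebesgue (\<lambda>x. indicator \<Omega> x * H x ((a n x + b n x) / 2))" for n
    by (intro H_int(1) a b Lp_r_mid)+
  have hi: "integrable lebesgue (h n)" for n
    unfolding h_def by (intro Bochner_Integration.integrable_diff integrable_divide
        Bochner_Integration.integrable_add i)
  have hI: "(LINT x|lebesgue. h n x) = (HI (a n) + HI (b n)) / 2 - HI (\<lambda>x. (a n x + b n x) / 2)" for n
    unfolding h_def HI_def using i by simp
  have Zi: "integrable lebesgue (Z n)" for n
    using Lp_r_diff[OF a w, of n] Lp_r_diff[OF b w, of n] unfolding Z_def Lp_def by auto
  have ZI: "(LINT x|lebesgue. Z n x) = C0 * (Lp_int lebesgue r (\<lambda>x. a n x - w x)
      + Lp_int lebesgue r (\<lambda>x. b n x - w x))" for n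
    using Lp_r_diff[OF a w, of n] Lp_r_diff[OF b w, of n] unfolding Z_def Lp_def Lp_int_def by simp
  have "\<forall>\<^sub>F n in sequentially. (LINT x|lebesgue. \<bar>h n x\<bar>) \<le> \<epsilon> + (LINT x|lebesgue. Z n x)"
  proof (rule dominated_convergence_up_to[OF _ _ Zi _ _ _ \<epsilon>])
    show "h n \<in> borel_measurable lebesgue" for n using hi by (rule borel_measurable_integrable)
    show "AE x in lebesgue. (\<lambda>n. h n x) \<longlonglongrightarrow> 0" using lim H_continuous
    proof eventually_elim
      case (elim x)
      show ?case
      proof (cases "x \<in> \<Omega>")
        case True
        have "(\<lambda>n. (H x (a n x) + H x (b n x)) / 2 - H x ((a n x + b n x) / 2)) \<longlonglongrightarrow> (H x (w x)
            + H x (w x)) / 2 - H x ((w x + w x) / 2)"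
          using elim True by (intro tendsto_intros isCont_tendsto_compose[of _ "H x"]) auto
        then show ?thesis using True by (simp add: h_def)
      qed (simp add: h_def)
    qed
    show "0 \<le> Z n x" for n x using C0_nonneg by (simp add: Z_def)
    show "integrable lebesgue W"
      using w unfolding W_def Lp_def
      by (intro Bochner_Integration.integrable_add integrable_mult_right \<Omega>_integrable) simp
    show "AE x in lebesgue. \<bar>h n x\<bar> \<le> W x + Z n x" for n using H_bound
    proof eventually_elim
      case (elim x)
      show ?case
      proof (cases "x \<in> \<Omega>")
        case True
        have e: "\<bar>H x t\<bar> \<le> 2 * K * (1 + \<bar>t\<bar> powr r)" for t using elim True by blast
        have "\<bar>(y + z) / 2 - t\<bar> \<le> (\<bar>y\<bar> + \<bar>z\<bar>) / 2 + \<bar>t\<bar>" for y z t :: real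
        proof -
          have "\<bar>(y + z) / 2\<bar> \<le> (\<bar>y\<bar> + \<bar>z\<bar>) / 2"
            using divide_right_mono[OF abs_triangle_ineq[of y z], of 2] by simp
          then have "\<bar>(y + z) / 2\<bar> + \<bar>t\<bar> \<le> (\<bar>y\<bar> + \<bar>z\<bar>) / 2 + \<bar>t\<bar>" by (rule add_right_mono)
          with abs_triangle_ineq4 show ?thesis by (rule order_trans)
        qed
        then have "\<bar>h n x\<bar> \<le> (\<bar>H x (a n x)\<bar> + \<bar>H x (b n x)\<bar>) / 2 + \<bar>H x ((a n x + b n x) / 2)\<bar>"
          using True by (simp add: h_def)
        also have "\<dots> \<le> (2 * K * (1 + \<bar>a n x\<bar> powr r) + 2 * K * (1 + \<bar>b n x\<bar> powr r)) / 2 + 2 * K * (1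
            + (\<bar>a n x\<bar> powr r + \<bar>b n x\<bar> powr r))"
        proof (intro add_mono divide_right_mono e)
          show "\<bar>H x ((a n x + b n x) / 2)\<bar> \<le> 2 * K * (1 + (\<bar>a n x\<bar> powr r + \<bar>b n x\<bar> powr r))"
            by (rule order_trans[OF e]) (use K mid_powr_le[of "a n x" "b n x"] in \<open>intro mult_left_mono
                add_left_mono; simp\<close>)
        qed simp
        also have "\<dots> = 4 * K + 3 * K * (\<bar>a n x\<bar> powr r + \<bar>b n x\<bar> powr r)" by (simp add: algebra_simps)
        also have "\<dots> \<le> 4 * K + 8 * K * (\<bar>a n x\<bar> powr r + \<bar>b n x\<bar> powr r)"
          using K by (intro add_left_mono mult_right_mono) auto
        also have "\<dots> \<le> 4 * K + 8 * K * (2 powr r * (\<bar>a n x - w x\<bar> powr r + \<bar>w x\<bar> powr r)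
            + 2 powr r * (\<bar>b n x - w x\<bar> powr r + \<bar>w x\<bar> powr r))"
          using K powr_add_le[of "a n x - w x" "w x"] powr_add_le[of "b n x - w x" "w x"]
          by (intro add_left_mono mult_left_mono add_mono) auto
        also have "\<dots> = W x + Z n x" using True by (simp add: W_def Z_def C0_def algebra_simps)
        finally show ?thesis .
      qed (use K C0_nonneg in \<open>simp add: h_def W_def Z_def\<close>)
    qed
  qed
  then show ?thesis
  proof eventually_elim
    case (elim n)
    have "(LINT x|lebesgue. h n x) \<le> (LINT x|lebesgue. \<bar>h n x\<bar>)"
      by (intro integral_mono hi integrable_abs) simp
    then show ?case using elim unfolding hI ZI by linarith
  qed
qed

text \<open>The same domination as for the midpoint defect, but now the distance in L^r tends to 0
  and with it the part that is not dominated.\<close>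

lemma HI_tendsto:
  assumes a: "\<And>n. Lp lebesgue r (a n)" and w: "Lp lebesgue r w"
    and lim: "AE x in lebesgue. (\<lambda>n. a n x) \<longlonglongrightarrow> w x" "(\<lambda>n. Lp_int lebesgue r (\<lambda>x. a n x - w x)) \<longlonglongrightarrow> 0"
  shows "(\<lambda>n. HI (a n)) \<longlonglongrightarrow> HI w"
proof (rule LIMSEQ_I)
  fix \<epsilon> :: real assume \<epsilon>: "0 < \<epsilon>"
  define h where "h n x = indicator \<Omega> x * H x (a n x) - indicator \<Omega> x * H x (w x)" for n x
  define Z where "Z n x = C0 * \<bar>a n x - w x\<bar> powr r" for n x
  define W where "W x = 4 * K * indicator \<Omega> x + 2 * C0 * \<bar>w x\<bar> powr r" for x
  have i: "integrable lebesgue (\<lambda>x. indicator \<Omega> x * H x (a n x))" "integrable lebesgue (\<lambda>x. indicator \<Omega> x *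
      H x (w x))" for n
    by (intro H_int(1) a w)+
  have hi: "integrable lebesgue (h n)" for n
    unfolding h_def by (intro Bochner_Integration.integrable_diff i)
  have hI: "(LINT x|lebesgue. h n x) = HI (a n) - HI w" for n
    unfolding h_def HI_def using i by simp
  have Zi: "integrable lebesgue (Z n)" for n
    using Lp_r_diff[OF a w, of n] unfolding Z_def Lp_def by auto
  have ZI: "(LINT x|lebesgue. Z n x) = C0 * Lp_int lebesgue r (\<lambda>x. a n x - w x)" for n
    using Lp_r_diff[OF a w, of n] unfolding Z_def Lp_def Lp_int_def by simp
  have "\<forall>\<^sub>F n in sequentially. (LINT x|lebesgue. \<bar>h n x\<bar>) \<le> \<epsilon> / 4 + (LINT x|lebesgue. Z n x)"
  proof (rule dominated_convergence_up_to[OF _ _ Zi])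
    show "h n \<in> borel_measurable lebesgue" for n using hi by (rule borel_measurable_integrable)
    show "AE x in lebesgue. (\<lambda>n. h n x) \<longlonglongrightarrow> 0" using lim(1) H_continuous
    proof eventually_elim
      case (elim x)
      show ?case
      proof (cases "x \<in> \<Omega>")
        case True
        have "(\<lambda>n. H x (a n x) - H x (w x)) \<longlonglongrightarrow> H x (w x) - H x (w x)"
          using elim True by (intro tendsto_intros isCont_tendsto_compose[of _ "H x"]) auto
        then show ?thesis using True by (simp add: h_def)
      qed (simp add: h_def)
    qed
    show "0 \<le> Z n x" for n x using C0_nonneg by (simp add: Z_def)
    show "integrable lebesgue W"
      using w unfolding W_def Lp_def
      by (intro Bochner_Integration.integrable_add integrable_mult_right \<Omega>_integrable) simp
    show "AE x in lebesgue. \<bar>h n x\<bar> \<le> W x + Z n x" for n using H_bound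
    proof eventually_elim
      case (elim x)
      show ?case
      proof (cases "x \<in> \<Omega>")
        case True
        have e: "\<bar>H x t\<bar> \<le> 2 * K * (1 + \<bar>t\<bar> powr r)" for t using elim True by blast
        have one: "1 \<le> 2 powr r" using r by (intro ge_one_powr_ge_zero) auto
        have "\<bar>h n x\<bar> \<le> \<bar>H x (a n x)\<bar> + \<bar>H x (w x)\<bar>" using True by (simp add: h_def)
        also have "\<dots> \<le> 2 * K * (1 + \<bar>a n x\<bar> powr r) + 2 * K * (1 + \<bar>w x\<bar> powr r)" by (intro add_mono e)
        also have "\<dots> = 4 * K + 2 * K * (\<bar>a n x\<bar> powr r + \<bar>w x\<bar> powr r)" by (simp add: algebra_simps)
        also have "\<dots> \<le> 4 * K + 8 * K * (\<bar>a n x\<bar> powr r + \<bar>w x\<bar> powr r)"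
          using K by (intro add_left_mono mult_right_mono) auto
        also have "\<dots> \<le> 4 * K + 8 * K * (2 powr r * (\<bar>a n x - w x\<bar> powr r + \<bar>w x\<bar> powr r)
            + 2 powr r * \<bar>w x\<bar> powr r)"
          using K powr_add_le[of "a n x - w x" "w x"] mult_right_mono[OF one, of "\<bar>w x\<bar> powr r"]
          by (intro add_left_mono mult_left_mono add_mono) auto
        also have "\<dots> = W x + Z n x" using True by (simp add: W_def Z_def C0_def algebra_simps)
        finally show ?thesis .
      qed (use K C0_nonneg in \<open>simp add: h_def W_def Z_def\<close>)
    qed
  qed (use \<epsilon> in simp)
  moreover have "(\<lambda>n. C0 * Lp_int lebesgue r (\<lambda>x. a n x - w x)) \<longlonglongrightarrow> 0"
    by (rule tendsto_mult_right_zero[OF lim(2)])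
  then have "\<forall>\<^sub>F n in sequentially. C0 * Lp_int lebesgue r (\<lambda>x. a n x - w x) < \<epsilon> / 4"
    using \<epsilon> by (intro order_tendstoD) auto
  ultimately have "\<forall>\<^sub>F n in sequentially. norm (HI (a n) - HI w) < \<epsilon>"
  proof eventually_elim
    case (elim n)
    have "norm (HI (a n) - HI w) \<le> (LINT x|lebesgue. \<bar>h n x\<bar>)"
      unfolding hI[symmetric] using integral_norm_bound[of lebesgue "h n"] by simp
    then show ?case using elim \<epsilon> unfolding ZI by linarith
  qed
  then show "\<exists>no. \<forall>n\<ge>no. norm (HI (a n) - HI w) < \<epsilon>" by (simp add: eventually_sequentially)
qed


section \<open>Existence of a minimiser on a small ball\<close>

lemma X_Lp_int_r:
  assumes "u \<in> X" "P u \<le> R"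
  shows "Lp_int lebesgue r u \<le> Sob * R powr (r / p)"
proof -
  have "Lp_int lebesgue r u \<le> Sob * P u powr (r / p)" using X_sobolev(2)[OF assms(1)]
      by (simp add: Lp_int_def)
  also have "\<dots> \<le> Sob * R powr (r / p)"
    using r p1 assms(2) P_nonneg by (intro mult_left_mono powr_mono2 Sob_nonneg) auto
  finally show ?thesis .
qed

lemma P_diff_le:
  assumes "u \<in> X" "v \<in> X" "P u \<le> R" "P v \<le> R"
  shows "P (\<lambda>x. u x - v x) \<le> 2 powr (p + 1) * R"
proof -
  have "(1/2) powr p * P (\<lambda>x. u x - v x) \<le> (P u + P v) / 2"
    using P_Clarkson[OF assms(1,2)] P_nonneg[of "\<lambda>x. 1/2 * u x + 1/2 * v x"] by linarith
  also have "\<dots> \<le> R" using assms by simp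
  finally have "P (\<lambda>x. u x - v x) \<le> 2 powr p * R" by (simp add: powr_divide field_simps)
  also have "\<dots> \<le> 2 powr (p + 1) * R"
    using order_trans[OF P_nonneg assms(3)] by (intro mult_right_mono powr_mono) auto
  finally show ?thesis .
qed

text \<open>By Sobolev's inequality the bracket bounds the ratio of the integral of |u i - u j|^r to
  P (u i - u j) inside the ball. The factor in front is twice the coefficient with which this ratio
  enters the estimate for the diameter in \<open>minimizing_Cauchy\<close>, so that this coefficient
  times the ratio is at most 1/2. As r / p > 1, the condition holds for all small R > 0.\<close>

definition small :: "real \<Rightarrow> bool" where
  "small R \<longleftrightarrow> 0 < R \<and> 4 * p * 2 powr p * C0 * (Sob * (2 powr (p + 1) * R) powr (r / p - 1)) \<le> 1"

text \<open>With \<open>d n = sup {P (u i - u j) | i, j \<ge> n}\<close>, Clarkson's inequality for almost maximal pairs yields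
  \<open>d n \<le> d n / 2 + o(1)\<close>.\<close>

lemma minimizing_Cauchy:
  assumes R: "small R" and u: "\<And>n. u n \<in> X" "\<And>n. P (u n) \<le> R"
    and m: "(\<lambda>n. J (u n)) \<longlonglongrightarrow> m" "\<And>v. v \<in> X \<Longrightarrow> P v \<le> R \<Longrightarrow> m \<le> J v"
    and w: "w \<in> borel_measurable lebesgue" "AE x in lebesgue. (\<lambda>n. u n x) \<longlonglongrightarrow> w x" and \<epsilon>: "0 < \<epsilon>"
  shows "\<exists>M. \<forall>i\<ge>M. \<forall>j\<ge>M. P (\<lambda>x. u i x - u j x) \<le> \<epsilon>"
proof -
  have um: "u n \<in> borel_measurable lebesgue" for n by (rule X_D(1)[OF u(1)])
  define R' where "R' = 2 powr (p + 1) * R"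
  define \<theta> where "\<theta> = Sob * R' powr (r / p - 1)"
  have R0: "0 < R" "4 * p * 2 powr p * C0 * \<theta> \<le> 1" using R by (auto simp: small_def \<theta>_def R'_def)
  have \<theta>0: "0 \<le> \<theta>" by (simp add: \<theta>_def Sob_nonneg)
  have PR': "P (\<lambda>x. u i x - u j x) \<le> R'" for i j unfolding R'_def
      by (rule P_diff_le[OF u(1) u(1) u(2) u(2)])
  \<comment> \<open>One factor P is split off from the Sobolev bound; the positive power r / p - 1
    that remains is estimated by P <= R'.\<close>
  have sob: "Lp_int lebesgue r (\<lambda>x. u i x - u j x) \<le> \<theta> * P (\<lambda>x. u i x - u j x)" for i j
  proof -
    let ?P = "P (\<lambda>x. u i x - u j x)"
    have "Lp_int lebesgue r (\<lambda>x. u i x - u j x) \<le> Sob * ?P powr (r / p)"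
      using X_sobolev(2)[OF X_diff[OF u(1) u(1)]] by (simp add: Lp_int_def)
    also have "?P powr (r / p) = ?P powr (r / p - 1) * ?P"
      using P_nonneg[of "\<lambda>x. u i x - u j x"] by (cases "?P = 0") (auto simp: powr_diff)
    also have "Sob * (?P powr (r / p - 1) * ?P) \<le> Sob * (R' powr (r / p - 1) * ?P)"
      using r p1 PR' P_nonneg by (intro mult_left_mono mult_right_mono powr_mono2 Sob_nonneg) auto
    finally show ?thesis by (simp add: \<theta>_def mult_ac)
  qed
  have wL: "Lp lebesgue r w"
  proof -
    have "Lp lebesgue r w \<and> Lp_int lebesgue r w \<le> Sob * R powr (r / p)"
      by (rule Lp_Fatou[OF um w(1) _ w(2)]) (use r X_Lp_r[OF u(1)] X_Lp_int_r[OF u] in auto)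
    then show ?thesis by blast
  qed
  define d where "d n = (SUP ij\<in>{n..} \<times> {n..}. P (\<lambda>x. u (fst ij) x - u (snd ij) x))" for n
  have bdd: "bdd_above ((\<lambda>ij. P (\<lambda>x. u (fst ij) x - u (snd ij) x)) ` ({n..} \<times> {n..}))" for n
    using PR' by (auto intro!: bdd_aboveI[where M = R'])
  have d_ge: "P (\<lambda>x. u i x - u j x) \<le> d n" if "n \<le> i" "n \<le> j" for i j n
    unfolding d_def using cSUP_upper[OF _ bdd, of "(i, j)" n] that by auto
  \<comment> \<open>Fatou's lemma in j carries the bound from u i - u j to u i - w, although w is
    not yet known to lie in \<open>X\<close>.\<close>
  have tail: "Lp_int lebesgue r (\<lambda>x. u i x - w x) \<le> \<theta> * d n" if i: "n \<le> i" for i n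
  proof -
    have "Lp lebesgue r (\<lambda>x. u i x - w x) \<and> Lp_int lebesgue r (\<lambda>x. u i x - w x) \<le> \<theta> * d n"
    proof (rule Lp_Fatou[where f = "\<lambda>j x. u i x - u j x"])
      show "AE x in lebesgue. (\<lambda>j. u i x - u j x) \<longlonglongrightarrow> u i x - w x"
        using w(2) by eventually_elim (intro tendsto_intros)
      have "Lp lebesgue r (\<lambda>x. u i x - u j x) \<and> Lp_int lebesgue r (\<lambda>x. u i x - u j x) \<le> \<theta> * d n" if "n \<le> j"
          for j
        using order_trans[OF sob mult_left_mono[OF d_ge[OF i that] \<theta>0]] X_Lp_r[OF X_diff[OF u(1) u(1)]]
            by blast
      then show "\<forall>\<^sub>F j in sequentially. Lp lebesgue r (\<lambda>x. u i x - u j x)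
          \<and> Lp_int lebesgue r (\<lambda>x. u i x - u j x) \<le> \<theta> * d n"
        by (auto simp: eventually_sequentially)
    qed (use um w r in auto)
    then show ?thesis by blast
  qed
  have "\<exists>ij. n \<le> fst ij \<and> n \<le> snd ij \<and> d n - 1 / real (Suc n) < P (\<lambda>x. u (fst ij) x - u (snd ij) x)" for n
  proof -
    have "d n - 1 / real (Suc n) < d n" by simp
    then obtain ij where "ij \<in> {n..} \<times> {n..}" "d n - 1 / real (Suc n) < P (\<lambda>x. u (fst ij) x - u (snd ij) x)"
      unfolding d_def[of n] by (subst (asm) less_cSUP_iff[OF _ bdd]) auto
    then show ?thesis by (auto simp: mem_Times_iff)
  qed
  then obtain ij where ij: "\<And>n. n \<le> fst (ij n)" "\<And>n. n \<le> snd (ij n)"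
    "\<And>n. d n - 1 / real (Suc n) < P (\<lambda>x. u (fst (ij n)) x - u (snd (ij n)) x)" by metis
  define a where "a n = u (fst (ij n))" for n
  define b where "b n = u (snd (ij n))" for n
  have flim: "filterlim (\<lambda>n. fst (ij n)) sequentially sequentially" "filterlim (\<lambda>n. snd (ij n)) sequentially
      sequentially"
    using ij(1,2) by (auto intro!: filterlim_at_top_mono[OF filterlim_ident])
  have ab: "AE x in lebesgue. (\<lambda>n. a n x) \<longlonglongrightarrow> w x" "AE x in lebesgue. (\<lambda>n. b n x) \<longlonglongrightarrow> w x"
  proof -
    show "AE x in lebesgue. (\<lambda>n. a n x) \<longlonglongrightarrow> w x" using w(2)
    proof eventually_elim
      case (elim x)
      show ?case unfolding a_def by (rule filterlim_compose[OF elim flim(1)])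
    qed
    show "AE x in lebesgue. (\<lambda>n. b n x) \<longlonglongrightarrow> w x" using w(2)
    proof eventually_elim
      case (elim x)
      show ?case unfolding b_def by (rule filterlim_compose[OF elim flim(2)])
    qed
  qed
  have Jab: "(\<lambda>n. J (a n)) \<longlonglongrightarrow> m" "(\<lambda>n. J (b n)) \<longlonglongrightarrow> m"
    unfolding a_def b_def using filterlim_compose[OF m(1)] flim by blast+
  \<comment> \<open>The inverse of the factor (1/2)^p / p before Q in the midpoint estimate. The 8
    in \<eta> gives c * (2 * \<eta>) = \<epsilon> / 4; with 1 / (n + 1) < \<epsilon> / 4 the
    inequality d n - 1 / (n + 1) < \<epsilon> / 4 + d n / 2 becomes d n < \<epsilon>.\<close>
  define c where "c = p * 2 powr p"
  have c: "0 < c" using p1 by (simp add: c_def)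
  define \<eta> where "\<eta> = \<epsilon> / (8 * c)"
  have \<eta>: "0 < \<eta>" using \<epsilon> c by (simp add: \<eta>_def)
  have e1: "\<forall>\<^sub>F n in sequentially. (J (a n) + J (b n)) / 2 < m + \<eta>"
  proof (rule order_tendstoD(2))
    show "(\<lambda>n. (J (a n) + J (b n)) / 2) \<longlonglongrightarrow> (m + m) / 2" by (intro tendsto_intros Jab) auto
  qed (use \<eta> in simp)
  have e2: "\<forall>\<^sub>F n in sequentially. (HI (a n) + HI (b n)) / 2 - HI (\<lambda>x. (a n x + b n x) / 2) \<le>
      \<eta> + C0 * (Lp_int lebesgue r (\<lambda>x. a n x - w x) + Lp_int lebesgue r (\<lambda>x. b n x - w x))"
    by (rule midpoint_defect[OF _ _ wL ab \<eta>]) (simp_all add: a_def b_def X_Lp_r[OF u(1)])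
  have e3: "\<forall>\<^sub>F n in sequentially. 1 / real (Suc n) < \<epsilon> / 4"
    using order_tendstoD(2)[OF LIMSEQ_inverse_real_of_nat, of "\<epsilon> / 4"] \<epsilon> by (simp add: inverse_eq_divide)
  have "\<forall>\<^sub>F n in sequentially. d n \<le> \<epsilon>"
    using e1 e2 e3
  proof eventually_elim
    case (elim n)
    define Q where "Q = P (\<lambda>x. a n x - b n x)"
    have aX: "a n \<in> X" "b n \<in> X" "P (a n) \<le> R" "P (b n) \<le> R" by (auto simp: a_def b_def u)
    have mid: "(\<lambda>x. (a n x + b n x) / 2) = (\<lambda>x. 1/2 * a n x + 1/2 * b n x)"
        by (simp add: add_divide_distrib)
    have cl: "P (\<lambda>x. (a n x + b n x) / 2) + (1/2) powr p * Q \<le> (P (a n) + P (b n)) / 2"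
      unfolding mid Q_def by (rule P_Clarkson[OF aX(1,2)])
    \<comment> \<open>Without this term Clarkson's inequality says that the midpoint stays in the
      ball, so the infimum m bounds its energy from below.\<close>
    moreover have "0 \<le> (1/2) powr p * Q" by (simp add: Q_def P_nonneg)
    moreover have "(P (a n) + P (b n)) / 2 \<le> R" using aX by simp
    ultimately have "P (\<lambda>x. (a n x + b n x) / 2) \<le> R" by linarith
    then have mJ: "m \<le> J (\<lambda>x. (a n x + b n x) / 2)"
      using X_lin(1)[OF aX(1,2), of "1/2" "1/2"] unfolding mid[symmetric] by (intro m(2))
    have t: "Lp_int lebesgue r (\<lambda>x. a n x - w x) \<le> \<theta> * d n" "Lp_int lebesgue r (\<lambda>x. b n x - w x) \<le> \<theta> * d n"
      unfolding a_def b_def by (intro tail ij)+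
    have "(1/2) powr p * Q / p \<le> (J (a n) + J (b n)) / 2 - J (\<lambda>x. (a n x + b n x) / 2) + ((HI (a n)
        + HI (b n)) / 2 - HI (\<lambda>x. (a n x + b n x) / 2))"
    proof -
      have alg: "q \<le> ((A - x) + (B - y)) / 2 - (M - z) + ((x + y) / 2 - z)" if "M + q \<le> (A + B) / 2"
          for q A B M x y z :: real
        using that by (simp add: field_simps)
      show ?thesis
        unfolding J_def by (rule alg) (use divide_right_mono[OF cl, of p] p1 in \<open>simp add:
            add_divide_distrib\<close>)
    qed
    also have "\<dots> \<le> \<eta> + (\<eta> + C0 * (\<theta> * d n + \<theta> * d n))"
      using elim(1,2) mJ mult_left_mono[OF add_mono[OF t] C0_nonneg] by linarith
    finally have "(1/2) powr p * Q / p \<le> 2 * \<eta> + 2 * (C0 * \<theta> * d n)" by (simp add: algebra_simps)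
    then have "c * ((1/2) powr p * Q / p) \<le> c * (2 * \<eta> + 2 * (C0 * \<theta> * d n))"
      using c by (intro mult_left_mono) auto
    moreover have "c * ((1/2) powr p * Q / p) = Q" using p1 by (simp add: c_def powr_divide)
    moreover have "c * (2 * \<eta>) = \<epsilon> / 4" using c by (simp add: \<eta>_def)
    ultimately have "Q \<le> \<epsilon> / 4 + 2 * c * C0 * \<theta> * d n" by (simp add: distrib_left mult_ac)
    moreover have "2 * c * C0 * \<theta> * d n \<le> 1 / 2 * d n"
    proof (rule mult_right_mono)
      show "2 * c * C0 * \<theta> \<le> 1 / 2" using R0(2) by (simp add: c_def mult_ac)
      show "0 \<le> d n" using d_ge[of n n n] P_nonneg[of "\<lambda>x. u n x - u n x"] by linarith
    qed
    moreover have "d n - 1 / real (Suc n) < Q" using ij(3)[of n] by (simp add: Q_def a_def b_def)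
    ultimately show ?case using elim(3) by linarith
  qed
  then obtain n where "d n \<le> \<epsilon>" by (auto simp: eventually_sequentially)
  then show ?thesis using d_ge[of n] by (meson order_trans)
qed

theorem minimizer_on_ball:
  assumes R: "small R"
  obtains w where "w \<in> X" "P w \<le> R" "\<And>v. v \<in> X \<Longrightarrow> P v \<le> R \<Longrightarrow> J w \<le> J v"
proof -
  define B where "B = {u \<in> X. P u \<le> R}"
  have zX: "(\<lambda>x. 0) \<in> X"
    by (rule X_I(1)[where G = "\<lambda>_. 0"])
       (auto simp: is_weak_gradient_def locally_integrable_def set_integrable_def Lp_def frac_fun_finite_def
           frac_quot_def[abs_def])
  have "P (\<lambda>x. 0) = 0" using P_scale[OF zX, of 0] by simp
  then have zB: "(\<lambda>x. 0) \<in> B" using zX R by (simp add: B_def small_def)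
  have lower: "- (2 * K * (vol + Sob * R powr (r / p))) \<le> J v" if "v \<in> B" for v
  proof -
    have v: "v \<in> X" "P v \<le> R" using that by (auto simp: B_def)
    have "\<bar>HI v\<bar> \<le> 2 * K * (vol + Lp_int lebesgue r v)" by (rule H_int(2)[OF X_Lp_r[OF v(1)]])
    also have "\<dots> \<le> 2 * K * (vol + Sob * R powr (r / p))"
      using K X_Lp_int_r[OF v] by (intro mult_left_mono add_left_mono) auto
    moreover have "0 \<le> P v / p" using P_nonneg p1 by simp
    ultimately show ?thesis unfolding J_def by linarith
  qed
  define m where "m = Inf (J ` B)"
  have bdd: "bdd_below (J ` B)" using lower by (auto intro!: bdd_belowI)
  have m_le: "m \<le> J v" if "v \<in> X" "P v \<le> R" for v
    unfolding m_def using that by (intro cINF_lower bdd) (simp add: B_def)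
  have "\<exists>v\<in>B. J v < m + 1 / real (Suc n)" for n
    using cInf_lessD[of "J ` B" "m + 1 / real (Suc n)"] zB by (auto simp: m_def[symmetric])
  then obtain v where v: "\<And>n. v n \<in> B" "\<And>n. J (v n) < m + 1 / real (Suc n)" by metis
  have vX: "v n \<in> X" "P (v n) \<le> R" for n using v(1) by (auto simp: B_def)
  have Jv: "(\<lambda>n. J (v n)) \<longlonglongrightarrow> m"
  proof (rule tendsto_sandwich[of "\<lambda>_. m" _ _ "\<lambda>n. m + 1 / real (Suc n)"])
    have "(\<lambda>n. m + 1 / real (Suc n)) \<longlonglongrightarrow> m + 0"
      using LIMSEQ_inverse_real_of_nat by (intro tendsto_intros) (simp add: inverse_eq_divide)
    then show "(\<lambda>n. m + 1 / real (Suc n)) \<longlonglongrightarrow> m" by simp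
  qed (use m_le[OF vX] v(2) in \<open>auto intro!: always_eventually less_imp_le\<close>)
  obtain \<sigma> :: "nat \<Rightarrow> nat" and w where \<sigma>: "strict_mono \<sigma>" "integrable lebesgue w" "\<And>x. x \<notin> \<Omega> \<Longrightarrow> w x = 0"
    "AE x in lebesgue. (\<lambda>n. v (\<sigma> n) x) \<longlonglongrightarrow> w x" "(\<lambda>n. LINT x|lebesgue. norm (v (\<sigma> n) x - w x)) \<longlonglongrightarrow> 0"
    by (rule X_compact[of v R, OF vX]) blast
  define u where "u n = v (\<sigma> n)" for n
  have u: "u n \<in> X" "P (u n) \<le> R" for n unfolding u_def by (intro vX)+
  have Ju: "(\<lambda>n. J (u n)) \<longlonglongrightarrow> m"
    using LIMSEQ_subseq_LIMSEQ[OF Jv \<sigma>(1)] by (simp add: o_def u_def)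
  have ae: "AE x in lebesgue. (\<lambda>n. u n x) \<longlonglongrightarrow> w x" using \<sigma>(4) by (simp add: u_def)
  have cauchy: "\<exists>M. \<forall>i\<ge>M. \<forall>j\<ge>M. P (\<lambda>x. u i x - u j x) \<le> \<epsilon>" if "0 < \<epsilon>" for \<epsilon>
    by (rule minimizing_Cauchy[OF R u Ju m_le borel_measurable_integrable[OF \<sigma>(2)] ae that])
  have l1: "(\<lambda>n. LINT x|lebesgue. norm (u n x - w x)) \<longlonglongrightarrow> 0" using \<sigma>(5) by (simp add: u_def)
  have wX: "w \<in> X" and Pw0: "(\<lambda>n. P (\<lambda>x. u n x - w x)) \<longlonglongrightarrow> 0"
    using X_complete[OF u(1) \<sigma>(2,3) ae l1 cauchy] by auto
  \<comment> \<open>Semicontinuity of P, for an arbitrary convergent upper bound b n of P (u n). It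
    is used twice: with the constant R, so that w stays in the ball, and with p * (J (u n) + HI (u
    n)), so that w attains the infimum.\<close>
  have Pw: "P w \<le> (1 - c) powr (1 - p) * L"
    if c: "0 < c" "c < 1" and L: "(\<lambda>n. b n) \<longlonglongrightarrow> L" "\<And>n. P (u n) \<le> b n" for c L and b :: "nat \<Rightarrow> real"
  proof (rule LIMSEQ_le_const)
    have "(\<lambda>n. (1 - c) powr (1 - p) * b n + c powr (1 - p) * P (\<lambda>x. u n x - w x)) \<longlonglongrightarrow>
        (1 - c) powr (1 - p) * L + c powr (1 - p) * 0"
      by (intro tendsto_intros L Pw0)
    then show "(\<lambda>n. (1 - c) powr (1 - p) * b n + c powr (1 - p) * P (\<lambda>x. u n x - w x))
        \<longlonglongrightarrow> (1 - c) powr (1 - p) * L" by simp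
    have "P w \<le> (1 - c) powr (1 - p) * b n + c powr (1 - p) * P (\<lambda>x. u n x - w x)" for n
    proof -
      have "P w = P (\<lambda>x. u n x + (w x - u n x))" by simp
      also have "\<dots> \<le> (1 - c) powr (1 - p) * P (u n) + c powr (1 - p) * P (\<lambda>x. w x - u n x)"
        by (rule P_add_le[OF u(1) X_diff[OF wX u(1)] c])
      also have "P (\<lambda>x. w x - u n x) = P (\<lambda>x. u n x - w x)"
        using P_scale[OF X_diff[OF u(1)[of n] wX], of "-1"] by simp
      also have "(1 - c) powr (1 - p) * P (u n) \<le> (1 - c) powr (1 - p) * b n"
        by (intro mult_left_mono L) simp
      finally show ?thesis by simp
    qed
    then show "\<exists>N. \<forall>n\<ge>N. P w \<le> (1 - c) powr (1 - p) * b n + c powr (1 - p) * P (\<lambda>x. u n x - w x)" by blast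
  qed
  have PwR: "P w \<le> R"
  proof (rule le_of_forall_powr_factor)
    fix c :: real assume c: "0 < c" "c < 1"
    show "P w \<le> (1 - c) powr (1 - p) * R" by (rule Pw[OF c tendsto_const u(2)])
  qed
  have "(\<lambda>n. Lp_int lebesgue r (\<lambda>x. u n x - w x)) \<longlonglongrightarrow> 0"
  proof (rule Lim_null_comparison)
    have "(\<lambda>n. P (\<lambda>x. u n x - w x) powr (r / p)) \<longlonglongrightarrow> 0"
      using r p1 P_nonneg by (intro tendsto_zero_powrI[OF Pw0 tendsto_const]) auto
    then show "(\<lambda>n. Sob * P (\<lambda>x. u n x - w x) powr (r / p)) \<longlonglongrightarrow> 0" by (rule tendsto_mult_right_zero)
    have "norm (Lp_int lebesgue r (\<lambda>x. u n x - w x)) \<le> Sob * P (\<lambda>x. u n x - w x) powr (r / p)" for n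
      using X_sobolev(2)[OF X_diff[OF u(1) wX]] Lp_int_nonneg[of lebesgue r "\<lambda>x. u n x - w x"]
      by (simp add: Lp_int_def)
    then show "\<forall>\<^sub>F n in sequentially. norm (Lp_int lebesgue r (\<lambda>x. u n x - w x))
        \<le> Sob * P (\<lambda>x. u n x - w x) powr (r / p)" by simp
  qed
  then have "(\<lambda>n. HI (u n)) \<longlonglongrightarrow> HI w"
    by (rule HI_tendsto[OF X_Lp_r[OF u(1)] X_Lp_r[OF wX] ae])
  \<comment> \<open>The sequence is p times the sum of two convergent ones, and it equals P (u n);
    its limit p * (m + HI w) bounds P w, which rearranges to J w <= m.\<close>
  then have lim: "(\<lambda>n. p * (J (u n) + HI (u n))) \<longlonglongrightarrow> p * (m + HI w)"
    by (intro tendsto_intros Ju)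
  have le: "P (u n) \<le> p * (J (u n) + HI (u n))" for n using p1 by (simp add: J_def)
  have "P w \<le> p * (m + HI w)"
  proof (rule le_of_forall_powr_factor)
    fix c :: real assume c: "0 < c" "c < 1"
    show "P w \<le> (1 - c) powr (1 - p) * (p * (m + HI w))" by (rule Pw[OF c lim le])
  qed
  then have "J w \<le> m" using p1 by (simp add: J_def field_simps)
  then show ?thesis using that wX PwR m_le by (meson order_trans)
qed

text \<open>The constraint is inactive: P is differentiable and hence continuous along the line w +
  t v, so the line stays in the ball for small t, and the derivative of J along it vanishes at t =
  0.\<close>

lemma interior_minimizer_weak_equation:
  assumes w: "w \<in> X" "P w < R" "\<And>v. v \<in> X \<Longrightarrow> P v \<le> R \<Longrightarrow> J w \<le> J v" and v: "v \<in> X"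
  shows "(LINT x|lebesgue. norm (weak_grad w x) powr (p - 2) * (weak_grad w x \<bullet> weak_grad v x))
      + frac_form \<Omega> s p w v =
    (LINT x|lebesgue. indicator \<Omega> x * k x (w x) * v x)"
proof -
  let ?a = "(LINT x|lebesgue. norm (weak_grad w x) powr (p - 2) * (weak_grad w x \<bullet> weak_grad v x))
      + frac_form \<Omega> s p w v"
  let ?b = "LINT x|lebesgue. indicator \<Omega> x * k x (w x) * v x"
  note DP = P_has_derivative[OF w(1) v]
  have "((\<lambda>t. J (\<lambda>x. w x + t * v x)) has_real_derivative p * ?a / p - ?b) (at 0)"
    unfolding J_def by (intro DERIV_diff DERIV_cdivide DP HI_has_derivative(2) X_Lp_r w(1) v)
  then have DJ: "((\<lambda>t. J (\<lambda>x. w x + t * v x)) has_real_derivative ?a - ?b) (at 0)" using p1 by simp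
  have "(\<lambda>t. P (\<lambda>x. w x + t * v x)) \<midarrow>0\<rightarrow> P (\<lambda>x. w x + 0 * v x)"
    using DERIV_isCont[OF DP] by (simp add: isCont_def)
  then have "\<forall>\<^sub>F t in at 0. P (\<lambda>x. w x + t * v x) < R" using w(2) by (intro order_tendstoD) auto
  then obtain d where d: "0 < d" "\<And>t. t \<noteq> 0 \<Longrightarrow> dist t 0 < d \<Longrightarrow> P (\<lambda>x. w x + t * v x) < R"
    by (auto simp: eventually_at)
  have "J (\<lambda>x. w x + 0 * v x) \<le> J (\<lambda>x. w x + t * v x)" if "\<bar>0 - t\<bar> < d" for t
  proof (cases "t = 0")
    case False
    then have "P (\<lambda>x. w x + t * v x) \<le> R" using d(2)[of t] that by simp
    then show ?thesis using w(3) X_lin(1)[OF w(1) v, of 1 t] by simp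
  qed simp
  then have "?a - ?b = 0" by (intro DERIV_local_min[OF DJ d(1)]) auto
  then show ?thesis by simp
qed

text \<open>As P w < R, some c still satisfies (1 - c)^(1 - p) * P w < R. The room that is left,
  divided by the factor of the second summand in \<open>P_add_le\<close>, is the admissible size of
  P (v - w).\<close>

lemma interior_minimizer_local_min:
  assumes w: "w \<in> X" "P w < R" "\<And>v. v \<in> X \<Longrightarrow> P v \<le> R \<Longrightarrow> J w \<le> J v"
  shows "\<exists>\<rho>>0. \<forall>v\<in>X. X_norm s p (\<lambda>x. v x - w x) < \<rho> \<longrightarrow> J w \<le> J v"
proof -
  have "\<exists>c. 0 < c \<and> c < 1 \<and> (1 - c) powr (1 - p) * P w < R"
  proof (rule ccontr)
    assume *: "\<not> ?thesis"
    have "R \<le> (1 - c) powr (1 - p) * P w" if "0 < c" "c < 1" for c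
      using * that not_less by blast
    then have "R \<le> P w" by (rule le_of_forall_powr_factor)
    then show False using w(2) by simp
  qed
  then obtain c where c: "0 < c" "c < 1" "(1 - c) powr (1 - p) * P w < R" by blast
  define \<eta> where "\<eta> = (R - (1 - c) powr (1 - p) * P w) / c powr (1 - p)"
  have \<eta>: "0 < \<eta>" "c powr (1 - p) * \<eta> = R - (1 - c) powr (1 - p) * P w" using c by (auto simp: \<eta>_def)
  show ?thesis
  proof (intro exI[of _ "\<eta> powr (1 / p)"] conjI ballI impI)
    show "0 < \<eta> powr (1 / p)" using \<eta> by simp
    fix v assume v: "v \<in> X" and "X_norm s p (\<lambda>x. v x - w x) < \<eta> powr (1 / p)"
    then have "P (\<lambda>x. v x - w x) powr (1 / p) < \<eta> powr (1 / p)" by (simp add: X_norm_P)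
    then have lt: "P (\<lambda>x. v x - w x) \<le> \<eta>"
      using p1 \<eta> powr_mono2[of "1 / p" \<eta> "P (\<lambda>x. v x - w x)"] by (cases "P (\<lambda>x. v x - w x) \<le> \<eta>") auto
    have "P v = P (\<lambda>x. w x + (v x - w x))" by simp
    also have "\<dots> \<le> (1 - c) powr (1 - p) * P w + c powr (1 - p) * P (\<lambda>x. v x - w x)"
      by (rule P_add_le[OF w(1) X_diff[OF v w(1)] c(1,2)])
    also have "\<dots> \<le> (1 - c) powr (1 - p) * P w + c powr (1 - p) * \<eta>"
      by (intro add_left_mono mult_left_mono lt) simp
    also have "\<dots> = R" using \<eta> by simp
    finally show "J w \<le> J v" by (intro w(3) v)
  qed
qed

end

section \<open>Caratheodory functions and the main theorem\<close>

text \<open>Rounding t down to a multiple of 1 / (n + 1) leaves countably many values, for each of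
  which g is measurable in x; continuity in t gives the limit.\<close>

lemma caratheodory_joint_measurable:
  fixes \<Omega> :: "'a::euclidean_space set"
  assumes g: "caratheodory_on \<Omega> g" and \<Omega>: "\<Omega> \<in> sets lebesgue"
  shows "(\<lambda>z. indicator \<Omega> (fst z) * g (fst z) (snd z)) \<in> borel_measurable (lebesgue \<Otimes>\<^sub>M borel)"
proof (rule borel_measurable_LIMSEQ_real)
  have gm: "(\<lambda>x. indicator \<Omega> x * g x t) \<in> borel_measurable lebesgue" for t
    using g borel_measurable_restrict_space_iff[of \<Omega> lebesgue "\<lambda>x. g x t"] \<Omega>
    by (simp add: caratheodory_on_def)
  define f where "f n z = indicator \<Omega> (fst z) * g (fst z) (of_int \<lfloor>real (Suc n) * snd z\<rfloor> / real (Suc n))"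
    for n and z :: "'a \<times> real"
  show "f n \<in> borel_measurable (lebesgue \<Otimes>\<^sub>M borel)" for n
    unfolding f_def
  proof (rule measurable_compose_countable[where f = "\<lambda>i z. indicator \<Omega> (fst z) * g (fst z) (of_int i / real
      (Suc n))"])
    show "(\<lambda>z. indicator \<Omega> (fst z) * g (fst z) (of_int i / real (Suc n))) \<in> borel_measurable (lebesgue \<Otimes>\<^sub>M
        borel)" for i
      by (rule measurable_compose[OF measurable_fst gm])
    show "(\<lambda>z. \<lfloor>real (Suc n) * snd z\<rfloor>) \<in> lebesgue \<Otimes>\<^sub>M borel \<rightarrow>\<^sub>M count_space UNIV"
      by measurable
  qed
  fix z :: "'a \<times> real"
  obtain x \<tau> where z: "z = (x, \<tau>)" by (cases z)
  have "(\<lambda>n. of_int \<lfloor>real (Suc n) * \<tau>\<rfloor> / real (Suc n)) \<longlonglongrightarrow> \<tau>"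
  proof (rule LIM_zero_cancel, rule Lim_null_comparison)
    show "(\<lambda>n. 1 / real (Suc n)) \<longlonglongrightarrow> 0" using LIMSEQ_inverse_real_of_nat by (simp add: inverse_eq_divide)
    have "norm (of_int \<lfloor>real (Suc n) * \<tau>\<rfloor> / real (Suc n) - \<tau>) \<le> 1 / real (Suc n)" for n
    proof -
      have "of_int \<lfloor>real (Suc n) * \<tau>\<rfloor> / real (Suc n) - \<tau> = (of_int \<lfloor>real (Suc n) * \<tau>\<rfloor> - real (Suc n) * \<tau>) /
          real (Suc n)"
        by (simp add: diff_divide_distrib)
      moreover have "\<bar>of_int \<lfloor>real (Suc n) * \<tau>\<rfloor> - real (Suc n) * \<tau>\<bar> \<le> 1"
        using of_int_floor_le[of "real (Suc n) * \<tau>"] real_of_int_floor_add_one_ge[of "real (Suc n) * \<tau>"]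
            by linarith
      ultimately show ?thesis by (simp add: divide_right_mono del: of_nat_Suc)
    qed
    then show "\<forall>\<^sub>F n in sequentially. norm (of_int \<lfloor>real (Suc n) * \<tau>\<rfloor> / real (Suc n) - \<tau>)
        \<le> 1 / real (Suc n)" by simp
  qed
  then show "(\<lambda>n. f n z) \<longlonglongrightarrow> indicator \<Omega> (fst z) * g (fst z) (snd z)"
    using g by (cases "x \<in> \<Omega>")
      (auto simp: f_def z caratheodory_on_def intro!: continuous_on_tendsto_compose[of UNIV "g x"])
qed

lemma caratheodory_primitive_measurable:
  fixes \<Omega> :: "'a::euclidean_space set"
  assumes g: "caratheodory_on \<Omega> g" and \<Omega>: "\<Omega> \<in> sets lebesgue" and w: "w \<in> borel_measurable lebesgue"
  shows "(\<lambda>x. indicator \<Omega> x * (LBINT \<tau>=0..ereal (w x). g x \<tau>)) \<in> borel_measurable lebesgue"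
proof -
  note [measurable] = caratheodory_joint_measurable[OF g \<Omega>] w
  have jm[measurable]: "(\<lambda>(x, \<tau>). indicator \<Omega> x * g x \<tau>) \<in> borel_measurable (lebesgue \<Otimes>\<^sub>M lborel)"
  proof -
    have "sets (lebesgue \<Otimes>\<^sub>M lborel) = sets ((lebesgue :: 'a measure) \<Otimes>\<^sub>M (borel :: real measure))"
      by (rule sets_pair_measure_cong) auto
    then have "(\<lambda>z. indicator \<Omega> (fst z) * g (fst z) (snd z)) \<in> borel_measurable (lebesgue \<Otimes>\<^sub>M lborel)"
      using caratheodory_joint_measurable[OF g \<Omega>] measurable_cong_sets by blast
    then show ?thesis by (simp add: case_prod_beta)
  qed
  \<comment> \<open>The oriented integral is rewritten with jointly measurable kernels, so that
    measurability of parameter integrals applies. A covers w x \<ge> 0, and B, with a minus sign,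
    covers w x < 0.\<close>
  define A where "A x = (LINT \<tau>|lborel. (if 0 < \<tau> \<and> \<tau> < w x then 1 else 0) * (indicator \<Omega> x * g x \<tau>))" for x
  define B where "B x = (LINT \<tau>|lborel. (if w x < \<tau> \<and> \<tau> < 0 then 1 else 0) * (indicator \<Omega> x * g x \<tau>))" for x
  have "A \<in> borel_measurable lebesgue" "B \<in> borel_measurable lebesgue"
    unfolding A_def B_def by (intro lborel.borel_measurable_lebesgue_integral; measurable)+
  moreover have "indicator \<Omega> x * (LBINT \<tau>=0..ereal (w x). g x \<tau>) = (if 0 \<le> w x then A x else - B x)" for x
  proof -
    have 1: "indicator (einterval 0 (ereal t)) \<tau> = (if 0 < \<tau> \<and> \<tau> < t then 1 else 0 :: real)"
      "indicator (einterval (ereal t) 0) \<tau> = (if t < \<tau> \<and> \<tau> < 0 then 1 else 0 :: real)" for t \<tau> :: real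
      by (auto simp: einterval_def indicator_def)
    have 2: "A x = indicator \<Omega> x * (LINT \<tau>|lborel. (if 0 < \<tau> \<and> \<tau> < w x then 1 else 0) * g x \<tau>)"
      "B x = indicator \<Omega> x * (LINT \<tau>|lborel. (if w x < \<tau> \<and> \<tau> < 0 then 1 else 0) * g x \<tau>)"
      unfolding A_def B_def by (simp_all add: mult.left_commute[of _ "indicator \<Omega> x"])
    show ?thesis
      unfolding interval_lebesgue_integral_def set_lebesgue_integral_def 2 1 by simp
  qed
  ultimately show ?thesis by (simp add: w)
qed

lemma caratheodory_compose_measurable:
  fixes \<Omega> :: "'a::euclidean_space set"
  assumes g: "caratheodory_on \<Omega> g" and \<Omega>: "\<Omega> \<in> sets lebesgue" and w: "w \<in> borel_measurable lebesgue"
  shows "(\<lambda>x. indicator \<Omega> x * g x (w x)) \<in> borel_measurable lebesgue"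
proof -
  have "(\<lambda>x. (x, w x)) \<in> lebesgue \<rightarrow>\<^sub>M lebesgue \<Otimes>\<^sub>M borel" using w by measurable
  from measurable_compose[OF this caratheodory_joint_measurable[OF g \<Omega>]] show ?thesis by simp
qed

lemma primitive_has_derivative:
  fixes f :: "real \<Rightarrow> real"
  assumes "continuous_on UNIV f"
  shows "((\<lambda>t. LBINT \<tau>=0..ereal t. f \<tau>) has_real_derivative f t) (at t)"
proof -
  define a where "a = - \<bar>t\<bar> - 1"
  define b where "b = \<bar>t\<bar> + 1"
  have ab: "a \<le> 0" "0 \<le> b" "t \<in> {a<..<b}" by (auto simp: a_def b_def)
  have "((\<lambda>u. LBINT y=ereal 0..ereal u. f y) has_vector_derivative f t) (at t within {a..b})"
    using ab by (intro interval_integral_FTC2 continuous_on_subset[OF assms]) auto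
  moreover have "at t within {a..b} = at t"
    using ab(3) at_within_interior[of t "{a..b}"] by simp
  ultimately show ?thesis
    by (simp add: has_real_derivative_iff_has_vector_derivative zero_ereal_def)
qed

text \<open>The cap \<open>lam \<le> 1\<close> makes the growth constant
  \<open>a\<^sub>1 + a\<^sub>2 + \<gamma>\<close> of the integrand independent of
  \<open>lam\<close>, so the radius can be fixed before \<open>lam\<close>.\<close>

locale critical_problem = sobolev_setting \<Omega> s p for \<Omega> :: "'a::euclidean_space set" and s p +
  fixes q :: real and g :: "'a \<Rightarrow> real \<Rightarrow> real" and a\<^sub>1 a\<^sub>2 \<gamma> lam :: real
  assumes q: "1 \<le> q" "q < crit_exp DIM('a) p" and g: "caratheodory_on \<Omega> g"
    and a: "0 < a\<^sub>1" "0 < a\<^sub>2" and growth: "growth_on \<Omega> q a\<^sub>1 a\<^sub>2 g" and \<gamma>: "0 < \<gamma>" and lam: "0 < lam" "lam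
        \<le> 1"
begin

definition prim :: "'a \<Rightarrow> real \<Rightarrow> real" where
  "prim x t = (LBINT \<tau>=0..ereal t. g x \<tau>)"

definition HH :: "'a \<Rightarrow> real \<Rightarrow> real" where
  "HH x t = lam * prim x t + \<gamma> / r * \<bar>t\<bar> powr r"

definition kk :: "'a \<Rightarrow> real \<Rightarrow> real" where
  "kk x t = lam * g x t + \<gamma> * (\<bar>t\<bar> powr (r - 2) * t)"

text \<open>Subcritical growth is relaxed to critical growth: the power q - 1 is at most 1 for |t|
  <= 1 and at most the power r - 1 for |t| > 1.\<close>

lemma g_bound: "AE x in lebesgue. x \<in> \<Omega> \<longrightarrow> (\<forall>t. \<bar>g x t\<bar> \<le> (a\<^sub>1 + a\<^sub>2) * (1 + \<bar>t\<bar> powr (r - 1)))"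
  using growth unfolding growth_on_def
proof eventually_elim
  case (elim x)
  show ?case
  proof (intro impI allI)
    fix t assume "x \<in> \<Omega>"
    then have "\<bar>g x t\<bar> \<le> a\<^sub>1 + a\<^sub>2 * (if q = 1 then 1 else \<bar>t\<bar> powr (q - 1))" using elim by blast
    also have "(if q = 1 then 1 else \<bar>t\<bar> powr (q - 1)) \<le> 1 + \<bar>t\<bar> powr (r - 1)"
    proof (cases "q = 1 \<or> \<bar>t\<bar> \<le> 1")
      case True
      then show ?thesis using q powr_mono2[of "q - 1" "\<bar>t\<bar>" 1] by (auto intro: add_increasing2)
    next
      case False
      then have "\<bar>t\<bar> powr (q - 1) \<le> \<bar>t\<bar> powr (r - 1)" using q by (intro powr_mono) (auto simp: r_def)
      then show ?thesis by (simp add: add_increasing)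
    qed
    also have "a\<^sub>1 + a\<^sub>2 * (1 + \<bar>t\<bar> powr (r - 1)) \<le> (a\<^sub>1 + a\<^sub>2) * (1 + \<bar>t\<bar> powr (r - 1))"
      using a by (simp add: algebra_simps)
    finally show "\<bar>g x t\<bar> \<le> (a\<^sub>1 + a\<^sub>2) * (1 + \<bar>t\<bar> powr (r - 1))" using a by simp
  qed
qed

lemma prim_derivative:
  assumes "x \<in> \<Omega>"
  shows "(prim x has_real_derivative g x t) (at t)"
  using primitive_has_derivative[of "g x" t] g assms unfolding prim_def by (simp add: caratheodory_on_def)

sublocale critical_functional \<Omega> s p HH kk "a\<^sub>1 + a\<^sub>2 + \<gamma>"
proof
  have powr_m: "(\<lambda>x. indicator \<Omega> x * \<bar>w x\<bar> powr r) \<in> borel_measurable lebesgue"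
    "(\<lambda>x. indicator \<Omega> x * (\<bar>w x\<bar> powr (r - 2) * w x)) \<in> borel_measurable lebesgue"
    if [measurable]: "w \<in> borel_measurable lebesgue" for w :: "'a \<Rightarrow> real"
    by measurable
  fix w :: "'a \<Rightarrow> real" assume w: "w \<in> borel_measurable lebesgue"
  have "(\<lambda>x. lam * (indicator \<Omega> x * prim x (w x)) + \<gamma> / r * (indicator \<Omega> x * \<bar>w x\<bar> powr r)) \<in>
      borel_measurable lebesgue"
    unfolding prim_def
    by (rule borel_measurable_add[OF borel_measurable_times[OF borel_measurable_const
        caratheodory_primitive_measurable[OF g \<Omega>_sets(1) w]]
        borel_measurable_times[OF borel_measurable_const powr_m(1)[OF w]]])
  then show "(\<lambda>x. indicator \<Omega> x * HH x (w x)) \<in> borel_measurable lebesgue"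
    by (simp add: HH_def distrib_left mult_ac)
  have "(\<lambda>x. lam * (indicator \<Omega> x * g x (w x)) + \<gamma> * (indicator \<Omega> x * (\<bar>w x\<bar> powr (r - 2) * w x))) \<in>
      borel_measurable lebesgue"
    by (rule borel_measurable_add[OF borel_measurable_times[OF borel_measurable_const
        caratheodory_compose_measurable[OF g \<Omega>_sets(1) w]]
        borel_measurable_times[OF borel_measurable_const powr_m(2)[OF w]]])
  then show "(\<lambda>x. indicator \<Omega> x * kk x (w x)) \<in> borel_measurable lebesgue"
    by (simp add: kk_def distrib_left mult_ac)
next
  show "AE x in lebesgue. x \<in> \<Omega> \<longrightarrow> HH x 0 = 0 \<and>
    (\<forall>t. (HH x has_real_derivative kk x t) (at t) \<and> \<bar>kk x t\<bar> \<le> (a\<^sub>1 + a\<^sub>2 + \<gamma>) * (1 + \<bar>t\<bar> powr (r - 1)))"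
    using g_bound
  proof eventually_elim
    case (elim x)
    show ?case
    proof (intro impI conjI allI)
      assume x: "x \<in> \<Omega>"
      have "prim x 0 = 0" by (simp add: prim_def zero_ereal_def)
      then show "HH x 0 = 0" using r by (simp add: HH_def)
      fix t
      have "((\<lambda>t. lam * prim x t + \<gamma> / r * \<bar>t\<bar> powr r) has_real_derivative lam * g x t
          + \<gamma> / r * (r * (\<bar>t\<bar> powr (r - 2) * t))) (at t)"
        by (intro DERIV_add DERIV_cmult prim_derivative x abs_powr_has_derivative r)
      then show "(HH x has_real_derivative kk x t) (at t)"
        using r by (simp add: HH_def[abs_def] kk_def)
      have "\<bar>kk x t\<bar> \<le> \<bar>lam * g x t\<bar> + \<bar>\<gamma> * (\<bar>t\<bar> powr (r - 2) * t)\<bar>"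
        unfolding kk_def by (rule abs_triangle_ineq)
      also have "\<dots> = lam * \<bar>g x t\<bar> + \<gamma> * \<bar>t\<bar> powr (r - 1)"
        using lam \<gamma> by (simp add: abs_mult[of lam] abs_mult[of \<gamma>] abs_powr_minus_two)
      also have "\<dots> \<le> 1 * ((a\<^sub>1 + a\<^sub>2) * (1 + \<bar>t\<bar> powr (r - 1))) + \<gamma> * (1 + \<bar>t\<bar> powr (r - 1))"
        using elim x lam \<gamma> a by (intro add_mono mult_mono) auto
      also have "\<dots> = (a\<^sub>1 + a\<^sub>2 + \<gamma>) * (1 + \<bar>t\<bar> powr (r - 1))" by (simp add: algebra_simps)
      finally show "\<bar>kk x t\<bar> \<le> (a\<^sub>1 + a\<^sub>2 + \<gamma>) * (1 + \<bar>t\<bar> powr (r - 1))" .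
    qed
  qed
  show "0 < a\<^sub>1 + a\<^sub>2 + \<gamma>" using a \<gamma> by simp
qed

lemma crit_split:
  assumes u: "Lp lebesgue r u"
  shows "integrable lebesgue (\<lambda>x. indicator \<Omega> x * \<bar>u x\<bar> powr r)"
    "integrable lebesgue (\<lambda>x. indicator \<Omega> x * prim x (u x))"
    "HI u = lam * (LINT x|lebesgue. indicator \<Omega> x * prim x (u x))
        + \<gamma> / r * (LINT x|lebesgue. indicator \<Omega> x * \<bar>u x\<bar> powr r)"
proof -
  show 1: "integrable lebesgue (\<lambda>x. indicator \<Omega> x * \<bar>u x\<bar> powr r)"
    using integrable_mult_indicator[OF \<Omega>_sets(1), of "\<lambda>x. \<bar>u x\<bar> powr r"] u by (simp add: Lp_def)
  \<comment> \<open>The primitive is recovered from \<open>HH\<close>, whose integrability is known,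
    by solving for it; this divides by \<open>lam > 0\<close>.\<close>
  have "integrable lebesgue (\<lambda>x. 1 / lam * (indicator \<Omega> x * HH x (u x) - \<gamma> / r * (indicator \<Omega> x * \<bar>u x\<bar> powr
      r)))"
    by (intro integrable_mult_right Bochner_Integration.integrable_diff H_int(1) u 1)
  moreover have "(\<lambda>x. 1 / lam * (indicator \<Omega> x * HH x (u x) - \<gamma> / r * (indicator \<Omega> x * \<bar>u x\<bar> powr r)))
      = (\<lambda>x. indicator \<Omega> x * prim x (u x))"
    using lam by (auto simp: HH_def fun_eq_iff indicator_def)
  ultimately show 2: "integrable lebesgue (\<lambda>x. indicator \<Omega> x * prim x (u x))" by simp
  have "HI u = (LINT x|lebesgue. lam * (indicator \<Omega> x * prim x (u x))
      + \<gamma> / r * (indicator \<Omega> x * \<bar>u x\<bar> powr r))"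
    unfolding HI_def HH_def by (intro Bochner_Integration.integral_cong refl) (simp add: distrib_left
        mult_ac)
  then show "HI u = lam * (LINT x|lebesgue. indicator \<Omega> x * prim x (u x))
      + \<gamma> / r * (LINT x|lebesgue. indicator \<Omega> x * \<bar>u x\<bar> powr r)"
    using 1 2 by simp
qed

text \<open>Keeps \<open>lam\<close> as a factor, unlike the general bound \<open>H_int\<close>. On
  the sphere the critical term is of higher order in R than R / p, whereas the other term has no
  such decay and can be made small through \<open>lam\<close> alone.\<close>

lemma HI_le:
  assumes u: "u \<in> X" "P u \<le> R"
  shows "HI u \<le> lam * (2 * (a\<^sub>1 + a\<^sub>2) * (vol + Sob * R powr (r / p))) + \<gamma> / r * (Sob * R powr (r / p))"
proof -
  note L = X_Lp_r[OF u(1)]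
  have Lr: "integrable lebesgue (\<lambda>x. \<bar>u x\<bar> powr r)" using L by (simp add: Lp_def)
  have le: "Lp_int lebesgue r u \<le> Sob * R powr (r / p)" by (rule X_Lp_int_r[OF u])
  have "(LINT x|lebesgue. indicator \<Omega> x * \<bar>u x\<bar> powr r) \<le> (LINT x|lebesgue. \<bar>u x\<bar> powr r)"
    by (intro integral_mono crit_split(1)[OF L] Lr) (auto simp: indicator_def)
  also have "\<dots> \<le> Sob * R powr (r / p)" using le by (simp add: Lp_int_def)
  finally have 1: "(LINT x|lebesgue. indicator \<Omega> x * \<bar>u x\<bar> powr r) \<le> Sob * R powr (r / p)" .
  have "(LINT x|lebesgue. indicator \<Omega> x * prim x (u x)) \<le> (LINT x|lebesgue. 2 * (a\<^sub>1 + a\<^sub>2) * (indicator \<Omega> x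
      + \<bar>u x\<bar> powr r))"
  proof (rule integral_mono_AE[OF crit_split(2)[OF L]])
    show "integrable lebesgue (\<lambda>x. 2 * (a\<^sub>1 + a\<^sub>2) * (indicator \<Omega> x + \<bar>u x\<bar> powr r))"
      by (intro integrable_mult_right Bochner_Integration.integrable_add \<Omega>_integrable Lr)
    show "AE x in lebesgue. indicator \<Omega> x * prim x (u x) \<le> 2 * (a\<^sub>1 + a\<^sub>2) * (indicator \<Omega> x + \<bar>u x\<bar> powr r)"
      using g_bound
    proof eventually_elim
      case (elim x)
      show ?case
      proof (cases "x \<in> \<Omega>")
        case True
        have "\<bar>prim x (u x)\<bar> \<le> 2 * (a\<^sub>1 + a\<^sub>2) * (1 + \<bar>u x\<bar> powr r)"
        proof (rule primitive_growth[OF prim_derivative[OF True]])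
          show "prim x 0 = 0" by (simp add: prim_def zero_ereal_def)
        qed (use elim True a in auto)
        then show ?thesis using True by simp
      qed (use a in simp)
    qed
  qed
  also have "\<dots> = 2 * (a\<^sub>1 + a\<^sub>2) * (vol + Lp_int lebesgue r u)"
    using Lr \<Omega>_integrable by (simp add: vol_def Lp_int_def)
  also have "\<dots> \<le> 2 * (a\<^sub>1 + a\<^sub>2) * (vol + Sob * R powr (r / p))"
    using a le by (intro mult_left_mono) auto
  finally have 2: "(LINT x|lebesgue. indicator \<Omega> x * prim x (u x)) \<le> 2 * (a\<^sub>1 + a\<^sub>2) * (vol
      + Sob * R powr (r / p))" .
  show ?thesis
    unfolding crit_split(3)[OF L] using 1 2 lam \<gamma> r by (intro add_mono mult_left_mono) auto
qed

text \<open>The definitions of the problem integrate gradients over \<Omega>, while \<open>P\<close>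
  and its derivative integrate over the whole space.\<close>

lemma weak_grad_set_integral:
  assumes "u \<in> X" "F \<in> borel_measurable lebesgue" "\<And>x. weak_grad u x = 0 \<Longrightarrow> F x = (0::real)"
  shows "(LINT x:\<Omega>|lebesgue. F x) = (LINT x|lebesgue. F x)"
  unfolding set_lebesgue_integral_def
proof (rule integral_cong_AE)
  show "AE x in lebesgue. indicator \<Omega> x *\<^sub>R F x = F x"
    using weak_grad_outside[OF assms(1)] by eventually_elim (use assms(3) in \<open>auto simp: indicator_def\<close>)
qed (use assms(2) \<Omega>_sets in \<open>auto intro!: borel_measurable_times\<close>)

lemma energy_eq_J:
  assumes u: "u \<in> X"
  shows "energy \<Omega> s p g \<gamma> lam u = J u"
proof -
  note [measurable] = weak_grad_measurable[OF u]
  have "(LINT x:\<Omega>|lebesgue. norm (weak_grad u x) powr p) = Lp_int lebesgue p (weak_grad u)"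
    unfolding Lp_int_def by (rule weak_grad_set_integral[OF u]) simp_all
  then show ?thesis
    unfolding energy_def J_def crit_split(3)[OF X_Lp_r[OF u]] P_def frac_seminorm_powr
    by (simp add: r_def[symmetric] set_lebesgue_integral_def prim_def add_divide_distrib)
qed

theorem solution_exists:
  assumes R: "small R" and bdry: "\<And>v. v \<in> X \<Longrightarrow> P v = R \<Longrightarrow> HI v < R / p"
  shows "\<exists>u. weak_solution \<Omega> s p g \<gamma> lam u \<and> X_local_min \<Omega> s p (energy \<Omega> s p g \<gamma> lam) u"
proof -
  obtain w where w: "w \<in> X" "P w \<le> R" "\<And>v. v \<in> X \<Longrightarrow> P v \<le> R \<Longrightarrow> J w \<le> J v"
    using minimizer_on_ball[OF R] by blast
  have z: "(\<lambda>x. 0) \<in> X" using X_lin(1)[OF w(1) w(1), of 0 0] by simp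
  have Pz: "P (\<lambda>x. 0) = 0" using P_scale[OF z, of 0] by simp
  have "AE x in lebesgue. indicator \<Omega> x * HH x 0 = 0" using Hk by eventually_elim auto
  then have "HI (\<lambda>x. 0) = 0"
    unfolding HI_def using integral_cong_AE[OF Hm[of "\<lambda>_. 0"], of "\<lambda>_. 0"] by simp
  then have "J w \<le> 0" using w(3)[OF z] R by (simp add: Pz J_def small_def)
  have "P w \<noteq> R"
  proof
    assume "P w = R"
    with bdry[OF w(1)] have "HI w < P w / p" by simp
    then show False using \<open>J w \<le> 0\<close> by (simp add: J_def)
  qed
  then have lt: "P w < R" using w(2) by simp
  have ws: "weak_solution \<Omega> s p g \<gamma> lam w"
    unfolding weak_solution_def
  proof (intro conjI ballI w(1))
    fix v assume v: "v \<in> X"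
    note [measurable] = weak_grad_measurable[OF w(1)] weak_grad_measurable[OF v]
    have 1: "(LINT x:\<Omega>|lebesgue. norm (weak_grad w x) powr (p - 2) * (weak_grad w x \<bullet> weak_grad v x)) =
        (LINT x|lebesgue. norm (weak_grad w x) powr (p - 2) * (weak_grad w x \<bullet> weak_grad v x))"
      by (rule weak_grad_set_integral[OF w(1)]) simp_all
    have 2: "(LINT x:\<Omega>|lebesgue. (lam * g x (w x) + \<gamma> * \<bar>w x\<bar> powr (crit_exp DIM('a) p - 2) * w x) * v x) =
        (LINT x|lebesgue. indicator \<Omega> x * kk x (w x) * v x)"
      unfolding set_lebesgue_integral_def
      by (intro Bochner_Integration.integral_cong refl) (simp add: kk_def r_def[symmetric] mult.assoc)
    show "(LINT x:\<Omega>|lebesgue. norm (weak_grad w x) powr (p - 2) * (weak_grad w x \<bullet> weak_grad v x))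
        + frac_form \<Omega> s p w v =
        (LINT x:\<Omega>|lebesgue. (lam * g x (w x) + \<gamma> * \<bar>w x\<bar> powr (crit_exp DIM('a) p - 2) * w x) * v x)"
      unfolding 1 2 by (rule interior_minimizer_weak_equation[OF w(1) lt w(3) v])
  qed
  have "X_local_min \<Omega> s p (energy \<Omega> s p g \<gamma> lam) w"
    using interior_minimizer_local_min[OF w(1) lt w(3)] w(1) unfolding X_local_min_def
        by (simp add: energy_eq_J)
  with ws show ?thesis by blast
qed

end

text \<open>A positive power of R tends to 0 with R. The summand 1 in A + 1 allows A = 0.\<close>

lemma small_powr_exists:
  assumes "0 \<le> (A::real)" "0 < e" "0 < (\<delta>::real)"
  shows "\<exists>R0>0. \<forall>R. 0 < R \<and> R \<le> R0 \<longrightarrow> A * R powr e \<le> \<delta>"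
proof (intro exI[of _ "(\<delta> / (A + 1)) powr (1 / e)"] conjI allI impI)
  show "0 < (\<delta> / (A + 1)) powr (1 / e)" using assms by simp
  fix R assume R: "0 < R \<and> R \<le> (\<delta> / (A + 1)) powr (1 / e)"
  have "R powr e \<le> ((\<delta> / (A + 1)) powr (1 / e)) powr e" using R assms by (intro powr_mono2) auto
  also have "\<dots> = \<delta> / (A + 1)" using assms by (simp add: powr_powr)
  finally have "A * R powr e \<le> A * (\<delta> / (A + 1))" using assms by (intro mult_left_mono) auto
  also have "\<dots> \<le> \<delta>" using assms by (simp add: field_simps)
  finally show "A * R powr e \<le> \<delta>" .
qed

theorem corollary8p5:
  fixes \<Omega> :: "'a::euclidean_space set"
    and s p q :: real
    and g :: "'a \<Rightarrow> real \<Rightarrow> real"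
  assumes "bounded \<Omega>" and "open \<Omega>"
    and "0 \<le> s" and "s < 1"
    and "2 \<le> p" and "p < real DIM('a)"
    and "1 \<le> q" and "q < crit_exp DIM('a) p"
    and "caratheodory_on \<Omega> g"
    and "\<exists>a\<^sub>1>0. \<exists>a\<^sub>2>0. growth_on \<Omega> q a\<^sub>1 a\<^sub>2 g"
  shows "\<forall>\<gamma>>0. \<exists>\<Lambda>>0. \<forall>lam. 0 < lam \<and> lam < \<Lambda> \<longrightarrow>
           (\<exists>u. weak_solution \<Omega> s p g \<gamma> lam u \<and>
                X_local_min \<Omega> s p (energy \<Omega> s p g \<gamma> lam) u)"
proof (intro allI impI)
  fix \<gamma> :: real assume \<gamma>: "0 < \<gamma>"
  obtain a\<^sub>1 a\<^sub>2 where a: "0 < a\<^sub>1" "0 < a\<^sub>2" "growth_on \<Omega> q a\<^sub>1 a\<^sub>2 g" using assms(10) by blast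
  interpret S: sobolev_setting \<Omega> s p using assms by unfold_locales
  \<comment> \<open>The value of \<open>C0\<close>, written out here because the locale that defines
    it can be interpreted only once \<open>lam\<close> is given.\<close>
  define c0 where "c0 = 8 * (a\<^sub>1 + a\<^sub>2 + \<gamma>) * 2 powr S.r"
  define e where "e = S.r / p - 1"
  have e: "0 < e" using S.r S.p1 by (simp add: e_def)
  have c0: "0 \<le> c0" using a \<gamma> by (simp add: c0_def)
  define A where "A = 4 * p * 2 powr p * c0 * (S.Sob * (2 powr (p + 1)) powr e)"
  have A: "0 \<le> A" using S.p1 c0 S.Sob_nonneg by (simp add: A_def)
  obtain R1 where R1: "0 < R1" "\<And>R. 0 < R \<Longrightarrow> R \<le> R1 \<Longrightarrow> A * R powr e \<le> 1"
    using small_powr_exists[OF A e, of 1] by auto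
  \<comment> \<open>The bound 1 / (4 * p) grants the critical term a quarter of R / p on the sphere.
    The \<open>lam\<close> term gets another quarter, so that their sum stays strictly below R /
    p.\<close>
  have "0 \<le> \<gamma> / S.r * S.Sob" "0 < 1 / (4 * p)" using \<gamma> S.r S.p1 S.Sob_nonneg by auto
  then obtain R2 where R2: "0 < R2" "\<And>R. 0 < R \<Longrightarrow> R \<le> R2 \<Longrightarrow> \<gamma> / S.r * S.Sob * R powr e \<le> 1 / (4 * p)"
    using small_powr_exists[OF _ e, of "\<gamma> / S.r * S.Sob" "1 / (4 * p)"] by blast
  define R where "R = min R1 R2"
  have R: "0 < R" "A * R powr e \<le> 1" "\<gamma> / S.r * S.Sob * R powr e \<le> 1 / (4 * p)"
    using R1 R2 by (auto simp: R_def)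
  define D where "D = 2 * (a\<^sub>1 + a\<^sub>2) * (S.vol + S.Sob * R powr (S.r / p))"
  have D: "0 \<le> D" using a S.vol_nonneg S.Sob_nonneg by (simp add: D_def)
  \<comment> \<open>The 1 meets the cap on \<open>lam\<close> in \<open>critical_problem\<close>;
    the other value gives lam * D <= R / (4 * p), with D + 1 in place of D to allow D = 0.\<close>
  define \<Lambda> where "\<Lambda> = min 1 (R / (4 * p * (D + 1)))"
  have \<Lambda>: "0 < \<Lambda>" using R D S.p1 by (simp add: \<Lambda>_def)
  show "\<exists>\<Lambda>>0. \<forall>lam. 0 < lam \<and> lam < \<Lambda> \<longrightarrow>
           (\<exists>u. weak_solution \<Omega> s p g \<gamma> lam u \<and> X_local_min \<Omega> s p (energy \<Omega> s p g \<gamma> lam) u)"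
  proof (intro exI[of _ \<Lambda>] conjI allI impI \<Lambda>)
    fix lam assume lam: "0 < lam \<and> lam < \<Lambda>"
    interpret C: critical_problem \<Omega> s p q g a\<^sub>1 a\<^sub>2 \<gamma> lam
      using assms a \<gamma> lam by unfold_locales (auto simp: \<Lambda>_def)
    show "\<exists>u. weak_solution \<Omega> s p g \<gamma> lam u \<and> X_local_min \<Omega> s p (energy \<Omega> s p g \<gamma> lam) u"
    proof (rule C.solution_exists)
      have "4 * p * 2 powr p * C.C0 * (S.Sob * (2 powr (p + 1) * R) powr (S.r / p - 1)) = A * R powr e"
        using R by (simp add: A_def c0_def C.C0_def e_def powr_mult mult_ac)
      then show "C.small R" using R unfolding C.small_def by simp
      fix v assume v: "v \<in> S.X" "S.P v = R"
      have "C.HI v \<le> lam * D + \<gamma> / S.r * (S.Sob * R powr (S.r / p))"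
        using C.HI_le[OF v(1), of R] v(2) by (simp add: D_def)
      moreover have "lam * D \<le> R / (4 * p)"
      proof -
        have "lam * D \<le> R / (4 * p * (D + 1)) * (D + 1)"
          using lam D by (intro mult_mono) (auto simp: \<Lambda>_def)
        then show ?thesis using D by simp
      qed
      moreover have "\<gamma> / S.r * (S.Sob * R powr (S.r / p)) \<le> R / (4 * p)"
      proof -
        have "R powr (S.r / p) = R powr e * R" using R by (simp add: e_def powr_diff)
        then have "\<gamma> / S.r * (S.Sob * R powr (S.r / p)) = (\<gamma> / S.r * S.Sob * R powr e) * R" by simp
        also have "\<dots> \<le> 1 / (4 * p) * R" using R by (intro mult_right_mono) auto
        finally show ?thesis by simp
      qed
      moreover have "R / (4 * p) + R / (4 * p) < R / p" using R S.p1 by (simp add: field_simps)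
      ultimately show "C.HI v < R / p" by linarith
    qed
  qed
qed

end
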